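(* Suppose that $L|K$ satisfies (I) or (II). Then: (i) There exists a unique homomorphism of $A$-modules $\mathrm{rsw}: H/H^2\to \omega^1_A/(\mathcal{I}_\sigma\cap A)\omega^1_A$ such that $\frac1g\mapsto \mathrm{dlog}\, g$ for all $g\in\mathfrak{A}$. (ii) There is a $B$-module isomorphism $\varphi_\sigma:\omega^1_{B|A}/\mathcal{J}_\sigma\omega^1_{B|A}\to \mathcal{J}_\sigma/\mathcal{J}_\sigma^2$ such that $\mathrm{dlog}\, x\mapsto \frac{\sigma(x)}{x}-1$ for all $x\in L^\times$. (iii) Furthermore, these maps fit into a commutative diagram with the maps $\overline{\Delta_N}:\omega^1_{B|A}/\mathcal{J}_\sigma\omega^1_{B|A}\to\omega^1_A/(\mathcal{I}_\sigma\cap A)\omega^1_A$ and $\overline{N}:\mathcal{J}_\sigma/\mathcal{J}_\sigma^2\hookrightarrow H/H^2$ (injective) induced by the norm map $N$, that is, $$\overline{\Delta_N}=\mathrm{rsw}\circ\overline{N}\circ\varphi_\sigma .$$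
   Context: Let $K$ be a valued field of characteristic $p>0$ with henselian valuation ring $A$, valuation $v_K$, residue field $k$ and value group $\Gamma=v_K(K^\times)$. Let $L=K(\alpha)$ be the Artin–Schreier extension defined by $\alpha^p-\alpha=f$ for some $f\in K^\times$, assumed non-trivial, i.e. $[L:K]=p$. Let $B$ be the integral closure of $A$ in $L$ (a valuation ring), $v_L$ the valuation on $L$ extending $v_K$, and $l$ the residue field of $L$. $\mathrm{Gal}(L|K)$ is cyclic of order $p$, generated by $\sigma:\alpha\mapsto\alpha+1$. Let $N=N_{L|K}$. Conditions: (I) (Defectless) either $v_L(L^\times)/v_K(K^\times)$ has order $p$ and $l|k$ is trivial, or $l|k$ has degree $p$ and $L$ has the same value group as $K$. (II) (Rank 1) $\Gamma$ is isomorphic to a subgroup of $\mathbb{R}$ as an ordered group. $L|K$ has defect if it is not defectless. $\mathfrak{A}=\{g\in K^\times\mid$ the solutions of $X^p-X=g$ generate $L$ over $K\}$. $\mathcal{J}_\sigma$ is the ideal of $B$ generated by $\{\sigma(b)/b-1\mid b\in L^\times\}$; $\mathcal{I}_\sigma$ is the ideal of $B$ generated by $\{\sigma(b)-b\mid b\in B\}$; $H$ is the ideal of $A$ generated by $\{1/g\mid g\in\mathfrak{A}\}$. Logarithmic differentials: for a valuation ring $R$ with fraction field $F$, $\omega^1_R$ is the $R$-module generated by symbols $db$ ($b\in R$) and $\mathrm{dlog}\,x$ ($x\in F^\times$) subject to $d(b+c)=db+dc$, $d(bc)=c\,db+b\,dc$, $\mathrm{dlog}(xy)=\mathrm{dlog}\,x+\mathrm{dlog}\,y$,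 and $b\,\mathrm{dlog}\,b=db$ for $0\ne b\in R$. $\omega^1_{B|A}$ is the cokernel of $B\otimes_A\omega^1_A\to\omega^1_B$. The maps induced by the norm: $\overline{N}$ is the map induced by $x\mapsto N(x)$, $\mathcal{J}_\sigma\to H$. The map $\overline{\Delta_N}$ is described as follows. An element $g\in K^\times$ is called best if either $g\in A^\times$ or $-v_K(g)=\inf\{-v_K(h)\mid h\equiv g \bmod \mathfrak{P}(K)\}$, where $\mathfrak{P}(x)=x^p-x$. (Defectless case) One takes $f$ best (such $f\in\mathfrak{A}$ exists) and $\alpha^p-\alpha=f$; then $\mathrm{dlog}\,\alpha$ generates $\omega^1_{B|A}$, and $\overline{\Delta_N}$ sends the class of $b\,\mathrm{dlog}\,\alpha$ to the class of $N(b)\,\mathrm{dlog}\,f$ for $b\in B$. (Case (II) with defect) Let $\mathscr{S}=\{\beta\in L\mid \beta^p-\beta\in K,\ \beta \text{ generates } L|K\}$, fix $\alpha_0\in\mathscr{S}$ and put $\mathscr{S}_0=\{\beta\in\mathscr{S}\mid v_L(\alpha_0)<v_L(\beta)\}$. For $\beta\in\mathscr{S}_0$ choose $\gamma_\beta\in A$ with $v_K(\gamma_\beta)=-v_L(\beta)$, and set $\beta'=\beta\gamma_\beta\in B^\times$ and $f_\beta=\beta^p-\beta=N(\beta)$. Then $\overline{\Delta_N}$ sends the class of $b\,d\beta'=b\beta'\,\mathrm{dlog}\,\beta$ to the class of $N(b\beta')\,\mathrm{dlog}\,f_\beta$ for all $\beta\in\mathscr{S}_0$ and $b\in A[\beta']$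 (every element of $\omega^1_{B|A}$ is of the form $b\,d\beta'$ for some such $\beta$ and $b$).
   Formalization: In (i), the rule 1/g ↦ dlog g is required only for g in 𝔄 with g ≡ f mod 𝔓(K) (the class belonging to σ); for all g in 𝔄 it contradicts linearity when p ≥ 3, since dlog(jg) = dlog g for j in F_p^×. *)

theory Defs
  imports "HOL-Algebra.Algebra" "HOL-Algebra.Algebraic_Closure_Type" "HOL-Library.Poly_Mapping"
begin

text \<open>
  The big field \<open>L\<close> is a type of class \<^class>\<open>field\<close>; the subfield \<open>K\<close> and the rings \<open>A\<close>, \<open>B\<close> are
  subsets of it.  Rings and modules that occur as objects are records of HOL-Algebra.
\<close>

abbreviation type_ring :: "'a::field ring" where
  "type_ring \<equiv> ring_of_type_algebra"

definition ring_on :: "'a::field set \<Rightarrow> 'a ring" where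
  "ring_on R = type_ring\<lparr>carrier := R\<rparr>"


section \<open>Modules\<close>

definition submodule_gen :: "('r, 'c) ring_scheme \<Rightarrow> ('r, 'm) module \<Rightarrow> 'm set \<Rightarrow> 'm set" where
  "submodule_gen R M S = \<Inter>{N. submodule N R M \<and> S \<subseteq> N}"

text \<open>
  The module record of HOL-Algebra extends the ring record, so it has two fields \<open>mult\<close> and \<open>one\<close>
  that are meaningless for a module.  Scalar multiplication of cosets is written as in
  \<^const>\<open>rcoset_mult\<close>.
\<close>

definition quot_module :: "('r, 'm) module \<Rightarrow> 'm set \<Rightarrow> ('r, 'm set) module" where
  "quot_module M N =
     \<lparr>carrier = a_rcosets\<^bsub>M\<^esub> N, monoid.mult = undefined, one = undefined, ring.zero = N,
      add = set_add M, module.smult = (\<lambda>r Y. \<Union>x\<in>Y. N +>\<^bsub>M\<^esub> (r \<odot>\<^bsub>M\<^esub> x))\<rparr>"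

definition ideal_smult :: "('r, 'c) ring_scheme \<Rightarrow> 'r set \<Rightarrow> ('r, 'm) module \<Rightarrow> 'm set" where
  "ideal_smult R I M = submodule_gen R M {a \<odot>\<^bsub>M\<^esub> m |a m. a \<in> I \<and> m \<in> carrier M}"

definition ideal_module :: "'r ring \<Rightarrow> 'r set \<Rightarrow> ('r, 'r) module" where
  "ideal_module R I =
     \<lparr>carrier = I, monoid.mult = monoid.mult R, one = one R, ring.zero = ring.zero R, add = add R,
      module.smult = monoid.mult R\<rparr>"

text \<open>
  Maps between modules are extensional (\<open>\<rightarrow>\<^sub>E\<close>), so that equality and uniqueness of maps mean equality on the carrier.
\<close>

definition module_hom ::
  "('r, 'c) ring_scheme \<Rightarrow> ('r, 'm) module \<Rightarrow> ('r, 'n) module \<Rightarrow> ('m \<Rightarrow> 'n) set" where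
  "module_hom R M N = {h \<in> carrier M \<rightarrow>\<^sub>E carrier N.
     (\<forall>x\<in>carrier M. \<forall>y\<in>carrier M. h (x \<oplus>\<^bsub>M\<^esub> y) = h x \<oplus>\<^bsub>N\<^esub> h y) \<and>
     (\<forall>r\<in>carrier R. \<forall>x\<in>carrier M. h (r \<odot>\<^bsub>M\<^esub> x) = r \<odot>\<^bsub>N\<^esub> h x)}"

definition module_iso ::
  "('r, 'c) ring_scheme \<Rightarrow> ('r, 'm) module \<Rightarrow> ('r, 'n) module \<Rightarrow> ('m \<Rightarrow> 'n) set" where
  "module_iso R M N = {h \<in> module_hom R M N. bij_betw h (carrier M) (carrier N)}"

definition free_module :: "'a::field set \<Rightarrow> 'x set \<Rightarrow> ('a, 'x \<Rightarrow>\<^sub>0 'a) module" where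
  "free_module R S =
     \<lparr>carrier = {c. Poly_Mapping.keys c \<subseteq> S \<and> range (Poly_Mapping.lookup c) \<subseteq> R},
      monoid.mult = undefined, one = undefined, ring.zero = 0, add = (+),
      module.smult = (\<lambda>r. Poly_Mapping.map ((*) r))\<rparr>"


section \<open>Logarithmic differentials\<close>

datatype 'a logsym = D 'a | Dlog 'a

definition fraction_field :: "'a::field set \<Rightarrow> 'a set" where
  "fraction_field R = {a / b |a b. a \<in> R \<and> b \<in> R \<and> b \<noteq> 0}"

definition log_free :: "'a::field set \<Rightarrow> ('a, 'a logsym \<Rightarrow>\<^sub>0 'a) module" where
  "log_free R = free_module R (D ` R \<union> Dlog ` (fraction_field R - {0}))"

definition log_relators :: "'a::field set \<Rightarrow> ('a logsym \<Rightarrow>\<^sub>0 'a) set" where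
  "log_relators R =
     (let s = Poly_Mapping.single; F = fraction_field R - {0} in
       {s (D (b + c)) 1 - s (D b) 1 - s (D c) 1 |b c. b \<in> R \<and> c \<in> R} \<union>
       {s (D (b * c)) 1 - s (D b) c - s (D c) b |b c. b \<in> R \<and> c \<in> R} \<union>
       {s (Dlog (x * y)) 1 - s (Dlog x) 1 - s (Dlog y) 1 |x y. x \<in> F \<and> y \<in> F} \<union>
       {s (Dlog b) b - s (D b) 1 |b. b \<in> R \<and> b \<noteq> 0})"

definition log_relations :: "'a::field set \<Rightarrow> ('a logsym \<Rightarrow>\<^sub>0 'a) set" where
  "log_relations R = submodule_gen (ring_on R) (log_free R) (log_relators R)"

definition omega :: "'a::field set \<Rightarrow> ('a, ('a logsym \<Rightarrow>\<^sub>0 'a) set) module" where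
  "omega R = quot_module (log_free R) (log_relations R)"

definition omega_sym :: "'a::field set \<Rightarrow> 'a logsym \<Rightarrow> ('a logsym \<Rightarrow>\<^sub>0 'a) set" where
  "omega_sym R s = log_relations R +>\<^bsub>log_free R\<^esub> Poly_Mapping.single s 1"

text \<open>
  For \<open>A \<subseteq> B\<close>, \<open>omega_map A B\<close> is the canonical map \<open>\<iota> : \<omega>\<^sub>A \<rightarrow> \<omega>\<^sub>B\<close>, which sends the class of a formal
  combination of symbols to the class of the same combination.  The map \<open>B \<otimes>\<^sub>A \<omega>\<^sub>A \<rightarrow> \<omega>\<^sub>B\<close> is
  \<open>b \<otimes> w \<mapsto> b \<cdot> \<iota> w\<close>; since pure tensors generate, its image is the \<open>B\<close>-submodule generated by the
  range of \<open>\<iota>\<close>, and the cokernel is the quotient by this image.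
\<close>

definition omega_map ::
  "'a::field set \<Rightarrow> 'a set \<Rightarrow> ('a logsym \<Rightarrow>\<^sub>0 'a) set \<Rightarrow> ('a logsym \<Rightarrow>\<^sub>0 'a) set" where
  "omega_map A B W = log_relations B <+>\<^bsub>log_free B\<^esub> W"

definition omega_image :: "'a::field set \<Rightarrow> 'a set \<Rightarrow> ('a logsym \<Rightarrow>\<^sub>0 'a) set set" where
  "omega_image A B = submodule_gen (ring_on B) (omega B) (omega_map A B ` carrier (omega A))"

definition omega_rel ::
  "'a::field set \<Rightarrow> 'a set \<Rightarrow> ('a, ('a logsym \<Rightarrow>\<^sub>0 'a) set set) module" where
  "omega_rel A B = quot_module (omega B) (omega_image A B)"

definition omega_rel_sym ::
  "'a::field set \<Rightarrow> 'a set \<Rightarrow> 'a logsym \<Rightarrow> ('a logsym \<Rightarrow>\<^sub>0 'a) set set" where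
  "omega_rel_sym A B s = omega_image A B +>\<^bsub>omega B\<^esub> omega_sym B s"


section \<open>Valued fields\<close>

text \<open>
  A valuation is written additively; its value at \<open>0\<close> (mathematically \<open>\<infinity>\<close>) is left unspecified and
  never used.  The valuation on the subfield \<open>K\<close> is the restriction of the one on \<open>L\<close>.
\<close>

definition valuation :: "('a::field \<Rightarrow> 'g::linordered_ab_group_add) \<Rightarrow> bool" where
  "valuation v \<longleftrightarrow>
     (\<forall>x y. x \<noteq> 0 \<longrightarrow> y \<noteq> 0 \<longrightarrow> v (x * y) = v x + v y) \<and>
     (\<forall>x y. x \<noteq> 0 \<longrightarrow> y \<noteq> 0 \<longrightarrow> x + y \<noteq> 0 \<longrightarrow> min (v x) (v y) \<le> v (x + y))"

definition value_group :: "('a::field \<Rightarrow> 'g::linordered_ab_group_add) \<Rightarrow> 'a set \<Rightarrow> 'g monoid" where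
  "value_group v F = \<lparr>carrier = v ` (F - {0}), monoid.mult = (+), one = 0\<rparr>"

definition val_ring :: "('a::field \<Rightarrow> 'g::linordered_ab_group_add) \<Rightarrow> 'a set \<Rightarrow> 'a set" where
  "val_ring v F = {x \<in> F. x = 0 \<or> 0 \<le> v x}"

definition max_ideal :: "('a::field \<Rightarrow> 'g::linordered_ab_group_add) \<Rightarrow> 'a set \<Rightarrow> 'a set" where
  "max_ideal v R = {x \<in> R. x = 0 \<or> 0 < v x}"

definition henselian :: "('a::field \<Rightarrow> 'g::linordered_ab_group_add) \<Rightarrow> 'a set \<Rightarrow> bool" where
  "henselian v F \<longleftrightarrow>
     (let A = val_ring v F; \<mm> = max_ideal v A in
       \<forall>P a. lead_coeff P = 1 \<and> set (coeffs P) \<subseteq> A \<and> a \<in> A \<and> poly P a \<in> \<mm> \<and> poly (pderiv P) a \<notin> \<mm>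
         \<longrightarrow> (\<exists>b\<in>A. poly P b = 0 \<and> b - a \<in> \<mm>))"

definition integral_closure :: "'a::field set \<Rightarrow> 'a set" where
  "integral_closure A = {x. \<exists>P. lead_coeff P = 1 \<and> set (coeffs P) \<subseteq> A \<and> poly P x = 0}"

definition adjoin :: "'a::field set \<Rightarrow> 'a \<Rightarrow> 'a set" where
  "adjoin A x = {poly P x |P. set (coeffs P) \<subseteq> A}"

abbreviation ring_A :: "'a::field set \<Rightarrow> ('a \<Rightarrow> 'g::linordered_ab_group_add) \<Rightarrow> 'a set" where
  "ring_A K v \<equiv> val_ring v K"

definition ring_B :: "'a::field set \<Rightarrow> ('a \<Rightarrow> 'g::linordered_ab_group_add) \<Rightarrow> 'a set" where
  "ring_B K v = integral_closure (ring_A K v)"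

definition residue_L :: "'a::field set \<Rightarrow> ('a \<Rightarrow> 'g::linordered_ab_group_add) \<Rightarrow> 'a set ring" where
  "residue_L K v = ring_on (ring_B K v) Quot max_ideal v (ring_B K v)"

text \<open>The residue field of \<open>K\<close>, viewed inside the residue field of \<open>L\<close>.\<close>

definition residue_K :: "'a::field set \<Rightarrow> ('a \<Rightarrow> 'g::linordered_ab_group_add) \<Rightarrow> 'a set set" where
  "residue_K K v =
     (\<lambda>a. max_ideal v (ring_B K v) +>\<^bsub>ring_on (ring_B K v)\<^esub> a) ` ring_A K v"

definition defectless :: "'a::field set \<Rightarrow> ('a \<Rightarrow> 'g::linordered_ab_group_add) \<Rightarrow> bool" where
  "defectless K v \<longleftrightarrow>
     (let p = CHAR('a); l = residue_L K v; k = residue_K K v in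
       (Coset.order (value_group v UNIV Mod carrier (value_group v K)) = p \<and> carrier l = k) \<or>
       (ring.dimension l p k (carrier l) \<and>
         carrier (value_group v UNIV) = carrier (value_group v K)))"

definition rank_one :: "'a::field set \<Rightarrow> ('a \<Rightarrow> 'g::linordered_ab_group_add) \<Rightarrow> bool" where
  "rank_one K v \<longleftrightarrow>
     (let \<Gamma> = carrier (value_group v K) in
       \<exists>h :: 'g \<Rightarrow> real. (\<forall>x\<in>\<Gamma>. \<forall>y\<in>\<Gamma>. h (x + y) = h x + h y) \<and> strict_mono_on \<Gamma> h)"


section \<open>Artin--Schreier extensions\<close>

definition galois_group :: "'a::field set \<Rightarrow> ('a \<Rightarrow> 'a) set" where
  "galois_group K = {\<tau> \<in> ring_iso type_ring type_ring. \<forall>x\<in>K. \<tau> x = x}"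

definition galois_norm :: "'a::field set \<Rightarrow> 'a \<Rightarrow> 'a" where
  "galois_norm K x = (\<Prod>\<tau>\<in>galois_group K. \<tau> x)"

definition AS :: "'a::field \<Rightarrow> 'a" where
  "AS x = x ^ CHAR('a) - x"

definition generates :: "'a::field set \<Rightarrow> 'a \<Rightarrow> bool" where
  "generates K x \<longleftrightarrow> generate_field type_ring (insert x K) = UNIV"

definition as_solutions :: "'a::field set \<Rightarrow> 'a set" where
  "as_solutions K = {\<beta>. AS \<beta> \<in> K \<and> generates K \<beta>}"

definition as_elements :: "'a::field set \<Rightarrow> 'a set" where
  "as_elements K = {g \<in> K - {0}. \<exists>\<beta>. AS \<beta> = g \<and> generates K \<beta>}"

text \<open>
  The elements of \<^term>\<open>as_elements K\<close> that define the same character as \<open>f\<close>, i.e. whose solutions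
  \<open>\<beta>\<close> satisfy \<open>\<sigma> \<beta> = \<beta> + 1\<close> for the automorphism \<open>\<sigma>\<close> attached to \<open>f\<close>.  With \<open>g\<close>, also \<open>j * g\<close> lies in
  \<^term>\<open>as_elements K\<close> for each nonzero \<open>j\<close> of the prime field, and \<open>dlog (j * g) = dlog g\<close> whereas
  \<open>1 / (j * g) = inverse j * (1 / g)\<close>.  Hence a linear map with \<open>1 / g \<mapsto> dlog g\<close> has to refer to one
  such class.
\<close>

definition as_class :: "'a::field set \<Rightarrow> 'a \<Rightarrow> 'a set" where
  "as_class K f = {g \<in> as_elements K. g - f \<in> AS ` K}"

text \<open>
  The infimum of \<open>- v h\<close> over all \<open>h\<close> congruent to \<open>g\<close> is taken over a set containing \<open>- v g\<close>, so it
  equals \<open>- v g\<close> iff \<open>- v g\<close> is a lower bound.  The condition \<open>h \<noteq> 0\<close> is there because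
  \<open>- v 0 = - \<infinity>\<close>.
\<close>

definition best :: "'a::field set \<Rightarrow> ('a \<Rightarrow> 'g::linordered_ab_group_add) \<Rightarrow> 'a \<Rightarrow> bool" where
  "best K v g \<longleftrightarrow> g \<in> K - {0} \<and>
     (v g = 0 \<or> (\<forall>h\<in>K. h - g \<in> AS ` K \<longrightarrow> h \<noteq> 0 \<and> - v g \<le> - v h))"

definition ideal_J ::
  "'a::field set \<Rightarrow> ('a \<Rightarrow> 'g::linordered_ab_group_add) \<Rightarrow> ('a \<Rightarrow> 'a) \<Rightarrow> 'a set" where
  "ideal_J K v \<sigma> = Idl\<^bsub>ring_on (ring_B K v)\<^esub> {\<sigma> b / b - 1 |b. b \<noteq> 0}"

definition ideal_I ::
  "'a::field set \<Rightarrow> ('a \<Rightarrow> 'g::linordered_ab_group_add) \<Rightarrow> ('a \<Rightarrow> 'a) \<Rightarrow> 'a set" where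
  "ideal_I K v \<sigma> = Idl\<^bsub>ring_on (ring_B K v)\<^esub> {\<sigma> b - b |b. b \<in> ring_B K v}"

definition ideal_H :: "'a::field set \<Rightarrow> ('a \<Rightarrow> 'g::linordered_ab_group_add) \<Rightarrow> 'a set" where
  "ideal_H K v = Idl\<^bsub>ring_on (ring_A K v)\<^esub> {1 / g |g. g \<in> as_elements K}"


subsection \<open>The four modules of the diagram and their canonical elements\<close>

definition mod_H :: "'a::field set \<Rightarrow> ('a \<Rightarrow> 'g::linordered_ab_group_add) \<Rightarrow> ('a, 'a set) module" where
  "mod_H K v =
     (let R = ring_on (ring_A K v); H = ideal_H K v in quot_module (ideal_module R H) (H \<cdot>\<^bsub>R\<^esub> H))"

definition cls_H :: "'a::field set \<Rightarrow> ('a \<Rightarrow> 'g::linordered_ab_group_add) \<Rightarrow> 'a \<Rightarrow> 'a set" where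
  "cls_H K v x =
     (let R = ring_on (ring_A K v); H = ideal_H K v in (H \<cdot>\<^bsub>R\<^esub> H) +>\<^bsub>ideal_module R H\<^esub> x)"

definition mod_J ::
  "'a::field set \<Rightarrow> ('a \<Rightarrow> 'g::linordered_ab_group_add) \<Rightarrow> ('a \<Rightarrow> 'a) \<Rightarrow> ('a, 'a set) module" where
  "mod_J K v \<sigma> =
     (let R = ring_on (ring_B K v); J = ideal_J K v \<sigma> in quot_module (ideal_module R J) (J \<cdot>\<^bsub>R\<^esub> J))"

definition cls_J ::
  "'a::field set \<Rightarrow> ('a \<Rightarrow> 'g::linordered_ab_group_add) \<Rightarrow> ('a \<Rightarrow> 'a) \<Rightarrow> 'a \<Rightarrow> 'a set" where
  "cls_J K v \<sigma> x =
     (let R = ring_on (ring_B K v); J = ideal_J K v \<sigma> in (J \<cdot>\<^bsub>R\<^esub> J) +>\<^bsub>ideal_module R J\<^esub> x)"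

definition sub_omega_A ::
  "'a::field set \<Rightarrow> ('a \<Rightarrow> 'g::linordered_ab_group_add) \<Rightarrow> ('a \<Rightarrow> 'a)
     \<Rightarrow> ('a logsym \<Rightarrow>\<^sub>0 'a) set set" where
  "sub_omega_A K v \<sigma> =
     ideal_smult (ring_on (ring_A K v)) (ideal_I K v \<sigma> \<inter> ring_A K v) (omega (ring_A K v))"

definition mod_omega_A ::
  "'a::field set \<Rightarrow> ('a \<Rightarrow> 'g::linordered_ab_group_add) \<Rightarrow> ('a \<Rightarrow> 'a)
     \<Rightarrow> ('a, ('a logsym \<Rightarrow>\<^sub>0 'a) set set) module" where
  "mod_omega_A K v \<sigma> = quot_module (omega (ring_A K v)) (sub_omega_A K v \<sigma>)"

definition sym_omega_A ::
  "'a::field set \<Rightarrow> ('a \<Rightarrow> 'g::linordered_ab_group_add) \<Rightarrow> ('a \<Rightarrow> 'a)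
     \<Rightarrow> 'a logsym \<Rightarrow> ('a logsym \<Rightarrow>\<^sub>0 'a) set set" where
  "sym_omega_A K v \<sigma> s =
     sub_omega_A K v \<sigma> +>\<^bsub>omega (ring_A K v)\<^esub> omega_sym (ring_A K v) s"

definition sub_omega_BA ::
  "'a::field set \<Rightarrow> ('a \<Rightarrow> 'g::linordered_ab_group_add) \<Rightarrow> ('a \<Rightarrow> 'a)
     \<Rightarrow> ('a logsym \<Rightarrow>\<^sub>0 'a) set set set" where
  "sub_omega_BA K v \<sigma> =
     ideal_smult (ring_on (ring_B K v)) (ideal_J K v \<sigma>) (omega_rel (ring_A K v) (ring_B K v))"

definition mod_omega_BA ::
  "'a::field set \<Rightarrow> ('a \<Rightarrow> 'g::linordered_ab_group_add) \<Rightarrow> ('a \<Rightarrow> 'a)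
     \<Rightarrow> ('a, ('a logsym \<Rightarrow>\<^sub>0 'a) set set set) module" where
  "mod_omega_BA K v \<sigma> =
     quot_module (omega_rel (ring_A K v) (ring_B K v)) (sub_omega_BA K v \<sigma>)"

definition sym_omega_BA ::
  "'a::field set \<Rightarrow> ('a \<Rightarrow> 'g::linordered_ab_group_add) \<Rightarrow> ('a \<Rightarrow> 'a)
     \<Rightarrow> 'a logsym \<Rightarrow> ('a logsym \<Rightarrow>\<^sub>0 'a) set set set" where
  "sym_omega_BA K v \<sigma> s =
     sub_omega_BA K v \<sigma> +>\<^bsub>omega_rel (ring_A K v) (ring_B K v)\<^esub>
       omega_rel_sym (ring_A K v) (ring_B K v) s"


subsection \<open>The maps of the diagram\<close>

definition is_rsw ::
  "'a::field set \<Rightarrow> ('a \<Rightarrow> 'g::linordered_ab_group_add) \<Rightarrow> ('a \<Rightarrow> 'a) \<Rightarrow> 'a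
     \<Rightarrow> ('a set \<Rightarrow> ('a logsym \<Rightarrow>\<^sub>0 'a) set set) \<Rightarrow> bool" where
  "is_rsw K v \<sigma> f rsw \<longleftrightarrow>
     rsw \<in> module_hom (ring_on (ring_A K v)) (mod_H K v) (mod_omega_A K v \<sigma>) \<and>
     (\<forall>g\<in>as_class K f. rsw (cls_H K v (1 / g)) = sym_omega_A K v \<sigma> (Dlog g))"

definition is_phi ::
  "'a::field set \<Rightarrow> ('a \<Rightarrow> 'g::linordered_ab_group_add) \<Rightarrow> ('a \<Rightarrow> 'a)
     \<Rightarrow> (('a logsym \<Rightarrow>\<^sub>0 'a) set set set \<Rightarrow> 'a set) \<Rightarrow> bool" where
  "is_phi K v \<sigma> \<phi> \<longleftrightarrow>
     \<phi> \<in> module_iso (ring_on (ring_B K v)) (mod_omega_BA K v \<sigma>) (mod_J K v \<sigma>) \<and>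
     (\<forall>x. x \<noteq> 0 \<longrightarrow> \<phi> (sym_omega_BA K v \<sigma> (Dlog x)) = cls_J K v \<sigma> (\<sigma> x / x - 1))"

definition is_norm_map ::
  "'a::field set \<Rightarrow> ('a \<Rightarrow> 'g::linordered_ab_group_add) \<Rightarrow> ('a \<Rightarrow> 'a)
     \<Rightarrow> ('a set \<Rightarrow> 'a set) \<Rightarrow> bool" where
  "is_norm_map K v \<sigma> Nb \<longleftrightarrow>
     Nb \<in> carrier (mod_J K v \<sigma>) \<rightarrow>\<^sub>E carrier (mod_H K v) \<and>
     (\<forall>x\<in>ideal_J K v \<sigma>. galois_norm K x \<in> ideal_H K v \<and>
        Nb (cls_J K v \<sigma> x) = cls_H K v (galois_norm K x))"

text \<open>
  The description of \<open>\<Delta>\<^sub>N\<close> depends on auxiliary choices: in the defectless case a solution \<open>\<alpha>\<close> whose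
  \<open>f = AS \<alpha>\<close> is best; in the case with defect a base solution \<open>\<alpha>\<^sub>0\<close> and elements \<open>\<gamma> \<beta>\<close> of \<open>A\<close>.
\<close>

definition choice_defectless ::
  "'a::field set \<Rightarrow> ('a \<Rightarrow> 'g::linordered_ab_group_add) \<Rightarrow> 'a \<Rightarrow> bool" where
  "choice_defectless K v \<alpha> \<longleftrightarrow> \<alpha> \<in> as_solutions K \<and> best K v (AS \<alpha>)"

definition is_Delta_defectless ::
  "'a::field set \<Rightarrow> ('a \<Rightarrow> 'g::linordered_ab_group_add) \<Rightarrow> ('a \<Rightarrow> 'a) \<Rightarrow> 'a
     \<Rightarrow> (('a logsym \<Rightarrow>\<^sub>0 'a) set set set \<Rightarrow> ('a logsym \<Rightarrow>\<^sub>0 'a) set set) \<Rightarrow> bool" where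
  "is_Delta_defectless K v \<sigma> \<alpha> \<Delta> \<longleftrightarrow>
     \<Delta> \<in> carrier (mod_omega_BA K v \<sigma>) \<rightarrow>\<^sub>E carrier (mod_omega_A K v \<sigma>) \<and>
     (\<forall>b\<in>ring_B K v.
        \<Delta> (b \<odot>\<^bsub>mod_omega_BA K v \<sigma>\<^esub> sym_omega_BA K v \<sigma> (Dlog \<alpha>)) =
        galois_norm K b \<odot>\<^bsub>mod_omega_A K v \<sigma>\<^esub> sym_omega_A K v \<sigma> (Dlog (AS \<alpha>)))"

definition solutions_above ::
  "'a::field set \<Rightarrow> ('a \<Rightarrow> 'g::linordered_ab_group_add) \<Rightarrow> 'a \<Rightarrow> 'a set" where
  "solutions_above K v \<alpha>\<^sub>0 = {\<beta> \<in> as_solutions K. v \<alpha>\<^sub>0 < v \<beta>}"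

definition choice_defect ::
  "'a::field set \<Rightarrow> ('a \<Rightarrow> 'g::linordered_ab_group_add) \<Rightarrow> 'a \<Rightarrow> ('a \<Rightarrow> 'a) \<Rightarrow> bool" where
  "choice_defect K v \<alpha>\<^sub>0 \<gamma> \<longleftrightarrow> \<alpha>\<^sub>0 \<in> as_solutions K \<and>
     (\<forall>\<beta>\<in>solutions_above K v \<alpha>\<^sub>0. \<gamma> \<beta> \<in> ring_A K v - {0} \<and> v (\<gamma> \<beta>) = - v \<beta>)"

definition is_Delta_defect ::
  "'a::field set \<Rightarrow> ('a \<Rightarrow> 'g::linordered_ab_group_add) \<Rightarrow> ('a \<Rightarrow> 'a) \<Rightarrow> 'a \<Rightarrow> ('a \<Rightarrow> 'a)
     \<Rightarrow> (('a logsym \<Rightarrow>\<^sub>0 'a) set set set \<Rightarrow> ('a logsym \<Rightarrow>\<^sub>0 'a) set set) \<Rightarrow> bool" where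
  "is_Delta_defect K v \<sigma> \<alpha>\<^sub>0 \<gamma> \<Delta> \<longleftrightarrow>
     \<Delta> \<in> carrier (mod_omega_BA K v \<sigma>) \<rightarrow>\<^sub>E carrier (mod_omega_A K v \<sigma>) \<and>
     (\<forall>\<beta>\<in>solutions_above K v \<alpha>\<^sub>0. let \<beta>' = \<beta> * \<gamma> \<beta> in
        \<forall>b\<in>adjoin (ring_A K v) \<beta>'.
          \<Delta> (b \<odot>\<^bsub>mod_omega_BA K v \<sigma>\<^esub> sym_omega_BA K v \<sigma> (D \<beta>')) =
          galois_norm K (b * \<beta>') \<odot>\<^bsub>mod_omega_A K v \<sigma>\<^esub> sym_omega_A K v \<sigma> (Dlog (AS \<beta>)))"

end

theory Submission imports Defs begin

text \<open>
  Let \<open>\<beta>\<close> run through the set \<open>gens\<close> of the translates \<open>\<alpha> + c\<close>, \<open>c \<in> K\<close>; on these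
  \<open>\<sigma>\<close> acts by \<open>\<beta> \<mapsto> \<beta> + 1\<close>, and every Artin--Schreier generator of \<open>L|K\<close> is a multiple of one of them by
  an element of the prime field.  The valuation is invariant under \<open>\<sigma>\<close> because \<open>K\<close> is henselian, so the
  norm \<open>AS \<beta>\<close> of \<open>\<beta>\<close> has the value \<open>p \<cdot> v \<beta>\<close>, and \<open>v \<beta> \<le> 0\<close>.  The proof lets \<open>v \<beta>\<close> grow.

  The central fact, \<open>eventually_expands\<close>, is that for each \<open>x \<in> L\<close> and for all \<open>\<beta>\<close> of sufficiently large
  value, \<open>x\<close> is a polynomial in \<open>\<beta>\<close> over \<open>K\<close> of degree less than \<open>p\<close> none of whose terms has a smaller value
  than \<open>x\<close>.  Suppose first that some \<open>\<beta>\<close> has the largest possible value.  If \<open>v \<beta>\<close> is not a value of \<open>K\<close>,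
  then the terms of the polynomial have different values.  Otherwise some \<open>\<beta> \<gamma>\<close> with \<open>\<gamma> \<in> K\<close> is a unit, and
  the residue classes of its powers below \<open>p\<close> are linearly independent over the residue field of \<open>K\<close>
  (\<open>residue_independent\<close>).  If no \<open>\<beta>\<close> has the largest possible value, then eventually the constant term
  dominates all others (\<open>defect_expansion\<close>); where this might fail, Hensel's lemma splits off a linear factor.

  Three descriptions follow.
  \<^item> Apply \<open>\<sigma> - 1\<close> to the expansion of \<open>x\<close>: the constant term disappears, and the others are multiplied by
    elements of \<open>(1 / \<beta>)\<close>.  Hence \<open>J\<close> is the union of the ideals \<open>(1 / \<beta>)\<close> of \<open>B\<close>; likewise \<open>H\<close> is the union of
    the ideals \<open>(1 / AS \<beta>)\<close> of \<open>A\<close>.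
  \<^item> Apply the logarithmic differential: \<open>dlog\<close> of the coefficients is zero in \<open>\<omega>\<^sub>B\<^sub>|\<^sub>A\<close>, and the quotients of
    the terms by \<open>x\<close> are integral, so \<open>dlog x\<close> is a multiple of \<open>dlog \<beta>\<close>.  Hence \<open>\<omega>\<^sub>B\<^sub>|\<^sub>A\<close> modulo \<open>J\<close> is the
    union of the modules \<open>B dlog \<beta>\<close>.
  \<^item> Apply the trace, which vanishes on \<open>\<beta>\<^sup>i\<close> for \<open>i < p - 1\<close>: the trace of \<open>x\<close> is divisible by
    \<open>x (1 / \<beta>)\<^sup>p\<^sup>-\<^sup>1\<close>.  The mixed terms in \<open>N (x + z)\<close> are such traces.

  Now \<open>rsw\<close> exists because for \<open>\<beta> = \<beta>' + c\<close> the relation \<open>AS \<beta> = AS \<beta>' + c\<^sup>p - c\<close> makes \<open>dlog (AS \<beta>)\<close> the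
  right multiple of \<open>dlog (AS \<beta>')\<close> modulo \<open>I \<omega>\<close> (\<open>dlA_gens\<close>).  The map \<open>\<phi>\<close> exists because
  \<open>b \<mapsto> \<sigma> b - b\<close> is a derivation modulo \<open>J\<^sup>2\<close>, and it is bijective because it sends the generator \<open>dlog \<beta>\<close> to
  the generator \<open>1 / \<beta>\<close>.  The estimate of the mixed terms shows that the norm is well defined and injective
  modulo squares (\<open>norm_congruent\<close>, \<open>norm_injective\<close>).  Finally the composition sends \<open>b dlog \<beta>\<close> to
  \<open>b / \<beta>\<close>, to \<open>N b / AS \<beta>\<close> and to \<open>N b dlog (AS \<beta>)\<close>.  This is the formula that defines \<open>\<Delta>\<close>, both in
  the defectless case, which is the case of a \<open>\<beta>\<close> of largest value (\<open>defectless_iff_best\<close>), and in the case of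
  defect.
\<close>

section \<open>Comparing values\<close>

locale valued_field =
  fixes v :: "'a::field \<Rightarrow> 'g::linordered_ab_group_add"
  assumes val: "valuation v"
begin

text \<open>
  All estimates use the following relations instead of \<open>\<le>\<close> between values, so that \<open>0\<close>, whose value is
  unspecified, counts as the element of infinite value.
\<close>

definition vle :: "'a \<Rightarrow> 'a \<Rightarrow> bool" (infix \<open>\<preceq>\<close> 50) where
  "x \<preceq> y \<longleftrightarrow> y = 0 \<or> (x \<noteq> 0 \<and> v x \<le> v y)"

definition vless :: "'a \<Rightarrow> 'a \<Rightarrow> bool" (infix \<open>\<lless>\<close> 50) where
  "x \<lless> y \<longleftrightarrow> \<not> y \<preceq> x"

abbreviation integers :: "'a set" (\<open>\<O>\<close>) where
  "\<O> \<equiv> val_ring v UNIV"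

lemma v_mult: "x \<noteq> 0 \<Longrightarrow> y \<noteq> 0 \<Longrightarrow> v (x * y) = v x + v y"
  using val by (auto simp: valuation_def)

lemma v_add: "x \<noteq> 0 \<Longrightarrow> y \<noteq> 0 \<Longrightarrow> x + y \<noteq> 0 \<Longrightarrow> min (v x) (v y) \<le> v (x + y)"
  using val unfolding valuation_def by blast

lemma v_one [simp]: "v 1 = 0"
  using v_mult[of 1 1] by simp

lemma v_uminus [simp]: "v (- x) = v x"
proof (cases "x = 0")
  case False
  have "v (-1) + v (-1) = 0" using v_mult[of "-1" "-1"] by simp
  hence "v (-1) = 0" by (simp add: double_zero)
  thus ?thesis using v_mult[of "-1" x] False by simp
qed simp

lemma v_inverse: "x \<noteq> 0 \<Longrightarrow> v (inverse x) = - v x"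
  using v_mult[of x "inverse x"] by (simp add: eq_neg_iff_add_eq_0 add.commute)

lemma vless_iff: "x \<lless> y \<longleftrightarrow> x \<noteq> 0 \<and> (y = 0 \<or> v x < v y)"
  by (auto simp: vless_def vle_def)

lemma vle_refl [simp]: "x \<preceq> x" by (auto simp: vle_def)

lemma vle_trans [trans]: "x \<preceq> y \<Longrightarrow> y \<preceq> z \<Longrightarrow> x \<preceq> z"
  by (auto simp: vle_def)

lemma vle_total: "x \<preceq> y \<or> y \<preceq> x"
  by (auto simp: vle_def)

lemma vle_vless_trans [trans]: "x \<preceq> y \<Longrightarrow> y \<lless> z \<Longrightarrow> x \<lless> z"
  using vle_trans vless_def by blast

lemma vless_vle_trans [trans]: "x \<lless> y \<Longrightarrow> y \<preceq> z \<Longrightarrow> x \<lless> z"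
  using vle_trans vless_def by blast

lemma vless_imp_vle: "x \<lless> y \<Longrightarrow> x \<preceq> y"
  using vle_total vless_def by blast

lemma vless_irrefl [simp]: "\<not> x \<lless> x" by (simp add: vless_def)

lemma not_vle: "\<not> x \<preceq> y \<longleftrightarrow> y \<lless> x" by (simp add: vless_def)

lemma not_vless: "\<not> x \<lless> y \<longleftrightarrow> y \<preceq> x" by (simp add: vless_def)

lemma vle_0 [simp]: "x \<preceq> 0" by (simp add: vle_def)

lemma zero_vle [simp]: "0 \<preceq> x \<longleftrightarrow> x = 0" by (simp add: vle_def)

lemma vless_0 [simp]: "x \<lless> 0 \<longleftrightarrow> x \<noteq> 0" by (simp add: vless_iff)

lemma vless_nonzero: "x \<lless> y \<Longrightarrow> x \<noteq> 0" by (simp add: vless_iff)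

lemma vle_uminus [simp]: "x \<preceq> - y \<longleftrightarrow> x \<preceq> y" "- x \<preceq> y \<longleftrightarrow> x \<preceq> y"
  by (auto simp: vle_def)

lemma vless_uminus [simp]: "x \<lless> - y \<longleftrightarrow> x \<lless> y" "- x \<lless> y \<longleftrightarrow> x \<lless> y"
  by (auto simp: vless_def)

lemma vle_add: "z \<preceq> x \<Longrightarrow> z \<preceq> y \<Longrightarrow> z \<preceq> x + y"
  using v_add[of x y] by (cases "x = 0"; cases "y = 0"; cases "x + y = 0") (auto simp: vle_def min_def split: if_splits)

lemma vle_diff: "z \<preceq> x \<Longrightarrow> z \<preceq> y \<Longrightarrow> z \<preceq> x - y"
  using vle_add[of z x "- y"] by simp

lemma vle_sum: "(\<And>i. i \<in> I \<Longrightarrow> z \<preceq> f i) \<Longrightarrow> z \<preceq> sum f I"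
  by (induction I rule: infinite_finite_induct) (auto intro: vle_add)

lemma vless_add: "z \<lless> x \<Longrightarrow> z \<lless> y \<Longrightarrow> z \<lless> x + y"
  using v_add[of x y] by (cases "x = 0"; cases "y = 0"; cases "x + y = 0") (auto simp: vless_iff min_def split: if_splits)

lemma vless_diff: "z \<lless> x \<Longrightarrow> z \<lless> y \<Longrightarrow> z \<lless> x - y"
  using vless_add[of z x "- y"] by simp

lemma vless_sum: "z \<noteq> 0 \<Longrightarrow> (\<And>i. i \<in> I \<Longrightarrow> z \<lless> f i) \<Longrightarrow> z \<lless> sum f I"
  by (induction I rule: infinite_finite_induct) (auto intro: vless_add)

lemma dominant_add:
  assumes "x \<lless> y" shows "x \<preceq> x + y" "x + y \<preceq> x"
proof -
  show "x \<preceq> x + y" using assms by (intro vle_add) (auto intro: vless_imp_vle)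
  show "x + y \<preceq> x"
  proof (rule ccontr)
    assume "\<not> x + y \<preceq> x"
    hence "x \<lless> (x + y) - y" using assms by (intro vless_diff) (auto simp: not_vle)
    thus False by simp
  qed
qed

lemma vle_mult: "a \<preceq> b \<Longrightarrow> c \<preceq> d \<Longrightarrow> a * c \<preceq> b * d"
  by (auto simp: vle_def v_mult intro: add_mono)

lemma vless_mult: "a \<lless> b \<Longrightarrow> c \<preceq> d \<Longrightarrow> c \<noteq> 0 \<Longrightarrow> a * c \<lless> b * d"
  by (cases "d = 0"; cases "b = 0") (auto simp: vle_def vless_iff v_mult intro: add_less_le_mono)

lemma vless_mult': "a \<preceq> b \<Longrightarrow> c \<lless> d \<Longrightarrow> a \<noteq> 0 \<Longrightarrow> a * c \<lless> b * d"
  using vless_mult[of c d a b] by (simp add: mult.commute)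

lemma vle_mult_cancel [simp]: "c \<noteq> 0 \<Longrightarrow> a * c \<preceq> b * c \<longleftrightarrow> a \<preceq> b" "c \<noteq> 0 \<Longrightarrow> c * a \<preceq> c * b \<longleftrightarrow> a \<preceq> b"
  by (auto simp: vle_def v_mult)

lemma vless_mult_cancel [simp]: "c \<noteq> 0 \<Longrightarrow> a * c \<lless> b * c \<longleftrightarrow> a \<lless> b" "c \<noteq> 0 \<Longrightarrow> c * a \<lless> c * b \<longleftrightarrow> a \<lless> b"
  by (simp_all add: vless_def)

lemma vle_power: "a \<preceq> b \<Longrightarrow> a ^ n \<preceq> b ^ n"
  by (induction n) (auto intro: vle_mult)

lemma vless_power: "a \<lless> b \<Longrightarrow> n > 0 \<Longrightarrow> a ^ n \<lless> b ^ n"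
proof (induction n)
  case (Suc n)
  have "a * a ^ n \<lless> b * b ^ n"
    using Suc.prems by (intro vless_mult vle_power vless_imp_vle) (auto dest: vless_nonzero)
  thus ?case by simp
qed simp

lemma vle_power_cancel: "a ^ n \<preceq> b ^ n \<Longrightarrow> n > 0 \<Longrightarrow> a \<preceq> b"
  using vless_power[of b a n] by (auto simp: vless_def)

lemma vle_divide_right: "c \<noteq> 0 \<Longrightarrow> a \<preceq> b / c \<longleftrightarrow> a * c \<preceq> b"
  using vle_mult_cancel(1)[of c a "b / c"] by simp

lemma vle_divide_left: "c \<noteq> 0 \<Longrightarrow> a / c \<preceq> b \<longleftrightarrow> a \<preceq> b * c"
  using vle_mult_cancel(1)[of c "a / c" b] by simp

lemma vless_divide_right: "c \<noteq> 0 \<Longrightarrow> a \<lless> b / c \<longleftrightarrow> a * c \<lless> b"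
  by (simp add: vless_def vle_divide_left)

lemma vle_prod: "(\<And>i. i \<in> I \<Longrightarrow> f i \<preceq> g i) \<Longrightarrow> prod f I \<preceq> prod g I"
  by (induction I rule: infinite_finite_induct) (auto intro: vle_mult)

lemma mem_integers: "x \<in> \<O> \<longleftrightarrow> 1 \<preceq> x"
  by (auto simp: val_ring_def vle_def)

lemma mem_val_ring: "x \<in> val_ring v F \<longleftrightarrow> x \<in> F \<and> 1 \<preceq> x"
  by (auto simp: val_ring_def vle_def)

lemma mem_max_ideal: "x \<in> max_ideal v (val_ring v F) \<longleftrightarrow> x \<in> F \<and> 1 \<lless> x"
  by (auto simp: val_ring_def vless_iff max_ideal_def)

lemma one_vle_mult: "1 \<preceq> a \<Longrightarrow> 1 \<preceq> b \<Longrightarrow> 1 \<preceq> a * b"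
  using vle_mult[of 1 a 1 b] by simp

lemma vle_mult_integer: "a \<preceq> b \<Longrightarrow> 1 \<preceq> c \<Longrightarrow> a \<preceq> c * b"
  using vle_mult[of 1 c a b] by simp

lemma one_vle_power: "1 \<preceq> a \<Longrightarrow> 1 \<preceq> a ^ n"
  using vle_power[of 1 a n] by simp

lemma vless_mult_integer: "a \<lless> b \<Longrightarrow> 1 \<preceq> c \<Longrightarrow> a \<lless> c * b"
  using vless_mult'[of 1 c a b] by simp

lemma one_vle_of_nat [simp]: "1 \<preceq> of_nat n"
  by (induction n) (auto intro: vle_add)

text \<open>
  No cancellation occurs: the nonzero term of smallest value strictly dominates the sum of the others.
\<close>

lemma sum_vle_terms:
  assumes "finite I"
    and dist: "\<And>i j. i \<in> I \<Longrightarrow> j \<in> I \<Longrightarrow> i \<noteq> j \<Longrightarrow> t i \<noteq> 0 \<Longrightarrow> t j \<noteq> 0 \<Longrightarrow> v (t i) \<noteq> v (t j)"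
    and "i \<in> I"
  shows "sum t I \<preceq> t i"
proof (cases "\<forall>i\<in>I. t i = 0")
  case False
  define I' where "I' = {i\<in>I. t i \<noteq> 0}"
  have fin: "finite I'" "I' \<noteq> {}" using False assms(1) by (auto simp: I'_def)
  have "Min ((\<lambda>i. v (t i)) ` I') \<in> (\<lambda>i. v (t i)) ` I'" using fin by (intro Min_in) auto
  then obtain j where "j \<in> I'" and min: "v (t j) = Min ((\<lambda>i. v (t i)) ` I')" by auto
  with fin have j: "j \<in> I'" "\<And>k. k \<in> I' \<Longrightarrow> v (t j) \<le> v (t k)"
    by (auto simp: min)
  have less: "t j \<lless> t k" if "k \<in> I - {j}" for k
    using that j dist[of j k] by (cases "t k = 0") (auto simp: vless_iff I'_def order.strict_iff_order)
  have "sum t I = t j + sum t (I - {j})"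
    using j assms(1) by (subst sum.remove[of I j]) (auto simp: I'_def)
  moreover have "t j \<lless> sum t (I - {j})"
    using j less by (intro vless_sum) (auto simp: I'_def)
  ultimately have "sum t I \<preceq> t j" by (simp add: dominant_add)
  also have "t j \<preceq> t i" using less[of i] assms(3) by (cases "i = j") (auto intro: vless_imp_vle)
  finally show ?thesis .
qed (use assms in auto)

end


section \<open>Artin--Schreier extensions\<close>

text \<open>
  Translating the variable of a polynomial expresses an expansion in powers of one generator by the expansion
  in powers of another one.
\<close>

lemma pcompose_linear_coeff:
  fixes P :: "'a::comm_ring_1 poly"
  assumes "degree P \<le> n"
  shows "coeff (P \<circ>\<^sub>p [:c, 1:]) k = (\<Sum>i\<le>n. of_nat (i choose k) * coeff P i * c ^ (i - k))"
proof -
  have P: "P = (\<Sum>i\<le>n. smult (coeff P i) ([:0, 1:] ^ i))"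
    using poly_as_sum_of_monoms'[OF assms] by (simp add: monom_altdef)
  have pw: "([:0, 1:] ^ i) \<circ>\<^sub>p [:c, 1:] = [:c, 1:] ^ i" for i
    by (induction i) (simp_all add: pcompose_1 pcompose_mult pcompose_pCons)
  have "P \<circ>\<^sub>p [:c, 1:] = (\<Sum>i\<le>n. smult (coeff P i) ([:c, 1:] ^ i))"
    by (subst P) (simp add: pcompose_sum pcompose_smult pw)
  hence "coeff (P \<circ>\<^sub>p [:c, 1:]) k = (\<Sum>i\<le>n. coeff P i * coeff ([:c, 1:] ^ i) k)"
    by (simp add: coeff_sum)
  also have "\<dots> = (\<Sum>i\<le>n. of_nat (i choose k) * coeff P i * c ^ (i - k))"
  proof (rule sum.cong)
    fix i
    have "coeff ([:c, 1:] ^ i) k = of_nat (i choose k) * c ^ (i - k)"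
    proof (cases "k \<le> i")
      case True
      thus ?thesis using coeff_linear_poly_power[of k i c 1] by simp
    next
      case False
      hence "degree ([:c, 1:] ^ i) < k"
        by (metis degree_linear_power not_le_imp_less)
      thus ?thesis using False by (simp add: coeff_eq_0 binomial_eq_0)
    qed
    thus "coeff P i * coeff ([:c, 1:] ^ i) k = of_nat (i choose k) * coeff P i * c ^ (i - k)"
      by (simp only: ac_simps)
  qed simp
  finally show ?thesis .
qed

locale as_extension =
  fixes K :: "'a::field set" and p :: nat and \<alpha> :: 'a and \<sigma> :: "'a \<Rightarrow> 'a"
  assumes char: "CHAR('a) = p" and p_pos: "p > 0"
    and subfield_K: "subfield K type_ring"
    and AS_\<alpha>: "\<alpha> ^ p - \<alpha> \<in> K" and gen_\<alpha>: "generates K \<alpha>"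
    and \<sigma>_gal: "\<sigma> \<in> galois_group K" and \<sigma>_\<alpha>: "\<sigma> \<alpha> = \<alpha> + 1"
begin

lemma prime_p: "normalization_semidom_class.prime p"
  using prime_CHAR_semidom[where 'a = 'a] char p_pos by simp

lemma p_ge_2: "p \<ge> 2" using prime_ge_2_nat[OF prime_p] .

lemma of_nat_p [simp]: "of_nat p = (0::'a)"
  using of_nat_CHAR[where 'a = 'a] char by simp

lemma of_nat_eq_0_iff: "of_nat n = (0::'a) \<longleftrightarrow> p dvd n"
  by (simp add: of_nat_eq_0_iff_char_dvd char)

lemma of_nat_neq_0: "0 < n \<Longrightarrow> n < p \<Longrightarrow> of_nat n \<noteq> (0::'a)"
  by (auto simp: of_nat_eq_0_iff dest: dvd_imp_le)

lemma inj_of_nat: "inj_on (of_nat :: nat \<Rightarrow> 'a) {..<p}"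
proof (rule linorder_inj_onI')
  fix i j :: nat assume "i \<in> {..<p}" "j \<in> {..<p}" "i < j"
  hence "of_nat (j - i) \<noteq> (0::'a)" by (intro of_nat_neq_0) auto
  thus "of_nat i \<noteq> (of_nat j :: 'a)" using \<open>i < j\<close> by (simp add: of_nat_diff)
qed

lemma frobenius_add: "(x + y) ^ p = x ^ p + (y ^ p :: 'a)"
  by (rule freshmans_dream) (simp_all add: char prime_p)

lemma frobenius_uminus: "(- x) ^ p = - (x ^ p :: 'a)"
  by (rule minus_power_prime_CHAR) (simp_all add: char prime_p)

lemma frobenius_diff: "(x - y) ^ p = x ^ p - (y ^ p :: 'a)"
  using frobenius_add[of x "- y"] by (simp add: frobenius_uminus)

lemma frobenius_of_nat [simp]: "of_nat j ^ p = (of_nat j :: 'a)"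
  using p_pos by (induction j) (simp_all add: frobenius_add)

lemma AS_eq: "AS x = x ^ p - (x::'a)" by (simp add: AS_def char)

lemma AS_add: "AS (x + y) = AS x + (AS y :: 'a)"
  by (simp add: AS_eq frobenius_add)

lemma AS_diff: "AS (x - y) = AS x - (AS y :: 'a)"
  by (simp add: AS_eq frobenius_diff)

lemma AS_of_nat [simp]: "AS (of_nat j) = (0::'a)"
  by (simp add: AS_eq)

lemma AS_of_nat_mult: "AS (of_nat j * x) = of_nat j * (AS x :: 'a)"
  by (simp add: AS_eq power_mult_distrib right_diff_distrib)

text \<open>Both sides are monic of degree \<open>p\<close> in \<open>x\<close> and vanish on the prime field.\<close>

lemma prod_translates: "(\<Prod>j<p. x + of_nat j) = x ^ p - (x::'a)"
proof -
  define P where "P = (\<Prod>j<p. [:of_nat j, 1::'a:])"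
  define Q where "Q = monom (1::'a) p - [:0, 1:]"
  have degP: "degree P = p"
    unfolding P_def by (subst degree_prod_sum_eq) auto
  have lP: "coeff P p = 1"
    using lead_coeff_prod[of "\<lambda>j. [:of_nat j, 1::'a:]" "{..<p}"] degP unfolding P_def by simp
  have "P = Q"
  proof (rule poly_eqI_degree_lead_coeff[where n = p and A = "(\<lambda>j. - of_nat j) ` {..<p}"])
    show "coeff P p = coeff Q p" using lP p_ge_2 by (simp add: Q_def coeff_pCons split: nat.split)
    show "p \<le> card ((\<lambda>j. - of_nat j :: 'a) ` {..<p})"
      using inj_of_nat by (subst card_image) (auto simp: inj_on_def)
    show "degree Q \<le> p" using p_ge_2 unfolding Q_def
      by (intro degree_diff_le) (auto simp: degree_monom_le)
    fix z :: 'a assume "z \<in> (\<lambda>j. - of_nat j) ` {..<p}"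
    then obtain j where j: "j < p" "z = - of_nat j" by auto
    have "poly P z = 0" unfolding P_def poly_prod using j by (intro prod_zero) auto
    moreover have "poly Q z = 0" using j by (simp add: Q_def poly_monom frobenius_uminus)
    ultimately show "poly P z = poly Q z" by simp
  qed (use degP in auto)
  hence "poly P x = poly Q x" by simp
  thus ?thesis by (simp add: P_def Q_def poly_prod poly_monom add.commute)
qed

lemma AS_eq_0_iff: "AS x = (0::'a) \<longleftrightarrow> (\<exists>j<p. x = of_nat j)"
proof
  assume "AS x = 0"
  hence "(\<Prod>j<p. x + of_nat j) = 0" by (simp add: prod_translates AS_eq)
  then obtain j where j: "j < p" "x + of_nat j = 0" by auto
  show "\<exists>j<p. x = of_nat j"
  proof (cases "j = 0")
    case False
    have "x = of_nat (p - j)" using j by (simp add: of_nat_diff eq_neg_iff_add_eq_0)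
    thus ?thesis using False p_pos by (intro exI[of _ "p - j"]) auto
  qed (use j in auto)
qed auto


subsection \<open>The base field\<close>

lemma K_0 [simp]: "0 \<in> K" and K_1 [simp]: "1 \<in> K"
  and K_uminus [simp]: "x \<in> K \<Longrightarrow> - x \<in> K"
  and K_mult [simp]: "x \<in> K \<Longrightarrow> y \<in> K \<Longrightarrow> x * y \<in> K"
  and K_add [simp]: "x \<in> K \<Longrightarrow> y \<in> K \<Longrightarrow> x + y \<in> K"
proof -
  note E = subringE[OF subfieldE(1)[OF subfield_K]]
  interpret ring "type_ring :: 'a ring" by (rule ring_from_type_algebra)
  show "0 \<in> K" "1 \<in> K" "x \<in> K \<Longrightarrow> y \<in> K \<Longrightarrow> x * y \<in> K" "x \<in> K \<Longrightarrow> y \<in> K \<Longrightarrow> x + y \<in> K"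
    using E by (auto simp: ring_of_type_algebra_def)
  assume "x \<in> K"
  have "\<ominus>\<^bsub>type_ring\<^esub> x = - x"
    by (rule minus_equality) (auto simp: ring_of_type_algebra_def)
  thus "- x \<in> K" using E(5)[OF \<open>x \<in> K\<close>] by simp
qed

lemma K_diff [simp]: "x \<in> K \<Longrightarrow> y \<in> K \<Longrightarrow> x - y \<in> K"
  using K_add[of x "- y"] by simp

lemma K_inverse [simp]: "x \<in> K \<Longrightarrow> inverse x \<in> K"
proof (cases "x = 0")
  case False
  interpret R: field "type_ring :: 'a ring" by (rule field_from_type_algebra)
  assume x: "x \<in> K"
  have "inv\<^bsub>type_ring\<^esub> x = inverse x"
    using False by (intro R.comm_inv_char) (auto simp: ring_of_type_algebra_def)
  thus ?thesis using R.subfield_m_inv(1)[OF subfield_K, of x] x False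
    by (auto simp: ring_of_type_algebra_def)
qed simp

lemma K_divide [simp]: "x \<in> K \<Longrightarrow> y \<in> K \<Longrightarrow> x / y \<in> K"
  by (simp add: divide_inverse)

lemma K_power [simp]: "x \<in> K \<Longrightarrow> x ^ n \<in> K" by (induction n) auto

lemma K_of_nat [simp]: "of_nat n \<in> K" by (induction n) auto

lemma K_sum: "(\<And>i. i \<in> I \<Longrightarrow> h i \<in> K) \<Longrightarrow> sum h I \<in> K"
  by (induction I rule: infinite_finite_induct) auto

definition K_poly :: "'a poly \<Rightarrow> bool" where
  "K_poly P \<longleftrightarrow> (\<forall>i. coeff P i \<in> K)"

lemma K_poly_coeff [simp]: "K_poly P \<Longrightarrow> coeff P i \<in> K" by (simp add: K_poly_def)

lemma K_poly_0 [simp]: "K_poly 0" and K_poly_1 [simp]: "K_poly 1"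
  by (simp_all add: K_poly_def coeff_1)

lemma K_poly_pCons [simp]: "K_poly (pCons a P) \<longleftrightarrow> a \<in> K \<and> K_poly P"
  unfolding K_poly_def by (metis coeff_pCons_0 coeff_pCons_Suc not0_implies_Suc)

lemma K_poly_add [simp]: "K_poly P \<Longrightarrow> K_poly Q \<Longrightarrow> K_poly (P + Q)"
  and K_poly_diff [simp]: "K_poly P \<Longrightarrow> K_poly Q \<Longrightarrow> K_poly (P - Q)"
  and K_poly_uminus [simp]: "K_poly P \<Longrightarrow> K_poly (- P)"
  and K_poly_smult [simp]: "a \<in> K \<Longrightarrow> K_poly P \<Longrightarrow> K_poly (smult a P)"
  by (simp_all add: K_poly_def)

lemma K_poly_mult [simp]: "K_poly P \<Longrightarrow> K_poly Q \<Longrightarrow> K_poly (P * Q)"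
  by (auto simp: K_poly_def coeff_mult intro!: K_sum)

lemma K_poly_monom [simp]: "a \<in> K \<Longrightarrow> K_poly (monom a n)"
  by (simp add: K_poly_def)

lemma K_poly_pcompose [simp]: "K_poly P \<Longrightarrow> K_poly Q \<Longrightarrow> K_poly (P \<circ>\<^sub>p Q)"
  unfolding K_poly_def by (intro allI coeff_pcompose_semiring_closed) auto

lemma K_poly_pderiv [simp]: "K_poly P \<Longrightarrow> K_poly (pderiv P)"
  by (simp add: K_poly_def coeff_pderiv del: of_nat_Suc)

lemma poly_in_K: "K_poly P \<Longrightarrow> x \<in> K \<Longrightarrow> poly P x \<in> K"
  by (induction P) auto


subsection \<open>The Galois group\<close>

lemma galD:
  assumes "\<tau> \<in> galois_group K"
  shows gal_add: "\<tau> (x + y) = \<tau> x + \<tau> y" and gal_mult: "\<tau> (x * y) = \<tau> x * \<tau> y"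
    and gal_1: "\<tau> 1 = 1" and gal_bij: "bij \<tau>" and gal_K: "c \<in> K \<Longrightarrow> \<tau> c = c"
  using assms by (auto simp: galois_group_def ring_iso_def ring_hom_def ring_of_type_algebra_def)

lemma gal_comp:
  assumes "\<tau> \<in> galois_group K" "\<rho> \<in> galois_group K"
  shows "\<tau> \<circ> \<rho> \<in> galois_group K"
  using galD[OF assms(1)] galD[OF assms(2)]
  by (auto simp: galois_group_def ring_iso_def ring_hom_def ring_of_type_algebra_def bij_comp)

lemma gal_id: "id \<in> galois_group K"
  by (auto simp: galois_group_def ring_iso_def ring_hom_def ring_of_type_algebra_def)

lemma gal_pow: "\<sigma> ^^ i \<in> galois_group K"
proof (induction i)
  case (Suc i)
  thus ?case using gal_comp[OF \<sigma>_gal] by (simp add: comp_def)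
qed (use gal_id in \<open>simp add: id_def\<close>)

lemma gal_0: "\<tau> \<in> galois_group K \<Longrightarrow> \<tau> 0 = 0"
  using gal_K[of \<tau> 0] by simp

lemma gal_uminus: "\<tau> \<in> galois_group K \<Longrightarrow> \<tau> (- x) = - \<tau> x"
  using gal_add[of \<tau> x "- x"] gal_0[of \<tau>] by (simp add: eq_neg_iff_add_eq_0 add.commute)

lemma gal_diff: "\<tau> \<in> galois_group K \<Longrightarrow> \<tau> (x - y) = \<tau> x - \<tau> y"
  using gal_add[of \<tau> x "- y"] gal_uminus[of \<tau> y] by simp

lemma gal_eq_0: "\<tau> \<in> galois_group K \<Longrightarrow> \<tau> x = 0 \<longleftrightarrow> x = 0"
  using gal_bij[of \<tau>] gal_0[of \<tau>] by (metis bij_is_inj injD)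

lemma gal_power: "\<tau> \<in> galois_group K \<Longrightarrow> \<tau> (x ^ n) = \<tau> x ^ n"
  by (induction n) (simp_all add: gal_1 gal_mult)

lemma gal_inverse: "\<tau> \<in> galois_group K \<Longrightarrow> \<tau> (inverse x) = inverse (\<tau> x)"
  using gal_mult[of \<tau> x "inverse x"] gal_1[of \<tau>] gal_0[of \<tau>]
  by (cases "x = 0") (auto intro!: inverse_unique[symmetric])

lemma gal_divide: "\<tau> \<in> galois_group K \<Longrightarrow> \<tau> (x / y) = \<tau> x / \<tau> y"
  by (simp add: divide_inverse gal_mult gal_inverse)

lemma gal_sum: "\<tau> \<in> galois_group K \<Longrightarrow> \<tau> (sum h I) = (\<Sum>i\<in>I. \<tau> (h i))"
  by (induction I rule: infinite_finite_induct) (simp_all add: gal_0 gal_add)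

lemma gal_prod: "\<tau> \<in> galois_group K \<Longrightarrow> \<tau> (prod h I) = (\<Prod>i\<in>I. \<tau> (h i))"
  by (induction I rule: infinite_finite_induct) (simp_all add: gal_1 gal_mult)

lemma gal_poly: "\<tau> \<in> galois_group K \<Longrightarrow> K_poly P \<Longrightarrow> \<tau> (poly P x) = poly P (\<tau> x)"
  by (induction P) (simp_all add: gal_0 gal_add gal_mult gal_K)

lemmas \<sigma>_add = gal_add[OF \<sigma>_gal] and \<sigma>_mult = gal_mult[OF \<sigma>_gal] and \<sigma>_1 = gal_1[OF \<sigma>_gal]
  and \<sigma>_K = gal_K[OF \<sigma>_gal] and \<sigma>_0 = gal_0[OF \<sigma>_gal] and \<sigma>_diff = gal_diff[OF \<sigma>_gal]
  and \<sigma>_eq_0 = gal_eq_0[OF \<sigma>_gal] and \<sigma>_power = gal_power[OF \<sigma>_gal]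
  and \<sigma>_divide = gal_divide[OF \<sigma>_gal] and \<sigma>_sum = gal_sum[OF \<sigma>_gal]

lemma \<sigma>_pow_\<alpha>: "(\<sigma> ^^ i) \<alpha> = \<alpha> + of_nat i"
  by (induction i) (auto simp: \<sigma>_add \<sigma>_\<alpha> \<sigma>_K)

text \<open>
  Such a \<open>P\<close> takes the value \<open>P 0\<close> at all \<open>p\<close> elements of the prime field.
\<close>

lemma shift_invariant_const:
  fixes P :: "'a poly"
  assumes "P \<circ>\<^sub>p [:1, 1:] = P" "degree P < p"
  shows "P = [:coeff P 0:]"
proof (rule poly_eqI_degree[where A = "of_nat ` {..<p}"])
  have "poly P (of_nat j) = poly P 0" for j
  proof (induction j)
    case (Suc j)
    have "poly P (of_nat (Suc j)) = poly (P \<circ>\<^sub>p [:1, 1:]) (of_nat j)"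
      by (simp add: poly_pcompose add.commute)
    thus ?case using Suc assms by simp
  qed simp
  thus "poly P x = poly [:coeff P 0:] x" if "x \<in> of_nat ` {..<p}" for x
    using that by (auto simp: poly_0_coeff_0)
qed (use assms p_pos inj_of_nat in \<open>auto simp: card_image\<close>)

lemma degree_shift_diff:
  fixes P :: "'a poly"
  assumes "degree P > 0"
  shows "degree (P \<circ>\<^sub>p [:c, 1:] - P) < degree P"
proof (rule degree_lessI)
  show "\<forall>k\<ge>degree P. coeff (P \<circ>\<^sub>p [:c, 1:] - P) k = 0"
  proof (intro allI impI)
    fix k assume k: "k \<ge> degree P"
    have "degree (P \<circ>\<^sub>p [:c, 1:]) = degree P" by (simp add: degree_pcompose)
    moreover have "lead_coeff (P \<circ>\<^sub>p [:c, 1:]) = lead_coeff P" by (simp add: lead_coeff_comp)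
    ultimately show "coeff (P \<circ>\<^sub>p [:c, 1:] - P) k = 0"
      using k by (cases "k = degree P") (auto simp: coeff_eq_0)
  qed
qed (use assms in auto)

text \<open>
  Applying \<open>\<sigma>\<close> to a relation \<open>P \<alpha> = 0\<close> gives the relation \<open>P (\<alpha> + 1) - P \<alpha> = 0\<close> of smaller degree.  By
  induction \<open>P\<close> is invariant under the shift of the variable by \<open>1\<close>, hence constant.
\<close>

lemma independent_powers:
  assumes "K_poly P" "degree P < p" "poly P \<alpha> = 0"
  shows "P = 0"
  using assms
proof (induction "degree P" arbitrary: P rule: less_induct)
  case less
  define Q where "Q = P \<circ>\<^sub>p [:1, 1:] - P"
  have "P = [:coeff P 0:]"
  proof (cases "degree P = 0")
    case False
    have "poly Q \<alpha> = \<sigma> (poly P \<alpha>) - poly P \<alpha>"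
      using gal_poly[OF \<sigma>_gal less.prems(1), of \<alpha>] \<sigma>_\<alpha> by (simp add: Q_def poly_pcompose add.commute)
    hence "poly Q \<alpha> = 0" using less.prems by (simp add: \<sigma>_0)
    moreover have "degree Q < degree P" using False unfolding Q_def by (intro degree_shift_diff) auto
    moreover have "K_poly Q" using less.prems by (simp add: Q_def)
    ultimately have "Q = 0" using less.hyps[of Q] less.prems by simp
    thus ?thesis using less.prems by (intro shift_invariant_const) (auto simp: Q_def)
  qed (metis degree_0_id)
  thus ?case using less.prems(3) by (metis poly_const_conv pCons_0_0)
qed

lemma fixed_poly_in_K:
  assumes "K_poly P" "degree P < p" "\<sigma> (poly P \<alpha>) = poly P \<alpha>"
  shows "poly P \<alpha> \<in> K"
proof -
  define Q where "Q = P \<circ>\<^sub>p [:1, 1:] - P"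
  have "poly Q \<alpha> = 0"
    using gal_poly[OF \<sigma>_gal assms(1), of \<alpha>] \<sigma>_\<alpha> assms by (simp add: Q_def poly_pcompose add.commute)
  moreover have "degree Q < p"
    unfolding Q_def using assms(2) by (intro degree_diff_less) (simp_all add: degree_pcompose)
  ultimately have "Q = 0" using assms by (intro independent_powers) (auto simp: Q_def)
  hence "P = [:coeff P 0:]" using assms by (intro shift_invariant_const) (auto simp: Q_def)
  thus ?thesis using assms by (metis K_poly_coeff poly_const_conv)
qed

text \<open>
  The polynomials in \<open>\<alpha>\<close> of degree less than \<open>p\<close> form a ring because \<open>\<alpha> ^ p = \<alpha> + AS \<alpha>\<close>; the
  inverse of \<open>x\<close> is the product of the other conjugates divided by the norm.
\<close>

definition low :: "'a set" where
  "low = {poly P \<alpha> |P. K_poly P \<and> degree P < p}"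

lemma poly_in_low: "K_poly P \<Longrightarrow> poly P \<alpha> \<in> low"
proof (induction P)
  case 0
  thus ?case using p_pos by (auto simp: low_def intro!: exI[of _ 0])
next
  case (pCons a P)
  then obtain Q where Q: "poly P \<alpha> = poly Q \<alpha>" "K_poly Q" "degree Q < p"
    by (auto simp: low_def)
  define R where "R = pCons a Q - smult (coeff Q (p - 1)) (monom 1 p - [:AS \<alpha>, 1:])"
  have AS_K: "AS \<alpha> \<in> K" using AS_\<alpha> by (simp add: AS_eq)
  have "K_poly R" using Q pCons.prems AS_K by (auto simp: R_def)
  moreover have "poly R \<alpha> = poly (pCons a P) \<alpha>"
    using Q by (simp add: R_def poly_monom AS_eq)
  moreover have "degree R < p"
  proof (rule degree_lessI)
    show "\<forall>k\<ge>p. coeff R k = 0"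
      using Q p_ge_2 by (auto simp: R_def coeff_pCons coeff_eq_0 split: nat.splits)
  qed (use p_pos in auto)
  ultimately show ?case unfolding low_def by force
qed

lemma low_closed:
  assumes "x \<in> low" "y \<in> low"
  shows "x + y \<in> low" "x * y \<in> low" "- x \<in> low" "\<sigma> x \<in> low"
proof -
  obtain P Q where P: "x = poly P \<alpha>" "K_poly P" and Q: "y = poly Q \<alpha>" "K_poly Q"
    using assms by (auto simp: low_def)
  show "x + y \<in> low" using poly_in_low[of "P + Q"] P Q by simp
  show "x * y \<in> low" using poly_in_low[of "P * Q"] P Q by simp
  show "- x \<in> low" using poly_in_low[of "- P"] P by simp
  show "\<sigma> x \<in> low" using poly_in_low[of "P \<circ>\<^sub>p [:1, 1:]"] P
    by (simp add: gal_poly[OF \<sigma>_gal] \<sigma>_\<alpha> poly_pcompose add.commute)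
qed

lemma K_low: "c \<in> K \<Longrightarrow> c \<in> low" using poly_in_low[of "[:c:]"] by simp

lemma \<sigma>_pow_p_low: "x \<in> low \<Longrightarrow> (\<sigma> ^^ p) x = x"
  by (auto simp: low_def gal_poly[OF gal_pow] \<sigma>_pow_\<alpha>)

lemma prod_conjugates_shift:
  assumes "(\<sigma> ^^ p) x = x"
  shows "(\<Prod>i<p. (\<sigma> ^^ Suc i) x) = (\<Prod>i<p. (\<sigma> ^^ i) x)"
proof -
  obtain q where q: "p = Suc q" using p_pos by (cases p) auto
  have "(\<Prod>i<p. (\<sigma> ^^ Suc i) x) = (\<Prod>i<q. (\<sigma> ^^ Suc i) x) * (\<sigma> ^^ p) x"
    using q by simp
  also have "\<dots> = (\<Prod>i<p. (\<sigma> ^^ i) x)"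
    unfolding assms using q prod.lessThan_Suc_shift[of "\<lambda>i. (\<sigma> ^^ i) x" q] by (simp add: mult.commute)
  finally show ?thesis .
qed

lemma low_inverse:
  assumes "x \<in> low" "x \<noteq> 0" shows "inverse x \<in> low"
proof -
  obtain q where q: "p = Suc q" using p_pos by (cases p) auto
  define y where "y = (\<Prod>i<q. (\<sigma> ^^ Suc i) x)"
  have conj: "(\<sigma> ^^ i) x \<in> low" for i
    using assms(1) by (induction i) (auto simp: low_closed)
  have y: "y \<in> low"
    unfolding y_def using K_low[of 1] conj by (induction q) (auto intro: low_closed simp del: funpow.simps)
  have xy: "x * y = (\<Prod>i<p. (\<sigma> ^^ i) x)"
    using q prod.lessThan_Suc_shift[of "\<lambda>i. (\<sigma> ^^ i) x" q] by (simp add: y_def)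
  have "\<sigma> (x * y) = x * y"
    using prod_conjugates_shift[OF \<sigma>_pow_p_low[OF assms(1)]] unfolding xy by (simp add: gal_prod[OF \<sigma>_gal])
  moreover have "x * y \<in> low" using assms y by (intro low_closed)
  ultimately have N: "x * y \<in> K" using fixed_poly_in_K unfolding low_def by auto
  have "x * y \<noteq> 0" unfolding xy using assms gal_eq_0[OF gal_pow] by simp
  hence "inverse x = y * inverse (x * y)" using assms by (simp add: field_simps)
  also have "\<dots> \<in> low" by (rule low_closed(2)[OF y K_low[OF K_inverse[OF N]]])
  finally show ?thesis .
qed

lemma generate_field_min:
  assumes "S \<subseteq> E" "1 \<in> E" "\<And>x y. x \<in> E \<Longrightarrow> y \<in> E \<Longrightarrow> x + y \<in> E" "\<And>x. x \<in> E \<Longrightarrow> - x \<in> E"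
    "\<And>x y. x \<in> E \<Longrightarrow> y \<in> E \<Longrightarrow> x * y \<in> E" "\<And>x. x \<in> E \<Longrightarrow> x \<noteq> 0 \<Longrightarrow> inverse x \<in> (E :: 'a set)"
  shows "generate_field type_ring S \<subseteq> E"
proof
  interpret R: field "type_ring :: 'a ring" by (rule field_from_type_algebra)
  fix x assume "x \<in> generate_field type_ring S"
  thus "x \<in> E"
  proof induction
    case (a_inv h)
    have "\<ominus>\<^bsub>type_ring\<^esub> h = - h"
      by (rule R.minus_equality) (auto simp: ring_of_type_algebra_def)
    thus ?case using a_inv assms by simp
  next
    case (m_inv h)
    hence "inv\<^bsub>type_ring\<^esub> h = inverse h"
      by (intro R.comm_inv_char) (auto simp: ring_of_type_algebra_def)
    thus ?case using m_inv assms by (simp add: ring_of_type_algebra_def)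
  qed (use assms in \<open>auto simp: ring_of_type_algebra_def\<close>)
qed

lemma low_UNIV: "low = UNIV"
proof -
  have "\<alpha> \<in> low" using poly_in_low[of "[:0, 1:]"] by simp
  hence "generate_field type_ring (insert \<alpha> K) \<subseteq> low"
    by (intro generate_field_min) (auto intro: low_closed low_inverse K_low)
  thus ?thesis using gen_\<alpha> by (auto simp: generates_def)
qed

lemma \<sigma>_pow_p [simp]: "(\<sigma> ^^ p) x = x"
  using \<sigma>_pow_p_low low_UNIV by simp

lemma fixed_in_K: "\<sigma> x = x \<Longrightarrow> x \<in> K"
proof -
  assume "\<sigma> x = x"
  moreover have "x \<in> low" by (simp add: low_UNIV)
  ultimately show "x \<in> K" using fixed_poly_in_K by (auto simp: low_def)
qed


subsection \<open>Artin--Schreier generators\<close>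

text \<open>
  These are the translates of \<open>\<alpha>\<close> by elements of \<open>K\<close>.  The condition on the action of \<open>\<sigma>\<close> removes the factor
  in the prime field up to which Artin--Schreier generators are determined.
\<close>

definition gens :: "'a set" where
  "gens = {\<beta>. \<sigma> \<beta> = \<beta> + 1}"

lemma \<alpha>_gens: "\<alpha> \<in> gens" using \<sigma>_\<alpha> by (simp add: gens_def)

lemma gens_add: "\<beta> \<in> gens \<Longrightarrow> c \<in> K \<Longrightarrow> \<beta> + c \<in> gens"
  by (simp add: gens_def \<sigma>_add \<sigma>_K)

lemma gens_minus: "\<beta> \<in> gens \<Longrightarrow> c \<in> K \<Longrightarrow> \<beta> - c \<in> gens"
  by (simp add: gens_def \<sigma>_diff \<sigma>_K)

lemma gens_diff: "\<beta> \<in> gens \<Longrightarrow> \<beta>' \<in> gens \<Longrightarrow> \<beta> - \<beta>' \<in> K"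
  by (intro fixed_in_K) (simp add: gens_def \<sigma>_diff)

lemma gens_not_K: "\<beta> \<in> gens \<Longrightarrow> \<beta> \<notin> K"
  using \<sigma>_K[of \<beta>] by (auto simp: gens_def)

lemma gens_nonzero: "\<beta> \<in> gens \<Longrightarrow> \<beta> \<noteq> 0"
  using gens_not_K K_0 by blast

lemma gens_AS: "\<beta> \<in> gens \<Longrightarrow> AS \<beta> \<in> K"
  by (intro fixed_in_K) (auto simp: gens_def AS_eq \<sigma>_diff \<sigma>_power frobenius_add)

lemma gens_pow: "\<beta> \<in> gens \<Longrightarrow> (\<sigma> ^^ i) \<beta> = \<beta> + of_nat i"
  by (induction i) (auto simp: gens_def \<sigma>_add \<sigma>_K)

lemma poly_repr:
  assumes "\<beta> \<in> gens"
  obtains P where "K_poly P" "degree P < p" "x = poly P \<beta>"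
proof -
  obtain Q where Q: "K_poly Q" "degree Q < p" "x = poly Q \<alpha>"
    using low_UNIV by (auto simp: low_def)
  have "K_poly (Q \<circ>\<^sub>p [:\<alpha> - \<beta>, 1:])" using Q gens_diff[OF \<alpha>_gens assms] by simp
  moreover have "degree (Q \<circ>\<^sub>p [:\<alpha> - \<beta>, 1:]) < p" using Q by (simp add: degree_pcompose)
  moreover have "x = poly (Q \<circ>\<^sub>p [:\<alpha> - \<beta>, 1:]) \<beta>" using Q by (simp add: poly_pcompose)
  ultimately show thesis using that by blast
qed

lemma gens_generates: assumes "\<beta> \<in> gens" shows "generates K \<beta>"
proof -
  interpret R: field "type_ring :: 'a ring" by (rule field_from_type_algebra)
  define G where "G = generate_field type_ring (insert \<beta> K)"
  have "x \<in> G" for x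
  proof -
    obtain P where P: "K_poly P" "x = poly P \<beta>" using poly_repr[OF assms] by metis
    have "poly P \<beta> \<in> G" using P(1)
    proof (induction P)
      case 0
      show ?case unfolding G_def using generate_field.incl[of 0 "insert \<beta> K" type_ring] by simp
    next
      case (pCons a P)
      have a: "a \<in> G" and b: "\<beta> \<in> G" using pCons.prems
        unfolding G_def by (auto intro: generate_field.incl)
      have "poly P \<beta> \<in> G" using pCons by simp
      from generate_field.eng_mult[OF b[unfolded G_def] this[unfolded G_def]]
      have "\<beta> * poly P \<beta> \<in> G" by (simp add: G_def ring_of_type_algebra_def)
      from generate_field.eng_add[OF a[unfolded G_def] this[unfolded G_def]]
      show ?case by (simp add: G_def ring_of_type_algebra_def)
    qed
    thus ?thesis using P by simp
  qed
  thus ?thesis by (auto simp: generates_def G_def)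
qed

lemma generates_not_K: assumes "generates K \<beta>" shows "\<beta> \<notin> K"
proof
  assume "\<beta> \<in> K"
  hence "generate_field type_ring (insert \<beta> K) \<subseteq> K"
    by (intro generate_field_min) auto
  thus False using assms gens_not_K[OF \<alpha>_gens] by (auto simp: generates_def)
qed

text \<open>
  The difference \<open>\<sigma> \<beta> - \<beta>\<close> is a root of \<open>X\<^sup>p - X\<close>, so it lies in the prime field, and it is not zero because
  \<open>\<beta>\<close> is not in \<open>K\<close>.
\<close>

lemma as_solution_scaled:
  assumes "AS \<beta> \<in> K" "generates K \<beta>"
  obtains j where "0 < j" "j < p" "\<sigma> \<beta> = \<beta> + of_nat j" "\<beta> / of_nat j \<in> gens" "(of_nat j :: 'a) \<noteq> 0"
    "AS (\<beta> / of_nat j) = AS \<beta> / of_nat j"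
proof -
  have "AS (\<sigma> \<beta> - \<beta>) = \<sigma> (AS \<beta>) - AS \<beta>"
    unfolding AS_diff by (simp add: AS_eq \<sigma>_diff \<sigma>_power)
  also have "\<dots> = 0" using assms by (simp add: \<sigma>_K)
  finally obtain j where j: "j < p" "\<sigma> \<beta> - \<beta> = of_nat j" using AS_eq_0_iff by blast
  have "j > 0" using j generates_not_K[OF assms(2)] fixed_in_K[of \<beta>] by (cases j) auto
  moreover have nz: "(of_nat j :: 'a) \<noteq> 0" using j \<open>j > 0\<close> by (intro of_nat_neq_0) auto
  moreover have "\<sigma> \<beta> = \<beta> + of_nat j" using j by (simp add: algebra_simps)
  moreover from this have "\<beta> / of_nat j \<in> gens"
    using nz by (simp add: gens_def \<sigma>_divide \<sigma>_K add_divide_distrib)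
  moreover have "AS (\<beta> / of_nat j) = AS \<beta> / of_nat j"
    using AS_of_nat_mult[of j "\<beta> / of_nat j"] nz by (simp add: field_simps)
  ultimately show thesis using that j by blast
qed

lemma gens_AS_nonzero: "\<beta> \<in> gens \<Longrightarrow> AS \<beta> \<noteq> 0"
  using AS_eq_0_iff gens_not_K by (metis K_of_nat)

lemma as_class_eq: "as_class K (AS \<alpha>) = AS ` gens"
proof (intro equalityI subsetI)
  fix g assume "g \<in> as_class K (AS \<alpha>)"
  then obtain c where c: "c \<in> K" "g - AS \<alpha> = AS c" by (auto simp: as_class_def)
  hence "g = AS (\<alpha> + c)" by (simp add: AS_add algebra_simps)
  thus "g \<in> AS ` gens" using gens_add[OF \<alpha>_gens c(1)] by blast
next
  fix g assume "g \<in> AS ` gens"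
  then obtain \<beta> where \<beta>: "\<beta> \<in> gens" "g = AS \<beta>" by blast
  hence "g - AS \<alpha> = AS (\<beta> - \<alpha>)" by (simp add: AS_diff)
  thus "g \<in> as_class K (AS \<alpha>)"
    using \<beta> gens_diff[OF \<beta>(1) \<alpha>_gens] gens_AS gens_generates gens_AS_nonzero
    by (auto simp: as_class_def as_elements_def)
qed


subsection \<open>Norm and trace\<close>

text \<open>
  An automorphism over \<open>K\<close> is determined by the image of \<open>\<alpha>\<close>, which is a root of \<open>X\<^sup>p - X - AS \<alpha>\<close>.
\<close>

lemma galois_group_eq: "galois_group K = (\<lambda>i. \<sigma> ^^ i) ` {..<p}"
proof (intro equalityI subsetI)
  fix \<tau> assume \<tau>: "\<tau> \<in> galois_group K"
  have "AS (\<tau> \<alpha> - \<alpha>) = \<tau> (AS \<alpha>) - AS \<alpha>"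
    unfolding AS_diff using \<tau> by (simp add: AS_eq gal_diff gal_power)
  also have "\<dots> = 0" using gens_AS[OF \<alpha>_gens] \<tau> by (simp add: gal_K)
  finally obtain j where j: "j < p" "\<tau> \<alpha> = \<alpha> + of_nat j"
    using AS_eq_0_iff by (metis diff_eq_eq add.commute)
  have "\<tau> x = (\<sigma> ^^ j) x" for x
  proof -
    obtain P where P: "K_poly P" "x = poly P \<alpha>" using poly_repr[OF \<alpha>_gens] by metis
    show ?thesis using P j \<tau> by (simp add: gal_poly gal_poly[OF gal_pow] \<sigma>_pow_\<alpha>)
  qed
  thus "\<tau> \<in> (\<lambda>i. \<sigma> ^^ i) ` {..<p}" using j by auto
qed (use gal_pow in auto)

lemma galois_norm_eq: "galois_norm K x = (\<Prod>i<p. (\<sigma> ^^ i) x)"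
proof -
  have "inj_on (\<lambda>i. \<sigma> ^^ i) {..<p}"
  proof (rule inj_onI)
    fix i j assume ij: "i \<in> {..<p}" "j \<in> {..<p}" "\<sigma> ^^ i = \<sigma> ^^ j"
    hence "of_nat i = (of_nat j :: 'a)" using \<sigma>_pow_\<alpha>[of i] \<sigma>_pow_\<alpha>[of j] by simp
    thus "i = j" using inj_of_nat ij by (auto dest: inj_onD)
  qed
  thus ?thesis by (simp add: galois_norm_def galois_group_eq prod.reindex)
qed

lemma norm_in_K: "galois_norm K x \<in> K"
  using prod_conjugates_shift[OF \<sigma>_pow_p] by (intro fixed_in_K) (simp add: galois_norm_eq gal_prod[OF \<sigma>_gal])

lemma norm_mult: "galois_norm K (x * y) = galois_norm K x * galois_norm K y"
  by (simp add: galois_norm_eq gal_mult[OF gal_pow] prod.distrib)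

lemma norm_divide: "galois_norm K (x / y) = galois_norm K x / galois_norm K y"
  by (simp add: galois_norm_eq gal_divide[OF gal_pow] prod_dividef)

lemma norm_of_K: "c \<in> K \<Longrightarrow> galois_norm K c = c ^ p"
  by (simp add: galois_norm_eq gal_K[OF gal_pow])

lemma norm_gens: "\<beta> \<in> gens \<Longrightarrow> galois_norm K \<beta> = AS \<beta>"
  by (simp add: galois_norm_eq gens_pow prod_translates AS_eq)

end


section \<open>The valuation on the extension\<close>

context valued_field
begin

lemma vle_argmin:
  assumes "finite I" "I \<noteq> {}"
  shows "\<exists>i\<in>I. \<forall>j\<in>I. t i \<preceq> t j"
  using assms
proof (induction rule: finite_ne_induct)
  case (insert x F)
  then obtain i where i: "i \<in> F" "\<forall>j\<in>F. t i \<preceq> t j" by blast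
  show ?case
  proof (cases "t i \<preceq> t x")
    case False
    hence "t x \<preceq> t i" using vle_total by blast
    thus ?thesis using i by (intro bexI[of _ x]) (auto intro: vle_trans)
  qed (use i in auto)
qed auto

lemma poly_vle: "(\<And>i. i \<le> degree P \<Longrightarrow> c \<preceq> coeff P i * x ^ i) \<Longrightarrow> c \<preceq> poly P x"
  unfolding poly_altdef by (intro vle_sum) auto

lemma poly_vless: "c \<noteq> 0 \<Longrightarrow> (\<And>i. i \<le> degree P \<Longrightarrow> c \<lless> coeff P i * x ^ i) \<Longrightarrow> c \<lless> poly P x"
  unfolding poly_altdef by (intro vless_sum) auto

definition int_poly :: "'a poly \<Rightarrow> bool" where
  "int_poly P \<longleftrightarrow> (\<forall>i. 1 \<preceq> coeff P i)"

text \<open>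
  The polynomials that vanish modulo the maximal ideal.
\<close>

definition small_poly :: "'a poly \<Rightarrow> bool" where
  "small_poly P \<longleftrightarrow> (\<forall>i. 1 \<lless> coeff P i)"

lemma small_imp_int_poly: "small_poly P \<Longrightarrow> int_poly P"
  by (auto simp: small_poly_def int_poly_def intro: vless_imp_vle)

lemma int_poly_0 [simp]: "int_poly 0" and int_poly_1 [simp]: "int_poly 1"
  by (simp_all add: int_poly_def coeff_1)

lemma small_poly_0 [simp]: "small_poly 0" by (simp add: small_poly_def)

lemma int_poly_pCons [simp]: "int_poly (pCons a P) \<longleftrightarrow> 1 \<preceq> a \<and> int_poly P"
  unfolding int_poly_def by (metis coeff_pCons_0 coeff_pCons_Suc not0_implies_Suc)

lemma small_poly_pCons [simp]: "small_poly (pCons a P) \<longleftrightarrow> 1 \<lless> a \<and> small_poly P"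
  unfolding small_poly_def by (metis coeff_pCons_0 coeff_pCons_Suc not0_implies_Suc)

lemma int_poly_monom: "1 \<preceq> a \<Longrightarrow> int_poly (monom a n)"
  by (simp add: int_poly_def)

lemma int_poly_add: "int_poly P \<Longrightarrow> int_poly Q \<Longrightarrow> int_poly (P + Q)"
  by (simp add: int_poly_def vle_add)

lemma int_poly_diff: "int_poly P \<Longrightarrow> int_poly Q \<Longrightarrow> int_poly (P - Q)"
  by (simp add: int_poly_def vle_diff)

lemma small_poly_add: "small_poly P \<Longrightarrow> small_poly Q \<Longrightarrow> small_poly (P + Q)"
  by (simp add: small_poly_def vless_add)

lemma small_poly_diff: "small_poly P \<Longrightarrow> small_poly Q \<Longrightarrow> small_poly (P - Q)"
  by (simp add: small_poly_def vless_diff)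

lemma int_poly_mult: "int_poly P \<Longrightarrow> int_poly Q \<Longrightarrow> int_poly (P * Q)"
  unfolding int_poly_def coeff_mult by (auto intro!: vle_sum one_vle_mult)

lemma small_poly_mult: "int_poly P \<Longrightarrow> small_poly Q \<Longrightarrow> small_poly (P * Q)"
  unfolding int_poly_def small_poly_def coeff_mult by (auto intro!: vless_sum vless_mult_integer)

lemma int_poly_smult: "1 \<preceq> a \<Longrightarrow> int_poly P \<Longrightarrow> int_poly (smult a P)"
  by (simp add: int_poly_def one_vle_mult)

lemma int_poly_pcompose: "int_poly P \<Longrightarrow> int_poly Q \<Longrightarrow> int_poly (P \<circ>\<^sub>p Q)"
  by (induction P) (auto simp: pcompose_pCons intro!: int_poly_add int_poly_mult)

lemma small_poly_pcompose: "small_poly P \<Longrightarrow> int_poly Q \<Longrightarrow> small_poly (P \<circ>\<^sub>p Q)"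
  by (induction P) (auto simp: pcompose_pCons intro!: small_poly_add small_poly_mult)

lemma small_poly_pderiv: "small_poly P \<Longrightarrow> small_poly (pderiv P)"
  by (auto simp: small_poly_def coeff_pderiv simp del: of_nat_Suc intro: vless_mult_integer)

lemma int_poly_eval: "int_poly P \<Longrightarrow> 1 \<preceq> x \<Longrightarrow> 1 \<preceq> poly P x"
  by (auto intro!: poly_vle one_vle_mult one_vle_power simp: int_poly_def)

lemma small_poly_eval: "small_poly P \<Longrightarrow> 1 \<preceq> x \<Longrightarrow> 1 \<lless> poly P x"
  unfolding small_poly_def
  by (intro poly_vless) (auto intro!: vless_mult[of 1 _ 1, simplified] one_vle_power)

text \<open>
  A root \<open>x\<close> of negative value is impossible for a monic polynomial with coefficients of nonnegative
  value, because then \<open>x ^ n\<close> has strictly smaller value than all other terms.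
\<close>

lemma integral_imp_integer:
  assumes "lead_coeff P = 1" "int_poly P" "poly P x = 0"
  shows "1 \<preceq> x"
proof (rule ccontr)
  assume "\<not> 1 \<preceq> x"
  hence x: "x \<lless> 1" by (simp add: not_vle)
  define n where "n = degree P"
  have "x ^ n \<lless> (\<Sum>i<n. coeff P i * x ^ i)"
  proof (rule vless_sum)
    show "x ^ n \<noteq> 0" using x by (auto dest: vless_nonzero)
    fix i assume "i \<in> {..<n}"
    hence "x ^ (n - i) \<lless> 1 ^ (n - i)" by (intro vless_power x) auto
    hence "x ^ (n - i) * x ^ i \<lless> coeff P i * x ^ i"
      using assms(2) x by (subst vless_mult_cancel)
        (auto simp: int_poly_def intro: vless_vle_trans dest: vless_nonzero)
    thus "x ^ n \<lless> coeff P i * x ^ i" using \<open>i \<in> {..<n}\<close> by (simp add: power_add[symmetric])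
  qed
  moreover have "(\<Sum>i<n. coeff P i * x ^ i) = - (x ^ n)"
  proof -
    have "0 = (\<Sum>i\<le>n. coeff P i * x ^ i)" using assms(3) by (simp add: poly_altdef n_def)
    also have "\<dots> = (\<Sum>i<n. coeff P i * x ^ i) + x ^ n"
      using assms(1) by (simp add: n_def flip: lessThan_Suc_atMost)
    finally show ?thesis by (simp add: eq_neg_iff_add_eq_0)
  qed
  ultimately show False by simp
qed

end

context as_extension
begin

lemma map_poly_gal_mult:
  "\<tau> \<in> galois_group K \<Longrightarrow> map_poly \<tau> (P * Q) = map_poly \<tau> P * map_poly \<tau> Q"
  by (rule poly_eqI) (simp add: coeff_map_poly gal_0 coeff_mult gal_sum gal_mult)

lemma map_poly_gal_prod:
  "\<tau> \<in> galois_group K \<Longrightarrow> map_poly \<tau> (prod h I) = (\<Prod>i\<in>I. map_poly \<tau> (h i))"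
  by (induction I rule: infinite_finite_induct) (simp_all add: map_poly_gal_mult gal_1)

text \<open>The factors are permuted cyclically by \<open>\<sigma>\<close>.\<close>

lemma K_poly_prod_conjugates:
  "K_poly (\<Prod>i<p. [:(\<sigma> ^^ i) x, (\<sigma> ^^ i) y:])"
proof -
  let ?h = "\<lambda>i. [:(\<sigma> ^^ i) x, (\<sigma> ^^ i) y:]"
  obtain q where q: "p = Suc q" using p_pos by (cases p) auto
  have s: "map_poly \<sigma> (?h i) = ?h (Suc i)" for i
    by (simp add: map_poly_pCons \<sigma>_0)
  have "map_poly \<sigma> (\<Prod>i<p. ?h i) = (\<Prod>i<p. ?h (Suc i))"
    by (simp only: map_poly_gal_prod[OF \<sigma>_gal] s)
  also have "\<dots> = (\<Prod>i<q. ?h (Suc i)) * ?h p" using q by simp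
  also have "?h p = ?h 0" by simp
  also have "(\<Prod>i<q. ?h (Suc i)) * ?h 0 = (\<Prod>i<p. ?h i)"
    using prod.lessThan_Suc_shift[of ?h q] q by (simp only: mult.commute)
  finally have inv: "map_poly \<sigma> (\<Prod>i<p. ?h i) = (\<Prod>i<p. ?h i)" .
  have "coeff (map_poly \<sigma> P) k = \<sigma> (coeff P k)" for P k
    by (rule coeff_map_poly) (rule \<sigma>_0)
  from this[of "\<Prod>i<p. ?h i"] have "\<sigma> (coeff (\<Prod>i<p. ?h i) k) = coeff (\<Prod>i<p. ?h i) k" for k
    unfolding inv by (rule sym)
  thus ?thesis unfolding K_poly_def using fixed_in_K by blast
qed

lemma char_poly_monic: "degree (\<Prod>i<p. [:- (\<sigma> ^^ i) x, 1:]) = p" "lead_coeff (\<Prod>i<p. [:- (\<sigma> ^^ i) x, 1:]) = 1"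
proof -
  show "degree (\<Prod>i<p. [:- (\<sigma> ^^ i) x, 1:]) = p" by (simp add: degree_prod_sum_eq)
  show "lead_coeff (\<Prod>i<p. [:- (\<sigma> ^^ i) x, 1:]) = 1"
    using lead_coeff_prod[of "\<lambda>i. [:- (\<sigma> ^^ i) x, 1:]" "{..<p}"] by simp
qed

lemma K_poly_char_poly: "K_poly (\<Prod>i<p. [:- (\<sigma> ^^ i) x, 1:])"
  using K_poly_prod_conjugates[of "- x" 1] by (simp add: gal_uminus[OF gal_pow] gal_1[OF gal_pow])

lemma \<sigma>_pow_add: "(\<sigma> ^^ i) ((\<sigma> ^^ j) x) = (\<sigma> ^^ (i + j)) x"
  by (simp add: funpow_add)

lemma \<sigma>_pow_mult_p [simp]: "(\<sigma> ^^ (p * k)) x = x"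
  by (induction k) (simp_all add: funpow_add)

lemma \<sigma>_pow_mod: "(\<sigma> ^^ (i mod p)) x = (\<sigma> ^^ i) x"
  using \<sigma>_pow_add[of "p * (i div p)" "i mod p" x] by (simp add: mult.commute)

lemma \<sigma>_pow_fixed: "x \<in> K \<Longrightarrow> (\<sigma> ^^ i) x = x"
  using gal_K[OF gal_pow] .

end

locale artin_schreier = valued_field v + as_extension K p \<alpha> \<sigma>
  for v :: "'a::field \<Rightarrow> 'g::linordered_ab_group_add" and K :: "'a set" and p \<alpha> \<sigma> +
  assumes hensel: "henselian v K"
begin

text \<open>
  The only shape in which Hensel's lemma is applied: modulo the maximal ideal the polynomial is
  \<open>(X + e) X\<^sup>n\<close> with a unit \<open>e\<close>, so that \<open>- e\<close> is a simple zero.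
\<close>

lemma hensel_root:
  assumes R: "K_poly R" "small_poly R" "degree R \<le> n"
    and e: "e \<in> K" "1 \<preceq> e" "e \<preceq> 1"
  obtains b where "b \<in> K" "poly ([:e, 1:] * monom 1 n + R) b = 0" "1 \<lless> b + e"
proof -
  define M where "M = [:e, 1:] * monom 1 n + R"
  have "degree ([:e, 1:] * monom 1 n) = Suc n"
    by (subst degree_mult_eq) (auto simp: degree_monom_eq)
  moreover have "lead_coeff ([:e, 1:] * monom 1 n) = 1"
    unfolding lead_coeff_mult lead_coeff_monom by simp
  ultimately have lead: "lead_coeff M = 1"
    using R(3) lead_coeff_add_le[of R "[:e, 1:] * monom 1 n"] unfolding M_def
    by (simp add: add.commute[of _ R] del: mult_pCons_left)
  have "int_poly M"
    unfolding M_def by (intro int_poly_add int_poly_mult small_imp_int_poly[OF R(2)] int_poly_monom) (use e in auto)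
  moreover have "K_poly M" using R e by (simp add: M_def del: mult_pCons_left)
  ultimately have coeffs: "set (coeffs M) \<subseteq> val_ring v K"
    by (auto simp: mem_val_ring int_poly_def K_poly_def coeffs_def)
  have ev: "poly M (- e) = poly R (- e)" by (simp add: M_def)
  have small: "poly M (- e) \<in> max_ideal v (val_ring v K)"
    unfolding ev mem_max_ideal using R e by (auto intro!: small_poly_eval poly_in_K)
  have "poly (pderiv M) (- e) = poly (monom 1 n) (- e) + poly (pderiv R) (- e)"
    by (simp add: M_def pderiv_add pderiv_mult pderiv_pCons del: mult_pCons_left)
  hence "poly (pderiv M) (- e) = (- e) ^ n + poly (pderiv R) (- e)"
    by (simp add: poly_monom)
  moreover have "(- e) ^ n \<preceq> 1 ^ n" using e by (intro vle_power) auto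
  moreover have "1 \<lless> poly (pderiv R) (- e)"
    using R e by (auto intro!: small_poly_eval small_poly_pderiv)
  ultimately have "poly (pderiv M) (- e) \<preceq> 1"
    using dominant_add(2) vle_trans vle_vless_trans by (metis power_one)
  hence "poly (pderiv M) (- e) \<notin> max_ideal v (val_ring v K)"
    by (auto simp: mem_max_ideal vless_def)
  moreover have "- e \<in> val_ring v K" using e by (simp add: mem_val_ring)
  ultimately obtain b where "b \<in> val_ring v K" "poly M b = 0" "b - (- e) \<in> max_ideal v (val_ring v K)"
    using hensel lead coeffs small unfolding henselian_def Let_def by blast
  thus thesis using that[of b] by (auto simp: mem_val_ring mem_max_ideal M_def)
qed

text \<open>
  Suppose that the conjugates of \<open>z\<close> do not all have the same value.  The set of exponents \<open>i\<close> for which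
  \<open>\<sigma>\<^sup>i z\<close> has minimal value is a proper subset of the cyclic group of prime order \<open>p\<close>, so it is not
  stable under a shift \<open>s\<close> that joins two of its elements; replacing \<open>z\<close> by \<open>z \<cdot> \<sigma>\<^sup>s z\<close> makes it smaller.
  In the end one conjugate has a value strictly below all the others.
\<close>

definition min_exps :: "'a \<Rightarrow> nat set" where
  "min_exps z = {i. \<forall>j. (\<sigma> ^^ i) z \<preceq> (\<sigma> ^^ j) z}"

lemma min_exps_mod: "i mod p \<in> min_exps z \<longleftrightarrow> i \<in> min_exps z"
  by (simp add: min_exps_def \<sigma>_pow_mod)

lemma min_exps_add_mult: "i + p * k \<in> min_exps z \<longleftrightarrow> i \<in> min_exps z"
  using min_exps_mod[of "i + p * k" z] min_exps_mod[of i z] by simp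

lemma min_exps_nonempty: "\<exists>i<p. i \<in> min_exps z"
proof -
  obtain i where i: "i < p" "\<forall>j<p. (\<sigma> ^^ i) z \<preceq> (\<sigma> ^^ j) z"
    using vle_argmin[of "{..<p}" "\<lambda>i. (\<sigma> ^^ i) z"] p_pos by auto
  have "(\<sigma> ^^ i) z \<preceq> (\<sigma> ^^ j) z" for j
    using i p_pos \<sigma>_pow_mod[of j z] by (metis mod_less_divisor)
  thus ?thesis using i by (auto simp: min_exps_def)
qed

text \<open>
  The set is periodic modulo \<open>p\<close>, and \<open>s\<close> generates the cyclic group of order \<open>p\<close>.
\<close>

lemma min_exps_stable:
  assumes s: "0 < s" "s < p" and i: "i \<in> min_exps z"
    and stable: "\<And>i. i \<in> min_exps z \<Longrightarrow> i + s \<in> min_exps z"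
  shows "min_exps z = UNIV"
proof -
  have "\<not> p dvd s" using s by (auto dest: dvd_imp_le)
  hence "coprime s p" using prime_p by (simp add: prime_imp_coprime coprime_commute)
  then obtain x y where xy: "s * x = p * y + 1"
    using bezout_nat[of s p] s by auto
  have mult: "i + s * k \<in> min_exps z" if "i \<in> min_exps z" for i k
  proof (induction k)
    case (Suc k)
    thus ?case using stable[of "i + s * k"] by (simp add: ac_simps)
  qed (use that in simp)
  have "Suc i \<in> min_exps z" if "i \<in> min_exps z" for i
    using mult[OF that, of x] min_exps_add_mult[of "Suc i" y z] by (simp add: xy)
  hence shift: "i + k \<in> min_exps z" for k
    using i by (induction k) (auto simp: \<open>\<And>i. i \<in> min_exps z \<Longrightarrow> Suc i \<in> min_exps z\<close>)
  have "t \<in> min_exps z" for t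
  proof -
    have "i + (t + p * i - i) = t + p * i" using p_pos by (simp add: trans_le_add2)
    thus ?thesis using shift[of "t + p * i - i"] by (simp add: min_exps_add_mult)
  qed
  thus ?thesis by blast
qed

text \<open>
  A product of two conjugates has the minimal value only if both factors have it.
\<close>

lemma min_exps_mult:
  assumes "z \<noteq> 0" and i0: "i0 \<in> min_exps z" "i0 + s \<in> min_exps z"
  shows "min_exps (z * (\<sigma> ^^ s) z) = {i. i \<in> min_exps z \<and> i + s \<in> min_exps z}"
proof (intro equalityI subsetI CollectI)
  have eq: "(\<sigma> ^^ i) (z * (\<sigma> ^^ s) z) = (\<sigma> ^^ i) z * (\<sigma> ^^ (i + s)) z" for i
    by (simp add: gal_mult[OF gal_pow] \<sigma>_pow_add)
  have nz: "(\<sigma> ^^ i) z \<noteq> 0" for i using assms(1) gal_eq_0[OF gal_pow] by simp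
  fix i
  {
    assume "i \<in> {i. i \<in> min_exps z \<and> i + s \<in> min_exps z}"
    thus "i \<in> min_exps (z * (\<sigma> ^^ s) z)"
      unfolding min_exps_def eq by (auto intro!: vle_mult)
  }
  assume "i \<in> min_exps (z * (\<sigma> ^^ s) z)"
  hence le: "(\<sigma> ^^ i) z * (\<sigma> ^^ (i + s)) z \<preceq> (\<sigma> ^^ i0) z * (\<sigma> ^^ (i0 + s)) z"
    unfolding min_exps_def mem_Collect_eq eq by blast
  have low: "(\<sigma> ^^ i0) z \<preceq> (\<sigma> ^^ j) z" "(\<sigma> ^^ (i0 + s)) z \<preceq> (\<sigma> ^^ j) z" for j
    using i0 by (auto simp: min_exps_def)
  have not_min: "(\<sigma> ^^ k) z \<lless> (\<sigma> ^^ i) z" if "i \<notin> min_exps z" "k \<in> min_exps z" for i k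
    using that unfolding min_exps_def by (auto simp: not_vle intro: vle_vless_trans)
  show "i \<in> min_exps z \<and> i + s \<in> min_exps z"
  proof (rule ccontr)
    assume "\<not> ?thesis"
    hence "(\<sigma> ^^ i0) z * (\<sigma> ^^ (i0 + s)) z \<lless> (\<sigma> ^^ i) z * (\<sigma> ^^ (i + s)) z"
      using not_min i0 nz low by (auto intro: vless_mult vless_mult')
    thus False using le by (simp add: vless_def)
  qed
qed

lemma ex_strictly_minimal_conjugate:
  assumes "z \<noteq> 0" "min_exps z \<noteq> UNIV"
  shows "\<exists>y. y \<noteq> 0 \<and> (\<forall>j. 0 < j \<longrightarrow> j < p \<longrightarrow> y \<lless> (\<sigma> ^^ j) y)"
  using assms
proof (induction "card (min_exps z \<inter> {..<p})" arbitrary: z rule: less_induct)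
  case less
  obtain i where i: "i < p" "i \<in> min_exps z" using min_exps_nonempty by blast
  show ?case
  proof (cases "\<exists>i'. i' \<in> min_exps z \<and> i' < p \<and> i' \<noteq> i")
    case False
    define y where "y = (\<sigma> ^^ i) z"
    have "y \<noteq> 0" using less.prems gal_eq_0[OF gal_pow] by (simp add: y_def)
    moreover have "y \<lless> (\<sigma> ^^ j) y" if j: "0 < j" "j < p" for j
    proof (rule ccontr)
      assume "\<not> ?thesis"
      hence "(\<sigma> ^^ (i + j)) z \<preceq> (\<sigma> ^^ i) z"
        by (simp add: not_vless y_def \<sigma>_pow_add add.commute)
      hence "i + j \<in> min_exps z" using i(2) unfolding min_exps_def by (auto intro: vle_trans)
      hence "(i + j) mod p \<in> min_exps z" by (simp add: min_exps_mod)
      hence *: "(i + j) mod p = i" using False p_pos by (meson mod_less_divisor)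
      show False
      proof (cases "i + j < p")
        case False
        hence "(i + j) mod p = i + j - p" using i j by (simp add: le_mod_geq)
        thus False using * j False by linarith
      qed (use * j in auto)
    qed
    ultimately show ?thesis by blast
  next
    case True
    then obtain i1 i2 where i12: "i1 \<in> min_exps z" "i2 \<in> min_exps z" "i1 < i2" "i2 < p"
      using i by (metis linorder_neqE_nat)
    define s where "s = i2 - i1"
    have s: "0 < s" "s < p" "i1 + s = i2" using i12 by (auto simp: s_def)
    define w where "w = z * (\<sigma> ^^ s) z"
    have w: "min_exps w = {i. i \<in> min_exps z \<and> i + s \<in> min_exps z}"
      unfolding w_def using i12 s less.prems by (intro min_exps_mult[of z i1]) auto
    obtain k where k: "k \<in> min_exps z" "k + s \<notin> min_exps z"
      using min_exps_stable[OF s(1,2) i12(1)] less.prems by blast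
    have k': "k mod p \<in> min_exps z" "k mod p + s \<notin> min_exps z"
      using k min_exps_mod[of "k mod p + s" z] min_exps_mod[of "k + s" z] min_exps_mod[of k z]
      by (simp_all add: mod_add_left_eq)
    have "min_exps w \<inter> {..<p} \<subset> min_exps z \<inter> {..<p}"
      using k' p_pos by (auto simp: w intro: mod_less_divisor dest!: equalityD2 subsetD[of _ _ "k mod p"])
    hence "card (min_exps w \<inter> {..<p}) < card (min_exps z \<inter> {..<p})"
      by (intro psubset_card_mono) auto
    moreover have "w \<noteq> 0" using less.prems gal_eq_0[OF gal_pow] by (simp add: w_def)
    moreover have "min_exps w \<noteq> UNIV" using k by (auto simp: w)
    ultimately show ?thesis using less.hyps by blast
  qed
qed

text \<open>
  If some \<open>y\<close> had a value strictly below those of its other conjugates, then \<open>x = y / tr y\<close> would be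
  congruent to \<open>1\<close> and its other conjugates to \<open>0\<close>, so that its characteristic polynomial would be
  \<open>X\<^sup>p - X\<^sup>p\<^sup>-\<^sup>1\<close> modulo the maximal ideal.  By Hensel's lemma it has a root in \<open>K\<close>, which is conjugate to
  \<open>x\<close>: a contradiction.
\<close>

lemma all_min_exps:
  assumes "z \<noteq> 0" shows "min_exps z = UNIV"
proof (rule ccontr)
  assume "min_exps z \<noteq> UNIV"
  then obtain y where y: "y \<noteq> 0" "\<And>j. 0 < j \<Longrightarrow> j < p \<Longrightarrow> y \<lless> (\<sigma> ^^ j) y"
    using ex_strictly_minimal_conjugate assms by blast
  obtain q where q: "p = Suc q" "q > 0" using p_ge_2 by (cases p) auto
  define T where "T = (\<Sum>i<p. (\<sigma> ^^ i) y)"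
  have "T = (\<Sum>i<q. (\<sigma> ^^ Suc i) y) + y"
    using sum.lessThan_Suc_shift[of "\<lambda>i. (\<sigma> ^^ i) y" q] q by (simp add: T_def add.commute)
  moreover have "\<sigma> T = (\<Sum>i<q. (\<sigma> ^^ Suc i) y) + (\<sigma> ^^ p) y"
    using q by (simp add: T_def \<sigma>_sum \<sigma>_add)
  ultimately have "\<sigma> T = T" and T: "T = y + (\<Sum>i<q. (\<sigma> ^^ Suc i) y)" by simp_all
  hence TK: "T \<in> K" by (intro fixed_in_K)
  \<comment> \<open>The trace \<open>T\<close> of \<open>y\<close> has the value of \<open>y\<close>, the dominant term.\<close>
  have rest: "y \<lless> (\<Sum>i<q. (\<sigma> ^^ Suc i) y)"
    by (rule vless_sum[OF y(1)], rule y(2)) (auto simp: q(1))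
  have Ty: "T \<preceq> y" using dominant_add(2)[OF rest] T by simp
  hence T0: "T \<noteq> 0" using y(1) by auto
  define x where "x = y / T"
  have conj: "(\<sigma> ^^ j) x = (\<sigma> ^^ j) y / T" for j
    using TK by (simp add: x_def gal_divide[OF gal_pow] \<sigma>_pow_fixed)
  have small: "1 \<lless> (\<sigma> ^^ j) x" if "0 < j" "j < p" for j
    using y(2)[OF that] Ty T0 by (simp add: conj vless_divide_right vle_vless_trans)
  have "1 - x = (T - y) / T" using T0 by (simp add: x_def field_simps)
  hence x1: "1 \<lless> 1 - x"
    using rest Ty T0 T by (simp add: vless_divide_right vle_vless_trans)
  have x_int: "1 \<preceq> x" using vle_diff[of 1 1 "1 - x"] x1 by (simp add: vless_imp_vle)
  define C where "C = (\<Prod>i<p. [:- (\<sigma> ^^ i) x, 1:])"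
  define D where "D = (\<lambda>n. \<Prod>i<n. [:- (\<sigma> ^^ Suc i) x, 1:])"
  have C: "C = [:- x, 1:] * D q"
    using prod.lessThan_Suc_shift[of "\<lambda>i. [:- (\<sigma> ^^ i) x, 1:]" q] q(1) by (simp add: C_def D_def)
  \<comment> \<open>The cofactor of \<open>X - x\<close> in the characteristic polynomial is \<open>X\<^sup>q\<close> modulo the maximal ideal.\<close>
  have D: "small_poly (D n - monom 1 n)" if "n \<le> q" for n
    using that
  proof (induction n)
    case (Suc n)
    let ?c = "(\<sigma> ^^ Suc n) x"
    have c: "1 \<lless> ?c" using Suc.prems q by (intro small) auto
    have "D (Suc n) - monom 1 (Suc n) = [:- ?c, 1:] * (D n - monom 1 n) + monom 1 n * [:- ?c:]"
      unfolding D_def prod.lessThan_Suc by (simp add: algebra_simps monom_Suc)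
    moreover have "small_poly ([:- ?c, 1:] * (D n - monom 1 n))"
      using Suc c by (intro small_poly_mult) (auto intro: vless_imp_vle)
    moreover have "small_poly (monom 1 n * [:- ?c:])"
      using c by (intro small_poly_mult int_poly_monom) auto
    ultimately show ?case by (simp only: small_poly_add)
  qed (simp add: D_def)
  define R where "R = C - [:-1, 1:] * monom 1 q"
  have "R = [:- x, 1:] * (D q - monom 1 q) + monom 1 q * [:1 - x:]"
  proof -
    have "[:1 - x:] = [:- x, 1:] - [:-1, 1:]" by simp
    show ?thesis unfolding R_def C \<open>[:1 - x:] = _\<close> by (simp only: algebra_simps)
  qed
  moreover have "small_poly ([:- x, 1:] * (D q - monom 1 q))"
    using D x_int by (intro small_poly_mult) auto
  moreover have "small_poly (monom 1 q * [:1 - x:])"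
    using x1 by (intro small_poly_mult int_poly_monom) auto
  ultimately have "small_poly R" by (simp only: small_poly_add)
  moreover have "K_poly R"
    unfolding R_def C_def by (intro K_poly_diff K_poly_char_poly) (simp del: mult_pCons_left)
  moreover have "degree R \<le> q"
  proof -
    have "degree ([:-1, 1::'a:] * monom 1 q) = p" and "lead_coeff ([:-1, 1::'a:] * monom 1 q) = 1"
      unfolding lead_coeff_mult lead_coeff_monom
      using q by (simp_all add: degree_mult_eq degree_monom_eq del: mult_pCons_left)
    hence "degree R \<le> p" "coeff R p = 0"
      using char_poly_monic[of x] unfolding R_def C_def[symmetric] by (auto intro!: degree_diff_le)
    thus ?thesis using eq_zero_or_degree_less[of R p] q by auto
  qed
  moreover have "(-1::'a) \<in> K" by simp
  ultimately obtain b where b: "b \<in> K" "poly ([:-1, 1:] * monom 1 q + R) b = 0"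
    using hensel_root[of R q "-1"] by auto
  have "poly C b = 0" using b(2) by (simp add: R_def del: mult_pCons_left)
  then obtain i where i: "i < p" "b = (\<sigma> ^^ i) x" by (auto simp: C_def poly_prod)
  have "x = (\<sigma> ^^ (p - i)) b" using i \<sigma>_pow_add[of "p - i" i x] by simp
  hence "\<sigma> x = x" using b(1) \<sigma>_pow_fixed \<sigma>_K by simp
  hence "1 \<lless> x" using small[of 1] p_ge_2 by simp
  hence "1 \<lless> (1 - x) + x" using x1 vless_add by blast
  thus False by simp
qed

text \<open>
  This is the uniqueness of the extension of a henselian valuation, in the case at hand.
\<close>

lemma \<sigma>_vle [simp]: "x \<preceq> \<sigma> y \<longleftrightarrow> x \<preceq> y" "\<sigma> x \<preceq> y \<longleftrightarrow> x \<preceq> y"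
proof -
  have *: "z \<preceq> \<sigma> z \<and> \<sigma> z \<preceq> z" for z
  proof (cases "z = 0")
    case False
    hence "0 \<in> min_exps z" "1 \<in> min_exps z" using all_min_exps by auto
    thus ?thesis
      unfolding min_exps_def by (auto dest: spec[of _ 0] spec[of _ "Suc 0"])
  qed (simp_all add: \<sigma>_0)
  show "x \<preceq> \<sigma> y \<longleftrightarrow> x \<preceq> y" using *[of y] vle_trans by blast
  show "\<sigma> x \<preceq> y \<longleftrightarrow> x \<preceq> y" using *[of x] vle_trans by blast
qed

lemma \<sigma>_vless [simp]: "x \<lless> \<sigma> y \<longleftrightarrow> x \<lless> y" "\<sigma> x \<lless> y \<longleftrightarrow> x \<lless> y"
  by (simp_all add: vless_def)

lemma \<sigma>_pow_vle [simp]: "x \<preceq> (\<sigma> ^^ i) y \<longleftrightarrow> x \<preceq> y" "(\<sigma> ^^ i) x \<preceq> y \<longleftrightarrow> x \<preceq> y"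
  by (induction i arbitrary: x y) auto

lemma norm_vle: "galois_norm K x \<preceq> x ^ p" "x ^ p \<preceq> galois_norm K x"
proof -
  have "(\<Prod>i<p. (\<sigma> ^^ i) x) \<preceq> (\<Prod>i<p. x)" by (intro vle_prod) auto
  thus "galois_norm K x \<preceq> x ^ p" by (simp add: galois_norm_eq)
  have "(\<Prod>i<p. x) \<preceq> (\<Prod>i<p. (\<sigma> ^^ i) x)" by (intro vle_prod) auto
  thus "x ^ p \<preceq> galois_norm K x" by (simp add: galois_norm_eq)
qed

text \<open>
  An element of nonnegative value is a root of its characteristic polynomial, whose coefficients are sums of
  products of conjugates, hence integral.
\<close>

lemma ring_B_eq: "ring_B K v = \<O>"
proof (intro equalityI subsetI)
  fix x assume "x \<in> ring_B K v"
  then obtain P where P: "lead_coeff P = 1" "set (coeffs P) \<subseteq> val_ring v K" "poly P x = 0"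
    by (auto simp: ring_B_def integral_closure_def)
  have "int_poly P"
    unfolding int_poly_def
  proof
    fix i
    have "coeff P i \<in> insert 0 (set (coeffs P))" by (metis insert_iff range_coeff range_eqI)
    thus "1 \<preceq> coeff P i" using P(2) by (auto simp: mem_val_ring)
  qed
  thus "x \<in> \<O>" using integral_imp_integer P by (simp add: mem_integers)
next
  fix x assume "x \<in> \<O>"
  hence x: "1 \<preceq> x" by (simp add: mem_integers)
  define C where "C = (\<Prod>i<p. [:- (\<sigma> ^^ i) x, 1:])"
  have "int_poly (\<Prod>i<n. [:- (\<sigma> ^^ i) x, 1:])" for n
    by (induction n) (auto intro!: int_poly_mult simp: x simp del: mult_pCons_left mult_pCons_right)
  hence "int_poly C" by (simp add: C_def)
  moreover have "K_poly C" unfolding C_def by (rule K_poly_char_poly)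
  ultimately have "set (coeffs C) \<subseteq> val_ring v K"
    by (auto simp: mem_val_ring int_poly_def K_poly_def coeffs_def)
  moreover have "poly C x = 0"
    unfolding C_def poly_prod using p_pos by (intro prod_zero) (auto intro!: bexI[of _ 0])
  ultimately show "x \<in> ring_B K v"
    using char_poly_monic[of x] unfolding ring_B_def integral_closure_def C_def by blast
qed

text \<open>Since \<open>\<beta>\<close> and \<open>\<beta> + 1\<close> have the same value, that value is not positive.\<close>

lemma gens_vle_1: "\<beta> \<in> gens \<Longrightarrow> \<beta> \<preceq> 1"
proof (rule ccontr)
  assume \<beta>: "\<beta> \<in> gens" "\<not> \<beta> \<preceq> 1"
  hence "1 \<lless> \<beta>" by (simp add: not_vle)
  hence "1 \<lless> \<sigma> \<beta> - \<beta>" by (intro vless_diff) auto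
  thus False using \<beta> by (simp add: gens_def)
qed

lemma gens_AS_vle: "\<beta> \<in> gens \<Longrightarrow> AS \<beta> \<preceq> \<beta> ^ p" "\<beta> \<in> gens \<Longrightarrow> \<beta> ^ p \<preceq> AS \<beta>"
  using norm_vle[of \<beta>] by (simp_all add: norm_gens)

end


section \<open>Expansions in powers of a generator\<close>

context valued_field
begin

lemma poly_split_const: "poly P (x::'a) = coeff P 0 + (\<Sum>i=1..degree P. coeff P i * x ^ i)"
proof -
  have "poly P x = (\<Sum>i\<le>degree P. coeff P i * x ^ i)" by (rule poly_altdef)
  thus ?thesis by (simp only: sum.atMost_shift sum.atLeast1_atMost_eq power_0 mult_1_right One_nat_def)
qed

lemma const_dominates:
  assumes "c \<noteq> 0" "poly P x = c" "\<And>i. i \<ge> 1 \<Longrightarrow> c \<lless> coeff P i * x ^ i"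
  shows "c \<lless> c - coeff P 0" "c \<preceq> coeff P 0" "coeff P 0 \<preceq> c"
proof -
  have "c \<lless> (\<Sum>i=1..degree P. coeff P i * x ^ i)"
    using assms(1,3) by (intro vless_sum) auto
  thus *: "c \<lless> c - coeff P 0" using poly_split_const[of P x] assms(2) by simp
  have "c \<lless> - (c - coeff P 0)" using * by (simp only: vless_uminus)
  from dominant_add[OF this] show "c \<preceq> coeff P 0" "coeff P 0 \<preceq> c" by simp_all
qed

lemma v_power_cong: "a \<noteq> 0 \<Longrightarrow> b \<noteq> 0 \<Longrightarrow> v a = v b \<Longrightarrow> v (a ^ n) = v (b ^ n)"
  by (induction n) (simp_all add: v_mult)

lemma v_divide: "a \<noteq> 0 \<Longrightarrow> b \<noteq> 0 \<Longrightarrow> v (a / b) = v a - v b"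
  by (simp add: divide_inverse v_mult v_inverse)

lemma v_eqI: "a \<noteq> 0 \<Longrightarrow> b \<noteq> 0 \<Longrightarrow> a \<preceq> b \<Longrightarrow> b \<preceq> a \<Longrightarrow> v a = v b"
  by (auto simp: vle_def)

lemma vle_of_v_eq: "a \<noteq> 0 \<Longrightarrow> v a = v b \<Longrightarrow> a \<preceq> b"
  by (auto simp: vle_def)

lemma small_poly_sum: "(\<And>i. i \<in> I \<Longrightarrow> small_poly (h i)) \<Longrightarrow> small_poly (sum h I)"
  by (induction I rule: infinite_finite_induct) (auto intro: small_poly_add)

lemma small_poly_monom: "1 \<lless> a \<Longrightarrow> small_poly (monom a n)"
  by (simp add: small_poly_def)

end

context artin_schreier
begin

lemma of_nat_unit: "0 < m \<Longrightarrow> m < p \<Longrightarrow> of_nat m \<preceq> 1"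
proof -
  assume m: "0 < m" "m < p"
  hence "\<not> p dvd m" by (auto dest: dvd_imp_le)
  hence "coprime m p" using prime_imp_coprime[OF prime_p] coprime_commute by blast
  then obtain x y where "m * x = p * y + 1" using bezout_nat[of m p] m by auto
  hence "of_nat (m * x) = (of_nat (p * y + 1) :: 'a)" by (simp only:)
  hence "of_nat m * of_nat x = (1::'a)" by simp
  moreover have "of_nat m * 1 \<preceq> of_nat m * of_nat x" by (intro vle_mult) auto
  ultimately show ?thesis by simp
qed

lemma of_nat_mult_vle: "0 < m \<Longrightarrow> m < p \<Longrightarrow> of_nat m * y \<preceq> y"
  using vle_mult[OF of_nat_unit vle_refl[of y], of m] by simp

definition best_gen :: "'a \<Rightarrow> bool" where
  "best_gen \<beta> \<longleftrightarrow> \<beta> \<in> gens \<and> (\<forall>\<beta>'\<in>gens. \<beta>' \<preceq> \<beta>)"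

text \<open>
  No cancellation of values occurs in the expansion of \<open>x\<close> in powers of \<open>\<beta>\<close>.
\<close>

definition expands :: "'a \<Rightarrow> 'a \<Rightarrow> bool" where
  "expands \<beta> x \<longleftrightarrow> (\<exists>P. K_poly P \<and> degree P < p \<and> x = poly P \<beta> \<and> (\<forall>i. x \<preceq> coeff P i * \<beta> ^ i))"

text \<open>
  Substitute \<open>\<beta> = \<beta>' + c\<close>, where \<open>v c \<ge> v \<beta>\<close>.
\<close>

lemma expands_mono:
  assumes "expands \<beta> x" "\<beta> \<in> gens" "\<beta>' \<in> gens" "\<beta> \<preceq> \<beta>'"
  shows "expands \<beta>' x"
proof -
  obtain P where P: "K_poly P" "degree P < p" "x = poly P \<beta>" "\<And>i. x \<preceq> coeff P i * \<beta> ^ i"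
    using assms(1) by (auto simp: expands_def)
  define c where "c = \<beta> - \<beta>'"
  have c: "c \<in> K" "\<beta> \<preceq> c" using assms gens_diff by (auto simp: c_def intro: vle_diff)
  define Q where "Q = P \<circ>\<^sub>p [:c, 1:]"
  have "x \<preceq> coeff Q k * \<beta>' ^ k" for k
  proof -
    have "x \<preceq> of_nat (i choose k) * coeff P i * c ^ (i - k) * \<beta>' ^ k" for i
    proof (cases "k \<le> i")
      case True
      have "x \<preceq> coeff P i * (\<beta> ^ (i - k) * \<beta> ^ k)"
        using P(4)[of i] True by (simp add: power_add[symmetric])
      also have "\<dots> \<preceq> coeff P i * (c ^ (i - k) * \<beta>' ^ k)"
        using c assms by (intro vle_mult vle_power) auto
      finally have "1 * x \<preceq> of_nat (i choose k) * (coeff P i * (c ^ (i - k) * \<beta>' ^ k))"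
        by (intro vle_mult) auto
      thus ?thesis by (simp add: mult_ac)
    qed (simp add: binomial_eq_0)
    thus ?thesis unfolding Q_def pcompose_linear_coeff[OF order_refl] sum_distrib_right
      by (intro vle_sum)
  qed
  moreover have "K_poly Q" "degree Q < p" "x = poly Q \<beta>'"
    using P c by (auto simp: Q_def degree_pcompose poly_pcompose c_def)
  ultimately show ?thesis unfolding expands_def by blast
qed


subsection \<open>A best generator of new value\<close>

text \<open>
  The multiple \<open>p \<cdot> v \<beta>\<close> is a value of \<open>K\<close>, namely that of \<open>AS \<beta>\<close>.  If \<open>d \<cdot> v \<beta>\<close> were one for some \<open>d\<close> prime
  to \<open>p\<close>, then so would be \<open>v \<beta>\<close>.
\<close>

lemma ramified_powers:
  assumes \<beta>: "\<beta> \<in> gens" "v \<beta> \<notin> v ` (K - {0})" and ij: "i < j" "j < p"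
    and c: "c \<in> K" "c \<noteq> 0"
  shows "v (c * \<beta> ^ i) \<noteq> v (\<beta> ^ j)"
proof
  assume eq: "v (c * \<beta> ^ i) = v (\<beta> ^ j)"
  have nz: "\<beta> \<noteq> 0" using gens_nonzero \<beta> by blast
  define d where "d = j - i"
  have d: "0 < d" "d < p" "j = d + i" using ij by (auto simp: d_def)
  have "v c = v (\<beta> ^ d)" using eq nz c by (simp add: d(3) v_mult power_add)
  have "\<not> p dvd d" using d by (auto dest: dvd_imp_le)
  hence "coprime d p" using prime_imp_coprime[OF prime_p] coprime_commute by blast
  then obtain x y where xy: "d * x = p * y + 1" using bezout_nat[of d p] d by auto
  let ?f = "AS \<beta>"
  have f: "?f \<in> K" "?f \<noteq> 0" using gens_AS gens_AS_nonzero \<beta> by auto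
  have "v ?f = v (\<beta> ^ p)" using gens_AS_vle[OF \<beta>(1)] f nz by (intro v_eqI) auto
  hence "v (?f ^ y) = v ((\<beta> ^ p) ^ y)" using f nz by (intro v_power_cong) auto
  moreover have "v (c ^ x) = v ((\<beta> ^ d) ^ x)"
    using c nz \<open>v c = _\<close> by (intro v_power_cong) auto
  moreover have "(\<beta> ^ d) ^ x = (\<beta> ^ p) ^ y * \<beta>"
    by (simp add: power_mult[symmetric] xy)
  ultimately have "v (c ^ x / ?f ^ y) = v \<beta>"
    using c f nz by (simp add: v_divide v_mult)
  moreover have "c ^ x / ?f ^ y \<in> K - {0}" using c f by simp
  ultimately show False using \<beta>(2) by (metis imageI)
qed

lemma ramified_terms:
  assumes \<beta>: "\<beta> \<in> gens" "v \<beta> \<notin> v ` (K - {0})" and P: "K_poly P" "degree P < p"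
    and ij: "i \<noteq> j" "coeff P i \<noteq> 0" "coeff P j \<noteq> 0"
  shows "v (coeff P i * \<beta> ^ i) \<noteq> v (coeff P j * \<beta> ^ j)"
proof -
  have nz: "\<beta> \<noteq> 0" using gens_nonzero \<beta> by blast
  have *: "v (coeff P i * \<beta> ^ i) \<noteq> v (coeff P j * \<beta> ^ j)"
    if ij: "i < j" "coeff P i \<noteq> 0" "coeff P j \<noteq> 0" for i j
  proof
    assume "v (coeff P i * \<beta> ^ i) = v (coeff P j * \<beta> ^ j)"
    hence "v (coeff P i / coeff P j * \<beta> ^ i) = v (\<beta> ^ j)"
      using ij nz by (simp add: v_mult v_divide algebra_simps)
    moreover have "j < p" using ij P le_degree[of P j] by simp
    ultimately show False
      using ramified_powers[OF \<beta> ij(1), of "coeff P i / coeff P j"] ij P by simp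
  qed
  thus ?thesis using *[of i j] *[of j i] ij by (metis linorder_neqE_nat)
qed

lemma ramified_expansion:
  assumes \<beta>: "\<beta> \<in> gens" "v \<beta> \<notin> v ` (K - {0})" and P: "K_poly P" "degree P < p"
  shows "poly P \<beta> \<preceq> coeff P i * \<beta> ^ i"
proof (cases "i \<le> degree P")
  case True
  show ?thesis unfolding poly_altdef
    by (rule sum_vle_terms) (use True ramified_terms[OF assms] in auto)
qed (simp add: coeff_eq_0)


subsection \<open>A best generator with new residue class\<close>

lemma monic_division:
  assumes M: "K_poly M" "int_poly M" "lead_coeff M = 1" "degree M > 0"
    and G: "K_poly G" "int_poly G"
  obtains T R where "G = M * T + R" "K_poly T" "int_poly T" "K_poly R" "int_poly R" "degree R < degree M"
proof -
  have "\<exists>T R. G = M * T + R \<and> K_poly T \<and> int_poly T \<and> K_poly R \<and> int_poly R \<and> degree R < degree M"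
    using G
  proof (induction "degree G" arbitrary: G rule: less_induct)
    case less
    show ?case
    proof (cases "degree G < degree M")
      case True
      thus ?thesis using less.prems by (intro exI[of _ 0] exI[of _ G]) auto
    next
      case False
      define S where "S = monom (lead_coeff G) (degree G - degree M)"
      have S: "K_poly S" "int_poly S" using less.prems
        by (auto simp: S_def int_poly_def intro!: int_poly_monom)
      have "G \<noteq> 0" "M \<noteq> 0" using False M by auto
      hence "degree (M * S) = degree G" using False
        by (simp add: S_def degree_mult_eq degree_monom_eq)
      moreover have "lead_coeff (M * S) = lead_coeff G"
        unfolding lead_coeff_mult S_def lead_coeff_monom M(3) by simp
      ultimately have "degree (G - M * S) < degree G"
        using M(4) False by (intro degree_lessI) (auto simp: coeff_eq_0 le_less)
      moreover have "K_poly (G - M * S)" using less.prems M S by simp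
      moreover have "int_poly (G - M * S)" using less.prems M S by (intro int_poly_diff int_poly_mult)
      ultimately obtain T R where TR: "G - M * S = M * T + R" "K_poly T" "int_poly T" "K_poly R"
        "int_poly R" "degree R < degree M"
        using less.hyps by blast
      have "G = M * (S + T) + R" using TR(1) by (simp add: algebra_simps)
      thus ?thesis using TR S by (intro exI[of _ "S + T"] exI[of _ R]) (auto intro: int_poly_add)
    qed
  qed
  thus thesis using that by blast
qed

text \<open>
  Modulo the maximal ideal this says that if \<open>M \<cdot> T = X\<^sup>n\<close> and \<open>M\<close> has a simple zero at \<open>0\<close>, then \<open>X\<^sup>n\<^sup>-\<^sup>1\<close>
  divides \<open>T\<close>.
\<close>

lemma cofactor_small:
  assumes "int_poly M" "int_poly T" "1 \<lless> coeff M 0" "coeff M 1 \<preceq> 1"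
    and small: "small_poly (M * T - monom 1 n)" and "Suc i < n"
  shows "1 \<lless> coeff T i"
  using \<open>Suc i < n\<close>
proof (induction i rule: less_induct)
  case (less i)
  have "1 \<lless> coeff (M * T - monom 1 n) (Suc i)" using small by (simp only: small_poly_def)
  hence total: "1 \<lless> (\<Sum>j\<le>Suc i. coeff M j * coeff T (Suc i - j))"
    using less.prems by (simp add: coeff_mult)
  define S where "S = (\<Sum>j<i. coeff M (Suc (Suc j)) * coeff T (i - Suc j))"
  have eq: "(\<Sum>j\<le>Suc i. coeff M j * coeff T (Suc i - j)) =
      coeff M 0 * coeff T (Suc i) + (coeff M 1 * coeff T i + S)"
    unfolding S_def by (subst sum.atMost_Suc_shift, subst sum.atMost_shift) simp
  have "1 \<lless> coeff T (Suc i) * coeff M 0"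
    using assms by (intro vless_mult_integer) (auto simp: int_poly_def)
  moreover have "1 \<lless> S"
    unfolding S_def using assms less by (intro vless_sum vless_mult_integer) (auto simp: int_poly_def)
  ultimately have "1 \<lless> coeff M 1 * coeff T i"
    using vless_diff[OF vless_diff[OF total], of "coeff T (Suc i) * coeff M 0" S]
    unfolding eq by (simp add: algebra_simps)
  also have "coeff M 1 * coeff T i \<preceq> 1 * coeff T i" using assms by (intro vle_mult) auto
  finally show ?case by simp
qed

text \<open>
  Modulo the maximal ideal \<open>X\<^sup>p - g X - a\<close> is \<open>(X - u)\<^sup>p\<close>.
\<close>

lemma shifted_AS_poly:
  assumes u: "1 \<preceq> u" and g: "1 \<lless> g" and root: "u ^ p - g * u - a = 0"
  shows "small_poly ((monom 1 p - [:a, g:]) \<circ>\<^sub>p [:u, 1:] - monom 1 p)"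
proof -
  have "[:u, 1:] = [:u:] + (monom 1 1 :: 'a poly)" by (simp add: monom_altdef)
  hence "[:u, 1:] ^ p = ([:u:] + (monom 1 1 :: 'a poly)) ^ p" by (simp only:)
  also have "\<dots> = [:u:] ^ p + (monom 1 1 :: 'a poly) ^ p"
    by (rule freshmans_dream) (simp_all add: char prime_p)
  also have "\<dots> = [:u ^ p:] + monom 1 p"
    by (simp add: monom_power poly_const_pow)
  finally have pw: "[:u, 1:] ^ p = [:u ^ p:] + monom 1 p" .
  have "monom 1 p \<circ>\<^sub>p [:u, 1:] = [:u, 1:] ^ p"
    by (induction p) (simp_all add: monom_Suc pcompose_pCons pcompose_1 flip: one_pCons)
  hence "(monom 1 p - [:a, g:]) \<circ>\<^sub>p [:u, 1:] - monom 1 p = [:u ^ p - g * u - a, - g:]"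
    by (simp add: pcompose_diff pw pcompose_pCons algebra_simps)
  thus ?thesis using g root by simp
qed

text \<open>
  Consider a relation \<open>M\<close> of minimal degree \<open>n\<close>, made monic, between the residue classes of the powers of the unit
  \<open>u = \<beta> \<gamma>\<close>.  If \<open>n = 1\<close>, then \<open>u\<close> is congruent to an element of \<open>K\<close>, and subtracting it yields a
  generator of larger value than \<open>\<beta>\<close>.  Let \<open>n \<ge> 2\<close>.  If \<open>\<gamma>\<close> is a unit, then \<open>\<sigma> u = u + \<gamma>\<close> shows that
  \<open>M (X + \<gamma>) - M\<close> is a relation too, of degree \<open>n - 1\<close> because its leading coefficient is \<open>n \<gamma>\<close>.
  If \<open>\<gamma>\<close> is not a unit, then \<open>M\<close> divides \<open>(X - u)\<^sup>p\<close> modulo the maximal ideal, although by minimality \<open>u\<close> is a simple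
  zero of \<open>M\<close>; the cofactor is then divisible by \<open>(X - u)\<^sup>p\<^sup>-\<^sup>1\<close>, which contradicts \<open>n \<ge> 2\<close>.
\<close>

lemma residue_independent:
  assumes best: "best_gen \<beta>" and \<gamma>: "\<gamma> \<in> K" "\<gamma> \<noteq> 0" and u: "1 \<preceq> \<beta> * \<gamma>" "\<beta> * \<gamma> \<preceq> 1"
    and P: "K_poly P" "int_poly P" "degree P < p" "1 \<lless> poly P (\<beta> * \<gamma>)"
  shows "small_poly P"
  using P
proof (induction "degree P" arbitrary: P rule: less_induct)
  case less
  define u where "u = \<beta> * \<gamma>"
  define n where "n = degree P"
  have \<beta>: "\<beta> \<in> gens" using best by (simp add: best_gen_def)
  have u: "1 \<preceq> u" "u \<preceq> 1" "u \<noteq> 0" using assms by (auto simp: u_def)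
  have IH: "small_poly Q" if "K_poly Q" "int_poly Q" "degree Q < n" "1 \<lless> poly Q u" for Q
    using less.hyps[of Q] that less.prems(3) by (simp add: u_def n_def)
  show ?case
  proof (cases "1 \<lless> lead_coeff P")
    case True
    define Q where "Q = P - monom (lead_coeff P) n"
    have S: "small_poly (monom (lead_coeff P) n)" using True by (rule small_poly_monom)
    have Q: "K_poly Q" "int_poly Q"
      using less.prems int_poly_diff[OF less.prems(2) small_imp_int_poly[OF S]] by (auto simp: Q_def)
    have "1 \<lless> poly Q u"
      using less.prems(4) small_poly_eval[OF S u(1)] by (simp add: Q_def u_def vless_diff)
    have "small_poly Q"
    proof (cases "n = 0")
      case True
      hence "Q = 0" unfolding Q_def n_def by (metis degree_0_id diff_self monom_0)
      thus ?thesis by simp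
    next
      case False
      hence "degree Q < n" unfolding Q_def
        by (intro degree_lessI) (auto simp: n_def coeff_eq_0 le_less)
      thus ?thesis using IH Q \<open>1 \<lless> poly Q u\<close> by blast
    qed
    moreover have "P = Q + monom (lead_coeff P) n" by (simp add: Q_def)
    ultimately show ?thesis using S small_poly_add by metis
  next
    case False
    hence lc: "lead_coeff P \<preceq> 1" "lead_coeff P \<noteq> 0" by (auto simp: vless_def)
    define M where "M = smult (1 / lead_coeff P) P"
    have M: "K_poly M" "int_poly M" "degree M = n" "lead_coeff M = 1"
      using less.prems lc
      by (auto simp: M_def n_def vle_divide_right intro!: int_poly_smult)
    have Mu: "1 \<lless> poly M u"
      using less.prems(4) lc by (auto simp: M_def u_def vless_divide_right intro: vle_vless_trans)
    have np: "n < p" using less.prems by (simp add: n_def)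
    have "False"
    proof (cases "n \<ge> 2")
      case False
      then consider "n = 0" | "n = 1" by linarith
      thus False
      proof cases
        case 1
        hence "M = 1" using M(3,4) by (metis degree_0_id one_pCons)
        thus False using Mu by simp
      next
        case 2
        then obtain a where Ma: "M = [:a, 1:]" using M(3,4)
          by (metis One_nat_def coeff_pCons_0 coeff_pCons_Suc degree1_coeffs)
        hence a: "a \<in> K" "1 \<lless> u + a" using M Mu by (auto simp: add.commute)
        \<comment> \<open>The translate of \<open>\<beta>\<close> by \<open>a / \<gamma>\<close> has a larger value than \<open>\<beta>\<close>.\<close>
        have "\<beta> + a / \<gamma> \<in> gens" using \<beta> a \<gamma> by (intro gens_add) auto
        hence "\<beta> + a / \<gamma> \<preceq> \<beta>" using best by (simp add: best_gen_def)
        hence "(\<beta> + a / \<gamma>) * \<gamma> \<preceq> u" using \<gamma> by (simp add: u_def)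
        moreover have "(\<beta> + a / \<gamma>) * \<gamma> = u + a" using \<gamma> by (simp add: u_def distrib_right)
        ultimately have "u + a \<preceq> u" by simp
        thus False using a u by (meson vle_trans vless_def)
      qed
    next
      case True
      have n_unit: "of_nat n \<preceq> 1" using True np by (intro of_nat_unit) auto
      have "1 \<preceq> \<gamma>"
      proof -
        have "1 \<preceq> \<beta> * \<gamma>" using u by (simp add: u_def)
        also have "\<beta> * \<gamma> \<preceq> 1 * \<gamma>" using gens_vle_1[OF \<beta>] by (intro vle_mult) auto
        finally show ?thesis by simp
      qed
      show False
      proof (cases "1 \<lless> \<gamma>")
        case False
        define Q where "Q = M \<circ>\<^sub>p [:\<gamma>, 1:] - M"
        have Q: "K_poly Q" "int_poly Q" "degree Q < n"
          using M \<gamma> \<open>1 \<preceq> \<gamma>\<close> degree_shift_diff[of M \<gamma>] True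
          by (auto simp: Q_def intro!: int_poly_diff int_poly_pcompose)
        have "\<sigma> u = u + \<gamma>" using \<beta> \<gamma> by (simp add: u_def gens_def \<sigma>_mult \<sigma>_K algebra_simps)
        hence "poly Q u = \<sigma> (poly M u) - poly M u"
          using M by (simp add: Q_def poly_pcompose gal_poly[OF \<sigma>_gal] add.commute)
        hence "1 \<lless> poly Q u" using Mu by (auto intro!: vless_diff)
        hence "small_poly Q" using IH Q by blast
        hence "1 \<lless> coeff Q (n - 1)" by (simp add: small_poly_def)
        moreover have "coeff Q (n - 1) = of_nat n * \<gamma>"
        proof -
          obtain k where k: "n = Suc k" using True by (cases n) auto
          have "coeff (M \<circ>\<^sub>p [:\<gamma>, 1:]) k = (\<Sum>i\<le>n. of_nat (i choose k) * coeff M i * \<gamma> ^ (i - k))"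
            by (rule pcompose_linear_coeff) (simp add: M)
          also have "\<dots> = (\<Sum>i\<in>{k, n}. of_nat (i choose k) * coeff M i * \<gamma> ^ (i - k))"
            by (rule sum.mono_neutral_right) (auto simp: k binomial_eq_0)
          also have "\<dots> = coeff M k + of_nat n * \<gamma>" using M by (simp add: k)
          finally show ?thesis by (simp add: Q_def k)
        qed
        moreover have "of_nat n * \<gamma> \<preceq> 1 * 1"
          using n_unit False by (intro vle_mult) (auto simp: not_vless)
        ultimately show False by (simp add: vless_def)
      next
        case \<gamma>_small: True
        define a where "a = \<gamma> ^ p * AS \<beta>"
        define g where "g = \<gamma> ^ (p - 1)"
        have p: "p = Suc (p - 1)" "p - 1 > 0" using p_ge_2 by auto
        have root: "u ^ p - g * u - a = 0"
        proof -
          have "\<gamma> ^ p = g * \<gamma>" using p(1) by (metis g_def power_Suc2)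
          thus ?thesis by (simp add: u_def a_def AS_eq power_mult_distrib algebra_simps)
        qed
        have g: "1 \<lless> g" using vless_power[OF \<gamma>_small p(2)] by (simp add: g_def)
        have "a = u ^ p - g * u" using root by simp
        hence a: "1 \<preceq> a" using vless_imp_vle[OF g] u by (auto intro!: vle_diff one_vle_mult one_vle_power)
        have aK: "a \<in> K" "g \<in> K" using gens_AS[OF \<beta>] \<gamma> by (auto simp: a_def g_def)
        define G where "G = monom 1 p - [:a, g:]"
        have G: "K_poly G" "int_poly G"
          using a aK vless_imp_vle[OF g] by (auto simp: G_def intro!: int_poly_diff int_poly_monom)
        obtain T R where TR: "G = M * T + R" "K_poly T" "int_poly T" "K_poly R" "int_poly R" "degree R < n"
          using monic_division[OF M(1,2,4) _ G] M(3) True by auto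
        have "poly G u = 0" using root by (simp add: G_def poly_monom algebra_simps)
        hence "poly R u = - (poly T u * poly M u)" using TR(1) by (simp add: eq_neg_iff_add_eq_0 algebra_simps)
        hence "1 \<lless> poly R u"
          using Mu int_poly_eval[OF TR(3) u(1)] by (simp add: vless_mult_integer)
        hence R: "small_poly R" using IH TR by blast
        define M' where "M' = M \<circ>\<^sub>p [:u, 1:]"
        define T' where "T' = T \<circ>\<^sub>p [:u, 1:]"
        have int': "int_poly M'" "int_poly T'" using M TR u by (auto simp: M'_def T'_def intro!: int_poly_pcompose)
        have "small_poly (G \<circ>\<^sub>p [:u, 1:] - monom 1 p)"
          unfolding G_def using u g root by (intro shifted_AS_poly)
        moreover have "small_poly (R \<circ>\<^sub>p [:u, 1:])" using R u by (intro small_poly_pcompose) auto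
        moreover have "M' * T' - monom 1 p = (G \<circ>\<^sub>p [:u, 1:] - monom 1 p) - R \<circ>\<^sub>p [:u, 1:]"
          by (simp add: TR(1) M'_def T'_def pcompose_add pcompose_mult)
        ultimately have prod: "small_poly (M' * T' - monom 1 p)" by (simp only: small_poly_diff)
        have M'0: "1 \<lless> coeff M' 0" using Mu by (simp add: M'_def pcompose_coeff_0)
        have M'1: "coeff M' 1 = poly (pderiv M) u"
        proof -
          have "coeff (pderiv M') 0 = poly (pderiv M) u"
            by (simp add: M'_def pderiv_pcompose pderiv_pCons pcompose_coeff_0 coeff_mult)
          thus ?thesis by (simp add: coeff_pderiv)
        qed
        have "coeff M' 1 \<preceq> 1"
        proof (rule ccontr)
          assume "\<not> ?thesis"
          hence "1 \<lless> poly (pderiv M) u" unfolding M'1 not_vle .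
          moreover have "degree (pderiv M) < n" using True M(3)
            by (intro degree_lessI) (auto simp: coeff_pderiv coeff_eq_0)
          moreover have "int_poly (pderiv M)"
            using M by (auto simp: int_poly_def coeff_pderiv simp del: of_nat_Suc intro: one_vle_mult)
          ultimately have "small_poly (pderiv M)" using IH M by simp
          hence "1 \<lless> coeff (pderiv M) (n - 1)" by (simp add: small_poly_def)
          moreover have "coeff (pderiv M) (n - 1) = of_nat n" using M True
            by (simp add: coeff_pderiv del: of_nat_Suc)
          ultimately show False using n_unit by (simp add: vless_def)
        qed
        hence T'_small: "1 \<lless> coeff T' i" if "Suc i < p" for i
          using cofactor_small[OF int' M'0 _ prod that] by blast
        have "degree G = p" "lead_coeff G = 1"
        proof -
          have "degree [:a, g:] < p" using p_ge_2 degree_pCons_le[of a "[:g:]"] by simp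
          hence "degree (- [:a, g:]) < degree (monom (1::'a) p)"
            unfolding degree_minus by (simp add: degree_monom_eq del: degree_pCons_eq_if)
          from degree_add_eq_left[OF this] show "degree G = p"
            unfolding G_def diff_conv_add_uminus by (simp add: degree_monom_eq del: degree_pCons_eq_if)
          thus "lead_coeff G = 1" using \<open>degree [:a, g:] < p\<close> by (simp add: G_def coeff_eq_0)
        qed
        moreover have MT: "M * T = G - R" using TR(1) by simp
        ultimately have "degree (M * T) = p" "lead_coeff (M * T) = 1"
          using TR(6) np degree_add_eq_left[of "- R" G] by (auto simp: coeff_eq_0)
        moreover have "M \<noteq> 0" "T \<noteq> 0" using calculation M True p_pos by auto
        ultimately have degT: "degree T = p - n" "lead_coeff T = 1"
          using M unfolding lead_coeff_mult by (auto simp: degree_mult_eq)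
        hence "coeff T' (p - n) = 1"
          using lead_coeff_comp[of "[:u, 1:]" T] degree_pcompose[of T "[:u, 1:]"]
          by (simp add: T'_def)
        moreover have "Suc (p - n) < p" using True np by linarith
        ultimately show False using T'_small[of "p - n"] by simp
      qed
    qed
    thus ?thesis by blast
  qed
qed

text \<open>
  After division by the coefficient of smallest value, the polynomial in the unit \<open>\<beta> \<gamma>\<close> does not vanish modulo
  the maximal ideal; so its value at \<open>\<beta> \<gamma>\<close> is a unit.
\<close>

lemma unramified_expansion:
  assumes best: "best_gen \<beta>" and \<gamma>: "\<gamma> \<in> K" "\<gamma> \<noteq> 0" and u: "1 \<preceq> \<beta> * \<gamma>" "\<beta> * \<gamma> \<preceq> 1"
    and P: "K_poly P" "degree P < p"
  shows "poly P \<beta> \<preceq> coeff P i * \<beta> ^ i"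
proof (cases "P = 0")
  case False
  define Q where "Q = P \<circ>\<^sub>p [:0, 1 / \<gamma>:]"
  have Qi: "coeff Q i = coeff P i / \<gamma> ^ i" for i
    by (simp add: Q_def coeff_pcompose_linear field_simps)
  have Q: "K_poly Q" "degree Q = degree P" "poly Q (\<beta> * \<gamma>) = poly P \<beta>"
    using P \<gamma> by (auto simp: Q_def degree_pcompose poly_pcompose)
  obtain j where j: "j \<le> degree P" "\<forall>i\<le>degree P. coeff Q j \<preceq> coeff Q i"
    using vle_argmin[of "{..degree P}" "coeff Q"] by auto
  have min: "coeff Q j \<preceq> coeff Q i" for i
    using j(2) by (cases "i \<le> degree P") (auto simp: Qi coeff_eq_0)
  have Qj: "coeff Q j \<noteq> 0"
    using min[of "degree P"] False \<gamma> by (auto simp: Qi)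
  define S where "S = smult (1 / coeff Q j) Q"
  have S: "K_poly S" "int_poly S" "degree S < p"
    using Q P min Qj by (auto simp: S_def int_poly_def vle_divide_right)
  have "coeff S j = 1" using Qj by (simp add: S_def)
  hence "\<not> small_poly S" unfolding small_poly_def by (metis vless_irrefl)
  hence "poly S (\<beta> * \<gamma>) \<preceq> 1"
    using residue_independent[OF best \<gamma> u S] by (auto simp: not_vless[symmetric])
  hence "poly P \<beta> \<preceq> coeff Q j" using Q Qj by (simp add: S_def vle_divide_left)
  also have "\<dots> \<preceq> coeff Q i" by (rule min)
  also have "coeff Q i * 1 \<preceq> coeff Q i * (\<beta> * \<gamma>) ^ i"
    using u by (intro vle_mult one_vle_power) auto
  hence "coeff Q i \<preceq> coeff P i * \<beta> ^ i" using \<gamma> by (simp add: Qi power_mult_distrib)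
  finally show ?thesis .
qed simp

lemma best_expansion:
  assumes "best_gen \<beta>" "K_poly P" "degree P < p"
  shows "poly P \<beta> \<preceq> coeff P i * \<beta> ^ i"
proof -
  have \<beta>: "\<beta> \<in> gens" "\<beta> \<noteq> 0" using assms gens_nonzero by (auto simp: best_gen_def)
  show ?thesis
  proof (cases "v \<beta> \<in> v ` (K - {0})")
    case False
    thus ?thesis using ramified_expansion \<beta> assms by blast
  next
    case True
    then obtain c where c: "c \<in> K" "c \<noteq> 0" "v \<beta> = v c" by auto
    have "1 \<preceq> \<beta> * (1 / c)" "\<beta> * (1 / c) \<preceq> 1"
      using c \<beta> by (simp_all add: vle_divide_right vle_divide_left vle_of_v_eq)
    thus ?thesis using unramified_expansion[of \<beta> "1 / c"] c assms by auto
  qed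
qed


subsection \<open>No best generator\<close>

lemma K_poly_synthetic_div: "K_poly P \<Longrightarrow> c \<in> K \<Longrightarrow> K_poly (synthetic_div P c)"
  by (induction P) (auto intro: poly_in_K)

text \<open>
  Each product of two terms of positive total degree contains a factor that is dominated by \<open>a\<close> or by \<open>b\<close>.
\<close>

lemma dominated_mult:
  assumes "a \<noteq> 0" "b \<noteq> 0" "\<And>i. i \<ge> 1 \<Longrightarrow> a \<lless> coeff P i * x ^ i" "\<And>i. i \<ge> 1 \<Longrightarrow> b \<lless> coeff Q i * x ^ i"
    "a \<preceq> coeff P 0" "b \<preceq> coeff Q 0" "i \<ge> 1"
  shows "a * b \<lless> coeff (P * Q) i * x ^ i"
proof -
  have "a * b \<lless> coeff P j * coeff Q (i - j) * x ^ i" if "j \<le> i" for j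
  proof -
    have le: "a \<preceq> coeff P j * x ^ j" "b \<preceq> coeff Q (i - j) * x ^ (i - j)"
      using assms by (cases "j = 0"; cases "i - j = 0"; auto intro: vless_imp_vle)+
    have "a * b \<lless> (coeff P j * x ^ j) * (coeff Q (i - j) * x ^ (i - j))"
    proof (cases "j = 0")
      case True
      thus ?thesis using le assms by (intro vless_mult') auto
    next
      case False
      thus ?thesis using le assms by (intro vless_mult) auto
    qed
    thus ?thesis using that by (simp add: mult_ac power_add[symmetric])
  qed
  thus ?thesis using assms(1,2) unfolding coeff_mult sum_distrib_right by (intro vless_sum) auto
qed

text \<open>
  Here \<open>Q\<close> has the shape to which Newton's method applies at \<open>0\<close>: with \<open>\<tau> = Q(0) / Q'(0)\<close> the
  polynomial \<open>Q(\<tau> / X) X\<^sup>n / Q(0)\<close> is congruent to \<open>X\<^sup>n + X\<^sup>n\<^sup>-\<^sup>1\<close>.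
\<close>

lemma newton_root:
  assumes Q: "K_poly Q" "degree Q = n" "n > 0" and nz: "coeff Q 0 \<noteq> 0" "coeff Q 1 \<noteq> 0"
    and small: "\<And>i. i \<ge> 2 \<Longrightarrow> coeff Q 0 \<lless> coeff Q i * (coeff Q 0 / coeff Q 1) ^ i"
  obtains r where "r \<in> K" "poly Q r = 0"
proof -
  define \<tau> where "\<tau> = coeff Q 0 / coeff Q 1"
  define m where "m = (\<lambda>i. coeff Q i * \<tau> ^ i / coeff Q 0)"
  have m: "m i \<in> K" "i \<ge> 2 \<Longrightarrow> 1 \<lless> m i" for i
    using Q nz small[of i] by (auto simp: m_def \<tau>_def vless_divide_right)
  define R where "R = (\<Sum>i=2..n. monom (m i) (n - i))"
  have "K_poly R" unfolding R_def K_poly_def coeff_sum using m by (auto intro!: K_sum)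
  moreover have "small_poly R" unfolding R_def using m by (intro small_poly_sum small_poly_monom) auto
  moreover have "degree R \<le> n - 1" unfolding R_def
    by (intro degree_sum_le) (auto intro: order.trans[OF degree_monom_le])
  ultimately obtain b where b: "b \<in> K" "poly ([:1, 1:] * monom 1 (n - 1) + R) b = 0" "1 \<lless> b + 1"
    using hensel_root[of R "n - 1" 1] by auto
  have "b \<noteq> 0" using b(3) by auto
  obtain k where k: "n = Suc k" using Q by (cases n) auto
  have "0 = (1 + b) * b ^ k + (\<Sum>i=2..n. m i * b ^ (n - i))"
  proof -
    have "poly R b = (\<Sum>i=2..n. m i * b ^ (n - i))" by (simp add: R_def poly_sum poly_monom)
    moreover have "n - 1 = k" using k by simp
    ultimately show ?thesis using b(2) by (simp add: poly_monom distrib_right)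
  qed
  also have "(\<Sum>i=2..n. m i * b ^ (n - i)) = (\<Sum>i=2..n. b ^ n * (m i / b ^ i))"
    using \<open>b \<noteq> 0\<close> by (intro sum.cong) (auto simp: power_diff)
  also have "\<dots> = b ^ n * (\<Sum>i=2..n. m i / b ^ i)" by (simp add: sum_distrib_left)
  also have "(1 + b) * b ^ k = b ^ n * (1 + 1 / b)" using \<open>b \<noteq> 0\<close> by (simp add: k field_simps)
  finally have "1 + 1 / b + (\<Sum>i=2..n. m i / b ^ i) = 0"
    using \<open>b \<noteq> 0\<close> by (simp flip: distrib_left)
  hence "0 = coeff Q 0 * (1 + 1 / b + (\<Sum>i=2..n. m i / b ^ i))" by simp
  also have "\<dots> = coeff Q 0 + coeff Q 1 * (\<tau> / b) + (\<Sum>i=2..n. coeff Q i * (\<tau> / b) ^ i)"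
    using nz by (simp add: distrib_left sum_distrib_left m_def \<tau>_def power_divide power_mult_distrib)
  also have "\<dots> = poly Q (\<tau> / b)"
  proof -
    have "{1..n} = insert 1 {2..n}" using Q by auto
    thus ?thesis using Q by (simp add: poly_split_const)
  qed
  finally show thesis using that[of "\<tau> / b"] Q b by (simp add: \<tau>_def)
qed

text \<open>
  In the expansion of \<open>P \<alpha>\<close> in powers of \<open>\<beta>\<close>, the constant term eventually dominates.  The proof is by
  induction on the degree.  The claim for the derivative says that the linear term has a smaller value than the
  terms of higher degree.  If \<open>P \<alpha>\<close> eventually has a smaller value than the linear term, nothing is left to prove.
  Otherwise the constant term cancels the linear one, and Newton's method yields a root of \<open>P\<close> in \<open>K\<close>; the
  claim for \<open>P\<close> then follows from the claim for the two factors.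
\<close>

lemma defect_expansion:
  assumes no_best: "\<And>\<beta>. \<not> best_gen \<beta>" and "K_poly P" "degree P < p" "P \<noteq> 0"
  shows "\<exists>\<beta>0\<in>gens. \<forall>\<beta>\<in>gens. \<beta>0 \<preceq> \<beta> \<longrightarrow> (\<forall>i\<ge>1. poly P \<alpha> \<lless> coeff (P \<circ>\<^sub>p [:\<alpha> - \<beta>, 1:]) i * \<beta> ^ i)"
  using assms(2-)
proof (induction "degree P" arbitrary: P rule: less_induct)
  case less
  define n where "n = degree P"
  have better: "\<exists>\<beta>'\<in>gens. \<beta> \<lless> \<beta>'" if "\<beta> \<in> gens" for \<beta>
    using no_best[of \<beta>] that by (auto simp: best_gen_def not_vle)
  have nz: "poly R \<alpha> \<noteq> 0" if "K_poly R" "degree R < p" "R \<noteq> 0" for R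
    using independent_powers that by blast
  define x where "x = poly P \<alpha>"
  have x: "x \<noteq> 0" using nz less.prems by (simp add: x_def)
  show ?case
  proof (cases "n = 0")
    case True
    then obtain c where "P = [:c:]" by (metis degree_0_id n_def)
    moreover from this have "c \<noteq> 0" using less.prems by simp
    ultimately show ?thesis using \<alpha>_gens by (intro bexI[of _ \<alpha>]) (auto simp: coeff_pCons split: nat.splits)
  next
    case False
    define P' where "P' = pderiv P"
    have "coeff P' (n - 1) = of_nat n * lead_coeff P"
      using False by (simp add: P'_def coeff_pderiv n_def del: of_nat_Suc)
    hence "P' \<noteq> 0" using less.prems of_nat_neq_0[of n] False n_def by auto
    have "degree P' < n" unfolding P'_def using False
      by (intro degree_lessI) (auto simp: coeff_pderiv coeff_eq_0 n_def)
    moreover have KP': "K_poly P'" using less.prems by (simp add: P'_def)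
    ultimately obtain \<beta>1 where \<beta>1: "\<beta>1 \<in> gens"
      "\<And>\<beta> i. \<beta> \<in> gens \<Longrightarrow> \<beta>1 \<preceq> \<beta> \<Longrightarrow> i \<ge> 1 \<Longrightarrow> poly P' \<alpha> \<lless> coeff (P' \<circ>\<^sub>p [:\<alpha> - \<beta>, 1:]) i * \<beta> ^ i"
      using less.hyps[of P'] \<open>P' \<noteq> 0\<close> less.prems unfolding n_def by (auto 0 4)
    define d where "d = poly P' \<alpha>"
    have d: "d \<noteq> 0" unfolding d_def
      using nz[of P'] KP' \<open>degree P' < n\<close> \<open>P' \<noteq> 0\<close> less.prems n_def by simp
    define Q where "Q = (\<lambda>\<beta>. P \<circ>\<^sub>p [:\<alpha> - \<beta>, 1:])"
    have Q: "K_poly (Q \<beta>)" "degree (Q \<beta>) = n" "poly (Q \<beta>) \<beta> = x" if "\<beta> \<in> gens" for \<beta>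
      using that less.prems gens_diff[OF \<alpha>_gens that]
      by (auto simp: Q_def x_def n_def degree_pcompose poly_pcompose)
    have P'_comp: "P' \<circ>\<^sub>p [:\<alpha> - \<beta>, 1:] = pderiv (Q \<beta>)" for \<beta>
      by (simp add: Q_def P'_def pderiv_pcompose pderiv_pCons)
    have high: "d * \<beta> \<lless> coeff (Q \<beta>) i * \<beta> ^ i" if \<beta>: "\<beta> \<in> gens" "\<beta>1 \<preceq> \<beta>" and i: "i \<ge> 2" for \<beta> i
    proof -
      have nz\<beta>: "\<beta> \<noteq> 0" using gens_nonzero \<beta> by blast
      obtain j where j: "i = Suc j" "j \<ge> 1" using i by (cases i) auto
      show ?thesis
      proof (cases "i \<le> n")
        case True
        have "d \<lless> of_nat i * coeff (Q \<beta>) i * \<beta> ^ j"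
          using \<beta>1(2)[OF \<beta> j(2)] unfolding d_def P'_comp by (simp add: coeff_pderiv j(1) del: of_nat_Suc)
        also have "\<dots> = of_nat i * (coeff (Q \<beta>) i * \<beta> ^ j)" by (simp add: mult.assoc)
        also have "\<dots> \<preceq> coeff (Q \<beta>) i * \<beta> ^ j"
          using i True less.prems(2) n_def by (intro of_nat_mult_vle) auto
        finally have "d * \<beta> \<lless> (coeff (Q \<beta>) i * \<beta> ^ j) * \<beta>" using nz\<beta> by simp
        thus ?thesis by (simp add: j(1) mult_ac)
      qed (use Q \<beta> d nz\<beta> in \<open>simp add: coeff_eq_0\<close>)
    qed
    \<comment> \<open>The linear coefficient is the constant term of the expansion of \<open>P' \<alpha>\<close>, so it has the value of \<open>d\<close>.\<close>
    have lin: "d \<preceq> coeff (Q \<beta>) 1" "coeff (Q \<beta>) 1 \<preceq> d" if \<beta>: "\<beta> \<in> gens" "\<beta>1 \<preceq> \<beta>" for \<beta>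
    proof -
      have "poly (P' \<circ>\<^sub>p [:\<alpha> - \<beta>, 1:]) \<beta> = d" by (simp add: d_def poly_pcompose)
      from const_dominates(2,3)[OF d this \<beta>1(2)[OF \<beta>, folded d_def]]
      show "d \<preceq> coeff (Q \<beta>) 1" "coeff (Q \<beta>) 1 \<preceq> d"
        by (simp_all add: P'_comp coeff_pderiv)
    qed
    show ?thesis
    proof (cases "\<exists>\<beta>2\<in>gens. \<beta>1 \<preceq> \<beta>2 \<and> x \<lless> d * \<beta>2")
      case True
      then obtain \<beta>2 where \<beta>2: "\<beta>2 \<in> gens" "\<beta>1 \<preceq> \<beta>2" "x \<lless> d * \<beta>2" by blast
      have "x \<lless> coeff (Q \<beta>) i * \<beta> ^ i" if \<beta>: "\<beta> \<in> gens" "\<beta>2 \<preceq> \<beta>" and i: "i \<ge> 1" for \<beta> i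
      proof -
        have le: "\<beta>1 \<preceq> \<beta>" using \<beta>2 \<beta> vle_trans by blast
        have "x \<lless> d * \<beta>2" by (rule \<beta>2)
        also have "\<dots> \<preceq> d * \<beta>" using \<beta> by (intro vle_mult) auto
        also have "d * \<beta> \<preceq> coeff (Q \<beta>) i * \<beta> ^ i"
        proof (cases "i = 1")
          case True
          thus ?thesis using lin(1)[OF \<beta>(1) le] by (auto intro: vle_mult)
        next
          case False
          thus ?thesis using high[OF \<beta>(1) le, of i] i by (intro vless_imp_vle) auto
        qed
        finally show ?thesis .
      qed
      thus ?thesis using \<beta>2(1) unfolding x_def Q_def by blast
    next
      case False
      obtain \<beta>2 where \<beta>2: "\<beta>2 \<in> gens" "\<beta>1 \<lless> \<beta>2" using better \<beta>1 by blast
      hence "d * \<beta>2 \<preceq> x" using False by (auto simp: not_vless dest: vless_imp_vle)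
      moreover have "d * \<beta>1 \<lless> d * \<beta>2" using \<beta>2 d by simp
      ultimately have lt: "d * \<beta>1 \<lless> x" using vless_vle_trans by blast
      let ?Q = "Q \<beta>1"
      note Q1 = Q[OF \<beta>1(1)] and lin1 = lin[OF \<beta>1(1) vle_refl] and high1 = high[OF \<beta>1(1) vle_refl]
      have \<beta>1nz: "\<beta>1 \<noteq> 0" using gens_nonzero \<beta>1 by blast
      have Q1nz: "coeff ?Q 1 \<noteq> 0" using lin1(2) d by auto
      have "{1..n} = insert 1 {2..n}" using False \<open>n \<noteq> 0\<close> by auto
      hence "x = coeff ?Q 0 + coeff ?Q 1 * \<beta>1 + (\<Sum>i=2..n. coeff ?Q i * \<beta>1 ^ i)"
        using Q1(2,3) poly_split_const[of ?Q \<beta>1] by (simp add: add.assoc)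
      hence split: "coeff ?Q 0 = - (coeff ?Q 1 * \<beta>1) + (x - (\<Sum>i=2..n. coeff ?Q i * \<beta>1 ^ i))"
        by simp
      have "d * \<beta>1 \<lless> x - (\<Sum>i=2..n. coeff ?Q i * \<beta>1 ^ i)"
        using lt high1 d \<beta>1nz by (intro vless_diff vless_sum) auto
      moreover have eq1: "coeff ?Q 1 * \<beta>1 \<preceq> d * \<beta>1" using lin1 by (intro vle_mult) auto
      ultimately have "- (coeff ?Q 1 * \<beta>1) \<lless> x - (\<Sum>i=2..n. coeff ?Q i * \<beta>1 ^ i)"
        by (auto intro: vle_vless_trans)
      from dominant_add[OF this] have Q0: "coeff ?Q 0 \<preceq> coeff ?Q 1 * \<beta>1" "coeff ?Q 1 * \<beta>1 \<preceq> coeff ?Q 0"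
        unfolding split[symmetric] by auto
      have Q0nz: "coeff ?Q 0 \<noteq> 0" using Q0(1) Q1nz \<beta>1nz by auto
      have \<tau>: "\<beta>1 \<preceq> coeff ?Q 0 / coeff ?Q 1" using Q0(2) Q1nz by (simp add: vle_divide_right mult.commute)
      have "coeff ?Q 0 \<lless> coeff ?Q i * (coeff ?Q 0 / coeff ?Q 1) ^ i" if "i \<ge> 2" for i
      proof -
        have "coeff ?Q 0 \<preceq> d * \<beta>1" using Q0(1) eq1 by (rule vle_trans)
        also have "\<dots> \<lless> coeff ?Q i * \<beta>1 ^ i" by (rule high1[OF that])
        also have "\<dots> \<preceq> coeff ?Q i * (coeff ?Q 0 / coeff ?Q 1) ^ i"
          using \<tau> by (intro vle_mult vle_power) auto
        finally show ?thesis .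
      qed
      \<comment> \<open>The quotient of the constant by the linear coefficient has at least the value of \<open>\<beta>1\<close>, as Newton's method requires.\<close>
      then obtain t where t: "t \<in> K" "poly ?Q t = 0"
        using newton_root[OF Q1(1,2) _ Q0nz Q1nz] \<open>n \<noteq> 0\<close> by blast
      define r where "r = t + (\<alpha> - \<beta>1)"
      have r: "r \<in> K" "poly P r = 0"
        using t gens_diff[OF \<alpha>_gens \<beta>1(1)] by (auto simp: r_def Q_def poly_pcompose add.commute)
      define S where "S = synthetic_div P r"
      have PS: "P = [:- r, 1:] * S"
        using synthetic_div_correct'[of r P] r by (simp add: S_def)
      have "K_poly S" unfolding S_def using less.prems(1) r(1) by (rule K_poly_synthetic_div)
      moreover have "degree S < n" unfolding S_def degree_synthetic_div using \<open>n \<noteq> 0\<close> by (simp add: n_def)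
      moreover have "S \<noteq> 0" using PS less.prems(3) by (metis mult_zero_right)
      ultimately have S: "K_poly S" "degree S < n" "S \<noteq> 0" by blast+
      then obtain \<beta>3 where \<beta>3: "\<beta>3 \<in> gens"
        "\<And>\<beta> i. \<beta> \<in> gens \<Longrightarrow> \<beta>3 \<preceq> \<beta> \<Longrightarrow> i \<ge> 1 \<Longrightarrow> poly S \<alpha> \<lless> coeff (S \<circ>\<^sub>p [:\<alpha> - \<beta>, 1:]) i * \<beta> ^ i"
        using less.hyps[of S] less.prems unfolding n_def by (auto 0 4)
      have ar: "\<alpha> - r \<in> gens" "\<alpha> - r \<noteq> 0" using \<alpha>_gens r gens_minus gens_nonzero by blast+
      then obtain \<beta>4 where \<beta>4: "\<beta>4 \<in> gens" "\<alpha> - r \<lless> \<beta>4" using better by blast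
      obtain \<beta>5 where \<beta>5: "\<beta>5 \<in> gens" "\<beta>3 \<preceq> \<beta>5" "\<beta>4 \<preceq> \<beta>5"
        using vle_total[of \<beta>3 \<beta>4] \<beta>3(1) \<beta>4(1) by auto
      have "x \<lless> coeff (Q \<beta>) i * \<beta> ^ i" if \<beta>: "\<beta> \<in> gens" "\<beta>5 \<preceq> \<beta>" and i: "i \<ge> 1" for \<beta> i
      proof -
        let ?S = "S \<circ>\<^sub>p [:\<alpha> - \<beta>, 1:]" and ?X = "[:- r, 1:] \<circ>\<^sub>p [:\<alpha> - \<beta>, 1:]"
        have X: "?X = [:\<alpha> - \<beta> - r, 1:]" by (simp add: pcompose_pCons)
        have le: "\<beta>3 \<preceq> \<beta>" "\<beta>4 \<preceq> \<beta>" using \<beta> \<beta>5 vle_trans by blast+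
        have Sx: "poly S \<alpha> \<noteq> 0" using nz S less.prems(2) n_def by simp
        have 1: "\<alpha> - r \<lless> coeff ?X i * \<beta> ^ i" if "i \<ge> 1" for i
          using that vless_vle_trans[OF \<beta>4(2) le(2)] ar
          unfolding X by (cases i; cases "i - 1") (auto simp: coeff_pCons split: nat.splits)
        have 2: "poly S \<alpha> \<lless> coeff ?S i * \<beta> ^ i" if "i \<ge> 1" for i
          using \<beta>3(2)[OF \<beta>(1) le(1) that] .
        have "poly ?X \<beta> = \<alpha> - r" unfolding X by simp
        from const_dominates(2)[OF ar(2) this 1] have 3: "\<alpha> - r \<preceq> coeff ?X 0" by blast
        have "poly ?S \<beta> = poly S \<alpha>" by (simp add: poly_pcompose)
        from const_dominates(2)[OF Sx this 2] have 4: "poly S \<alpha> \<preceq> coeff ?S 0" by blast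
        have "(\<alpha> - r) * poly S \<alpha> \<lless> coeff (?X * ?S) i * \<beta> ^ i"
          by (rule dominated_mult[OF ar(2) Sx 1 2 3 4 i])
        moreover have "x = (\<alpha> - r) * poly S \<alpha>" unfolding x_def by (subst PS) (simp add: algebra_simps)
        moreover have "Q \<beta> = ?X * ?S" unfolding Q_def by (subst PS) (rule pcompose_mult)
        ultimately show ?thesis by simp
      qed
      thus ?thesis using \<beta>5(1) unfolding x_def Q_def by blast
    qed
  qed
qed

lemma defect_dominated:
  assumes no_best: "\<And>\<beta>. \<not> best_gen \<beta>" and "x \<noteq> 0"
  obtains \<beta>0 where "\<beta>0 \<in> gens" "\<And>\<beta>. \<beta> \<in> gens \<Longrightarrow> \<beta>0 \<preceq> \<beta> \<Longrightarrow>
    \<exists>Q. K_poly Q \<and> degree Q < p \<and> poly Q \<beta> = x \<and> (\<forall>i\<ge>1. x \<lless> coeff Q i * \<beta> ^ i)"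
proof -
  obtain P where P: "K_poly P" "degree P < p" "x = poly P \<alpha>" using poly_repr[OF \<alpha>_gens] by metis
  have "P \<noteq> 0" using P assms by auto
  obtain \<beta>0 where \<beta>0: "\<beta>0 \<in> gens" "\<And>\<beta> i. \<beta> \<in> gens \<Longrightarrow> \<beta>0 \<preceq> \<beta> \<Longrightarrow> i \<ge> 1 \<Longrightarrow>
      poly P \<alpha> \<lless> coeff (P \<circ>\<^sub>p [:\<alpha> - \<beta>, 1:]) i * \<beta> ^ i"
    using defect_expansion[OF no_best P(1,2) \<open>P \<noteq> 0\<close>] by blast
  show thesis
  proof (rule that[OF \<beta>0(1)])
    fix \<beta> assume \<beta>: "\<beta> \<in> gens" "\<beta>0 \<preceq> \<beta>"
    have "K_poly (P \<circ>\<^sub>p [:\<alpha> - \<beta>, 1:])" using P gens_diff[OF \<alpha>_gens \<beta>(1)] by simp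
    thus "\<exists>Q. K_poly Q \<and> degree Q < p \<and> poly Q \<beta> = x \<and> (\<forall>i\<ge>1. x \<lless> coeff Q i * \<beta> ^ i)"
      using P \<beta>0(2)[OF \<beta>] by (intro exI[of _ "P \<circ>\<^sub>p [:\<alpha> - \<beta>, 1:]"]) (auto simp: degree_pcompose poly_pcompose)
  qed
qed

text \<open>
  The constant term of a dominated expansion approximates \<open>x\<close>.  So without a best generator \<open>L\<close> has the value group and
  the residue field of \<open>K\<close>.
\<close>

lemma defect_immediate:
  assumes "\<And>\<beta>. \<not> best_gen \<beta>" "x \<noteq> 0"
  obtains c where "c \<in> K" "x \<lless> x - c" "x \<preceq> c" "c \<preceq> x" "c \<noteq> 0"
proof -
  obtain \<beta> Q where "\<beta> \<in> gens" "K_poly Q" "poly Q \<beta> = x" "\<forall>i\<ge>1. x \<lless> coeff Q i * \<beta> ^ i"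
    using defect_dominated[OF assms] by (metis vle_refl)
  hence "x \<lless> x - coeff Q 0" "x \<preceq> coeff Q 0" "coeff Q 0 \<preceq> x" "coeff Q 0 \<in> K"
    using const_dominates[OF assms(2), of Q \<beta>] by auto
  thus thesis using that[of "coeff Q 0"] assms(2) by (metis zero_vle)
qed

theorem eventually_expands:
  obtains \<beta>0 where "\<beta>0 \<in> gens" "\<And>\<beta>. \<beta> \<in> gens \<Longrightarrow> \<beta>0 \<preceq> \<beta> \<Longrightarrow> expands \<beta> x"
proof (cases "\<exists>\<beta>. best_gen \<beta>")
  case True
  then obtain \<beta>0 where \<beta>0: "best_gen \<beta>0" by blast
  hence "\<beta>0 \<in> gens" by (simp add: best_gen_def)
  obtain P where P: "K_poly P" "degree P < p" "x = poly P \<beta>0" using poly_repr[OF \<open>\<beta>0 \<in> gens\<close>] by metis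
  have "expands \<beta>0 x" unfolding expands_def using P best_expansion[OF \<beta>0 P(1,2)] by blast
  thus thesis using that[of \<beta>0] expands_mono \<open>\<beta>0 \<in> gens\<close> by blast
next
  case False
  show thesis
  proof (cases "x = 0")
    case True
    show thesis using that[OF \<alpha>_gens] p_pos
      by (simp add: True expands_def) (metis K_poly_0 coeff_0 degree_0 mult_zero_left poly_0 vle_0)
  next
    case x: False
    obtain \<beta>0 where \<beta>0: "\<beta>0 \<in> gens" "\<And>\<beta>. \<beta> \<in> gens \<Longrightarrow> \<beta>0 \<preceq> \<beta> \<Longrightarrow>
      \<exists>Q. K_poly Q \<and> degree Q < p \<and> poly Q \<beta> = x \<and> (\<forall>i\<ge>1. x \<lless> coeff Q i * \<beta> ^ i)"
      using defect_dominated[OF _ x] False by metis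
    show thesis
    proof (rule that[OF \<beta>0(1)])
      fix \<beta> assume "\<beta> \<in> gens" "\<beta>0 \<preceq> \<beta>"
      then obtain Q where Q: "K_poly Q" "degree Q < p" "poly Q \<beta> = x" "\<And>i. i \<ge> 1 \<Longrightarrow> x \<lless> coeff Q i * \<beta> ^ i"
        using \<beta>0(2) by metis
      have "x \<preceq> coeff Q i * \<beta> ^ i" for i
        using const_dominates(2)[OF x Q(3,4)] Q(4)[of i] by (cases "i = 0") (auto intro: vless_imp_vle)
      thus "expands \<beta> x" unfolding expands_def using Q by blast
    qed
  qed
qed

end


section \<open>The ideals and the norm\<close>

context valued_field
begin

lemma vle_power_le_1: "x \<preceq> 1 \<Longrightarrow> i \<le> j \<Longrightarrow> x ^ j \<preceq> x ^ i"
proof -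
  assume "x \<preceq> 1" "i \<le> j"
  hence "x ^ (j - i) * x ^ i \<preceq> 1 ^ (j - i) * x ^ i" by (intro vle_mult vle_power) auto
  thus ?thesis using \<open>i \<le> j\<close> by (simp flip: power_add)
qed

lemma coeff_prod_linear_vle:
  assumes "\<And>j. s \<preceq> a j" "\<And>j. t \<preceq> b j"
  shows "k \<le> n \<Longrightarrow> t ^ k * s ^ (n - k) \<preceq> coeff (\<Prod>j<n. [:a j, b j:]) k"
    and "k > n \<Longrightarrow> coeff (\<Prod>j<n. [:a j, b j:]) k = 0"
proof (induction n arbitrary: k)
  case (Suc n)
  let ?P = "\<Prod>j<n. [:a j, b j:]"
  have "(\<Prod>j<Suc n. [:a j, b j:]) = [:a n, b n:] * ?P" by (simp add: mult.commute)
  hence c: "coeff (\<Prod>j<Suc n. [:a j, b j:]) k = a n * coeff ?P k + (case k of 0 \<Rightarrow> 0 | Suc l \<Rightarrow> b n * coeff ?P l)" for k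
    by (simp add: coeff_pCons split: nat.split)
  {
    case 1
    have "t ^ k * s ^ (Suc n - k) \<preceq> a n * coeff ?P k"
    proof (cases "k \<le> n")
      case True
      have "s * (t ^ k * s ^ (n - k)) \<preceq> a n * coeff ?P k"
        using Suc.IH(1)[OF True] assms by (intro vle_mult) auto
      thus ?thesis using True by (simp add: Suc_diff_le mult_ac)
    qed (use Suc.IH(2) in simp)
    moreover have "t ^ k * s ^ (Suc n - k) \<preceq> (case k of 0 \<Rightarrow> 0 | Suc l \<Rightarrow> b n * coeff ?P l)"
    proof (cases k)
      case (Suc l)
      have "t * (t ^ l * s ^ (n - l)) \<preceq> b n * coeff ?P l"
        using Suc.IH(1)[of l] 1 Suc assms by (intro vle_mult) auto
      thus ?thesis by (simp add: Suc mult_ac)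
    qed simp
    ultimately show ?case unfolding c by (rule vle_add)
  next
    case 2
    thus ?case unfolding c using Suc.IH(2) by (simp split: nat.split)
  }
qed (auto simp: coeff_1)

end

context as_extension
begin

definition trace :: "'a \<Rightarrow> 'a" where
  "trace x = (\<Sum>i<p. (\<sigma> ^^ i) x)"

text \<open>
  The power sums of the prime field: summing \<open>(j + 1)\<^sup>m\<^sup>+\<^sup>1 - j\<^sup>m\<^sup>+\<^sup>1\<close> over \<open>j\<close> gives \<open>0\<close>, and expresses
  \<open>m + 1\<close> times the power sum of exponent \<open>m\<close> by those of smaller exponent.
\<close>

lemma power_sums_prime_field:
  assumes "m < p - 1"
  shows "(\<Sum>j<p. of_nat j ^ m) = (0::'a)"
  using assms
proof (induction m rule: less_induct)
  case (less m)
  define S where "S = (\<lambda>k. \<Sum>j<p. (of_nat j :: 'a) ^ k)"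
  have "(of_nat j + 1) ^ Suc m - of_nat j ^ Suc m = (\<Sum>k\<le>m. of_nat (Suc m choose k) * (of_nat j :: 'a) ^ k)" for j
    by (simp add: binomial_ring del: power_Suc)
  hence "(\<Sum>j<p. (of_nat (Suc j)) ^ Suc m - of_nat j ^ Suc m) =
      (\<Sum>j<p. \<Sum>k\<le>m. of_nat (Suc m choose k) * (of_nat j :: 'a) ^ k)"
    by (simp add: add.commute del: power_Suc)
  also have "\<dots> = (\<Sum>k\<le>m. of_nat (Suc m choose k) * S k)"
    unfolding S_def sum_distrib_left by (rule sum.swap)
  also have "\<dots> = (\<Sum>k\<in>{m}. of_nat (Suc m choose k) * S k)"
    using less by (intro sum.mono_neutral_right) (auto simp: S_def)
  finally have "of_nat (Suc m) * S m = 0"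
    by (simp add: sum_lessThan_telescope[where f = "\<lambda>j. of_nat j ^ Suc m"] del: power_Suc of_nat_Suc)
  moreover have "of_nat (Suc m) \<noteq> (0::'a)" using less.prems by (intro of_nat_neq_0) auto
  ultimately show ?case by (simp add: S_def del: of_nat_Suc)
qed

text \<open>
  The conjugates of \<open>\<beta>\<close> are its translates by the prime field, so the binomial theorem reduces this to the power
  sums.
\<close>

lemma trace_gen_power:
  assumes "\<beta> \<in> gens" "m < p"
  shows "trace (\<beta> ^ m) = (if m = p - 1 then \<Sum>j<p. of_nat j ^ (p - 1) else 0)"
proof -
  define S where "S = (\<lambda>k. \<Sum>j<p. (of_nat j :: 'a) ^ k)"
  have "trace (\<beta> ^ m) = (\<Sum>j<p. (of_nat j + \<beta>) ^ m)"
    using assms by (simp add: trace_def gal_power[OF gal_pow] gens_pow add.commute)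
  also have "\<dots> = (\<Sum>j<p. \<Sum>k\<le>m. of_nat (m choose k) * of_nat j ^ k * \<beta> ^ (m - k))"
    by (simp add: binomial_ring)
  also have "\<dots> = (\<Sum>k\<le>m. of_nat (m choose k) * S k * \<beta> ^ (m - k))"
    by (subst sum.swap) (simp add: S_def sum_distrib_left sum_distrib_right)
  also have "\<dots> = (\<Sum>k\<in>{m}. of_nat (m choose k) * S k * \<beta> ^ (m - k))"
    using assms power_sums_prime_field by (intro sum.mono_neutral_right) (auto simp: S_def)
  finally show ?thesis using power_sums_prime_field[of m] assms by (auto simp: S_def)
qed

lemma trace_K_mult: "c \<in> K \<Longrightarrow> trace (c * x) = c * trace x"
  by (simp add: trace_def gal_mult[OF gal_pow] \<sigma>_pow_fixed sum_distrib_left)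

lemma trace_sum: "trace (sum h I) = (\<Sum>i\<in>I. trace (h i))"
  unfolding trace_def by (simp add: gal_sum[OF gal_pow]) (rule sum.swap)

text \<open>
  The polynomial \<open>G(X) = N (x + z X)\<close> has the derivative \<open>tr (z N (x + z X) / (x + z X))\<close>, taken
  coefficientwise.
\<close>

lemma pderiv_norm_poly:
  assumes "z \<noteq> 0"
  shows "of_nat (Suc k) * coeff (\<Prod>i<p. [:(\<sigma> ^^ i) x, (\<sigma> ^^ i) z:]) (Suc k) =
    trace (z * coeff (\<Prod>i<p - 1. [:(\<sigma> ^^ Suc i) x, (\<sigma> ^^ Suc i) z:]) k)"
proof -
  let ?h = "\<lambda>i. [:(\<sigma> ^^ i) x, (\<sigma> ^^ i) z:]"
  define G where "G = (\<Prod>i<p. ?h i)"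
  define R where "R = (\<Prod>i<p - 1. ?h (Suc i))"
  have hz: "?h i \<noteq> 0" for i using assms gal_eq_0[OF gal_pow] by auto
  have G0: "G = ?h 0 * R"
    using prod.lessThan_Suc_shift[of ?h "p - 1"] p_pos by (simp add: G_def R_def del: funpow.simps)
  have "map_poly \<tau> G = G" if "\<tau> \<in> galois_group K" for \<tau>
    using K_poly_prod_conjugates[of x z] that
    by (intro poly_eqI) (simp add: coeff_map_poly gal_0 gal_K G_def)
  hence inv: "map_poly (\<sigma> ^^ i) G = G" for i using gal_pow by blast
  have rest: "(\<Prod>j\<in>{..<p} - {i}. ?h j) = map_poly (\<sigma> ^^ i) R" if "i < p" for i
  proof -
    have "?h i * (\<Prod>j\<in>{..<p} - {i}. ?h j) = G"
      unfolding G_def using that by (subst (2) prod.remove[of _ i]) auto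
    also have "G = map_poly (\<sigma> ^^ i) (?h 0) * map_poly (\<sigma> ^^ i) R"
      using inv[of i] G0 map_poly_gal_mult[OF gal_pow] by metis
    also have "map_poly (\<sigma> ^^ i) (?h 0) = ?h i" by (simp add: map_poly_pCons gal_0[OF gal_pow])
    finally show ?thesis using hz mult_left_cancel by blast
  qed
  have "pderiv G = (\<Sum>i<p. (\<Prod>j\<in>{..<p} - {i}. ?h j) * [:(\<sigma> ^^ i) z:])"
    unfolding G_def pderiv_prod by (simp add: pderiv_pCons)
  also have "\<dots> = (\<Sum>i<p. map_poly (\<sigma> ^^ i) R * [:(\<sigma> ^^ i) z:])"
    using rest by (intro sum.cong) auto
  finally have "coeff (pderiv G) k = (\<Sum>i<p. (\<sigma> ^^ i) (coeff R k) * (\<sigma> ^^ i) z)"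
    by (simp add: coeff_sum coeff_map_poly gal_0[OF gal_pow] mult.commute)
  also have "\<dots> = trace (z * coeff R k)"
    by (simp add: trace_def gal_mult[OF gal_pow] mult.commute)
  finally show ?thesis by (simp add: coeff_pderiv G_def R_def del: of_nat_Suc funpow.simps)
qed

end

context artin_schreier
begin

text \<open>
  Statements that hold for all generators of sufficiently large value.  When there is a best generator,
  these are the statements that hold for the best generators.
\<close>

definition ev :: "('a \<Rightarrow> bool) \<Rightarrow> bool" where
  "ev Q \<longleftrightarrow> (\<exists>\<beta>0\<in>gens. \<forall>\<beta>\<in>gens. \<beta>0 \<preceq> \<beta> \<longrightarrow> Q \<beta>)"

lemma ev_conj: "ev Q \<Longrightarrow> ev R \<Longrightarrow> ev (\<lambda>\<beta>. Q \<beta> \<and> R \<beta>)"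
proof -
  assume "ev Q" "ev R"
  then obtain \<beta>1 \<beta>2 where *: "\<beta>1 \<in> gens" "\<beta>2 \<in> gens" "\<forall>\<beta>\<in>gens. \<beta>1 \<preceq> \<beta> \<longrightarrow> Q \<beta>" "\<forall>\<beta>\<in>gens. \<beta>2 \<preceq> \<beta> \<longrightarrow> R \<beta>"
    by (auto simp: ev_def)
  show ?thesis
  proof (cases "\<beta>1 \<preceq> \<beta>2")
    case True
    thus ?thesis unfolding ev_def using * vle_trans by (intro bexI[of _ \<beta>2]) blast+
  next
    case False
    hence "\<beta>2 \<preceq> \<beta>1" using vle_total by blast
    thus ?thesis unfolding ev_def using * vle_trans by (intro bexI[of _ \<beta>1]) blast+
  qed
qed

lemma ev_mono: "ev Q \<Longrightarrow> (\<And>\<beta>. \<beta> \<in> gens \<Longrightarrow> Q \<beta> \<Longrightarrow> R \<beta>) \<Longrightarrow> ev R"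
  unfolding ev_def by blast

lemma ev_ex: "ev Q \<Longrightarrow> \<exists>\<beta>\<in>gens. Q \<beta>"
  unfolding ev_def by (metis vle_refl)

lemma ev_const: "Q \<Longrightarrow> ev (\<lambda>_. Q)"
  unfolding ev_def using \<alpha>_gens by blast

lemma ev_finite: "finite I \<Longrightarrow> (\<And>i. i \<in> I \<Longrightarrow> ev (Q i)) \<Longrightarrow> ev (\<lambda>\<beta>. \<forall>i\<in>I. Q i \<beta>)"
proof (induction I rule: finite_induct)
  case (insert x F)
  hence "ev (\<lambda>\<beta>. Q x \<beta> \<and> (\<forall>i\<in>F. Q i \<beta>))" by (intro ev_conj) auto
  thus ?case by simp
qed (simp add: ev_const)

lemma ev_vle: "\<beta>0 \<in> gens \<Longrightarrow> ev (\<lambda>\<beta>. \<beta>0 \<preceq> \<beta>)"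
  unfolding ev_def by blast

lemma ev_expands: "ev (\<lambda>\<beta>. expands \<beta> x)"
  using eventually_expands[of x] unfolding ev_def by metis

lemma gen_power_diff_vle:
  assumes "\<beta> \<in> gens" shows "\<beta> ^ i \<preceq> (\<sigma> (\<beta> ^ i) - \<beta> ^ i) * \<beta>"
proof (induction i)
  case (Suc i)
  have s: "\<sigma> \<beta> = \<beta> + 1" using assms by (simp add: gens_def)
  have e: "\<sigma> (\<beta> ^ Suc i) - \<beta> ^ Suc i = \<sigma> \<beta> * (\<sigma> (\<beta> ^ i) - \<beta> ^ i) + \<beta> ^ i"
    by (simp add: \<sigma>_mult s algebra_simps)
  hence "(\<sigma> (\<beta> ^ Suc i) - \<beta> ^ Suc i) * \<beta> = \<sigma> \<beta> * ((\<sigma> (\<beta> ^ i) - \<beta> ^ i) * \<beta>) + \<beta> ^ Suc i"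
    unfolding e by (simp only: algebra_simps power_Suc)
  moreover have "\<beta> * \<beta> ^ i \<preceq> \<sigma> \<beta> * ((\<sigma> (\<beta> ^ i) - \<beta> ^ i) * \<beta>)"
    using Suc by (intro vle_mult) auto
  ultimately show ?case by (simp add: vle_add)
qed (simp add: \<sigma>_1)

text \<open>
  The constant term is fixed by \<open>\<sigma>\<close>, and on \<open>\<beta>\<^sup>i\<close> the difference \<open>\<sigma> - 1\<close> acts by a factor in \<open>(1 / \<beta>)\<close>.
\<close>

lemma expands_\<sigma>_diff:
  assumes "\<beta> \<in> gens" "expands \<beta> x"
  shows "x \<preceq> (\<sigma> x - x) * \<beta>"
proof -
  obtain P where P: "K_poly P" "x = poly P \<beta>" "\<And>i. x \<preceq> coeff P i * \<beta> ^ i"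
    using assms(2) by (auto simp: expands_def)
  have "\<sigma> x - x = (\<Sum>i\<le>degree P. coeff P i * (\<sigma> (\<beta> ^ i) - \<beta> ^ i))"
    using P(1) by (simp add: P(2) poly_altdef \<sigma>_sum \<sigma>_mult \<sigma>_K algebra_simps flip: sum_subtractf)
  hence "(\<sigma> x - x) * \<beta> = (\<Sum>i\<le>degree P. coeff P i * ((\<sigma> (\<beta> ^ i) - \<beta> ^ i) * \<beta>))"
    by (simp add: sum_distrib_right mult.assoc)
  moreover have "x \<preceq> coeff P i * ((\<sigma> (\<beta> ^ i) - \<beta> ^ i) * \<beta>)" for i
    using P(3)[of i] vle_mult[OF vle_refl gen_power_diff_vle[OF assms(1)]] vle_trans by blast
  ultimately show ?thesis by (simp add: vle_sum)
qed

text \<open>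
  Only the term of degree \<open>p - 1\<close> has a nonzero trace.
\<close>

lemma expands_trace:
  assumes "\<beta> \<in> gens" "expands \<beta> x"
  shows "x \<preceq> trace x * \<beta> ^ (p - 1)"
proof -
  obtain P where P: "K_poly P" "degree P < p" "x = poly P \<beta>" "\<And>i. x \<preceq> coeff P i * \<beta> ^ i"
    using assms(2) by (auto simp: expands_def)
  define c where "c = (\<Sum>j<p. (of_nat j :: 'a) ^ (p - 1))"
  have c: "1 \<preceq> c" unfolding c_def by (intro vle_sum one_vle_power) auto
  have "trace x = (\<Sum>i\<le>degree P. coeff P i * trace (\<beta> ^ i))"
    using P(1) by (simp add: P(3) poly_altdef trace_sum trace_K_mult)
  also have "\<dots> = (\<Sum>i\<le>degree P. if i = p - 1 then coeff P i * c else 0)"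
    using P(2) assms(1) by (intro sum.cong) (auto simp: trace_gen_power c_def)
  also have "\<dots> = coeff P (p - 1) * c"
    by (auto simp: sum.delta coeff_eq_0)
  finally have e: "trace x * \<beta> ^ (p - 1) = c * (coeff P (p - 1) * \<beta> ^ (p - 1))" by (simp add: mult_ac)
  show ?thesis unfolding e by (rule vle_mult_integer[OF P(4) c])
qed

text \<open>
  The mixed terms of \<open>N (x + z)\<close>, collected by their degree \<open>k\<close> in \<open>z\<close>, are traces up to the factor \<open>k\<close>,
  which is a unit.  Therefore they gain the factor \<open>1 / \<beta>\<^sup>p\<^sup>-\<^sup>1\<close>.
\<close>

lemma norm_add:
  obtains E where "galois_norm K (x + z) = galois_norm K x + galois_norm K z + (\<Sum>k\<in>{1..<p}. E k)"
    "ev (\<lambda>\<beta>. \<forall>k\<in>{1..<p}. \<forall>s t. s \<preceq> x \<longrightarrow> t \<preceq> z \<longrightarrow> t ^ k * s ^ (p - k) \<preceq> E k * \<beta> ^ (p - 1))"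
proof (cases "z = 0")
  case True
  have "galois_norm K 0 = 0" using p_pos by (simp add: galois_norm_eq gal_0[OF gal_pow])
  thus thesis using True by (intro that[of "\<lambda>_. 0"]) (simp_all add: ev_const)
next
  case z: False
  obtain q where q: "p = Suc q" using p_pos by (cases p) auto
  define G where "G = (\<Prod>i<p. [:(\<sigma> ^^ i) x, (\<sigma> ^^ i) z:])"
  define R where "R = (\<Prod>i<q. [:(\<sigma> ^^ Suc i) x, (\<sigma> ^^ Suc i) z:])"
  have degG: "degree G = p" and leadG: "lead_coeff G = galois_norm K z"
    using z gal_eq_0[OF gal_pow] lead_coeff_prod[of "\<lambda>i. [:(\<sigma> ^^ i) x, (\<sigma> ^^ i) z:]" "{..<p}"]
    by (simp_all add: G_def degree_prod_sum_eq galois_norm_eq)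
  have "galois_norm K (x + z) = poly G 1"
    by (simp add: galois_norm_eq G_def poly_prod gal_add[OF gal_pow])
  also have "\<dots> = (\<Sum>k\<le>p. coeff G k)" by (simp add: poly_altdef degG)
  also have "{..p} = insert 0 (insert p {1..<p})" using p_pos by auto
  also have "(\<Sum>k\<in>insert 0 (insert p {1..<p}). coeff G k) = coeff G 0 + coeff G p + (\<Sum>k\<in>{1..<p}. coeff G k)"
    using p_pos by (simp add: add.assoc)
  also have "coeff G 0 = galois_norm K x"
    by (simp add: G_def galois_norm_eq poly_prod flip: poly_0_coeff_0)
  also have "coeff G p = galois_norm K z" using leadG degG by simp
  finally have sum: "galois_norm K (x + z) = galois_norm K x + galois_norm K z + (\<Sum>k\<in>{1..<p}. coeff G k)" .
  have "ev (\<lambda>\<beta>. \<forall>k\<in>{..<p}. expands \<beta> (z * coeff R k))"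
    by (intro ev_finite ev_expands) auto
  hence "ev (\<lambda>\<beta>. \<forall>k\<in>{1..<p}. \<forall>s t. s \<preceq> x \<longrightarrow> t \<preceq> z \<longrightarrow> t ^ k * s ^ (p - k) \<preceq> coeff G k * \<beta> ^ (p - 1))"
  proof (rule ev_mono)
    fix \<beta> assume \<beta>: "\<beta> \<in> gens" "\<forall>k\<in>{..<p}. expands \<beta> (z * coeff R k)"
    show "\<forall>k\<in>{1..<p}. \<forall>s t. s \<preceq> x \<longrightarrow> t \<preceq> z \<longrightarrow> t ^ k * s ^ (p - k) \<preceq> coeff G k * \<beta> ^ (p - 1)"
    proof (intro ballI allI impI)
      fix k s t assume k: "k \<in> {1..<p}" and st: "s \<preceq> x" "t \<preceq> z"
      obtain l where l: "k = Suc l" using k by (cases k) auto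
      have "t ^ l * s ^ (q - l) \<preceq> coeff R l"
        unfolding R_def using st k l q by (intro coeff_prod_linear_vle(1)) (auto simp del: funpow.simps)
      hence "t * (t ^ l * s ^ (q - l)) \<preceq> z * coeff R l" using st by (intro vle_mult)
      hence "t ^ k * s ^ (p - k) \<preceq> z * coeff R l" by (simp add: l q mult.assoc)
      also have "\<dots> \<preceq> trace (z * coeff R l) * \<beta> ^ (p - 1)"
        using \<beta> k l by (intro expands_trace) auto
      also have "trace (z * coeff R l) = of_nat k * coeff G k"
        using pderiv_norm_poly[OF z, of l x] unfolding G_def R_def l by (simp add: q del: funpow.simps of_nat_Suc)
      also have "of_nat k * coeff G k * \<beta> ^ (p - 1) \<preceq> coeff G k * \<beta> ^ (p - 1)"
        using k by (intro vle_mult of_nat_mult_vle) auto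
      finally show "t ^ k * s ^ (p - k) \<preceq> coeff G k * \<beta> ^ (p - 1)" .
    qed
  qed
  thus thesis using that[of "coeff G"] sum by blast
qed


subsection \<open>Explicit descriptions of the ideals\<close>

text \<open>
  \<open>J_set n\<close> is the union of the ideals generated by \<open>(1 / \<beta>)\<^sup>n\<close> in the valuation ring of \<open>L\<close>, and
  \<open>H_set n\<close> the union of those generated by \<open>(1 / AS \<beta>)\<^sup>n\<close> in the valuation ring of \<open>K\<close>.
\<close>

definition J_set :: "nat \<Rightarrow> 'a set" where
  "J_set n = {x. \<exists>\<beta>\<in>gens. 1 \<preceq> x * \<beta> ^ n}"

definition H_set :: "nat \<Rightarrow> 'a set" where
  "H_set n = {x \<in> K. \<exists>\<beta>\<in>gens. 1 \<preceq> x * AS \<beta> ^ n}"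

lemma J_set_ev: "x \<in> J_set n \<longleftrightarrow> ev (\<lambda>\<beta>. 1 \<preceq> x * \<beta> ^ n)"
proof
  assume "x \<in> J_set n"
  then obtain \<beta>0 where \<beta>0: "\<beta>0 \<in> gens" "1 \<preceq> x * \<beta>0 ^ n" by (auto simp: J_set_def)
  have "1 \<preceq> x * \<beta> ^ n" if "\<beta>0 \<preceq> \<beta>" for \<beta>
    using \<beta>0(2) vle_mult[OF vle_refl vle_power[OF that]] vle_trans by blast
  thus "ev (\<lambda>\<beta>. 1 \<preceq> x * \<beta> ^ n)" unfolding ev_def using \<beta>0(1) by blast
qed (auto simp: J_set_def dest: ev_ex)

lemma AS_mono: "\<beta> \<in> gens \<Longrightarrow> \<beta>' \<in> gens \<Longrightarrow> \<beta> \<preceq> \<beta>' \<Longrightarrow> AS \<beta> \<preceq> AS \<beta>'"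
  using gens_AS_vle vle_power vle_trans by meson

lemma H_set_ev: "x \<in> H_set n \<longleftrightarrow> x \<in> K \<and> ev (\<lambda>\<beta>. 1 \<preceq> x * AS \<beta> ^ n)"
proof
  assume "x \<in> H_set n"
  then obtain \<beta>0 where \<beta>0: "x \<in> K" "\<beta>0 \<in> gens" "1 \<preceq> x * AS \<beta>0 ^ n" by (auto simp: H_set_def)
  have "1 \<preceq> x * AS \<beta> ^ n" if "\<beta> \<in> gens" "\<beta>0 \<preceq> \<beta>" for \<beta>
    using \<beta>0(3) vle_mult[OF vle_refl vle_power[OF AS_mono[OF \<beta>0(2) that]]] vle_trans by blast
  thus "x \<in> K \<and> ev (\<lambda>\<beta>. 1 \<preceq> x * AS \<beta> ^ n)" unfolding ev_def using \<beta>0(1,2) by blast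
qed (auto simp: H_set_def dest: ev_ex)

lemma gens_AS_vle_1: "\<beta> \<in> gens \<Longrightarrow> AS \<beta> \<preceq> 1"
  using gens_AS_vle(1)[of \<beta>] vle_power[OF gens_vle_1, of \<beta> p] vle_trans by fastforce

lemma J_set_integers: "x \<in> J_set n \<Longrightarrow> 1 \<preceq> x"
proof -
  assume "x \<in> J_set n"
  then obtain \<beta> where \<beta>: "\<beta> \<in> gens" "1 \<preceq> x * \<beta> ^ n" by (auto simp: J_set_def)
  have "x * \<beta> ^ n \<preceq> x * 1 ^ n" by (intro vle_mult vle_power gens_vle_1 \<beta>) auto
  thus ?thesis using \<beta>(2) vle_trans by fastforce
qed

lemma H_set_integers: "x \<in> H_set n \<Longrightarrow> 1 \<preceq> x"
proof -
  assume "x \<in> H_set n"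
  then obtain \<beta> where \<beta>: "\<beta> \<in> gens" "1 \<preceq> x * AS \<beta> ^ n" by (auto simp: H_set_def)
  have "x * AS \<beta> ^ n \<preceq> x * 1 ^ n" by (intro vle_mult vle_power gens_AS_vle_1 \<beta>) auto
  thus ?thesis using \<beta>(2) vle_trans by fastforce
qed

lemma J_set_add: "x \<in> J_set n \<Longrightarrow> y \<in> J_set n \<Longrightarrow> x + y \<in> J_set n"
  unfolding J_set_ev by (drule (1) ev_conj, erule ev_mono) (auto simp: distrib_right intro: vle_add)

lemma J_set_mult: "1 \<preceq> b \<Longrightarrow> x \<in> J_set n \<Longrightarrow> b * x \<in> J_set n"
  unfolding J_set_ev by (erule ev_mono) (auto simp: mult.assoc intro: one_vle_mult)

lemma H_set_add: "x \<in> H_set n \<Longrightarrow> y \<in> H_set n \<Longrightarrow> x + y \<in> H_set n"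
  unfolding H_set_ev using ev_conj[of "\<lambda>\<beta>. 1 \<preceq> x * AS \<beta> ^ n" "\<lambda>\<beta>. 1 \<preceq> y * AS \<beta> ^ n"]
  by (auto simp: distrib_right intro: vle_add elim: ev_mono)

lemma H_set_mult: "b \<in> K \<Longrightarrow> 1 \<preceq> b \<Longrightarrow> x \<in> H_set n \<Longrightarrow> b * x \<in> H_set n"
  unfolding H_set_ev by (auto simp: mult.assoc intro: one_vle_mult elim: ev_mono)

lemma J_set_0: "0 \<in> J_set n" and H_set_0: "0 \<in> H_set n"
  using \<alpha>_gens by (auto simp: J_set_def H_set_def)

lemma J_set_prod: "x \<in> J_set m \<Longrightarrow> y \<in> J_set n \<Longrightarrow> x * y \<in> J_set (m + n)"
  unfolding J_set_ev
proof (drule (1) ev_conj, erule ev_mono, elim conjE)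
  fix \<beta> assume "1 \<preceq> x * \<beta> ^ m" "1 \<preceq> y * \<beta> ^ n"
  from one_vle_mult[OF this] show "1 \<preceq> x * y * \<beta> ^ (m + n)" by (simp add: power_add mult_ac)
qed

lemma H_set_prod: "x \<in> H_set m \<Longrightarrow> y \<in> H_set n \<Longrightarrow> x * y \<in> H_set (m + n)"
proof -
  assume *: "x \<in> H_set m" "y \<in> H_set n"
  hence "ev (\<lambda>\<beta>. 1 \<preceq> x * AS \<beta> ^ m \<and> 1 \<preceq> y * AS \<beta> ^ n)" unfolding H_set_ev by (auto intro: ev_conj)
  hence "ev (\<lambda>\<beta>. 1 \<preceq> x * y * AS \<beta> ^ (m + n))"
  proof (rule ev_mono, elim conjE)
    fix \<beta> assume "1 \<preceq> x * AS \<beta> ^ m" "1 \<preceq> y * AS \<beta> ^ n"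
    from one_vle_mult[OF this] show "1 \<preceq> x * y * AS \<beta> ^ (m + n)" by (simp add: power_add mult_ac)
  qed
  thus ?thesis using * by (auto simp: H_set_ev)
qed

lemma inverse_gen_J: "\<beta> \<in> gens \<Longrightarrow> 1 / \<beta> \<in> J_set 1"
  using gens_nonzero[of \<beta>] by (auto simp: J_set_def intro!: bexI[of _ \<beta>])

lemma inverse_AS_H: "\<beta> \<in> gens \<Longrightarrow> 1 / AS \<beta> \<in> H_set 1"
  using gens_AS_nonzero[of \<beta>] gens_AS[of \<beta>] by (auto simp: H_set_def intro!: bexI[of _ \<beta>])

lemma J_generator: "b \<noteq> 0 \<Longrightarrow> \<sigma> b / b - 1 \<in> J_set 1"
  unfolding J_set_ev
proof (rule ev_mono[OF ev_expands[of b]])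
  fix \<beta> assume "b \<noteq> 0" "\<beta> \<in> gens" "expands \<beta> b"
  hence "b \<preceq> (\<sigma> b - b) * \<beta>" by (intro expands_\<sigma>_diff)
  hence "1 \<preceq> (\<sigma> b - b) * \<beta> / b" using \<open>b \<noteq> 0\<close> by (simp add: vle_divide_right)
  thus "1 \<preceq> (\<sigma> b / b - 1) * \<beta> ^ 1" using \<open>b \<noteq> 0\<close> by (simp add: field_simps)
qed

lemma \<sigma>_diff_J: "1 \<preceq> b \<Longrightarrow> \<sigma> b - b \<in> J_set 1"
proof (cases "b = 0")
  case False
  assume "1 \<preceq> b"
  moreover have "b * (\<sigma> b / b - 1) = \<sigma> b - b" using False by (simp add: field_simps)
  ultimately show ?thesis using J_set_mult[OF _ J_generator[OF False], of b] by simp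
qed (simp add: \<sigma>_0 J_set_0)


subsection \<open>The norm modulo squares\<close>

lemma norm_J_set: "x \<in> J_set n \<Longrightarrow> galois_norm K x \<in> H_set n"
proof -
  assume "x \<in> J_set n"
  then obtain \<beta> where \<beta>: "\<beta> \<in> gens" "1 \<preceq> x * \<beta> ^ n" by (auto simp: J_set_def)
  have "galois_norm K (\<beta> ^ n) = AS \<beta> ^ n"
    using \<beta>(1) by (induction n) (auto simp: norm_mult norm_gens norm_of_K)
  moreover have "1 \<preceq> galois_norm K (x * \<beta> ^ n)"
    using norm_vle(2) vle_power[OF \<beta>(2), of p] vle_trans by fastforce
  ultimately show ?thesis using \<beta>(1) norm_in_K by (auto simp: H_set_def norm_mult)
qed

text \<open>
  For \<open>x \<in> (1 / \<beta>)\<close> and \<open>z \<in> (1 / \<beta>)\<^sup>2\<close>, the mixed term of degree \<open>k\<close> in \<open>z\<close> is divisible by the power of \<open>1 / \<beta>\<close>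
  with exponent \<open>(p - k) + 2 k + (p - 1) \<ge> 2 p\<close>, hence by the square of \<open>1 / AS \<beta>\<close>.
\<close>

lemma norm_congruent:
  assumes x: "x \<in> J_set 1" and z: "z \<in> J_set 2"
  shows "galois_norm K (x + z) - galois_norm K x \<in> H_set 2"
proof -
  obtain E where E: "galois_norm K (x + z) = galois_norm K x + galois_norm K z + (\<Sum>k\<in>{1..<p}. E k)"
    "ev (\<lambda>\<beta>. \<forall>k\<in>{1..<p}. \<forall>s t. s \<preceq> x \<longrightarrow> t \<preceq> z \<longrightarrow> t ^ k * s ^ (p - k) \<preceq> E k * \<beta> ^ (p - 1))"
    by (rule norm_add)
  have "ev (\<lambda>\<beta>. (1 \<preceq> x * \<beta> ^ 1 \<and> 1 \<preceq> z * \<beta> ^ 2) \<and> (\<forall>k\<in>{1..<p}. \<forall>s t. s \<preceq> x \<longrightarrow> t \<preceq> z \<longrightarrow>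
    t ^ k * s ^ (p - k) \<preceq> E k * \<beta> ^ (p - 1)))"
    using x z E(2) by (intro ev_conj) (auto simp: J_set_ev)
  then obtain \<beta> where \<beta>: "\<beta> \<in> gens" "1 \<preceq> x * \<beta>" "1 \<preceq> z * \<beta> ^ 2"
    and bound: "\<And>k s t. k \<in> {1..<p} \<Longrightarrow> s \<preceq> x \<Longrightarrow> t \<preceq> z \<Longrightarrow> t ^ k * s ^ (p - k) \<preceq> E k * \<beta> ^ (p - 1)"
    by (auto dest!: ev_ex)
  have nz: "\<beta> \<noteq> 0" using gens_nonzero \<beta> by blast
  have st: "1 / \<beta> \<preceq> x" "1 / \<beta> ^ 2 \<preceq> z" using \<beta> nz by (simp_all add: vle_divide_left)
  have "1 \<preceq> E k * AS \<beta> ^ 2" if k: "k \<in> {1..<p}" for k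
  proof -
    have "(1 / \<beta> ^ 2) ^ k * (1 / \<beta>) ^ (p - k) = 1 / \<beta> ^ (p + k)"
      using k nz by (simp add: power_divide flip: power_mult power_add) (simp add: algebra_simps)
    hence "1 \<preceq> E k * \<beta> ^ (p - 1) * \<beta> ^ (p + k)"
      using bound[OF k st] nz by (simp add: vle_divide_left)
    also have "E k * \<beta> ^ (p - 1) * \<beta> ^ (p + k) = E k * \<beta> ^ (p - 1 + (p + k))"
      by (simp add: mult.assoc power_add)
    also have "\<dots> \<preceq> E k * \<beta> ^ (p * 2)"
      using k by (intro vle_mult vle_power_le_1 gens_vle_1 \<beta>) auto
    also have "\<dots> \<preceq> E k * AS \<beta> ^ 2"
      unfolding power_mult by (intro vle_mult vle_power gens_AS_vle \<beta>) auto
    finally show ?thesis .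
  qed
  hence "1 \<preceq> (\<Sum>k\<in>{1..<p}. E k) * AS \<beta> ^ 2"
    unfolding sum_distrib_right by (intro vle_sum)
  moreover have "(\<Sum>k\<in>{1..<p}. E k) \<in> K"
  proof -
    have "(\<Sum>k\<in>{1..<p}. E k) = galois_norm K (x + z) - galois_norm K x - galois_norm K z"
      using E(1) by simp
    thus ?thesis using norm_in_K by simp
  qed
  ultimately have "(\<Sum>k\<in>{1..<p}. E k) \<in> H_set 2" using \<beta>(1) by (auto simp: H_set_def)
  moreover have "galois_norm K z \<in> H_set 2" using norm_J_set[OF z] .
  ultimately have "galois_norm K z + (\<Sum>k\<in>{1..<p}. E k) \<in> H_set 2" by (intro H_set_add)
  thus ?thesis using E(1) by simp
qed

text \<open>
  If \<open>z\<close> is not in \<open>J\<^sup>2\<close>, then all \<open>z \<beta>\<^sup>2\<close> have negative values.  This makes the mixed terms negligible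
  against \<open>N z\<close>, so that \<open>N (y + z) - N y\<close> has the value of \<open>z\<^sup>p\<close>, too small for \<open>H\<^sup>2\<close>.
\<close>

lemma norm_injective:
  assumes y: "y \<in> J_set 1" and N: "galois_norm K (y + z) - galois_norm K y \<in> H_set 2"
  shows "z \<in> J_set 2"
proof (rule ccontr)
  assume "z \<notin> J_set 2"
  hence zl: "z * \<beta> ^ 2 \<lless> 1" if "\<beta> \<in> gens" for \<beta> using that by (auto simp: J_set_def not_vle)
  obtain E where E: "galois_norm K (y + z) = galois_norm K y + galois_norm K z + (\<Sum>k\<in>{1..<p}. E k)"
    "ev (\<lambda>\<beta>. \<forall>k\<in>{1..<p}. \<forall>s t. s \<preceq> y \<longrightarrow> t \<preceq> z \<longrightarrow> t ^ k * s ^ (p - k) \<preceq> E k * \<beta> ^ (p - 1))"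
    by (rule norm_add)
  let ?D = "galois_norm K (y + z) - galois_norm K y"
  have "ev (\<lambda>\<beta>. (1 \<preceq> y * \<beta> ^ 1 \<and> 1 \<preceq> ?D * AS \<beta> ^ 2) \<and> (\<forall>k\<in>{1..<p}. \<forall>s t. s \<preceq> y \<longrightarrow> t \<preceq> z \<longrightarrow>
    t ^ k * s ^ (p - k) \<preceq> E k * \<beta> ^ (p - 1)))"
    using y N E(2) by (intro ev_conj) (auto simp: J_set_ev H_set_ev)
  then obtain \<beta> where \<beta>: "\<beta> \<in> gens" "1 \<preceq> y * \<beta>" "1 \<preceq> ?D * AS \<beta> ^ 2"
    and bound: "\<And>k s t. k \<in> {1..<p} \<Longrightarrow> s \<preceq> y \<Longrightarrow> t \<preceq> z \<Longrightarrow> t ^ k * s ^ (p - k) \<preceq> E k * \<beta> ^ (p - 1)"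
    by (auto dest!: ev_ex)
  have nz: "\<beta> \<noteq> 0" using gens_nonzero \<beta> by blast
  have z0: "z \<noteq> 0" using zl[OF \<beta>(1)] by (auto dest: vless_nonzero)
  have "z ^ p \<lless> E k" if k: "k \<in> {1..<p}" for k
  proof -
    have "1 / \<beta> \<preceq> y" using \<beta> nz by (simp add: vle_divide_left)
    hence "z ^ k * (1 / \<beta>) ^ (p - k) \<preceq> E k * \<beta> ^ (p - 1)" by (rule bound[OF k _ vle_refl])
    hence "z ^ k \<preceq> E k * \<beta> ^ (p - 1) * \<beta> ^ (p - k)" using nz by (simp add: power_divide vle_divide_left)
    also have "E k * \<beta> ^ (p - 1) * \<beta> ^ (p - k) = E k * \<beta> ^ (p - 1 + (p - k))"
      by (simp add: mult.assoc power_add)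
    also have "\<dots> \<preceq> E k * \<beta> ^ (2 * (p - k))"
      using k by (intro vle_mult vle_power_le_1 gens_vle_1 \<beta>) auto
    finally have up: "z ^ k \<preceq> E k * \<beta> ^ (2 * (p - k))" .
    have "(z * \<beta> ^ 2) ^ (p - k) \<lless> 1 ^ (p - k)" using k by (intro vless_power zl \<beta>) auto
    hence "z ^ k * (z * \<beta> ^ 2) ^ (p - k) \<lless> z ^ k * 1" using z0 by (intro vless_mult') auto
    moreover have "z ^ k * (z * \<beta> ^ 2) ^ (p - k) = z ^ p * \<beta> ^ (2 * (p - k))"
      using k by (simp add: power_mult_distrib power_mult mult.assoc flip: power_add)
    ultimately have "z ^ p * \<beta> ^ (2 * (p - k)) \<lless> E k * \<beta> ^ (2 * (p - k))"
      using up vless_vle_trans by simp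
    thus ?thesis using nz by simp
  qed
  hence "z ^ p \<lless> (\<Sum>k\<in>{1..<p}. E k)" using z0 by (intro vless_sum) auto
  hence "galois_norm K z \<lless> (\<Sum>k\<in>{1..<p}. E k)" using norm_vle(1) vle_vless_trans by blast
  from dominant_add(2)[OF this] have "?D \<preceq> galois_norm K z" using E(1) by simp
  also have "\<dots> \<preceq> z ^ p" by (rule norm_vle)
  finally have "?D * AS \<beta> ^ 2 \<preceq> z ^ p * (\<beta> ^ p) ^ 2" by (intro vle_mult vle_power gens_AS_vle \<beta>)
  also have "\<dots> = (z * \<beta> ^ 2) ^ p" by (simp add: power_mult_distrib mult.commute flip: power_mult)
  also have "\<dots> \<lless> 1 ^ p" using zl[OF \<beta>(1)] p_pos by (intro vless_power) auto
  finally show False using \<beta>(3) by (simp add: vless_def)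
qed

end


section \<open>Modules, quotients and linear maps\<close>

text \<open>
  The elements of \<^const>\<open>module_hom\<close> without the condition of extensionality: canonical maps satisfy this, and it is
  stable under composition.
\<close>

definition linear_map ::
  "('r, 'c) ring_scheme \<Rightarrow> ('r, 'm) module \<Rightarrow> ('r, 'n) module \<Rightarrow> ('m \<Rightarrow> 'n) \<Rightarrow> bool" where
  "linear_map R M Y h \<longleftrightarrow> (\<forall>x\<in>carrier M. h x \<in> carrier Y) \<and>
     (\<forall>x\<in>carrier M. \<forall>y\<in>carrier M. h (x \<oplus>\<^bsub>M\<^esub> y) = h x \<oplus>\<^bsub>Y\<^esub> h y) \<and>
     (\<forall>r\<in>carrier R. \<forall>x\<in>carrier M. h (r \<odot>\<^bsub>M\<^esub> x) = r \<odot>\<^bsub>Y\<^esub> h x)"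

lemma module_hom_linear: "h \<in> module_hom R M Y \<Longrightarrow> linear_map R M Y h"
  by (auto simp: module_hom_def linear_map_def)

lemma linear_mapD:
  assumes "linear_map R M Y h"
  shows "x \<in> carrier M \<Longrightarrow> h x \<in> carrier Y"
    and "x \<in> carrier M \<Longrightarrow> y \<in> carrier M \<Longrightarrow> h (x \<oplus>\<^bsub>M\<^esub> y) = h x \<oplus>\<^bsub>Y\<^esub> h y"
    and "r \<in> carrier R \<Longrightarrow> x \<in> carrier M \<Longrightarrow> h (r \<odot>\<^bsub>M\<^esub> x) = r \<odot>\<^bsub>Y\<^esub> h x"
  using assms by (auto simp: linear_map_def)

lemma linear_map_zero:
  assumes "module R M" "module R Y" "linear_map R M Y h"
  shows "h \<zero>\<^bsub>M\<^esub> = \<zero>\<^bsub>Y\<^esub>"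
proof -
  interpret M: module R M by fact
  interpret Y: module R Y by fact
  have "h (\<zero>\<^bsub>R\<^esub> \<odot>\<^bsub>M\<^esub> \<zero>\<^bsub>M\<^esub>) = \<zero>\<^bsub>R\<^esub> \<odot>\<^bsub>Y\<^esub> h \<zero>\<^bsub>M\<^esub>"
    by (rule linear_mapD(3)[OF assms(3)]) auto
  moreover have "\<zero>\<^bsub>R\<^esub> \<odot>\<^bsub>Y\<^esub> h \<zero>\<^bsub>M\<^esub> = \<zero>\<^bsub>Y\<^esub>"
    using linear_mapD(1)[OF assms(3), of "\<zero>\<^bsub>M\<^esub>"] by simp
  ultimately show ?thesis by simp
qed

lemma linear_map_uminus:
  assumes "module R M" "module R Y" "linear_map R M Y h" "x \<in> carrier M"
  shows "h (\<ominus>\<^bsub>M\<^esub> x) = \<ominus>\<^bsub>Y\<^esub> h x"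
proof -
  interpret M: module R M by fact
  interpret Y: module R Y by fact
  have "h (\<ominus>\<^bsub>M\<^esub> x) \<oplus>\<^bsub>Y\<^esub> h x = h (\<ominus>\<^bsub>M\<^esub> x \<oplus>\<^bsub>M\<^esub> x)"
    using linear_mapD(2)[OF assms(3)] assms(4) by simp
  also have "\<dots> = \<zero>\<^bsub>Y\<^esub>"
    using assms(4) linear_map_zero[OF assms(1-3)] by (simp add: M.l_neg)
  finally show ?thesis
    using linear_mapD(1)[OF assms(3)] assms(4) by (intro Y.minus_equality[symmetric]) auto
qed

lemma submodule_vimage:
  assumes "module R M" "module R Y" "linear_map R M Y h" "submodule N R Y"
  shows "submodule {x \<in> carrier M. h x \<in> N} R M"
proof -
  interpret M: module R M by fact
  interpret Y: module R Y by fact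
  note E = Y.submoduleE[OF assms(4)]
  have "\<zero>\<^bsub>Y\<^esub> \<in> N" using subgroup.one_closed[OF submodule.axioms(1)[OF assms(4)]] by simp
  thus ?thesis
    using E linear_mapD[OF assms(3)] linear_map_zero[OF assms(1-3)] linear_map_uminus[OF assms(1-3)]
    by (intro M.submoduleI) auto
qed

lemma zero_submodule: "module R M \<Longrightarrow> submodule {\<zero>\<^bsub>M\<^esub>} R M"
proof -
  assume "module R M"
  then interpret M: module R M .
  show ?thesis by (rule M.submoduleI) auto
qed

lemma submodule_gen_incl: "S \<subseteq> submodule_gen R M S"
  by (auto simp: submodule_gen_def)

lemma submodule_gen_min: "submodule N R M \<Longrightarrow> S \<subseteq> N \<Longrightarrow> submodule_gen R M S \<subseteq> N"
  by (auto simp: submodule_gen_def)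

lemma submodule_gen_submodule:
  assumes "module R M" "S \<subseteq> carrier M"
  shows "submodule (submodule_gen R M S) R M"
proof -
  interpret M: module R M by fact
  have "submodule_gen R M S \<subseteq> carrier M"
    using submodule_gen_min[OF M.carrier_is_submodule assms(2)] .
  moreover have "\<zero>\<^bsub>M\<^esub> \<in> N" if "submodule N R M" for N
    using subgroup.one_closed[OF submodule.axioms(1)[OF that]] by simp
  ultimately show ?thesis
    by (intro M.submoduleI) (auto simp: submodule_gen_def M.submoduleE)
qed

locale module_quotient = M: module R M
  for R :: "('r, 'c) ring_scheme" (structure) and M :: "('r, 'm) module" (structure) +
  fixes N assumes sub: "submodule N R M"
begin

abbreviation cls :: "'m \<Rightarrow> 'm set" where
  "cls x \<equiv> N +>\<^bsub>M\<^esub> x"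

abbreviation Q :: "('r, 'm set) module" where
  "Q \<equiv> quot_module M N"

lemma abelian_subgroup: "abelian_subgroup N M"
  using submodule.axioms(1)[OF sub] M.M.abelian_group_axioms
  by (intro abelian_subgroupI3 additive_subgroup.intro) auto

sublocale S: abelian_subgroup N M by (rule abelian_subgroup)

lemma carrier_quot: "carrier Q = cls ` carrier M"
  by (auto simp: quot_module_def A_RCOSETS_def')

lemma zero_quot: "\<zero>\<^bsub>Q\<^esub> = N" by (simp add: quot_module_def)

lemma add_quot: "x \<in> carrier M \<Longrightarrow> y \<in> carrier M \<Longrightarrow> cls x \<oplus>\<^bsub>Q\<^esub> cls y = cls (x \<oplus>\<^bsub>M\<^esub> y)"
  by (simp add: quot_module_def S.a_rcos_sum)

lemma cls_eq_iff: "x \<in> carrier M \<Longrightarrow> y \<in> carrier M \<Longrightarrow> cls x = cls y \<longleftrightarrow> x \<ominus>\<^bsub>M\<^esub> y \<in> N"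
  using S.a_rcos_module[of y x] S.a_repr_independence'[of x y] S.a_rcos_self[of x]
  by (auto simp: a_minus_def)

lemma cls_mem: "x \<in> N \<Longrightarrow> cls x = N"
  by (rule S.a_rcos_const)

lemma cls_eq_zero_iff: "x \<in> carrier M \<Longrightarrow> cls x = N \<longleftrightarrow> x \<in> N"
  using S.a_rcos_self[of x] cls_mem by auto

lemma smult_quot:
  assumes "r \<in> carrier R" "x \<in> carrier M"
  shows "r \<odot>\<^bsub>Q\<^esub> cls x = cls (r \<odot>\<^bsub>M\<^esub> x)"
proof -
  have eq: "cls (r \<odot>\<^bsub>M\<^esub> y) = cls (r \<odot>\<^bsub>M\<^esub> x)" if y: "y \<in> cls x" for y
  proof -
    have yM: "y \<in> carrier M" using y assms S.a_elemrcos_carrier by blast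
    have "y \<ominus>\<^bsub>M\<^esub> x \<in> N" using y assms yM S.a_rcos_module by (simp add: a_minus_def)
    hence "r \<odot>\<^bsub>M\<^esub> (y \<ominus>\<^bsub>M\<^esub> x) \<in> N" using assms sub by (simp add: M.submoduleE(4))
    moreover have "r \<odot>\<^bsub>M\<^esub> (y \<ominus>\<^bsub>M\<^esub> x) = r \<odot>\<^bsub>M\<^esub> y \<ominus>\<^bsub>M\<^esub> r \<odot>\<^bsub>M\<^esub> x"
      using assms yM by (simp add: a_minus_def M.smult_r_distr M.smult_r_minus)
    ultimately show ?thesis using assms yM by (subst cls_eq_iff) auto
  qed
  have "cls x \<noteq> {}" using S.a_rcos_self[OF assms(2)] by (metis empty_iff)
  hence "(\<Union>y\<in>cls x. cls (r \<odot>\<^bsub>M\<^esub> y)) = cls (r \<odot>\<^bsub>M\<^esub> x)"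
    by (rule SUP_eq_const) (rule eq)
  thus ?thesis by (simp add: quot_module_def)
qed

lemma quot_is_module: "module R Q"
proof (rule moduleI)
  show "cring R" by (rule M.R.is_cring)
  show "abelian_group Q"
  proof (rule abelian_groupI)
    fix x y assume "x \<in> carrier Q" "y \<in> carrier Q"
    then obtain x' y' where [simp]: "x = cls x'" "y = cls y'" "x' \<in> carrier M" "y' \<in> carrier M"
      by (auto simp: carrier_quot)
    show "x \<oplus>\<^bsub>Q\<^esub> y \<in> carrier Q" "x \<oplus>\<^bsub>Q\<^esub> y = y \<oplus>\<^bsub>Q\<^esub> x"
      by (auto simp: add_quot carrier_quot M.M.a_comm)
  next
    show "\<zero>\<^bsub>Q\<^esub> \<in> carrier Q" using cls_mem[OF S.zero_closed] by (force simp: zero_quot carrier_quot)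
  next
    fix x y z assume "x \<in> carrier Q" "y \<in> carrier Q" "z \<in> carrier Q"
    then obtain x' y' z' where [simp]: "x = cls x'" "y = cls y'" "z = cls z'"
      "x' \<in> carrier M" "y' \<in> carrier M" "z' \<in> carrier M" by (auto simp: carrier_quot)
    show "x \<oplus>\<^bsub>Q\<^esub> y \<oplus>\<^bsub>Q\<^esub> z = x \<oplus>\<^bsub>Q\<^esub> (y \<oplus>\<^bsub>Q\<^esub> z)" by (simp add: add_quot M.M.a_assoc)
  next
    fix x assume "x \<in> carrier Q"
    then obtain x' where [simp]: "x = cls x'" "x' \<in> carrier M" by (auto simp: carrier_quot)
    have z: "\<zero>\<^bsub>Q\<^esub> = cls \<zero>\<^bsub>M\<^esub>" using cls_mem[OF S.zero_closed] by (simp add: zero_quot)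
    show "\<zero>\<^bsub>Q\<^esub> \<oplus>\<^bsub>Q\<^esub> x = x" by (simp add: z add_quot)
    show "\<exists>y\<in>carrier Q. y \<oplus>\<^bsub>Q\<^esub> x = \<zero>\<^bsub>Q\<^esub>"
      by (rule bexI[of _ "cls (\<ominus>\<^bsub>M\<^esub> x')"]) (auto simp: z add_quot carrier_quot M.M.l_neg)
  qed
qed (auto simp: carrier_quot add_quot smult_quot M.smult_l_distr M.smult_r_distr M.smult_assoc1)

lemma linear_cls: "linear_map R M Q cls"
  by (auto simp: linear_map_def carrier_quot add_quot smult_quot)

text \<open>The homomorphism theorem.\<close>

lemma factor:
  assumes Y: "module R Y" and h: "linear_map R M Y h" and kill: "\<And>x. x \<in> N \<Longrightarrow> h x = \<zero>\<^bsub>Y\<^esub>"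
  obtains g where "g \<in> module_hom R Q Y" "\<And>x. x \<in> carrier M \<Longrightarrow> g (cls x) = h x"
proof -
  interpret Y: module R Y by fact
  note D = linear_mapD[OF h]
  have wd: "h x = h y" if "x \<in> carrier M" "y \<in> carrier M" "cls x = cls y" for x y
  proof -
    have "x \<ominus>\<^bsub>M\<^esub> y \<in> N" using that cls_eq_iff by blast
    hence "h (x \<ominus>\<^bsub>M\<^esub> y) = \<zero>\<^bsub>Y\<^esub>" by (rule kill)
    hence "h x \<ominus>\<^bsub>Y\<^esub> h y = \<zero>\<^bsub>Y\<^esub>"
      using that D linear_map_uminus[OF M.module_axioms Y h] by (simp add: a_minus_def)
    hence "\<ominus>\<^bsub>Y\<^esub> (\<ominus>\<^bsub>Y\<^esub> h y) = h x"
      using D(1)[OF that(1)] D(1)[OF that(2)] by (intro Y.M.minus_equality) (auto simp: a_minus_def)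
    thus ?thesis using D(1)[OF that(2)] by simp
  qed
  define g where "g = (\<lambda>W\<in>carrier Q. h (SOME x. x \<in> carrier M \<and> W = cls x))"
  have g: "g (cls x) = h x" if "x \<in> carrier M" for x
  proof -
    have "\<exists>y. y \<in> carrier M \<and> cls x = cls y" using that by blast
    from someI_ex[OF this] show ?thesis
      unfolding g_def using that by (simp add: carrier_quot) (metis wd)
  qed
  have "g \<in> module_hom R Q Y"
    unfolding module_hom_def using g D
    by (auto simp: carrier_quot add_quot smult_quot) (auto simp: g_def carrier_quot)
  thus thesis using g that by blast
qed

end

lemma module_quotientI: "module R M \<Longrightarrow> submodule N R M \<Longrightarrow> module_quotient R M N"
  by (simp add: module_quotient_def module_quotient_axioms_def)

lemma factor_gen:
  assumes "module R M" "module R Y" "linear_map R M Y h" "S \<subseteq> carrier M" "\<And>x. x \<in> S \<Longrightarrow> h x = \<zero>\<^bsub>Y\<^esub>"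
  obtains g where "g \<in> module_hom R (quot_module M (submodule_gen R M S)) Y"
    "\<And>x. x \<in> carrier M \<Longrightarrow> g (submodule_gen R M S +>\<^bsub>M\<^esub> x) = h x"
proof -
  interpret module_quotient R M "submodule_gen R M S"
    using assms by (intro module_quotientI submodule_gen_submodule)
  have "submodule_gen R M S \<subseteq> {x \<in> carrier M. h x \<in> {\<zero>\<^bsub>Y\<^esub>}}"
    using assms(4,5) by (intro submodule_gen_min[OF submodule_vimage[OF assms(1-3) zero_submodule[OF assms(2)]]]) auto
  thus thesis using factor[OF assms(2,3)] that by blast
qed

lemma ideal_smult_submodule:
  assumes "module R M" "I \<subseteq> carrier R"
  shows "submodule (ideal_smult R I M) R M"
proof -
  interpret module R M by fact
  show ?thesis unfolding ideal_smult_def using assms by (intro submodule_gen_submodule) auto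
qed


subsection \<open>Modules over a subring of a field\<close>

definition is_subring :: "'a::field set \<Rightarrow> bool" where
  "is_subring R \<longleftrightarrow> 1 \<in> R \<and> (\<forall>x\<in>R. \<forall>y\<in>R. x + y \<in> R \<and> x * y \<in> R) \<and> (\<forall>x\<in>R. - x \<in> R)"

lemma is_subringD:
  assumes "is_subring R"
  shows "1 \<in> R" "0 \<in> R" "x \<in> R \<Longrightarrow> y \<in> R \<Longrightarrow> x + y \<in> R" "x \<in> R \<Longrightarrow> y \<in> R \<Longrightarrow> x * y \<in> R" "x \<in> R \<Longrightarrow> - x \<in> R"
    "x \<in> R \<Longrightarrow> y \<in> R \<Longrightarrow> x - y \<in> R" "of_nat n \<in> R"
proof -
  show *: "1 \<in> R" "x \<in> R \<Longrightarrow> y \<in> R \<Longrightarrow> x + y \<in> R" "x \<in> R \<Longrightarrow> y \<in> R \<Longrightarrow> x * y \<in> R" "x \<in> R \<Longrightarrow> - x \<in> R" for x y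
    using assms by (auto simp: is_subring_def)
  show "0 \<in> R" using *(1) *(2)[of 1 "- 1"] *(4)[of 1] by simp
  thus "of_nat n \<in> R" using * by (induction n) auto
  show "x \<in> R \<Longrightarrow> y \<in> R \<Longrightarrow> x - y \<in> R" using *(2)[of x "- y"] *(4)[of y] by simp
qed

lemma ring_on_simps [simp]:
  "carrier (ring_on R) = R" "\<zero>\<^bsub>ring_on R\<^esub> = 0" "\<one>\<^bsub>ring_on R\<^esub> = 1"
  "x \<oplus>\<^bsub>ring_on R\<^esub> y = x + y" "x \<otimes>\<^bsub>ring_on R\<^esub> y = x * y"
  by (simp_all add: ring_on_def ring_of_type_algebra_def)

lemma cring_ring_on: "is_subring R \<Longrightarrow> cring (ring_on R)"
proof (rule cringI)
  assume R: "is_subring R"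
  note D = is_subringD[OF R]
  show "abelian_group (ring_on R)"
    by (rule abelian_groupI) (use D in \<open>auto simp: algebra_simps intro!: bexI[of _ "- x" for x]\<close>)
  show "Group.comm_monoid (ring_on R)"
    by (rule comm_monoidI) (use D in \<open>auto simp: algebra_simps\<close>)
qed (auto simp: algebra_simps)

lemma uminus_ring_on: "is_subring R \<Longrightarrow> x \<in> R \<Longrightarrow> \<ominus>\<^bsub>ring_on R\<^esub> x = - x"
proof -
  assume R: "is_subring R" "x \<in> R"
  then interpret cring "ring_on R" by (intro cring_ring_on)
  show ?thesis using R is_subringD[OF R(1)] by (intro minus_equality) auto
qed

lemma ideal_ring_onI:
  assumes R: "is_subring R" and "Y \<subseteq> R" "0 \<in> Y" "\<And>x y. x \<in> Y \<Longrightarrow> y \<in> Y \<Longrightarrow> x + y \<in> Y"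
    "\<And>b x. b \<in> R \<Longrightarrow> x \<in> Y \<Longrightarrow> b * x \<in> Y"
  shows "ideal Y (ring_on R)"
proof -
  interpret cring "ring_on R" using R by (rule cring_ring_on)
  have comm: "a * x \<in> Y" if "a \<in> Y" "x \<in> R" for a x
    using assms(5)[OF that(2,1)] by (simp add: mult.commute[of a x])
  show ?thesis
  proof (rule idealI)
    show "subgroup Y (add_monoid (ring_on R))"
    proof
      fix x assume x: "x \<in> Y"
      have "inv\<^bsub>add_monoid (ring_on R)\<^esub> x = - x"
        using uminus_ring_on[OF R, of x] assms x by (auto simp: a_inv_def)
      thus "inv\<^bsub>add_monoid (ring_on R)\<^esub> x \<in> Y"
        using assms(5)[of "- 1" x] x is_subringD[OF R] by simp
    qed (use assms in auto)
  qed (use assms comm in \<open>auto simp: ring_axioms\<close>)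
qed

lemma ideal_ring_onD:
  assumes "ideal Y (ring_on R)"
  shows "Y \<subseteq> R" "0 \<in> Y" "x \<in> Y \<Longrightarrow> y \<in> Y \<Longrightarrow> x + y \<in> Y" "b \<in> R \<Longrightarrow> x \<in> Y \<Longrightarrow> b * x \<in> Y"
proof -
  interpret ideal Y "ring_on R" by fact
  show "Y \<subseteq> R" using a_subset by simp
  show "0 \<in> Y" using additive_subgroup.zero_closed[OF ideal.axioms(1)[OF assms]] by simp
  show "x \<in> Y \<Longrightarrow> y \<in> Y \<Longrightarrow> x + y \<in> Y"
    using additive_subgroup.a_closed[OF ideal.axioms(1)[OF assms], of x y] by simp
  show "b \<in> R \<Longrightarrow> x \<in> Y \<Longrightarrow> b * x \<in> Y" using I_l_closed by simp
qed

lemma ideal_module_simps [simp]: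
  "carrier (ideal_module (ring_on R) I) = I" "\<zero>\<^bsub>ideal_module (ring_on R) I\<^esub> = 0"
  "x \<oplus>\<^bsub>ideal_module (ring_on R) I\<^esub> y = x + y" "x \<odot>\<^bsub>ideal_module (ring_on R) I\<^esub> y = x * y"
  by (simp_all add: ideal_module_def)

lemma ideal_module_module:
  assumes R: "is_subring R" and I: "ideal I (ring_on R)"
  shows "module (ring_on R) (ideal_module (ring_on R) I)"
proof (rule moduleI)
  note D = ideal_ring_onD[OF I]
  show "cring (ring_on R)" using R by (rule cring_ring_on)
  have neg: "- x \<in> I" if "x \<in> I" for x using D(4)[of "- 1" x] that is_subringD[OF R] by simp
  show "abelian_group (ideal_module (ring_on R) I)"
    by (rule abelian_groupI) (use D neg in \<open>auto simp: algebra_simps intro!: bexI[of _ "- x" for x]\<close>)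
qed (use ideal_ring_onD[OF I] in \<open>auto simp: algebra_simps\<close>)

lemma uminus_ideal_module:
  assumes R: "is_subring R" and I: "ideal I (ring_on R)" and x: "x \<in> I"
  shows "\<ominus>\<^bsub>ideal_module (ring_on R) I\<^esub> x = - x"
proof -
  interpret module "ring_on R" "ideal_module (ring_on R) I" using R I by (rule ideal_module_module)
  have "- x \<in> I" using ideal_ring_onD(4)[OF I, of "- 1" x] x is_subringD[OF R] by simp
  thus ?thesis using x by (intro M.minus_equality) auto
qed

lemma ideal_submodule:
  assumes R: "is_subring R" and I: "ideal I (ring_on R)" and J: "ideal J (ring_on R)" "J \<subseteq> I"
  shows "submodule J (ring_on R) (ideal_module (ring_on R) I)"
proof -
  interpret module "ring_on R" "ideal_module (ring_on R) I" using R I by (rule ideal_module_module)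
  have "- x \<in> J" if "x \<in> J" for x
    using ideal_ring_onD(4)[OF J(1), of "- 1" x] that is_subringD[OF R] by simp
  thus ?thesis using J ideal_ring_onD[OF J(1)] uminus_ideal_module[OF R I]
    by (intro submoduleI) auto
qed

lemma genideal_eqI:
  assumes R: "is_subring R" and Y: "ideal Y (ring_on R)" and S: "S \<subseteq> Y"
    and min: "\<And>I. ideal I (ring_on R) \<Longrightarrow> S \<subseteq> I \<Longrightarrow> Y \<subseteq> I"
  shows "Idl\<^bsub>ring_on R\<^esub> S = Y"
  unfolding genideal_def using assms by blast

lemma free_module_simps [simp]:
  "c \<in> carrier (free_module R S) \<longleftrightarrow> Poly_Mapping.keys c \<subseteq> S \<and> (\<forall>k. Poly_Mapping.lookup c k \<in> R)"
  "\<zero>\<^bsub>free_module R S\<^esub> = 0" "c \<oplus>\<^bsub>free_module R S\<^esub> c' = c + c'"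
  "r \<odot>\<^bsub>free_module R S\<^esub> c = Poly_Mapping.map ((*) r) c"
  by (auto simp: free_module_def)

lemma lookup_scale [simp]: "Poly_Mapping.lookup (Poly_Mapping.map ((*) r) c) k = r * Poly_Mapping.lookup c k"
  for r :: "'a::field"
  by (simp add: Poly_Mapping.map.rep_eq when_def)

lemma keys_scale: "Poly_Mapping.keys (Poly_Mapping.map ((*) r) c) \<subseteq> Poly_Mapping.keys c"
  for r :: "'a::field"
  by (auto simp: in_keys_iff)

lemma free_module_module:
  assumes R: "is_subring R" shows "module (ring_on R) (free_module R S)"
proof (rule moduleI)
  note D = is_subringD[OF R]
  show "cring (ring_on R)" using R by (rule cring_ring_on)
  show "abelian_group (free_module R S)"
  proof (rule abelian_groupI)
    fix c c' assume "c \<in> carrier (free_module R S)" "c' \<in> carrier (free_module R S)"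
    thus "c \<oplus>\<^bsub>free_module R S\<^esub> c' \<in> carrier (free_module R S)"
      using D keys_add[of c c'] by (auto simp: lookup_add)
  next
    fix c assume "c \<in> carrier (free_module R S)"
    thus "\<exists>c'\<in>carrier (free_module R S). c' \<oplus>\<^bsub>free_module R S\<^esub> c = \<zero>\<^bsub>free_module R S\<^esub>"
      using D by (intro bexI[of _ "- c"]) auto
  qed (use D in \<open>auto simp: ac_simps\<close>)
next
  fix a c assume "a \<in> carrier (ring_on R)" "c \<in> carrier (free_module R S)"
  thus "a \<odot>\<^bsub>free_module R S\<^esub> c \<in> carrier (free_module R S)"
    using is_subringD[OF R] keys_scale[of a c] by auto
qed (simp_all add: poly_mapping_eq_iff fun_eq_iff lookup_add algebra_simps)

lemma single_scale: "Poly_Mapping.single k r = Poly_Mapping.map ((*) r) (Poly_Mapping.single k 1)"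
  for r :: "'a::field"
  by (simp add: poly_mapping_eq_iff fun_eq_iff lookup_single when_def)

lemma free_module_induct [consumes 2, case_names zero single add]:
  assumes R: "is_subring R" and c: "c \<in> carrier (free_module R S)"
    and P0: "P 0" and P1: "\<And>s r. s \<in> S \<Longrightarrow> r \<in> R \<Longrightarrow> P (Poly_Mapping.single s r)"
    and P2: "\<And>c c'. c \<in> carrier (free_module R S) \<Longrightarrow> c' \<in> carrier (free_module R S) \<Longrightarrow> P c \<Longrightarrow> P c' \<Longrightarrow> P (c + c')"
  shows "P c"
proof -
  note D = is_subringD[OF R]
  define h where "h = (\<lambda>k. Poly_Mapping.single k (Poly_Mapping.lookup c k))"
  have "sum h I \<in> carrier (free_module R S) \<and> P (sum h I)" if "finite I" "I \<subseteq> Poly_Mapping.keys c" for I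
    using that
  proof (induction I rule: finite_induct)
    case (insert k I)
    have "h k \<in> carrier (free_module R S)" "P (h k)"
      using insert.prems c D P1 by (auto simp: h_def lookup_single when_def)
    moreover from this have "h k + sum h I \<in> carrier (free_module R S)"
      using insert D keys_add[of "h k" "sum h I"] by (auto simp: lookup_add)
    ultimately show ?case using insert P2 by simp
  qed (use P0 D in auto)
  hence "P (sum h (Poly_Mapping.keys c))" by simp
  moreover have "sum h (Poly_Mapping.keys c) = c"
    by (rule poly_mapping_eqI) (auto simp: h_def lookup_sum lookup_single when_def in_keys_iff sum.delta)
  ultimately show ?thesis by simp
qed

definition lin_ext :: "('x \<Rightarrow> 'a) \<Rightarrow> ('x \<Rightarrow>\<^sub>0 'a) \<Rightarrow> 'a::field" where
  "lin_ext \<psi> c = (\<Sum>k\<in>Poly_Mapping.keys c. Poly_Mapping.lookup c k * \<psi> k)"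

lemma lin_ext_superset:
  "finite I \<Longrightarrow> Poly_Mapping.keys c \<subseteq> I \<Longrightarrow> lin_ext \<psi> c = (\<Sum>k\<in>I. Poly_Mapping.lookup c k * \<psi> k)"
  unfolding lin_ext_def by (rule sum.mono_neutral_left) (auto simp: in_keys_iff)

lemma lin_ext_add: "lin_ext \<psi> (c + c') = lin_ext \<psi> c + lin_ext \<psi> c'"
proof -
  let ?I = "Poly_Mapping.keys c \<union> Poly_Mapping.keys c'"
  have "lin_ext \<psi> (c + c') = (\<Sum>k\<in>?I. Poly_Mapping.lookup (c + c') k * \<psi> k)"
    using keys_add[of c c'] by (intro lin_ext_superset) auto
  moreover have "lin_ext \<psi> c = (\<Sum>k\<in>?I. Poly_Mapping.lookup c k * \<psi> k)"
    "lin_ext \<psi> c' = (\<Sum>k\<in>?I. Poly_Mapping.lookup c' k * \<psi> k)"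
    by (intro lin_ext_superset; auto)+
  ultimately show ?thesis by (simp add: lookup_add algebra_simps sum.distrib)
qed

lemma lin_ext_scale: "lin_ext \<psi> (Poly_Mapping.map ((*) r) c) = r * lin_ext \<psi> c"
proof -
  have "lin_ext \<psi> (Poly_Mapping.map ((*) r) c) =
      (\<Sum>k\<in>Poly_Mapping.keys c. Poly_Mapping.lookup (Poly_Mapping.map ((*) r) c) k * \<psi> k)"
    using keys_scale[of r c] by (intro lin_ext_superset) auto
  thus ?thesis by (simp add: lin_ext_def sum_distrib_left mult.assoc)
qed

lemma lin_ext_single [simp]: "lin_ext \<psi> (Poly_Mapping.single k r) = r * \<psi> k"
  by (simp add: lin_ext_def)

lemma lin_ext_diff: "lin_ext \<psi> (c - c') = lin_ext \<psi> c - lin_ext \<psi> c'"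
  using lin_ext_add[of \<psi> "c - c'" c'] by simp


subsection \<open>Logarithmic derivations\<close>

text \<open>
  Computations with logarithmic differentials use only their defining relations.  They are done here for arbitrary
  maps \<open>d\<close> and \<open>dlog\<close> that satisfy these relations, because they are needed for several quotients of \<open>\<omega>\<close>.
\<close>

locale log_derivation = M: module "ring_on R" M for R :: "'a::field set" and M :: "('a, 'm) module" (structure) +
  fixes d :: "'a \<Rightarrow> 'm" and dl :: "'a \<Rightarrow> 'm"
  assumes subring: "is_subring R"
    and d_closed [simp]: "b \<in> R \<Longrightarrow> d b \<in> carrier M"
    and dl_closed [simp]: "x \<in> fraction_field R \<Longrightarrow> x \<noteq> 0 \<Longrightarrow> dl x \<in> carrier M"
    and d_add: "b \<in> R \<Longrightarrow> c \<in> R \<Longrightarrow> d (b + c) = d b \<oplus>\<^bsub>M\<^esub> d c"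
    and d_mult: "b \<in> R \<Longrightarrow> c \<in> R \<Longrightarrow> d (b * c) = c \<odot>\<^bsub>M\<^esub> d b \<oplus>\<^bsub>M\<^esub> b \<odot>\<^bsub>M\<^esub> d c"
    and dl_mult: "x \<in> fraction_field R \<Longrightarrow> x \<noteq> 0 \<Longrightarrow> y \<in> fraction_field R \<Longrightarrow> y \<noteq> 0 \<Longrightarrow>
      dl (x * y) = dl x \<oplus>\<^bsub>M\<^esub> dl y"
    and dl_d: "b \<in> R \<Longrightarrow> b \<noteq> 0 \<Longrightarrow> b \<odot>\<^bsub>M\<^esub> dl b = d b"
begin

lemmas R_closed [simp] = is_subringD[OF subring]

lemma smult_assoc': "r \<in> R \<Longrightarrow> s \<in> R \<Longrightarrow> m \<in> carrier M \<Longrightarrow> (r * s) \<odot>\<^bsub>M\<^esub> m = r \<odot>\<^bsub>M\<^esub> (s \<odot>\<^bsub>M\<^esub> m)"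
  using M.smult_assoc1[of r s m] by simp

lemma smult_distr': "r \<in> R \<Longrightarrow> s \<in> R \<Longrightarrow> m \<in> carrier M \<Longrightarrow> (r + s) \<odot>\<^bsub>M\<^esub> m = r \<odot>\<^bsub>M\<^esub> m \<oplus>\<^bsub>M\<^esub> s \<odot>\<^bsub>M\<^esub> m"
  using M.smult_l_distr[of r s m] by simp

lemma smult_add': "r \<in> R \<Longrightarrow> m \<in> carrier M \<Longrightarrow> m' \<in> carrier M \<Longrightarrow>
  r \<odot>\<^bsub>M\<^esub> (m \<oplus>\<^bsub>M\<^esub> m') = r \<odot>\<^bsub>M\<^esub> m \<oplus>\<^bsub>M\<^esub> r \<odot>\<^bsub>M\<^esub> m'"
  using M.smult_r_distr[of r m m'] by simp

lemma smult_0' [simp]: "m \<in> carrier M \<Longrightarrow> 0 \<odot>\<^bsub>M\<^esub> m = \<zero>\<^bsub>M\<^esub>"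
  using M.smult_l_null[of m] by simp

lemma smult_1' [simp]: "m \<in> carrier M \<Longrightarrow> 1 \<odot>\<^bsub>M\<^esub> m = m"
  using M.smult_one[of m] by simp

lemma R_fraction: "x \<in> R \<Longrightarrow> x \<in> fraction_field R"
  unfolding fraction_field_def by (intro CollectI exI[of _ x] exI[of _ 1]) auto

lemma fraction_closed:
  assumes "x \<in> fraction_field R" "y \<in> fraction_field R"
  shows "x * y \<in> fraction_field R" "x / y \<in> fraction_field R"
proof -
  obtain a b c e where x: "x = a / b" "a \<in> R" "b \<in> R" "b \<noteq> 0" and y: "y = c / e" "c \<in> R" "e \<in> R" "e \<noteq> 0"
    using assms by (auto simp: fraction_field_def)
  show "x * y \<in> fraction_field R"
    unfolding fraction_field_def using x y by (intro CollectI exI[of _ "a * c"] exI[of _ "b * e"]) auto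
  show "x / y \<in> fraction_field R"
  proof (cases "y = 0")
    case False
    thus ?thesis unfolding fraction_field_def using x y
      by (intro CollectI exI[of _ "a * e"] exI[of _ "b * c"]) auto
  qed (simp add: R_fraction)
qed

lemma d_0 [simp]: "d 0 = \<zero>\<^bsub>M\<^esub>"
  using d_add[of 0 0] M.M.add.r_cancel_one'[of "d 0" "d 0"] by simp

lemma d_1 [simp]: "d 1 = \<zero>\<^bsub>M\<^esub>"
  using d_mult[of 1 1] M.M.add.r_cancel_one'[of "d 1" "d 1"] by simp

lemma d_of_nat [simp]: "d (of_nat n) = \<zero>\<^bsub>M\<^esub>"
  by (induction n) (simp_all add: d_add)

lemma dl_1 [simp]: "dl 1 = \<zero>\<^bsub>M\<^esub>"
  using dl_d[of 1] R_fraction[of 1] by simp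

lemma dl_power: "x \<in> fraction_field R \<Longrightarrow> x \<noteq> 0 \<Longrightarrow> dl (x ^ n) = of_nat n \<odot>\<^bsub>M\<^esub> dl x"
proof (induction n)
  case (Suc n)
  have "x ^ n \<in> fraction_field R"
    using Suc.prems by (induction n) (auto intro: fraction_closed R_fraction)
  thus ?case using Suc by (simp add: dl_mult smult_distr' M.M.a_comm)
qed simp

text \<open>The equation \<open>n dlog n = d n = 0\<close> is divided by the unit \<open>n\<close>.\<close>

lemma dl_of_nat:
  assumes "of_nat n \<noteq> (0::'a)" "1 / of_nat n \<in> R"
  shows "dl (of_nat n) = \<zero>\<^bsub>M\<^esub>"
proof -
  have cl: "dl (of_nat n) \<in> carrier M" using assms by (intro dl_closed R_fraction) auto
  have "dl (of_nat n) = (1 / of_nat n * of_nat n) \<odot>\<^bsub>M\<^esub> dl (of_nat n)" using assms cl by simp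
  also have "\<dots> = 1 / of_nat n \<odot>\<^bsub>M\<^esub> d (of_nat n)"
    using assms cl by (subst smult_assoc') (simp_all add: dl_d)
  finally show ?thesis using assms by simp
qed

text \<open>For \<open>t = x / y\<close> one has \<open>dlog x = dlog t + dlog y\<close> and \<open>t dlog t = d t\<close>.\<close>

lemma smult_dl:
  assumes "x \<in> fraction_field R" "x \<noteq> 0" "y \<in> fraction_field R" "y \<noteq> 0" "x / y \<in> R"
  shows "x / y \<odot>\<^bsub>M\<^esub> dl x = d (x / y) \<oplus>\<^bsub>M\<^esub> x / y \<odot>\<^bsub>M\<^esub> dl y"
proof -
  have f: "x / y \<in> fraction_field R" using assms by (intro R_fraction)
  have "dl x = dl (x / y * y)" using assms by simp
  also have "\<dots> = dl (x / y) \<oplus>\<^bsub>M\<^esub> dl y" using assms f by (intro dl_mult) auto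
  finally have "x / y \<odot>\<^bsub>M\<^esub> dl x = x / y \<odot>\<^bsub>M\<^esub> dl (x / y) \<oplus>\<^bsub>M\<^esub> x / y \<odot>\<^bsub>M\<^esub> dl y"
    using assms f by (simp add: smult_add')
  thus ?thesis using assms f by (simp add: dl_d)
qed

text \<open>
  Used for the quotients \<open>t\<^sub>i\<close> of the terms of a sum \<open>x\<close> by \<open>x\<close> itself, and for \<open>w = dlog x\<close>.  The sum of the \<open>t\<^sub>i\<close> is
  then \<open>1\<close>, and the left side of the conclusion is \<open>dlog x\<close>.
\<close>

lemma sum_d_smult:
  assumes "finite I" "\<And>i. i \<in> I \<Longrightarrow> t i \<in> R" "\<And>i. i \<in> I \<Longrightarrow> r i \<in> R" "m \<in> carrier M" "w \<in> carrier M"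
    and "\<And>i. i \<in> I \<Longrightarrow> d (t i) \<oplus>\<^bsub>M\<^esub> t i \<odot>\<^bsub>M\<^esub> w = r i \<odot>\<^bsub>M\<^esub> m"
  shows "d (sum t I) \<oplus>\<^bsub>M\<^esub> sum t I \<odot>\<^bsub>M\<^esub> w = sum r I \<odot>\<^bsub>M\<^esub> m \<and> sum t I \<in> R \<and> sum r I \<in> R"
  using assms
proof (induction I rule: finite_induct)
  case (insert i I)
  hence IH: "d (sum t I) \<oplus>\<^bsub>M\<^esub> sum t I \<odot>\<^bsub>M\<^esub> w = sum r I \<odot>\<^bsub>M\<^esub> m" "sum t I \<in> R" "sum r I \<in> R" by auto
  have "d (t i + sum t I) \<oplus>\<^bsub>M\<^esub> (t i + sum t I) \<odot>\<^bsub>M\<^esub> w =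
      (d (t i) \<oplus>\<^bsub>M\<^esub> t i \<odot>\<^bsub>M\<^esub> w) \<oplus>\<^bsub>M\<^esub> (d (sum t I) \<oplus>\<^bsub>M\<^esub> sum t I \<odot>\<^bsub>M\<^esub> w)"
    using insert.prems(1-4) IH(2,3) by (simp add: d_add smult_distr' M.M.a_ac)
  also have "\<dots> = r i \<odot>\<^bsub>M\<^esub> m \<oplus>\<^bsub>M\<^esub> sum r I \<odot>\<^bsub>M\<^esub> m"
    unfolding insert.prems(5)[OF insertI1] IH(1) ..
  also have "\<dots> = (r i + sum r I) \<odot>\<^bsub>M\<^esub> m"
    using insert.prems IH by (simp add: smult_distr')
  finally show ?case using insert IH by simp
qed simp

lemma quotient:
  assumes N: "submodule N (ring_on R) M"
  shows "log_derivation R (quot_module M N) (\<lambda>b. N +>\<^bsub>M\<^esub> d b) (\<lambda>x. N +>\<^bsub>M\<^esub> dl x)"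
proof -
  interpret Q: module_quotient "ring_on R" M N
    using M.module_axioms N by (rule module_quotientI)
  note D = linear_mapD[OF Q.linear_cls]
  show ?thesis
  proof (intro log_derivation.intro Q.quot_is_module log_derivation_axioms.intro)
    fix b c assume bc: "b \<in> R" "c \<in> R"
    show "N +>\<^bsub>M\<^esub> d (b + c) = (N +>\<^bsub>M\<^esub> d b) \<oplus>\<^bsub>quot_module M N\<^esub> (N +>\<^bsub>M\<^esub> d c)"
      using bc by (simp add: d_add D)
    show "N +>\<^bsub>M\<^esub> d (b * c) = c \<odot>\<^bsub>quot_module M N\<^esub> (N +>\<^bsub>M\<^esub> d b)
        \<oplus>\<^bsub>quot_module M N\<^esub> b \<odot>\<^bsub>quot_module M N\<^esub> (N +>\<^bsub>M\<^esub> d c)"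
      using bc by (simp add: d_mult D flip: D(3))
  next
    fix b assume b: "b \<in> R" "b \<noteq> 0"
    have "dl b \<in> carrier M" using b by (intro dl_closed R_fraction)
    thus "b \<odot>\<^bsub>quot_module M N\<^esub> (N +>\<^bsub>M\<^esub> dl b) = N +>\<^bsub>M\<^esub> d b"
      using b D(3)[of b "dl b"] by (simp add: dl_d)
  qed (use D subring in \<open>simp_all add: dl_mult\<close>)
qed

end

lemma log_free_module: "is_subring R \<Longrightarrow> module (ring_on R) (log_free R)"
  unfolding log_free_def by (rule free_module_module)

lemma log_free_single:
  assumes "is_subring R" "r \<in> R"
  shows "b \<in> R \<Longrightarrow> Poly_Mapping.single (D b) r \<in> carrier (log_free R)"
    and "x \<in> fraction_field R \<Longrightarrow> x \<noteq> 0 \<Longrightarrow> Poly_Mapping.single (Dlog x) r \<in> carrier (log_free R)"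
  using assms is_subringD[OF assms(1)] by (auto simp: log_free_def lookup_single when_def)

lemma log_free_diff:
  assumes R: "is_subring R" and "c \<in> carrier (log_free R)" "c' \<in> carrier (log_free R)"
  shows "c - c' \<in> carrier (log_free R)"
  using assms is_subringD[OF R] keys_diff[of c c'] by (auto simp: log_free_def lookup_minus)

lemma log_relators_carrier:
  assumes R: "is_subring R" shows "log_relators R \<subseteq> carrier (log_free R)"
proof -
  note D = is_subringD[OF R]
  have fm: "x * y \<in> fraction_field R" if xy: "x \<in> fraction_field R" "y \<in> fraction_field R" for x y
  proof -
    obtain a b c e where "x = a / b" "a \<in> R" "b \<in> R" "b \<noteq> 0" "y = c / e" "c \<in> R" "e \<in> R" "e \<noteq> 0"
      using xy by (auto simp: fraction_field_def)
    thus ?thesis unfolding fraction_field_def using D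
      by (intro CollectI exI[of _ "a * c"] exI[of _ "b * e"]) auto
  qed
  have fr: "x \<in> fraction_field R" if "x \<in> R" for x
    unfolding fraction_field_def using that D by (intro CollectI exI[of _ x] exI[of _ 1]) auto
  show ?thesis unfolding log_relators_def Let_def
    using D by (auto intro!: log_free_diff log_free_single R fm intro: fr)
qed

lemma log_relations_submodule: "is_subring R \<Longrightarrow> submodule (log_relations R) (ring_on R) (log_free R)"
  unfolding log_relations_def by (intro submodule_gen_submodule log_free_module log_relators_carrier)

lemma omega_quotient: "is_subring R \<Longrightarrow> module_quotient (ring_on R) (log_free R) (log_relations R)"
  by (intro module_quotientI log_free_module log_relations_submodule)

lemma omega_module: "is_subring R \<Longrightarrow> module (ring_on R) (omega R)"
  unfolding omega_def by (rule module_quotient.quot_is_module[OF omega_quotient])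

lemma omega_log_derivation:
  assumes R: "is_subring R"
  shows "log_derivation R (omega R) (\<lambda>b. omega_sym R (D b)) (\<lambda>x. omega_sym R (Dlog x))"
proof -
  interpret Q: module_quotient "ring_on R" "log_free R" "log_relations R"
    using R by (rule omega_quotient)
  note L = linear_mapD[OF Q.linear_cls, folded omega_def]
  note S = is_subringD[OF R]
  have add: "c \<oplus>\<^bsub>log_free R\<^esub> c' = c + c'" "r \<odot>\<^bsub>log_free R\<^esub> c = Poly_Mapping.map ((*) r) c" for c c' r
    by (simp_all add: log_free_def)
  have rel: "Q.cls (a + b) = Q.cls b" if "a \<in> log_relators R" "b \<in> carrier (log_free R)" for a b
  proof -
    have a: "a \<in> log_relations R" unfolding log_relations_def by (rule subsetD[OF submodule_gen_incl that(1)])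
    have "a \<in> carrier (log_free R)" by (rule subsetD[OF log_relators_carrier[OF R] that(1)])
    hence "Q.cls (a + b) = Q.cls a \<oplus>\<^bsub>omega R\<^esub> Q.cls b" using L(2)[of a b] that by (simp add: add)
    also have "\<dots> = \<zero>\<^bsub>omega R\<^esub> \<oplus>\<^bsub>omega R\<^esub> Q.cls b"
      using Q.cls_mem[OF a] by (simp add: omega_def Q.zero_quot)
    also have "\<dots> = Q.cls b"
      using abelian_monoid.l_zero[OF abelian_group.axioms(1)[OF module.axioms(2)[OF omega_module[OF R]]]] that L(1)
      by (metis omega_def)
    finally show ?thesis .
  qed
  have scale: "Q.cls (Poly_Mapping.single k r) = r \<odot>\<^bsub>omega R\<^esub> omega_sym R k"
    if "Poly_Mapping.single k 1 \<in> carrier (log_free R)" "r \<in> R" for k r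
    using L(3)[of r "Poly_Mapping.single k 1"] that
    by (subst single_scale) (simp add: omega_sym_def add)
  note single = log_free_single[OF R S(1)] log_free_single[OF R]
  show ?thesis
  proof (intro log_derivation.intro omega_module R log_derivation_axioms.intro)
    fix b c assume bc: "b \<in> R" "c \<in> R"
    let ?s = Poly_Mapping.single
    have "Q.cls (?s (D (b + c)) 1) =
        Q.cls ((?s (D (b + c)) 1 - ?s (D b) 1 - ?s (D c) 1) + (?s (D b) 1 + ?s (D c) 1))" by simp
    also have "\<dots> = Q.cls (?s (D b) 1 + ?s (D c) 1)"
    proof (rule rel)
      show "?s (D (b + c)) 1 - ?s (D b) 1 - ?s (D c) 1 \<in> log_relators R"
        using bc unfolding log_relators_def Let_def by blast
      show "?s (D b) 1 + ?s (D c) 1 \<in> carrier (log_free R)"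
        using Q.M.M.a_closed[OF single(1)[OF bc(1)] single(1)[OF bc(2)]] by (simp add: add)
    qed
    also have "\<dots> = omega_sym R (D b) \<oplus>\<^bsub>omega R\<^esub> omega_sym R (D c)"
      using L(2)[OF single(1)[OF bc(1)] single(1)[OF bc(2)]] by (simp add: add omega_sym_def)
    finally show "omega_sym R (D (b + c)) = omega_sym R (D b) \<oplus>\<^bsub>omega R\<^esub> omega_sym R (D c)"
      by (simp add: omega_sym_def)
    have "Q.cls (?s (D (b * c)) 1) =
        Q.cls ((?s (D (b * c)) 1 - ?s (D b) c - ?s (D c) b) + (?s (D b) c + ?s (D c) b))" by simp
    also have "\<dots> = Q.cls (?s (D b) c + ?s (D c) b)"
    proof (rule rel)
      show "?s (D (b * c)) 1 - ?s (D b) c - ?s (D c) b \<in> log_relators R"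
        using bc unfolding log_relators_def Let_def by blast
      show "?s (D b) c + ?s (D c) b \<in> carrier (log_free R)"
        using Q.M.M.a_closed[OF single(3)[OF bc(2,1)] single(3)[OF bc]] by (simp add: add)
    qed
    also have "\<dots> = Q.cls (?s (D b) c) \<oplus>\<^bsub>omega R\<^esub> Q.cls (?s (D c) b)"
      using L(2)[OF single(3)[OF bc(2,1)] single(3)[OF bc]] by (simp add: add)
    also have "\<dots> = c \<odot>\<^bsub>omega R\<^esub> omega_sym R (D b) \<oplus>\<^bsub>omega R\<^esub> b \<odot>\<^bsub>omega R\<^esub> omega_sym R (D c)"
      using bc single(1) by (simp add: scale)
    finally show "omega_sym R (D (b * c)) =
        c \<odot>\<^bsub>omega R\<^esub> omega_sym R (D b) \<oplus>\<^bsub>omega R\<^esub> b \<odot>\<^bsub>omega R\<^esub> omega_sym R (D c)"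
      by (simp add: omega_sym_def)
  next
    fix x y assume xy: "x \<in> fraction_field R" "x \<noteq> 0" "y \<in> fraction_field R" "y \<noteq> 0"
    let ?s = Poly_Mapping.single
    have "Q.cls (?s (Dlog (x * y)) 1) =
        Q.cls ((?s (Dlog (x * y)) 1 - ?s (Dlog x) 1 - ?s (Dlog y) 1) + (?s (Dlog x) 1 + ?s (Dlog y) 1))" by simp
    also have "\<dots> = Q.cls (?s (Dlog x) 1 + ?s (Dlog y) 1)"
    proof (rule rel)
      show "?s (Dlog (x * y)) 1 - ?s (Dlog x) 1 - ?s (Dlog y) 1 \<in> log_relators R"
        using xy unfolding log_relators_def Let_def by blast
      show "?s (Dlog x) 1 + ?s (Dlog y) 1 \<in> carrier (log_free R)"
        using Q.M.M.a_closed[OF single(2)[OF xy(1,2)] single(2)[OF xy(3,4)]] by (simp add: add)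
    qed
    also have "\<dots> = omega_sym R (Dlog x) \<oplus>\<^bsub>omega R\<^esub> omega_sym R (Dlog y)"
      using L(2)[OF single(2)[OF xy(1,2)] single(2)[OF xy(3,4)]] by (simp add: add omega_sym_def)
    finally show "omega_sym R (Dlog (x * y)) = omega_sym R (Dlog x) \<oplus>\<^bsub>omega R\<^esub> omega_sym R (Dlog y)"
      by (simp add: omega_sym_def)
  next
    fix b assume b: "b \<in> R" "b \<noteq> 0"
    let ?s = Poly_Mapping.single
    have fb: "b \<in> fraction_field R"
      unfolding fraction_field_def using b S by (intro CollectI exI[of _ b] exI[of _ 1]) auto
    have "b \<odot>\<^bsub>omega R\<^esub> omega_sym R (Dlog b) = Q.cls (?s (Dlog b) b)"
      using b single(2)[OF fb] by (simp add: scale)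
    also have "\<dots> = Q.cls ((?s (Dlog b) b - ?s (D b) 1) + ?s (D b) 1)" by simp
    also have "\<dots> = Q.cls (?s (D b) 1)"
    proof (rule rel)
      show "?s (Dlog b) b - ?s (D b) 1 \<in> log_relators R"
        using b unfolding log_relators_def Let_def by blast
    qed (use b single in auto)
    finally show "b \<odot>\<^bsub>omega R\<^esub> omega_sym R (Dlog b) = omega_sym R (D b)" by (simp add: omega_sym_def)
  qed (use L(1) single in \<open>simp_all add: omega_sym_def\<close>)
qed


section \<open>The modules of the diagram\<close>

context artin_schreier
begin

abbreviation A :: "'a set" where "A \<equiv> val_ring v K"
abbreviation MA :: "('a, ('a logsym \<Rightarrow>\<^sub>0 'a) set set) module" where "MA \<equiv> mod_omega_A K v \<sigma>"
abbreviation MB :: "('a, ('a logsym \<Rightarrow>\<^sub>0 'a) set set set) module" where "MB \<equiv> mod_omega_BA K v \<sigma>"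
abbreviation dlA :: "'a \<Rightarrow> ('a logsym \<Rightarrow>\<^sub>0 'a) set set" where "dlA x \<equiv> sym_omega_A K v \<sigma> (Dlog x)"
abbreviation dlB :: "'a \<Rightarrow> ('a logsym \<Rightarrow>\<^sub>0 'a) set set set" where "dlB x \<equiv> sym_omega_BA K v \<sigma> (Dlog x)"

lemma A_subring: "is_subring A"
  by (auto simp: is_subring_def mem_val_ring intro: vle_add one_vle_mult)

lemma B_subring: "is_subring \<O>"
  by (auto simp: is_subring_def mem_integers intro: vle_add one_vle_mult)

lemma fraction_A: "fraction_field A = K"
proof (intro equalityI subsetI)
  fix x assume x: "x \<in> K"
  show "x \<in> fraction_field A"
  proof (cases "1 \<preceq> x")
    case True
    thus ?thesis unfolding fraction_field_def using x
      by (intro CollectI exI[of _ x] exI[of _ 1]) (auto simp: mem_val_ring)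
  next
    case False
    hence "x \<noteq> 0" by auto
    moreover from this False have "1 \<preceq> 1 / x" using vle_total[of 1 x] by (simp add: vle_divide_right)
    ultimately show ?thesis unfolding fraction_field_def using x
      by (intro CollectI exI[of _ 1] exI[of _ "1 / x"]) (auto simp: mem_val_ring)
  qed
qed (auto simp: fraction_field_def mem_val_ring)

lemma fraction_B: "fraction_field \<O> = UNIV"
proof -
  have "x \<in> fraction_field \<O>" for x
  proof (cases "1 \<preceq> x")
    case True
    thus ?thesis unfolding fraction_field_def
      by (intro CollectI exI[of _ x] exI[of _ 1]) (auto simp: mem_integers)
  next
    case False
    hence "x \<noteq> 0" by auto
    moreover from this False have "1 \<preceq> 1 / x" using vle_total[of 1 x] by (simp add: vle_divide_right)
    ultimately show ?thesis unfolding fraction_field_def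
      by (intro CollectI exI[of _ 1] exI[of _ "1 / x"]) (auto simp: mem_integers)
  qed
  thus ?thesis by blast
qed

lemma of_nat_inverse_A: "0 < j \<Longrightarrow> j < p \<Longrightarrow> 1 / of_nat j \<in> A"
  using of_nat_unit[of j] of_nat_neq_0[of j] by (simp add: mem_val_ring vle_divide_right)


subsection \<open>The ideals\<close>

lemma J_set_ideal: "ideal (J_set n) (ring_on \<O>)"
  by (rule ideal_ring_onI[OF B_subring])
    (auto simp: mem_integers J_set_integers J_set_0 J_set_add J_set_mult)

lemma H_set_ideal: "ideal (H_set n) (ring_on A)"
  by (rule ideal_ring_onI[OF A_subring])
    (auto simp: mem_val_ring H_set_integers H_set_0 H_set_add H_set_mult, auto simp: H_set_def)

lemma J_set_eq_mult: "x \<in> J_set n \<Longrightarrow> \<exists>\<beta>\<in>gens. \<exists>b\<in>\<O>. x = b * (1 / \<beta>) ^ n"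
proof -
  assume "x \<in> J_set n"
  then obtain \<beta> where \<beta>: "\<beta> \<in> gens" "1 \<preceq> x * \<beta> ^ n" by (auto simp: J_set_def)
  have "x = (x * \<beta> ^ n) * (1 / \<beta>) ^ n" using gens_nonzero[OF \<beta>(1)] by (simp add: power_divide)
  thus ?thesis using \<beta> mem_integers by blast
qed

lemma H_set_eq_mult: "x \<in> H_set n \<Longrightarrow> \<exists>\<beta>\<in>gens. \<exists>a\<in>A. x = a * (1 / AS \<beta>) ^ n"
proof -
  assume "x \<in> H_set n"
  then obtain \<beta> where \<beta>: "x \<in> K" "\<beta> \<in> gens" "1 \<preceq> x * AS \<beta> ^ n" by (auto simp: H_set_def)
  have "x = (x * AS \<beta> ^ n) * (1 / AS \<beta>) ^ n" using gens_AS_nonzero[OF \<beta>(2)] by (simp add: power_divide)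
  moreover have "x * AS \<beta> ^ n \<in> A" using \<beta> gens_AS by (simp add: mem_val_ring)
  ultimately show ?thesis using \<beta> by blast
qed

lemma ideal_J_eq: "ideal_J K v \<sigma> = J_set 1"
  unfolding ideal_J_def ring_B_eq
proof (rule genideal_eqI[OF B_subring J_set_ideal])
  show "{\<sigma> b / b - 1 |b. b \<noteq> 0} \<subseteq> J_set 1" using J_generator by auto
  fix I assume I: "ideal I (ring_on \<O>)" "{\<sigma> b / b - 1 |b. b \<noteq> 0} \<subseteq> I"
  show "J_set 1 \<subseteq> I"
  proof
    fix x assume "x \<in> J_set 1"
    then obtain \<beta> b where \<beta>: "\<beta> \<in> gens" "b \<in> \<O>" "x = b * (1 / \<beta>)" using J_set_eq_mult[of x 1] by auto
    have "1 / \<beta> = \<sigma> \<beta> / \<beta> - 1" using \<beta>(1) gens_nonzero[OF \<beta>(1)] by (simp add: gens_def add_divide_distrib)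
    hence "1 / \<beta> \<in> I" using I(2) gens_nonzero[OF \<beta>(1)] by blast
    thus "x \<in> I" using ideal_ring_onD(4)[OF I(1)] \<beta> by blast
  qed
qed

lemma ideal_H_eq: "ideal_H K v = H_set 1"
  unfolding ideal_H_def
proof (rule genideal_eqI[OF A_subring H_set_ideal])
  show "{1 / g |g. g \<in> as_elements K} \<subseteq> H_set 1"
  proof clarify
    fix g assume "g \<in> as_elements K"
    then obtain \<beta> where "AS \<beta> = g" "generates K \<beta>" "g \<in> K" by (auto simp: as_elements_def)
    then obtain j where j: "0 < j" "j < p" "\<beta> / of_nat j \<in> gens" "AS (\<beta> / of_nat j) = g / of_nat j"
      using as_solution_scaled by metis
    have "1 / of_nat j * (1 / AS (\<beta> / of_nat j)) \<in> H_set 1"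
      using of_nat_inverse_A[OF j(1,2)] by (intro H_set_mult inverse_AS_H j) (auto simp: mem_val_ring)
    thus "1 / g \<in> H_set 1" using of_nat_neq_0[OF j(1,2)] by (simp add: j(4))
  qed
  fix I assume I: "ideal I (ring_on A)" "{1 / g |g. g \<in> as_elements K} \<subseteq> I"
  show "H_set 1 \<subseteq> I"
  proof
    fix x assume "x \<in> H_set 1"
    then obtain \<beta> a where \<beta>: "\<beta> \<in> gens" "a \<in> A" "x = a * (1 / AS \<beta>)" using H_set_eq_mult[of x 1] by auto
    have "AS \<beta> \<in> as_elements K" using as_class_eq \<beta>(1) by (auto simp: as_class_def)
    hence "1 / AS \<beta> \<in> I" using I(2) by blast
    thus "x \<in> I" using ideal_ring_onD(4)[OF I(1)] \<beta> by blast
  qed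
qed

lemma J_square: "J_set 1 \<cdot>\<^bsub>ring_on \<O>\<^esub> J_set 1 = J_set 2"
proof (intro equalityI subsetI)
  fix x assume "x \<in> J_set 1 \<cdot>\<^bsub>ring_on \<O>\<^esub> J_set 1"
  thus "x \<in> J_set 2"
  proof induction
    case (prod i j)
    thus ?case using J_set_prod[of i 1 j 1] by (simp add: numeral_2_eq_2)
  qed (simp add: J_set_add)
next
  fix x assume "x \<in> J_set 2"
  then obtain \<beta> b where \<beta>: "\<beta> \<in> gens" "b \<in> \<O>" "x = b * (1 / \<beta>) ^ 2" using J_set_eq_mult[of x 2] by auto
  have "b * (1 / \<beta>) \<in> J_set 1" using \<beta> by (intro J_set_mult inverse_gen_J) (auto simp: mem_integers)
  from ideal_prod.prod[of _ _ _ _ "ring_on \<O>", OF this inverse_gen_J[OF \<beta>(1)]]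
  show "x \<in> J_set 1 \<cdot>\<^bsub>ring_on \<O>\<^esub> J_set 1" by (simp add: \<beta>(3) power2_eq_square)
qed

lemma H_square: "H_set 1 \<cdot>\<^bsub>ring_on A\<^esub> H_set 1 = H_set 2"
proof (intro equalityI subsetI)
  fix x assume "x \<in> H_set 1 \<cdot>\<^bsub>ring_on A\<^esub> H_set 1"
  thus "x \<in> H_set 2"
  proof induction
    case (prod i j)
    thus ?case using H_set_prod[of i 1 j 1] by (simp add: numeral_2_eq_2)
  qed (simp add: H_set_add)
next
  fix x assume "x \<in> H_set 2"
  then obtain \<beta> b where \<beta>: "\<beta> \<in> gens" "b \<in> A" "x = b * (1 / AS \<beta>) ^ 2" using H_set_eq_mult[of x 2] by auto
  have "b * (1 / AS \<beta>) \<in> H_set 1" using \<beta> by (intro H_set_mult inverse_AS_H) (auto simp: mem_val_ring)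
  from ideal_prod.prod[of _ _ _ _ "ring_on A", OF this inverse_AS_H[OF \<beta>(1)]]
  show "x \<in> H_set 1 \<cdot>\<^bsub>ring_on A\<^esub> H_set 1" by (simp add: \<beta>(3) power2_eq_square)
qed

lemma J_set_2_subset: "J_set 2 \<subseteq> J_set 1"
proof
  fix x assume "x \<in> J_set 2"
  then obtain \<beta> where \<beta>: "\<beta> \<in> gens" "1 \<preceq> x * \<beta> ^ 2" by (auto simp: J_set_def)
  have "x * \<beta> ^ 2 \<preceq> x * \<beta> ^ 1" by (intro vle_mult vle_power_le_1 gens_vle_1 \<beta>) auto
  thus "x \<in> J_set 1" using \<beta> vle_trans unfolding J_set_def by blast
qed

lemma H_set_2_subset: "H_set 2 \<subseteq> H_set 1"
proof
  fix x assume "x \<in> H_set 2"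
  then obtain \<beta> where \<beta>: "x \<in> K" "\<beta> \<in> gens" "1 \<preceq> x * AS \<beta> ^ 2" by (auto simp: H_set_def)
  have "x * AS \<beta> ^ 2 \<preceq> x * AS \<beta> ^ 1" by (intro vle_mult vle_power_le_1 gens_AS_vle_1 \<beta>) auto
  thus "x \<in> H_set 1" using \<beta> vle_trans unfolding H_set_def by blast
qed

text \<open>Since \<open>\<sigma> (c \<beta>) - c \<beta> = c\<close> for \<open>c\<close> in \<open>K\<close>, the ideal \<open>I\<close> contains the \<open>c\<close> with \<open>c \<beta>\<close> integral.\<close>

lemma ideal_I_mem:
  assumes "\<beta> \<in> gens" "c \<in> K" "1 \<preceq> c * \<beta>"
  shows "c \<in> ideal_I K v \<sigma> \<inter> A"
proof
  interpret cring "ring_on \<O>" using B_subring by (rule cring_ring_on)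
  have "\<sigma> (c * \<beta>) - c * \<beta> = c" using assms by (simp add: \<sigma>_mult \<sigma>_K gens_def algebra_simps)
  hence "c \<in> {\<sigma> b - b |b. b \<in> \<O>}" using assms(3) mem_integers by force
  moreover have "{\<sigma> b - b |b. b \<in> \<O>} \<subseteq> carrier (ring_on \<O>)"
    by (auto simp: mem_integers intro!: vle_diff)
  ultimately show "c \<in> ideal_I K v \<sigma>" unfolding ideal_I_def ring_B_eq using genideal_self by blast
  have "c * \<beta> \<preceq> c * 1" by (intro vle_mult gens_vle_1 assms) auto
  thus "c \<in> A" using assms vle_trans by (auto simp: mem_val_ring)
qed


subsection \<open>The quotients of the ideals by their squares\<close>

lemma mod_J_eq: "mod_J K v \<sigma> = quot_module (ideal_module (ring_on \<O>) (J_set 1)) (J_set 2)"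
  by (simp add: mod_J_def Let_def ideal_J_eq[simplified] ring_B_eq J_square[simplified])

lemma cls_J_eq: "cls_J K v \<sigma> x = J_set 2 +>\<^bsub>ideal_module (ring_on \<O>) (J_set 1)\<^esub> x"
  by (simp add: cls_J_def Let_def ideal_J_eq[simplified] ring_B_eq J_square[simplified])

lemma mod_H_eq: "mod_H K v = quot_module (ideal_module (ring_on A) (H_set 1)) (H_set 2)"
  by (simp add: mod_H_def Let_def ideal_H_eq[simplified] H_square[simplified])

lemma cls_H_eq: "cls_H K v x = H_set 2 +>\<^bsub>ideal_module (ring_on A) (H_set 1)\<^esub> x"
  by (simp add: cls_H_def Let_def ideal_H_eq[simplified] H_square[simplified])

lemma quotient_J: "module_quotient (ring_on \<O>) (ideal_module (ring_on \<O>) (J_set 1)) (J_set 2)"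
  by (intro module_quotientI ideal_module_module ideal_submodule B_subring J_set_ideal J_set_2_subset)

lemma quotient_H: "module_quotient (ring_on A) (ideal_module (ring_on A) (H_set 1)) (H_set 2)"
  by (intro module_quotientI ideal_module_module ideal_submodule A_subring H_set_ideal H_set_2_subset)

lemma mod_J_module: "module (ring_on \<O>) (mod_J K v \<sigma>)"
  unfolding mod_J_eq by (rule module_quotient.quot_is_module[OF quotient_J])

lemma linear_cls_J: "linear_map (ring_on \<O>) (ideal_module (ring_on \<O>) (J_set 1)) (mod_J K v \<sigma>) (cls_J K v \<sigma>)"
  using module_quotient.linear_cls[OF quotient_J] unfolding mod_J_eq by (simp add: linear_map_def cls_J_eq)

lemma linear_cls_H: "linear_map (ring_on A) (ideal_module (ring_on A) (H_set 1)) (mod_H K v) (cls_H K v)"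
  using module_quotient.linear_cls[OF quotient_H] unfolding mod_H_eq by (simp add: linear_map_def cls_H_eq)

lemma carrier_mod_J: "carrier (mod_J K v \<sigma>) = cls_J K v \<sigma> ` J_set 1"
  using module_quotient.carrier_quot[OF quotient_J] unfolding mod_J_eq by (simp add: cls_J_eq)

lemma carrier_mod_H: "carrier (mod_H K v) = cls_H K v ` H_set 1"
  using module_quotient.carrier_quot[OF quotient_H] unfolding mod_H_eq by (simp add: cls_H_eq)

lemma cls_J_eq_iff: "x \<in> J_set 1 \<Longrightarrow> y \<in> J_set 1 \<Longrightarrow> cls_J K v \<sigma> x = cls_J K v \<sigma> y \<longleftrightarrow> x - y \<in> J_set 2"
  using module_quotient.cls_eq_iff[OF quotient_J, of x y] uminus_ideal_module[OF B_subring J_set_ideal, of y 1]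
  by (simp add: cls_J_eq a_minus_def)

lemma cls_H_eq_iff: "x \<in> H_set 1 \<Longrightarrow> y \<in> H_set 1 \<Longrightarrow> cls_H K v x = cls_H K v y \<longleftrightarrow> x - y \<in> H_set 2"
  using module_quotient.cls_eq_iff[OF quotient_H, of x y] uminus_ideal_module[OF A_subring H_set_ideal, of y 1]
  by (simp add: cls_H_eq a_minus_def)

lemma cls_J_zero_iff: "x \<in> J_set 1 \<Longrightarrow> cls_J K v \<sigma> x = \<zero>\<^bsub>mod_J K v \<sigma>\<^esub> \<longleftrightarrow> x \<in> J_set 2"
  using module_quotient.cls_eq_zero_iff[OF quotient_J, of x] module_quotient.zero_quot[OF quotient_J]
  by (simp add: cls_J_eq mod_J_eq)

lemma cls_J_smult: "b \<in> \<O> \<Longrightarrow> x \<in> J_set 1 \<Longrightarrow> b \<odot>\<^bsub>mod_J K v \<sigma>\<^esub> cls_J K v \<sigma> x = cls_J K v \<sigma> (b * x)"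
  using linear_mapD(3)[OF linear_cls_J, of b x] by simp

lemma cls_H_smult: "a \<in> A \<Longrightarrow> x \<in> H_set 1 \<Longrightarrow> a \<odot>\<^bsub>mod_H K v\<^esub> cls_H K v x = cls_H K v (a * x)"
  using linear_mapD(3)[OF linear_cls_H, of a x] by simp


subsection \<open>The modules of differentials\<close>

lemma smult_ideal_zero:
  assumes "module (ring_on R) M" "I \<subseteq> R" "a \<in> I" "w \<in> carrier (quot_module M (ideal_smult (ring_on R) I M))"
  shows "a \<odot>\<^bsub>quot_module M (ideal_smult (ring_on R) I M)\<^esub> w =
    \<zero>\<^bsub>quot_module M (ideal_smult (ring_on R) I M)\<^esub>"
proof -
  interpret module_quotient "ring_on R" M "ideal_smult (ring_on R) I M"
    using assms by (intro module_quotientI ideal_smult_submodule) auto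
  obtain m where m: "m \<in> carrier M" "w = cls m" using assms(4) by (auto simp: carrier_quot)
  have "a \<odot>\<^bsub>M\<^esub> m \<in> {a \<odot>\<^bsub>M\<^esub> m |a m. a \<in> I \<and> m \<in> carrier M}" using assms m by blast
  hence "a \<odot>\<^bsub>M\<^esub> m \<in> ideal_smult (ring_on R) I M"
    unfolding ideal_smult_def by (rule subsetD[OF submodule_gen_incl])
  thus ?thesis using m assms by (subst m(2), subst smult_quot) (auto simp: cls_mem zero_quot)
qed

lemma log_derivation_MA:
  "log_derivation A MA (\<lambda>b. sym_omega_A K v \<sigma> (D b)) (\<lambda>x. dlA x)"
  unfolding mod_omega_A_def sym_omega_A_def sub_omega_A_def
  by (intro log_derivation.quotient[OF omega_log_derivation[OF A_subring]] ideal_smult_submodule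
      omega_module A_subring) auto

lemma I_smult_MA:
  assumes "\<beta> \<in> gens" "c \<in> K" "1 \<preceq> c * \<beta>" "w \<in> carrier MA"
  shows "c \<odot>\<^bsub>MA\<^esub> w = \<zero>\<^bsub>MA\<^esub>"
  using smult_ideal_zero[OF omega_module[OF A_subring] _ ideal_I_mem[OF assms(1-3)], of w] assms(4)
  by (simp add: mod_omega_A_def sub_omega_A_def)

lemma log_free_mono: "carrier (log_free A) \<subseteq> carrier (log_free \<O>)"
proof -
  have AO: "A \<subseteq> \<O>" by (auto simp: mem_val_ring mem_integers)
  show ?thesis
  proof
    fix c assume "c \<in> carrier (log_free A)"
    hence c: "Poly_Mapping.keys c \<subseteq> D ` A \<union> Dlog ` (K - {0})" "\<forall>k. Poly_Mapping.lookup c k \<in> A"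
      by (simp_all add: log_free_def fraction_A)
    moreover have "D ` A \<union> Dlog ` (K - {0}) \<subseteq> D ` \<O> \<union> Dlog ` (UNIV - {0})" using AO by blast
    ultimately have "Poly_Mapping.keys c \<subseteq> D ` \<O> \<union> Dlog ` (UNIV - {0})" by (rule_tac subset_trans)
    moreover have "\<forall>k. Poly_Mapping.lookup c k \<in> \<O>" using c(2) AO by blast
    ultimately show "c \<in> carrier (log_free \<O>)" by (simp add: log_free_def fraction_B)
  qed
qed

lemma log_relations_mono: "log_relations A \<subseteq> log_relations \<O>"
proof -
  have AO: "A \<subseteq> \<O>" by (auto simp: mem_val_ring mem_integers)
  note MO = log_relations_submodule[OF B_subring]
  interpret MB: module "ring_on \<O>" "log_free \<O>" using B_subring by (rule log_free_module)
  interpret MA: module "ring_on A" "log_free A" using A_subring by (rule log_free_module)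
  have uminus: "\<ominus>\<^bsub>log_free A\<^esub> c = - c" if "c \<in> carrier (log_free A)" for c
    using that is_subringD[OF A_subring] by (intro MA.M.minus_equality) (auto simp: log_free_def)
  have uminus': "\<ominus>\<^bsub>log_free \<O>\<^esub> c = - c" if "c \<in> carrier (log_free \<O>)" for c
    using that is_subringD[OF B_subring] by (intro MB.M.minus_equality) (auto simp: log_free_def)
  have op: "c \<oplus>\<^bsub>log_free R\<^esub> c' = c + c'" "r \<odot>\<^bsub>log_free R\<^esub> c = Poly_Mapping.map ((*) r) c"
    "\<zero>\<^bsub>log_free R\<^esub> = 0" for c c' r and R :: "'a set"
    by (simp_all add: log_free_def)
  note E = MB.submoduleE[OF MO]
  have "submodule (log_relations \<O> \<inter> carrier (log_free A)) (ring_on A) (log_free A)"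
  proof (rule MA.submoduleI)
    have "0 \<in> log_relations \<O>" using subgroup.one_closed[OF submodule.axioms(1)[OF MO]] by (simp add: op)
    thus "\<zero>\<^bsub>log_free A\<^esub> \<in> log_relations \<O> \<inter> carrier (log_free A)" using MA.M.zero_closed by (simp add: op)
  next
    fix c assume "c \<in> log_relations \<O> \<inter> carrier (log_free A)"
    thus "\<ominus>\<^bsub>log_free A\<^esub> c \<in> log_relations \<O> \<inter> carrier (log_free A)"
      using E(3)[of c] MA.M.a_inv_closed[of c] uminus[of c] uminus'[of c] log_free_mono by auto
  next
    fix c c' assume "c \<in> log_relations \<O> \<inter> carrier (log_free A)" "c' \<in> log_relations \<O> \<inter> carrier (log_free A)"
    thus "c \<oplus>\<^bsub>log_free A\<^esub> c' \<in> log_relations \<O> \<inter> carrier (log_free A)"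
      using E(5)[of c c'] MA.M.a_closed[of c c'] by (simp add: op)
  next
    fix a c assume "a \<in> carrier (ring_on A)" "c \<in> log_relations \<O> \<inter> carrier (log_free A)"
    thus "a \<odot>\<^bsub>log_free A\<^esub> c \<in> log_relations \<O> \<inter> carrier (log_free A)"
      using E(4)[of a c] MA.smult_closed[of a c] AO by (auto simp: op)
  qed auto
  moreover have "log_relators A \<subseteq> log_relations \<O>"
  proof -
    have "log_relators A \<subseteq> log_relators \<O>"
      unfolding log_relators_def Let_def fraction_A fraction_B
      by (intro Un_mono Collect_mono) (use AO in blast)+
    from subset_trans[OF this submodule_gen_incl] show ?thesis unfolding log_relations_def[of \<O>] .
  qed
  ultimately have "log_relations A \<subseteq> log_relations \<O> \<inter> carrier (log_free A)"
    unfolding log_relations_def[of A]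
    by (intro submodule_gen_min) (use log_relators_carrier[OF A_subring] in auto)
  thus ?thesis by blast
qed

lemma omega_map_cls:
  "omega_map A \<O> (log_relations A +>\<^bsub>log_free A\<^esub> c) = log_relations \<O> +>\<^bsub>log_free \<O>\<^esub> c"
proof -
  note MO = log_relations_submodule[OF B_subring]
  interpret MB: module "ring_on \<O>" "log_free \<O>" using B_subring by (rule log_free_module)
  have op: "c \<oplus>\<^bsub>log_free R\<^esub> c' = c + c'" "\<zero>\<^bsub>log_free R\<^esub> = 0" for c c' and R :: "'a set"
    by (simp_all add: log_free_def)
  have add: "r + s \<in> log_relations \<O>" if "r \<in> log_relations \<O>" "s \<in> log_relations \<O>" for r s
    using MB.submoduleE(5)[OF MO that] by (simp add: op)
  have 0: "0 \<in> log_relations A"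
    using subgroup.one_closed[OF submodule.axioms(1)[OF log_relations_submodule[OF A_subring]]] by (simp add: op)
  show ?thesis
    unfolding omega_map_def set_add_defs a_r_coset_def'
    using 0 add log_relations_mono by (auto simp: op add.assoc[symmetric] r_coset_def)
qed

lemma omega_image_gen:
  "omega_image A \<O> = submodule_gen (ring_on \<O>) (omega \<O>) ((\<lambda>c. log_relations \<O> +>\<^bsub>log_free \<O>\<^esub> c) ` carrier (log_free A))"
proof -
  have "carrier (omega A) = (\<lambda>c. log_relations A +>\<^bsub>log_free A\<^esub> c) ` carrier (log_free A)"
    unfolding omega_def by (rule module_quotient.carrier_quot[OF omega_quotient[OF A_subring]])
  thus ?thesis unfolding omega_image_def by (simp add: image_image omega_map_cls)
qed

lemma omega_image_gen_carrier:
  "(\<lambda>c. log_relations \<O> +>\<^bsub>log_free \<O>\<^esub> c) ` carrier (log_free A) \<subseteq> carrier (omega \<O>)"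
  using log_free_mono module_quotient.carrier_quot[OF omega_quotient[OF B_subring]]
  unfolding omega_def by auto

lemma omega_image_submodule: "submodule (omega_image A \<O>) (ring_on \<O>) (omega \<O>)"
  unfolding omega_image_gen by (intro submodule_gen_submodule omega_module B_subring omega_image_gen_carrier)

lemma quotient_rel: "module_quotient (ring_on \<O>) (omega \<O>) (omega_image A \<O>)"
  by (intro module_quotientI omega_module B_subring omega_image_submodule)

lemma omega_rel_module: "module (ring_on \<O>) (omega_rel A \<O>)"
  unfolding omega_rel_def by (rule module_quotient.quot_is_module[OF quotient_rel])

lemma sub_omega_BA_eq: "sub_omega_BA K v \<sigma> = ideal_smult (ring_on \<O>) (J_set 1) (omega_rel A \<O>)"
  by (simp add: sub_omega_BA_def ideal_J_eq[simplified] ring_B_eq)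

lemma MB_eq: "MB = quot_module (omega_rel A \<O>) (ideal_smult (ring_on \<O>) (J_set 1) (omega_rel A \<O>))"
  by (simp add: mod_omega_BA_def sub_omega_BA_eq ring_B_eq)

lemma J_subset: "J_set n \<subseteq> \<O>"
  using J_set_integers by (auto simp: mem_integers)

lemma quotient_MB:
  "module_quotient (ring_on \<O>) (omega_rel A \<O>) (ideal_smult (ring_on \<O>) (J_set 1) (omega_rel A \<O>))"
  using J_subset by (intro module_quotientI omega_rel_module ideal_smult_submodule) auto

text \<open>
  The canonical map from the formal combinations of symbols to the last of three successive quotients: by the
  relations, by the image of \<open>\<omega>\<^sub>A\<close>, and by \<open>J \<omega>\<^sub>B\<^sub>|\<^sub>A\<close>.
\<close>

definition classBA :: "('a logsym \<Rightarrow>\<^sub>0 'a) \<Rightarrow> ('a logsym \<Rightarrow>\<^sub>0 'a) set set set" where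
  "classBA c = ideal_smult (ring_on \<O>) (J_set 1) (omega_rel A \<O>) +>\<^bsub>omega_rel A \<O>\<^esub>
     (omega_image A \<O> +>\<^bsub>omega \<O>\<^esub> (log_relations \<O> +>\<^bsub>log_free \<O>\<^esub> c))"

lemma sym_omega_BA_eq: "sym_omega_BA K v \<sigma> s = classBA (Poly_Mapping.single s 1)"
  by (simp add: sym_omega_BA_def omega_rel_sym_def omega_sym_def sub_omega_BA_eq classBA_def ring_B_eq)

lemma linear_comp:
  "linear_map R M Y h \<Longrightarrow> linear_map R Y Z k \<Longrightarrow> linear_map R M Z (\<lambda>x. k (h x))"
  by (simp add: linear_map_def)

lemma linear_classBA: "linear_map (ring_on \<O>) (log_free \<O>) MB classBA"
  using linear_comp[OF linear_comp[OF module_quotient.linear_cls[OF omega_quotient[OF B_subring], folded omega_def]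
      module_quotient.linear_cls[OF quotient_rel, folded omega_rel_def]] module_quotient.linear_cls[OF quotient_MB]]
  by (simp add: MB_eq classBA_def[abs_def])

lemma carrier_MB: "carrier MB = classBA ` carrier (log_free \<O>)"
proof -
  have "carrier (omega \<O>) = (\<lambda>c. log_relations \<O> +>\<^bsub>log_free \<O>\<^esub> c) ` carrier (log_free \<O>)"
    unfolding omega_def by (rule module_quotient.carrier_quot[OF omega_quotient[OF B_subring]])
  moreover have "carrier (omega_rel A \<O>) = (\<lambda>c. omega_image A \<O> +>\<^bsub>omega \<O>\<^esub> c) ` carrier (omega \<O>)"
    unfolding omega_rel_def by (rule module_quotient.carrier_quot[OF quotient_rel])
  ultimately show ?thesis
    unfolding MB_eq module_quotient.carrier_quot[OF quotient_MB] by (simp add: image_image classBA_def)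
qed

lemma log_derivation_MB:
  "log_derivation \<O> MB (\<lambda>b. sym_omega_BA K v \<sigma> (D b)) (\<lambda>x. dlB x)"
  using log_derivation.quotient[OF log_derivation.quotient[OF omega_log_derivation[OF B_subring]
        omega_image_submodule], folded omega_rel_def, OF ideal_smult_submodule[OF omega_rel_module, of "J_set 1"]]
    J_subset
  by (simp add: MB_eq sym_omega_BA_eq classBA_def omega_sym_def)

lemma J_smult_MB: "a \<in> J_set 1 \<Longrightarrow> w \<in> carrier MB \<Longrightarrow> a \<odot>\<^bsub>MB\<^esub> w = \<zero>\<^bsub>MB\<^esub>"
  using smult_ideal_zero[OF omega_rel_module J_subset, of a 1 w] unfolding MB_eq by blast

lemma classBA_A_zero: "c \<in> carrier (log_free A) \<Longrightarrow> classBA c = \<zero>\<^bsub>MB\<^esub>"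
proof -
  assume c: "c \<in> carrier (log_free A)"
  have "log_relations \<O> +>\<^bsub>log_free \<O>\<^esub> c \<in> omega_image A \<O>"
    unfolding omega_image_gen by (rule subsetD[OF submodule_gen_incl]) (use c in blast)
  hence "omega_image A \<O> +>\<^bsub>omega \<O>\<^esub> (log_relations \<O> +>\<^bsub>log_free \<O>\<^esub> c) = \<zero>\<^bsub>omega_rel A \<O>\<^esub>"
    using module_quotient.cls_mem[OF quotient_rel] module_quotient.zero_quot[OF quotient_rel]
    by (simp add: omega_rel_def)
  thus ?thesis
    using linear_map_zero[OF omega_rel_module _ module_quotient.linear_cls[OF quotient_MB]]
      module_quotient.quot_is_module[OF quotient_MB]
    by (simp add: classBA_def MB_eq)
qed

lemma dlB_K_zero: "x \<in> K \<Longrightarrow> x \<noteq> 0 \<Longrightarrow> dlB x = \<zero>\<^bsub>MB\<^esub>"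
  unfolding sym_omega_BA_eq
  by (intro classBA_A_zero log_free_single(2)[OF A_subring]) (auto simp: fraction_A mem_val_ring)

end


section \<open>The maps of the diagram\<close>

context artin_schreier
begin

interpretation LA: log_derivation A MA "\<lambda>b. sym_omega_A K v \<sigma> (D b)" "\<lambda>x. dlA x"
  by (rule log_derivation_MA)

interpretation LB: log_derivation \<O> MB "\<lambda>b. sym_omega_BA K v \<sigma> (D b)" "\<lambda>x. dlB x"
  by (rule log_derivation_MB)

lemma dlA_closed: "x \<in> K \<Longrightarrow> x \<noteq> 0 \<Longrightarrow> dlA x \<in> carrier MA"
  by (rule LA.dl_closed) (simp_all add: fraction_A)

lemma dlB_closed: "x \<noteq> 0 \<Longrightarrow> dlB x \<in> carrier MB"
  by (rule LB.dl_closed) (simp_all add: fraction_B)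

lemma dlA_gens_closed: "\<beta> \<in> gens \<Longrightarrow> dlA (AS \<beta>) \<in> carrier MA"
  by (intro dlA_closed gens_AS gens_AS_nonzero)


subsection \<open>The refined Swan conductor\<close>

text \<open>
  For \<open>g = AS \<beta>'\<close> and \<open>h = AS \<beta>\<close> with \<open>\<beta> = \<beta>' + c\<close> one has \<open>h = g + c\<^sup>p - c\<close>, hence
  \<open>h dlog h = g dlog g - c dlog c\<close>, where \<open>c\<^sup>p dlog c\<^sup>p\<close> vanishes because of the factor \<open>p\<close>.  After
  division by \<open>h\<close> the last term has the coefficient \<open>c / h\<close>, which lies in the ideal \<open>I\<close>.
\<close>

lemma dlA_gens:
  assumes "\<beta> \<in> gens" "\<beta>' \<in> gens" "\<beta> \<preceq> \<beta>'"
  shows "AS \<beta>' / AS \<beta> \<in> A" "dlA (AS \<beta>) = (AS \<beta>' / AS \<beta>) \<odot>\<^bsub>MA\<^esub> dlA (AS \<beta>')"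
proof -
  define h g c where "h = AS \<beta>" and "g = AS \<beta>'" and "c = \<beta> - \<beta>'"
  have hg: "h \<in> K" "h \<noteq> 0" "g \<in> K" "g \<noteq> 0"
    using assms gens_AS gens_AS_nonzero by (auto simp: h_def g_def)
  have c: "c \<in> K" "\<beta> \<preceq> c" using gens_diff[OF assms(1,2)] assms(3) by (auto simp: c_def intro: vle_diff)
  have h: "h = g + c ^ p + (- c)"
    using AS_add[of \<beta>' c] AS_eq[of c] by (simp add: h_def g_def c_def)
  have t0: "g / h \<in> A"
    using AS_mono[OF assms] hg by (simp add: mem_val_ring vle_divide_right h_def g_def)
  thus "AS \<beta>' / AS \<beta> \<in> A" by (simp add: h_def g_def)
  have h\<beta>: "h \<preceq> \<beta> ^ p" using gens_AS_vle(1)[OF assms(1)] by (simp add: h_def)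
  show "dlA (AS \<beta>) = (AS \<beta>' / AS \<beta>) \<odot>\<^bsub>MA\<^esub> dlA (AS \<beta>')"
  proof (cases "c = 0")
    case True
    hence "h = g" using h p_pos by simp
    thus ?thesis using hg dlA_gens_closed[OF assms(1)] by (simp add: h_def g_def)
  next
    case False
    have t1: "c ^ p / h \<in> A"
      using h\<beta> vle_power[OF c(2), of p] hg c vle_trans by (auto simp: mem_val_ring vle_divide_right)
    have "h \<preceq> \<beta> ^ 2" using h\<beta> vle_power_le_1[OF gens_vle_1[OF assms(1)] p_ge_2] vle_trans by blast
    also have "\<beta> ^ 2 \<preceq> (- c) * \<beta>" using c by (simp add: power2_eq_square vle_mult)
    finally have t2\<beta>: "1 \<preceq> (- c / h) * \<beta>" using hg by (simp add: vle_divide_right)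
    have t2K: "- c / h \<in> K" using c hg by simp
    have t2: "- c / h \<in> A" using ideal_I_mem[OF assms(1) t2K t2\<beta>] by blast
    define t where "t = (\<lambda>i::nat. if i = 0 then g / h else if i = 1 then c ^ p / h else - c / h)"
    define r where "r = (\<lambda>i::nat. if i = 0 then g / h else 0)"
    note frac = fraction_A
    have wcl: "dlA h \<in> carrier MA" "dlA g \<in> carrier MA" "dlA c \<in> carrier MA" "dlA (- c) \<in> carrier MA"
      "dlA (c ^ p) \<in> carrier MA"
      using hg c False by (auto intro!: dlA_closed)
    have "dlA (c ^ p) = of_nat p \<odot>\<^bsub>MA\<^esub> dlA c" using c False by (intro LA.dl_power) (auto simp: frac)
    hence p0: "dlA (c ^ p) = \<zero>\<^bsub>MA\<^esub>" using wcl(3) by simp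
    have "sym_omega_A K v \<sigma> (D (t i)) \<oplus>\<^bsub>MA\<^esub> t i \<odot>\<^bsub>MA\<^esub> dlA h = r i \<odot>\<^bsub>MA\<^esub> dlA g" if i012: "i \<in> {0,1,2}" for i
    proof -
      consider "i = 0" | "i = 1" | "i = 2" using i012 by auto
      thus ?thesis
      proof cases
        case 1
        thus ?thesis using LA.smult_dl[of g h] hg t0 by (simp add: t_def r_def frac)
      next
        case 2
        thus ?thesis using LA.smult_dl[of "c ^ p" h] hg c t1 False p0 wcl by (simp add: t_def r_def frac)
      next
        case 3
        thus ?thesis using LA.smult_dl[of "- c" h] hg c t2 False wcl I_smult_MA[OF assms(1) t2K t2\<beta> wcl(4)]
          by (simp add: t_def r_def frac)
      qed
    qed
    moreover have "t i \<in> A" "r i \<in> A" for i using t0 t1 t2 by (auto simp: t_def r_def)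
    ultimately have "sym_omega_A K v \<sigma> (D (sum t {0,1,2})) \<oplus>\<^bsub>MA\<^esub> sum t {0,1,2} \<odot>\<^bsub>MA\<^esub> dlA h
        = sum r {0,1,2} \<odot>\<^bsub>MA\<^esub> dlA g"
      using LA.sum_d_smult[of "{0,1,2}" t r "dlA g" "dlA h"] wcl by blast
    moreover have "sum t {0,1,2} = 1"
    proof -
      have "sum t {0,1,2} = (g + c ^ p + (- c)) / h" by (simp add: t_def add_divide_distrib diff_divide_distrib)
      thus ?thesis using h hg by simp
    qed
    moreover have "sum r {0,1,2} = g / h" by (simp add: r_def)
    ultimately show ?thesis using wcl by (simp add: h_def g_def)
  qed
qed

text \<open>
  The values at the generators \<open>1 / AS \<beta>\<close> of \<open>H\<close> are prescribed.  The choice of \<open>\<beta>\<close> does not matter, because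
  the prescribed values are compatible by \<open>dlA_gens\<close>.
\<close>

definition rsw_fun :: "'a \<Rightarrow> ('a logsym \<Rightarrow>\<^sub>0 'a) set set" where
  "rsw_fun x = (let \<beta> = (SOME \<beta>. \<beta> \<in> gens \<and> 1 \<preceq> x * AS \<beta>) in (x * AS \<beta>) \<odot>\<^bsub>MA\<^esub> dlA (AS \<beta>))"

lemma rsw_fun_eq:
  assumes "x \<in> K" "\<beta> \<in> gens" "1 \<preceq> x * AS \<beta>"
  shows "rsw_fun x = (x * AS \<beta>) \<odot>\<^bsub>MA\<^esub> dlA (AS \<beta>)"
proof -
  have *: "(x * AS \<beta>) \<odot>\<^bsub>MA\<^esub> dlA (AS \<beta>) = (x * AS \<beta>') \<odot>\<^bsub>MA\<^esub> dlA (AS \<beta>')"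
    if \<beta>: "\<beta> \<in> gens" "\<beta>' \<in> gens" "1 \<preceq> x * AS \<beta>" "\<beta> \<preceq> \<beta>'" for \<beta> \<beta>'
  proof -
    have "x * AS \<beta> \<in> A" using \<beta> assms(1) gens_AS by (simp add: mem_val_ring)
    hence "(x * AS \<beta>) \<odot>\<^bsub>MA\<^esub> ((AS \<beta>' / AS \<beta>) \<odot>\<^bsub>MA\<^esub> dlA (AS \<beta>')) =
        (x * AS \<beta> * (AS \<beta>' / AS \<beta>)) \<odot>\<^bsub>MA\<^esub> dlA (AS \<beta>')"
      using dlA_gens(1)[OF \<beta>(1,2,4)] dlA_gens_closed[OF \<beta>(2)] by (intro LA.smult_assoc'[symmetric])
    moreover have "x * AS \<beta> * (AS \<beta>' / AS \<beta>) = x * AS \<beta>'" using gens_AS_nonzero[OF \<beta>(1)] by simp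
    ultimately show ?thesis using dlA_gens(2)[OF \<beta>(1,2,4)] by simp
  qed
  define \<beta>' where "\<beta>' = (SOME \<beta>. \<beta> \<in> gens \<and> 1 \<preceq> x * AS \<beta>)"
  have \<beta>': "\<beta>' \<in> gens" "1 \<preceq> x * AS \<beta>'"
    using someI[of "\<lambda>\<beta>. \<beta> \<in> gens \<and> 1 \<preceq> x * AS \<beta>" \<beta>] assms by (auto simp: \<beta>'_def)
  have "(x * AS \<beta>') \<odot>\<^bsub>MA\<^esub> dlA (AS \<beta>') = (x * AS \<beta>) \<odot>\<^bsub>MA\<^esub> dlA (AS \<beta>)"
    using *[OF assms(2) \<beta>'(1) assms(3)] *[OF \<beta>'(1) assms(2) \<beta>'(2)] vle_total[of \<beta> \<beta>'] by auto
  thus ?thesis by (simp add: rsw_fun_def Let_def \<beta>'_def)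
qed

lemma rsw_fun_ev: "x \<in> H_set 1 \<Longrightarrow>
  ev (\<lambda>\<beta>. x * AS \<beta> \<in> A \<and> rsw_fun x = (x * AS \<beta>) \<odot>\<^bsub>MA\<^esub> dlA (AS \<beta>))"
  unfolding H_set_ev by (auto elim!: ev_mono simp: rsw_fun_eq mem_val_ring gens_AS)

lemma linear_rsw_fun: "linear_map (ring_on A) (ideal_module (ring_on A) (H_set 1)) MA rsw_fun"
  unfolding linear_map_def
proof (intro conjI ballI)
  fix x assume "x \<in> carrier (ideal_module (ring_on A) (H_set 1))"
  hence x: "x \<in> H_set 1" by simp
  show "rsw_fun x \<in> carrier MA" using ev_ex[OF rsw_fun_ev[OF x]] dlA_gens_closed by auto
  {
    fix y assume "y \<in> carrier (ideal_module (ring_on A) (H_set 1))"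
    hence y: "y \<in> H_set 1" by simp
    have "ev (\<lambda>\<beta>. (x * AS \<beta> \<in> A \<and> rsw_fun x = (x * AS \<beta>) \<odot>\<^bsub>MA\<^esub> dlA (AS \<beta>)) \<and>
        (y * AS \<beta> \<in> A \<and> rsw_fun y = (y * AS \<beta>) \<odot>\<^bsub>MA\<^esub> dlA (AS \<beta>)))"
      by (intro ev_conj rsw_fun_ev x y)
    then obtain \<beta> where \<beta>: "\<beta> \<in> gens" "x * AS \<beta> \<in> A" "rsw_fun x = (x * AS \<beta>) \<odot>\<^bsub>MA\<^esub> dlA (AS \<beta>)"
      "y * AS \<beta> \<in> A" "rsw_fun y = (y * AS \<beta>) \<odot>\<^bsub>MA\<^esub> dlA (AS \<beta>)" by (auto dest!: ev_ex)
    have "(x + y) * AS \<beta> \<in> A" using LA.R_closed(3)[OF \<beta>(2,4)] by (simp add: distrib_right)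
    hence "rsw_fun (x + y) = ((x + y) * AS \<beta>) \<odot>\<^bsub>MA\<^esub> dlA (AS \<beta>)"
      using x y \<beta>(1) by (intro rsw_fun_eq) (auto simp: H_set_def mem_val_ring)
    thus "rsw_fun (x \<oplus>\<^bsub>ideal_module (ring_on A) (H_set 1)\<^esub> y) = rsw_fun x \<oplus>\<^bsub>MA\<^esub> rsw_fun y"
      using \<beta> dlA_gens_closed by (simp add: distrib_right LA.smult_distr')
  }
  fix a assume "a \<in> carrier (ring_on A)"
  hence a: "a \<in> A" by simp
  obtain \<beta> where \<beta>: "\<beta> \<in> gens" "x * AS \<beta> \<in> A" "rsw_fun x = (x * AS \<beta>) \<odot>\<^bsub>MA\<^esub> dlA (AS \<beta>)"
    using ev_ex[OF rsw_fun_ev[OF x]] by blast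
  have "a * x * AS \<beta> \<in> A" using LA.R_closed(4)[OF a \<beta>(2)] by (simp add: mult.assoc)
  hence "rsw_fun (a * x) = (a * x * AS \<beta>) \<odot>\<^bsub>MA\<^esub> dlA (AS \<beta>)"
    using x a \<beta>(1) by (intro rsw_fun_eq) (auto simp: H_set_def mem_val_ring)
  thus "rsw_fun (a \<odot>\<^bsub>ideal_module (ring_on A) (H_set 1)\<^esub> x) = a \<odot>\<^bsub>MA\<^esub> rsw_fun x"
    using \<beta> a dlA_gens_closed by (simp add: mult.assoc LA.smult_assoc')
qed

text \<open>
  The coefficient \<open>x AS \<beta>\<close> lies in \<open>(1 / AS \<beta>)\<close>, hence in \<open>(1 / \<beta>) \<inter> A\<close>, which is contained in \<open>I\<close>.
\<close>

lemma rsw_fun_square: "x \<in> H_set 2 \<Longrightarrow> rsw_fun x = \<zero>\<^bsub>MA\<^esub>"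
proof -
  assume x: "x \<in> H_set 2"
  then obtain \<beta> where \<beta>: "x \<in> K" "\<beta> \<in> gens" "1 \<preceq> x * AS \<beta> ^ 2" by (auto simp: H_set_def)
  have "x * AS \<beta> ^ 2 \<preceq> x * AS \<beta> ^ 1" by (intro vle_mult vle_power_le_1 gens_AS_vle_1 \<beta>) auto
  hence x1: "1 \<preceq> x * AS \<beta>" using vle_trans[OF \<beta>(3)] by simp
  have "AS \<beta> \<preceq> \<beta> ^ p" by (rule gens_AS_vle(1)[OF \<beta>(2)])
  also have "\<beta> ^ p \<preceq> \<beta> ^ 1" using p_pos by (intro vle_power_le_1[OF gens_vle_1[OF \<beta>(2)]]) auto
  finally have "AS \<beta> \<preceq> \<beta>" by simp
  hence "x * AS \<beta> ^ 2 \<preceq> x * AS \<beta> * \<beta>"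
    unfolding power2_eq_square mult.assoc by (intro vle_mult) auto
  hence "1 \<preceq> x * AS \<beta> * \<beta>" using \<beta>(3) vle_trans by blast
  hence "(x * AS \<beta>) \<odot>\<^bsub>MA\<^esub> dlA (AS \<beta>) = \<zero>\<^bsub>MA\<^esub>"
    using \<beta> gens_AS by (intro I_smult_MA[OF \<beta>(2)] dlA_gens_closed) auto
  thus ?thesis using rsw_fun_eq[OF \<beta>(1,2) x1] by simp
qed

lemma is_rsw_smult:
  assumes "is_rsw K v \<sigma> (AS \<alpha>) rsw" "\<beta> \<in> gens" "a \<in> A"
  shows "rsw (cls_H K v (a * (1 / AS \<beta>))) = a \<odot>\<^bsub>MA\<^esub> dlA (AS \<beta>)"
proof -
  have lin: "linear_map (ring_on A) (mod_H K v) MA rsw"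
    using assms(1) by (auto simp: is_rsw_def intro: module_hom_linear)
  have cl: "cls_H K v (1 / AS \<beta>) \<in> carrier (mod_H K v)"
    using inverse_AS_H[OF assms(2)] by (simp add: carrier_mod_H)
  have "rsw (cls_H K v (a * (1 / AS \<beta>))) = rsw (a \<odot>\<^bsub>mod_H K v\<^esub> cls_H K v (1 / AS \<beta>))"
    by (subst cls_H_smult[OF assms(3) inverse_AS_H[OF assms(2)]]) simp
  also have "\<dots> = a \<odot>\<^bsub>MA\<^esub> rsw (cls_H K v (1 / AS \<beta>))"
    using linear_mapD(3)[OF lin, of a] cl assms(3) by simp
  also have "rsw (cls_H K v (1 / AS \<beta>)) = dlA (AS \<beta>)"
    using assms(1,2) as_class_eq by (auto simp: is_rsw_def)
  finally show ?thesis .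
qed

theorem ex1_rsw: "\<exists>!rsw. is_rsw K v \<sigma> (AS \<alpha>) rsw"
proof -
  obtain r where r: "r \<in> module_hom (ring_on A) (mod_H K v) MA" "\<And>x. x \<in> H_set 1 \<Longrightarrow> r (cls_H K v x) = rsw_fun x"
    using module_quotient.factor[OF quotient_H LA.M.module_axioms linear_rsw_fun rsw_fun_square]
    unfolding mod_H_eq cls_H_eq by auto
  have "is_rsw K v \<sigma> (AS \<alpha>) r"
    unfolding is_rsw_def
  proof (intro conjI ballI r(1))
    fix g assume "g \<in> as_class K (AS \<alpha>)"
    then obtain \<beta> where \<beta>: "\<beta> \<in> gens" "g = AS \<beta>" using as_class_eq by blast
    have "rsw_fun (1 / g) = (1 / g * AS \<beta>) \<odot>\<^bsub>MA\<^esub> dlA (AS \<beta>)"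
      using \<beta> gens_AS gens_AS_nonzero by (intro rsw_fun_eq) auto
    thus "r (cls_H K v (1 / g)) = dlA g"
      using r(2)[OF inverse_AS_H[OF \<beta>(1)]] \<beta> gens_AS_nonzero[OF \<beta>(1)] dlA_gens_closed[OF \<beta>(1)] by simp
  qed
  moreover have "r1 = r2" if r12: "is_rsw K v \<sigma> (AS \<alpha>) r1" "is_rsw K v \<sigma> (AS \<alpha>) r2" for r1 r2
  proof (rule extensionalityI)
    show "r1 \<in> extensional (carrier (mod_H K v))" "r2 \<in> extensional (carrier (mod_H K v))"
      using r12 by (auto simp: is_rsw_def module_hom_def PiE_def)
    fix w assume "w \<in> carrier (mod_H K v)"
    then obtain x where "x \<in> H_set 1" "w = cls_H K v x" by (auto simp: carrier_mod_H)
    moreover from this(1) obtain \<beta> a where "\<beta> \<in> gens" "a \<in> A" "x = a * (1 / AS \<beta>)"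
      using H_set_eq_mult[of x 1] by auto
    ultimately show "r1 w = r2 w" using is_rsw_smult[OF r12(1)] is_rsw_smult[OF r12(2)] by simp
  qed
  ultimately show ?thesis by blast
qed


subsection \<open>Generators of the relative differentials\<close>

text \<open>
  For \<open>\<beta> = \<beta>' + c\<close>, the quotients \<open>\<beta>' / \<beta>\<close> and \<open>c / \<beta>\<close> are integral with sum \<open>1\<close>, and \<open>dlog c = 0\<close>.
\<close>

lemma dlB_gens:
  assumes "\<beta> \<in> gens" "\<beta>' \<in> gens" "\<beta> \<preceq> \<beta>'"
  shows "\<beta>' / \<beta> \<in> \<O>" "dlB \<beta> = (\<beta>' / \<beta>) \<odot>\<^bsub>MB\<^esub> dlB \<beta>'"
proof -
  have nz: "\<beta> \<noteq> 0" "\<beta>' \<noteq> 0" using assms gens_nonzero by blast+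
  define c where "c = \<beta> - \<beta>'"
  have c: "c \<in> K" "\<beta> \<preceq> c" using gens_diff[OF assms(1,2)] assms(3) by (auto simp: c_def intro: vle_diff)
  have t0: "\<beta>' / \<beta> \<in> \<O>" and t1: "c / \<beta> \<in> \<O>"
    using assms(3) c nz by (simp_all add: mem_integers vle_divide_right)
  show "\<beta>' / \<beta> \<in> \<O>" by (rule t0)
  have cl: "dlB \<beta> \<in> carrier MB" "dlB \<beta>' \<in> carrier MB" using nz dlB_closed by auto
  show "dlB \<beta> = (\<beta>' / \<beta>) \<odot>\<^bsub>MB\<^esub> dlB \<beta>'"
  proof (cases "c = 0")
    case True
    thus ?thesis using nz cl by (simp add: c_def)
  next
    case False
    have e0: "(\<beta>' / \<beta>) \<odot>\<^bsub>MB\<^esub> dlB \<beta>' = sym_omega_BA K v \<sigma> (D (\<beta>' / \<beta>)) \<oplus>\<^bsub>MB\<^esub> (\<beta>' / \<beta>) \<odot>\<^bsub>MB\<^esub> dlB \<beta>"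
      using nz t0 by (intro LB.smult_dl) (auto simp: fraction_B)
    have "(c / \<beta>) \<odot>\<^bsub>MB\<^esub> dlB c = sym_omega_BA K v \<sigma> (D (c / \<beta>)) \<oplus>\<^bsub>MB\<^esub> (c / \<beta>) \<odot>\<^bsub>MB\<^esub> dlB \<beta>"
      using nz t1 False by (intro LB.smult_dl) (auto simp: fraction_B)
    hence e1: "\<zero>\<^bsub>MB\<^esub> = sym_omega_BA K v \<sigma> (D (c / \<beta>)) \<oplus>\<^bsub>MB\<^esub> (c / \<beta>) \<odot>\<^bsub>MB\<^esub> dlB \<beta>"
      using dlB_K_zero[OF c(1) False] t1 by simp
    have "(\<beta>' / \<beta>) \<odot>\<^bsub>MB\<^esub> dlB \<beta>' =
        (sym_omega_BA K v \<sigma> (D (\<beta>' / \<beta>)) \<oplus>\<^bsub>MB\<^esub> (\<beta>' / \<beta>) \<odot>\<^bsub>MB\<^esub> dlB \<beta>) \<oplus>\<^bsub>MB\<^esub>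
        (sym_omega_BA K v \<sigma> (D (c / \<beta>)) \<oplus>\<^bsub>MB\<^esub> (c / \<beta>) \<odot>\<^bsub>MB\<^esub> dlB \<beta>)"
      unfolding e0[symmetric] e1[symmetric] using t0 cl by simp
    also have "\<dots> = sym_omega_BA K v \<sigma> (D (\<beta>' / \<beta> + c / \<beta>)) \<oplus>\<^bsub>MB\<^esub> (\<beta>' / \<beta> + c / \<beta>) \<odot>\<^bsub>MB\<^esub> dlB \<beta>"
      using t0 t1 cl by (simp add: LB.d_add LB.smult_distr' LB.M.M.a_ac del: add_divide_distrib)
    also have "\<beta>' / \<beta> + c / \<beta> = 1" using nz by (simp add: c_def diff_divide_distrib)
    finally show ?thesis using cl by simp
  qed
qed

text \<open>
  If \<open>x\<close> is the sum of the terms \<open>P\<^sub>i \<beta>\<^sup>i\<close>, none of value smaller than that of \<open>x\<close>, then the quotients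
  \<open>t\<^sub>i\<close> of the terms by \<open>x\<close> are integral with sum \<open>1\<close>, so \<open>dlog x\<close> is the sum of the \<open>t\<^sub>i dlog (P\<^sub>i \<beta>\<^sup>i)\<close>,
  and \<open>dlog P\<^sub>i = 0\<close>.
\<close>

lemma dlB_expands:
  assumes "\<beta> \<in> gens" "expands \<beta> x" "x \<noteq> 0"
  shows "\<exists>b\<in>\<O>. dlB x = b \<odot>\<^bsub>MB\<^esub> dlB \<beta>"
proof -
  obtain P where P: "K_poly P" "x = poly P \<beta>" "\<And>i. x \<preceq> coeff P i * \<beta> ^ i"
    using assms(2) by (auto simp: expands_def)
  have nz: "\<beta> \<noteq> 0" using gens_nonzero assms by blast
  have cl: "dlB \<beta> \<in> carrier MB" "dlB x \<in> carrier MB" using nz assms dlB_closed by auto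
  define t where "t = (\<lambda>i. coeff P i * \<beta> ^ i / x)"
  have t: "t i \<in> \<O>" for i using P(3)[of i] assms(3) by (simp add: t_def mem_integers vle_divide_right)
  have "sym_omega_BA K v \<sigma> (D (t i)) \<oplus>\<^bsub>MB\<^esub> t i \<odot>\<^bsub>MB\<^esub> dlB x = (t i * of_nat i) \<odot>\<^bsub>MB\<^esub> dlB \<beta>" for i
  proof (cases "coeff P i = 0")
    case True
    thus ?thesis using cl by (simp add: t_def)
  next
    case False
    have "dlB (coeff P i * \<beta> ^ i) = dlB (coeff P i) \<oplus>\<^bsub>MB\<^esub> dlB (\<beta> ^ i)"
      using False nz by (intro LB.dl_mult) (auto simp: fraction_B)
    also have "dlB (coeff P i) = \<zero>\<^bsub>MB\<^esub>" using False P by (intro dlB_K_zero) auto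
    also have "dlB (\<beta> ^ i) = of_nat i \<odot>\<^bsub>MB\<^esub> dlB \<beta>" using nz by (intro LB.dl_power) (auto simp: fraction_B)
    finally have "dlB (coeff P i * \<beta> ^ i) = of_nat i \<odot>\<^bsub>MB\<^esub> dlB \<beta>" using cl by simp
    moreover have "t i \<odot>\<^bsub>MB\<^esub> dlB (coeff P i * \<beta> ^ i) = sym_omega_BA K v \<sigma> (D (t i)) \<oplus>\<^bsub>MB\<^esub> t i \<odot>\<^bsub>MB\<^esub> dlB x"
      unfolding t_def using False nz assms t[of i] by (intro LB.smult_dl) (auto simp: fraction_B t_def)
    ultimately show ?thesis using cl t[of i] LB.smult_assoc'[of "t i" "of_nat i" "dlB \<beta>"] by simp
  qed
  hence "sym_omega_BA K v \<sigma> (D (sum t {..degree P})) \<oplus>\<^bsub>MB\<^esub> sum t {..degree P} \<odot>\<^bsub>MB\<^esub> dlB x =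
      sum (\<lambda>i. t i * of_nat i) {..degree P} \<odot>\<^bsub>MB\<^esub> dlB \<beta> \<and> sum t {..degree P} \<in> \<O> \<and>
      sum (\<lambda>i. t i * of_nat i) {..degree P} \<in> \<O>"
    using cl t by (intro LB.sum_d_smult) auto
  moreover have "sum t {..degree P} = 1"
    using assms(3) P(2) by (simp add: t_def poly_altdef flip: sum_divide_distrib)
  ultimately show ?thesis using cl by auto
qed

text \<open>
  The symbols \<open>dlog x\<close> are multiples of \<open>dlog \<beta>\<close> for large \<open>\<beta>\<close>, and so are the symbols \<open>d b = b dlog b\<close>.
\<close>

lemma MB_generated:
  assumes "w \<in> carrier MB"
  shows "ev (\<lambda>\<beta>. \<exists>b\<in>\<O>. w = b \<odot>\<^bsub>MB\<^esub> dlB \<beta>)"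
proof -
  let ?E = "\<lambda>w. ev (\<lambda>\<beta>. \<exists>b\<in>\<O>. w = b \<odot>\<^bsub>MB\<^esub> dlB \<beta>)"
  have smult: "?E (r \<odot>\<^bsub>MB\<^esub> w)" if "r \<in> \<O>" "?E w" for r w
    using that(2)
  proof (rule ev_mono)
    fix \<beta> assume "\<beta> \<in> gens" "\<exists>b\<in>\<O>. w = b \<odot>\<^bsub>MB\<^esub> dlB \<beta>"
    then obtain b where b: "b \<in> \<O>" "w = b \<odot>\<^bsub>MB\<^esub> dlB \<beta>" by blast
    have "r \<odot>\<^bsub>MB\<^esub> w = (r * b) \<odot>\<^bsub>MB\<^esub> dlB \<beta>"
      using b that(1) dlB_closed[OF gens_nonzero[OF \<open>\<beta> \<in> gens\<close>]] by (simp add: LB.smult_assoc')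
    thus "\<exists>b\<in>\<O>. r \<odot>\<^bsub>MB\<^esub> w = b \<odot>\<^bsub>MB\<^esub> dlB \<beta>" using LB.R_closed(4)[OF that(1) b(1)] by blast
  qed
  have add: "?E (w \<oplus>\<^bsub>MB\<^esub> w')" if "?E w" "?E w'" for w w'
    using ev_conj[OF that]
  proof (rule ev_mono)
    fix \<beta> assume "\<beta> \<in> gens" "(\<exists>b\<in>\<O>. w = b \<odot>\<^bsub>MB\<^esub> dlB \<beta>) \<and> (\<exists>b\<in>\<O>. w' = b \<odot>\<^bsub>MB\<^esub> dlB \<beta>)"
    then obtain b b' where b: "b \<in> \<O>" "w = b \<odot>\<^bsub>MB\<^esub> dlB \<beta>" "b' \<in> \<O>" "w' = b' \<odot>\<^bsub>MB\<^esub> dlB \<beta>" by blast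
    have "w \<oplus>\<^bsub>MB\<^esub> w' = (b + b') \<odot>\<^bsub>MB\<^esub> dlB \<beta>"
      using b dlB_closed[OF gens_nonzero[OF \<open>\<beta> \<in> gens\<close>]] by (simp add: LB.smult_distr')
    thus "\<exists>b\<in>\<O>. w \<oplus>\<^bsub>MB\<^esub> w' = b \<odot>\<^bsub>MB\<^esub> dlB \<beta>" using LB.R_closed(3)[OF b(1,3)] by blast
  qed
  have zero_E: "?E \<zero>\<^bsub>MB\<^esub>"
    by (rule ev_mono[OF ev_const[of True]]) (auto intro!: bexI[of _ 0] simp: dlB_closed gens_nonzero)
  have dlog: "?E (dlB x)" if "x \<noteq> 0" for x
    using ev_expands[of x] by (rule ev_mono) (use dlB_expands that in blast)
  have d: "?E (sym_omega_BA K v \<sigma> (D b))" if "b \<in> \<O>" for b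
  proof (cases "b = 0")
    case False
    thus ?thesis using smult[OF that dlog[OF False]] LB.dl_d[OF that False] by simp
  qed (simp add: zero_E)
  obtain c where c: "c \<in> carrier (log_free \<O>)" "w = classBA c" using assms carrier_MB by blast
  have op: "c \<oplus>\<^bsub>log_free \<O>\<^esub> c' = c + c'" "r \<odot>\<^bsub>log_free \<O>\<^esub> c = Poly_Mapping.map ((*) r) c"
    "\<zero>\<^bsub>log_free \<O>\<^esub> = 0" for c c' r
    by (simp_all add: log_free_def)
  note L = linear_mapD[OF linear_classBA]
  have "?E (classBA c)"
    using B_subring c(1) unfolding log_free_def
  proof (induction c rule: free_module_induct)
    case zero
    show ?case
      using linear_map_zero[OF log_free_module[OF B_subring] LB.M.module_axioms linear_classBA] zero_E
      by (simp add: op)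
  next
    case (single s r)
    have s1: "Poly_Mapping.single s 1 \<in> carrier (log_free \<O>)"
      using single by (auto intro!: log_free_single B_subring)
    have "classBA (Poly_Mapping.single s r) = r \<odot>\<^bsub>MB\<^esub> sym_omega_BA K v \<sigma> s"
      using L(3)[of r, OF _ s1] single by (subst single_scale) (simp add: op sym_omega_BA_eq)
    moreover have "?E (sym_omega_BA K v \<sigma> s)" using single d dlog by auto
    ultimately show ?case using smult single by simp
  next
    case (add c c')
    thus ?case using L(2)[of c c'] \<open>\<And>w w'. ?E w \<Longrightarrow> ?E w' \<Longrightarrow> ?E (w \<oplus>\<^bsub>MB\<^esub> w')\<close>
      by (simp add: op log_free_def[symmetric])
  qed
  thus ?thesis using c by simp
qed


subsection \<open>The isomorphism with the ideal modulo its square\<close>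

definition phi_sym :: "'a logsym \<Rightarrow> 'a" where
  "phi_sym s = (case s of D b \<Rightarrow> \<sigma> b - b | Dlog x \<Rightarrow> \<sigma> x / x - 1)"

lemma phi_sym_J: "s \<in> D ` \<O> \<union> Dlog ` (fraction_field \<O> - {0}) \<Longrightarrow> phi_sym s \<in> J_set 1"
proof (cases s)
  case (D b)
  moreover assume "s \<in> D ` \<O> \<union> Dlog ` (fraction_field \<O> - {0})"
  ultimately show ?thesis using \<sigma>_diff_J[of b] by (auto simp: phi_sym_def mem_integers)
next
  case (Dlog x)
  moreover assume "s \<in> D ` \<O> \<union> Dlog ` (fraction_field \<O> - {0})"
  ultimately show ?thesis using J_generator[of x] by (auto simp: phi_sym_def)
qed

lemma phi_ext_J: "c \<in> carrier (log_free \<O>) \<Longrightarrow> lin_ext phi_sym c \<in> J_set 1"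
proof -
  assume c: "c \<in> carrier (log_free \<O>)"
  show ?thesis
    using B_subring c unfolding log_free_def
  proof (induction c rule: free_module_induct)
    case zero
    show ?case by (simp add: lin_ext_def J_set_0)
  next
    case (single s r)
    thus ?case using phi_sym_J J_set_mult by (simp add: mem_integers)
  next
    case (add c c')
    thus ?case by (simp add: lin_ext_add J_set_add)
  qed
qed

lemma phi_ext_A: "c \<in> carrier (log_free A) \<Longrightarrow> lin_ext phi_sym c = 0"
proof -
  assume c: "c \<in> carrier (log_free A)"
  show ?thesis
    using A_subring c unfolding log_free_def
  proof (induction c rule: free_module_induct)
    case (single s r)
    thus ?case by (auto simp: phi_sym_def fraction_A mem_val_ring \<sigma>_K split: if_splits)
  qed (simp_all add: lin_ext_add, simp add: lin_ext_def)
qed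

text \<open>
  Up to the square of \<open>J\<close>, the map \<open>b \<mapsto> \<sigma> b - b\<close> is a derivation and \<open>x \<mapsto> \<sigma> x / x - 1\<close> is a
  homomorphism.
\<close>

lemma phi_ext_relators: "c \<in> log_relators \<O> \<Longrightarrow> lin_ext phi_sym c \<in> J_set 2"
proof -
  have sq: "x * y \<in> J_set 2" if "x \<in> J_set 1" "y \<in> J_set 1" for x y
    using J_set_prod[OF that] by (simp add: numeral_2_eq_2)
  assume "c \<in> log_relators \<O>"
  then consider
    (a) b b' where "c = Poly_Mapping.single (D (b + b')) 1 - Poly_Mapping.single (D b) 1 - Poly_Mapping.single (D b') 1"
      "b \<in> \<O>" "b' \<in> \<O>"
  | (m) b b' where "c = Poly_Mapping.single (D (b * b')) 1 - Poly_Mapping.single (D b) b' - Poly_Mapping.single (D b') b"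
      "b \<in> \<O>" "b' \<in> \<O>"
  | (l) x y where "c = Poly_Mapping.single (Dlog (x * y)) 1 - Poly_Mapping.single (Dlog x) 1 - Poly_Mapping.single (Dlog y) 1"
      "x \<noteq> 0" "y \<noteq> 0"
  | (d) b where "c = Poly_Mapping.single (Dlog b) b - Poly_Mapping.single (D b) 1" "b \<in> \<O>" "b \<noteq> 0"
    unfolding log_relators_def Let_def by blast
  thus ?thesis
  proof cases
    case a
    thus ?thesis unfolding a(1) lin_ext_diff lin_ext_single by (simp add: phi_sym_def \<sigma>_add J_set_0)
  next
    case m
    have "lin_ext phi_sym c = (\<sigma> b - b) * (\<sigma> b' - b')"
      unfolding m(1) lin_ext_diff lin_ext_single by (simp add: phi_sym_def \<sigma>_mult algebra_simps)
    thus ?thesis using sq[OF \<sigma>_diff_J \<sigma>_diff_J, of b b'] m by (simp add: mem_integers)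
  next
    case l
    have "lin_ext phi_sym c = (\<sigma> x / x - 1) * (\<sigma> y / y - 1)"
      unfolding l(1) lin_ext_diff lin_ext_single using l(2,3) by (simp add: phi_sym_def \<sigma>_mult field_simps)
    thus ?thesis using sq[OF J_generator J_generator, of x y] l by simp
  next
    case d
    thus ?thesis unfolding d(1) lin_ext_diff lin_ext_single by (simp add: phi_sym_def field_simps J_set_0)
  qed
qed

text \<open>
  The formal map factors through the three quotients: it kills the relations modulo \<open>J\<^sup>2\<close>, it is zero on symbols from
  \<open>A\<close> and \<open>K\<close>, which \<open>\<sigma>\<close> fixes, and it sends \<open>J \<omega>\<^sub>B\<^sub>|\<^sub>A\<close> into \<open>J\<^sup>2\<close>, because all its values lie in \<open>J\<close>.
\<close>

lemma ex_phi_hom: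
  obtains \<phi> where "\<phi> \<in> module_hom (ring_on \<O>) MB (mod_J K v \<sigma>)"
    "\<And>c. c \<in> carrier (log_free \<O>) \<Longrightarrow> \<phi> (classBA c) = cls_J K v \<sigma> (lin_ext phi_sym c)"
proof -
  define h where "h = (\<lambda>c. cls_J K v \<sigma> (lin_ext phi_sym c))"
  have op: "c \<oplus>\<^bsub>log_free \<O>\<^esub> c' = c + c'" "r \<odot>\<^bsub>log_free \<O>\<^esub> c = Poly_Mapping.map ((*) r) c" for c c' r
    by (simp_all add: log_free_def)
  note L = linear_mapD[OF linear_cls_J, simplified]
  have h: "linear_map (ring_on \<O>) (log_free \<O>) (mod_J K v \<sigma>) h"
    unfolding linear_map_def h_def using L phi_ext_J
    by (simp add: op lin_ext_add lin_ext_scale)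
  have kill1: "h c = \<zero>\<^bsub>mod_J K v \<sigma>\<^esub>" if "c \<in> log_relators \<O>" for c
    using phi_ext_relators[OF that] J_set_2_subset cls_J_zero_iff unfolding h_def by blast
  obtain g1 where g1: "g1 \<in> module_hom (ring_on \<O>) (omega \<O>) (mod_J K v \<sigma>)"
    "\<And>c. c \<in> carrier (log_free \<O>) \<Longrightarrow> g1 (log_relations \<O> +>\<^bsub>log_free \<O>\<^esub> c) = h c"
    using factor_gen[OF log_free_module[OF B_subring] mod_J_module h log_relators_carrier[OF B_subring] kill1]
    unfolding omega_def log_relations_def by blast
  have kill2: "g1 w = \<zero>\<^bsub>mod_J K v \<sigma>\<^esub>"
    if w: "w \<in> (\<lambda>c. log_relations \<O> +>\<^bsub>log_free \<O>\<^esub> c) ` carrier (log_free A)" for w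
  proof -
    obtain c where c: "c \<in> carrier (log_free A)" "w = log_relations \<O> +>\<^bsub>log_free \<O>\<^esub> c" using w by blast
    have "g1 w = h c" using c log_free_mono g1(2) by blast
    also have "\<dots> = cls_J K v \<sigma> 0" using phi_ext_A[OF c(1)] by (simp add: h_def)
    also have "\<dots> = \<zero>\<^bsub>mod_J K v \<sigma>\<^esub>" using cls_J_zero_iff[of 0] J_set_0 by blast
    finally show ?thesis .
  qed
  obtain g2 where g2: "g2 \<in> module_hom (ring_on \<O>) (omega_rel A \<O>) (mod_J K v \<sigma>)"
    "\<And>w. w \<in> carrier (omega \<O>) \<Longrightarrow> g2 (omega_image A \<O> +>\<^bsub>omega \<O>\<^esub> w) = g1 w"
    using factor_gen[OF omega_module[OF B_subring] mod_J_module module_hom_linear[OF g1(1)]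
        omega_image_gen_carrier kill2]
    unfolding omega_rel_def omega_image_gen by blast
  have kill3: "g2 w = \<zero>\<^bsub>mod_J K v \<sigma>\<^esub>"
    if w: "w \<in> {a \<odot>\<^bsub>omega_rel A \<O>\<^esub> m |a m. a \<in> J_set 1 \<and> m \<in> carrier (omega_rel A \<O>)}" for w
  proof -
    obtain a m where am: "a \<in> J_set 1" "m \<in> carrier (omega_rel A \<O>)" "w = a \<odot>\<^bsub>omega_rel A \<O>\<^esub> m" using w by blast
    have aO: "a \<in> \<O>" using am J_subset by blast
    obtain y where y: "y \<in> J_set 1" "g2 m = cls_J K v \<sigma> y"
      using linear_mapD(1)[OF module_hom_linear[OF g2(1)] am(2)] carrier_mod_J by blast
    have "g2 w = a \<odot>\<^bsub>mod_J K v \<sigma>\<^esub> cls_J K v \<sigma> y"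
      using linear_mapD(3)[OF module_hom_linear[OF g2(1)], of a m] am aO y by simp
    also have "\<dots> = cls_J K v \<sigma> (a * y)" using aO y by (intro cls_J_smult)
    also have "\<dots> = \<zero>\<^bsub>mod_J K v \<sigma>\<^esub>"
      using J_set_prod[OF am(1) y(1)] J_set_2_subset cls_J_zero_iff[of "a * y"] by (auto simp: numeral_2_eq_2)
    finally show ?thesis .
  qed
  interpret MR: module "ring_on \<O>" "omega_rel A \<O>" by (rule omega_rel_module)
  have S3: "{a \<odot>\<^bsub>omega_rel A \<O>\<^esub> m |a m. a \<in> J_set 1 \<and> m \<in> carrier (omega_rel A \<O>)} \<subseteq> carrier (omega_rel A \<O>)"
    using subsetD[OF J_subset[of 1]] MR.smult_closed by auto
  obtain g3 where g3: "g3 \<in> module_hom (ring_on \<O>) MB (mod_J K v \<sigma>)"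
    "\<And>w. w \<in> carrier (omega_rel A \<O>) \<Longrightarrow>
      g3 (ideal_smult (ring_on \<O>) (J_set 1) (omega_rel A \<O>) +>\<^bsub>omega_rel A \<O>\<^esub> w) = g2 w"
    using factor_gen[OF omega_rel_module mod_J_module module_hom_linear[OF g2(1)] S3 kill3]
    unfolding MB_eq ideal_smult_def by blast
  have "g3 (classBA c) = cls_J K v \<sigma> (lin_ext phi_sym c)" if c: "c \<in> carrier (log_free \<O>)" for c
  proof -
    have 1: "log_relations \<O> +>\<^bsub>log_free \<O>\<^esub> c \<in> carrier (omega \<O>)"
      using c linear_mapD(1)[OF module_quotient.linear_cls[OF omega_quotient[OF B_subring]]] by (simp add: omega_def)
    hence 2: "omega_image A \<O> +>\<^bsub>omega \<O>\<^esub> (log_relations \<O> +>\<^bsub>log_free \<O>\<^esub> c) \<in> carrier (omega_rel A \<O>)"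
      using linear_mapD(1)[OF module_quotient.linear_cls[OF quotient_rel]] by (simp add: omega_rel_def)
    show ?thesis unfolding classBA_def g3(2)[OF 2] g2(2)[OF 1] g1(2)[OF c] h_def ..
  qed
  thus thesis using that g3(1) by blast
qed

text \<open>
  The map is surjective because it sends \<open>dlog \<beta>\<close> to \<open>1 / \<beta>\<close>.  For the injectivity let \<open>w = b dlog \<beta>\<close>.  If
  \<open>b / \<beta>\<close> lies in the square of \<open>J\<close>, then \<open>b \<beta>' / \<beta>\<close> lies in \<open>J\<close> for some \<open>\<beta>'\<close> of no smaller value, so that
  \<open>w = (b \<beta>' / \<beta>) dlog \<beta>'\<close> vanishes.
\<close>

theorem ex_phi: "\<exists>\<phi>. is_phi K v \<sigma> \<phi>"
proof -
  obtain \<phi> where \<phi>: "\<phi> \<in> module_hom (ring_on \<O>) MB (mod_J K v \<sigma>)"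
    "\<And>c. c \<in> carrier (log_free \<O>) \<Longrightarrow> \<phi> (classBA c) = cls_J K v \<sigma> (lin_ext phi_sym c)"
    using ex_phi_hom by blast
  note lin = module_hom_linear[OF \<phi>(1)]
  interpret MJ: module "ring_on \<O>" "mod_J K v \<sigma>" by (rule mod_J_module)
  have dlog: "\<phi> (dlB x) = cls_J K v \<sigma> (\<sigma> x / x - 1)" if "x \<noteq> 0" for x
    using \<phi>(2)[of "Poly_Mapping.single (Dlog x) 1"] log_free_single(2)[OF B_subring, of 1 x] that
    by (simp add: sym_omega_BA_eq phi_sym_def fraction_B mem_integers)
  have gen: "\<phi> (b \<odot>\<^bsub>MB\<^esub> dlB \<beta>) = cls_J K v \<sigma> (b * (1 / \<beta>))" if "b \<in> \<O>" "\<beta> \<in> gens" for b \<beta>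
  proof -
    have nz: "\<beta> \<noteq> 0" using gens_nonzero that by blast
    have "\<sigma> \<beta> / \<beta> - 1 = 1 / \<beta>" using that nz by (simp add: gens_def add_divide_distrib)
    moreover have "\<phi> (b \<odot>\<^bsub>MB\<^esub> dlB \<beta>) = b \<odot>\<^bsub>mod_J K v \<sigma>\<^esub> \<phi> (dlB \<beta>)"
      using linear_mapD(3)[OF lin, of b "dlB \<beta>"] that dlB_closed[OF nz] by simp
    ultimately show ?thesis using dlog[OF nz] cls_J_smult[OF that(1) inverse_gen_J[OF that(2)]] by simp
  qed
  have kernel: "w = \<zero>\<^bsub>MB\<^esub>" if w: "w \<in> carrier MB" "\<phi> w = \<zero>\<^bsub>mod_J K v \<sigma>\<^esub>" for w
  proof -
    obtain \<beta> b where \<beta>: "\<beta> \<in> gens" "b \<in> \<O>" "w = b \<odot>\<^bsub>MB\<^esub> dlB \<beta>"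
      using ev_ex[OF MB_generated[OF w(1)]] by blast
    have nz: "\<beta> \<noteq> 0" using gens_nonzero \<beta> by blast
    have "b * (1 / \<beta>) \<in> J_set 1" using \<beta> by (intro J_set_mult inverse_gen_J) (auto simp: mem_integers)
    hence "b * (1 / \<beta>) \<in> J_set 2" using w(2) gen[OF \<beta>(2,1)] \<beta>(3) cls_J_zero_iff by simp
    hence "ev (\<lambda>\<beta>'. 1 \<preceq> b * (1 / \<beta>) * \<beta>' ^ 2 \<and> \<beta> \<preceq> \<beta>')"
      unfolding J_set_ev by (intro ev_conj ev_vle \<beta>)
    then obtain \<beta>' where \<beta>': "\<beta>' \<in> gens" "1 \<preceq> b * (1 / \<beta>) * \<beta>' ^ 2" "\<beta> \<preceq> \<beta>'" by (auto dest: ev_ex)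
    have "w = (b * (\<beta>' / \<beta>)) \<odot>\<^bsub>MB\<^esub> dlB \<beta>'"
      using \<beta>(2,3) dlB_gens[OF \<beta>(1) \<beta>'(1,3)] dlB_closed[OF gens_nonzero[OF \<beta>'(1)]]
        LB.smult_assoc'[of b "\<beta>' / \<beta>" "dlB \<beta>'"] by (simp del: times_divide_eq_right)
    moreover have "b * (\<beta>' / \<beta>) \<in> J_set 1"
      unfolding J_set_def using \<beta>' by (auto simp: power2_eq_square mult.assoc intro!: bexI[of _ \<beta>'])
    ultimately show ?thesis using J_smult_MB dlB_closed[OF gens_nonzero[OF \<beta>'(1)]] by simp
  qed
  have "inj_on \<phi> (carrier MB)"
  proof (rule inj_onI)
    fix x y assume xy: "x \<in> carrier MB" "y \<in> carrier MB" "\<phi> x = \<phi> y"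
    have "\<phi> (x \<ominus>\<^bsub>MB\<^esub> y) = \<phi> x \<oplus>\<^bsub>mod_J K v \<sigma>\<^esub> \<ominus>\<^bsub>mod_J K v \<sigma>\<^esub> \<phi> y"
      using xy linear_mapD(2)[OF lin] linear_map_uminus[OF LB.M.module_axioms mod_J_module lin]
      by (simp add: a_minus_def)
    also have "\<dots> = \<zero>\<^bsub>mod_J K v \<sigma>\<^esub>"
      unfolding xy(3) using linear_mapD(1)[OF lin xy(2)] by (rule MJ.M.r_neg)
    finally have "x \<ominus>\<^bsub>MB\<^esub> y = \<zero>\<^bsub>MB\<^esub>" using xy by (intro kernel) auto
    hence "\<ominus>\<^bsub>MB\<^esub> (\<ominus>\<^bsub>MB\<^esub> y) = x" using xy by (intro LB.M.M.minus_equality) (auto simp: a_minus_def)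
    thus "x = y" using xy by simp
  qed
  moreover have "\<phi> ` carrier MB = carrier (mod_J K v \<sigma>)"
  proof (intro equalityI subsetI)
    fix y assume "y \<in> carrier (mod_J K v \<sigma>)"
    then obtain x where x: "x \<in> J_set 1" "y = cls_J K v \<sigma> x" by (auto simp: carrier_mod_J)
    then obtain \<beta> b where \<beta>: "\<beta> \<in> gens" "b \<in> \<O>" "x = b * (1 / \<beta>)" using J_set_eq_mult[of x 1] by auto
    have "b \<odot>\<^bsub>MB\<^esub> dlB \<beta> \<in> carrier MB" using \<beta> dlB_closed gens_nonzero by simp
    moreover have "\<phi> (b \<odot>\<^bsub>MB\<^esub> dlB \<beta>) = y" using gen[OF \<beta>(2,1)] \<beta>(3) x by simp
    ultimately show "y \<in> \<phi> ` carrier MB" by blast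
  qed (use linear_mapD(1)[OF lin] in blast)
  ultimately have "is_phi K v \<sigma> \<phi>"
    using \<phi>(1) dlog by (auto simp: is_phi_def module_iso_def bij_betw_def ring_B_eq)
  thus ?thesis by blast
qed


subsection \<open>The norm map and commutativity\<close>

theorem ex_norm_map: "\<exists>Nb. is_norm_map K v \<sigma> Nb \<and> inj_on Nb (carrier (mod_J K v \<sigma>))"
proof -
  define Nb where "Nb = (\<lambda>W\<in>carrier (mod_J K v \<sigma>). cls_H K v (galois_norm K (SOME x. x \<in> J_set 1 \<and> W = cls_J K v \<sigma> x)))"
  have Nb: "Nb (cls_J K v \<sigma> x) = cls_H K v (galois_norm K x)" if x: "x \<in> J_set 1" for x
  proof -
    define y where "y = (SOME y. y \<in> J_set 1 \<and> cls_J K v \<sigma> x = cls_J K v \<sigma> y)"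
    have y: "y \<in> J_set 1" "cls_J K v \<sigma> x = cls_J K v \<sigma> y"
      using someI_ex[of "\<lambda>y. y \<in> J_set 1 \<and> cls_J K v \<sigma> x = cls_J K v \<sigma> y"] x by (auto simp: y_def)
    hence "y - x \<in> J_set 2" using cls_J_eq_iff[OF y(1) x] by simp
    from norm_congruent[OF x this] have "cls_H K v (galois_norm K y) = cls_H K v (galois_norm K x)"
      using cls_H_eq_iff norm_J_set[OF x] norm_J_set[OF y(1)] by simp
    moreover have "cls_J K v \<sigma> x \<in> carrier (mod_J K v \<sigma>)" using x carrier_mod_J by blast
    ultimately show ?thesis by (simp add: Nb_def y_def)
  qed
  have "is_norm_map K v \<sigma> Nb"
    unfolding is_norm_map_def ideal_J_eq ideal_H_eq
  proof (intro conjI ballI)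
    show "Nb \<in> carrier (mod_J K v \<sigma>) \<rightarrow>\<^sub>E carrier (mod_H K v)"
    proof (rule PiE_I)
      fix W assume "W \<in> carrier (mod_J K v \<sigma>)"
      then obtain x where "x \<in> J_set 1" "W = cls_J K v \<sigma> x" using carrier_mod_J by blast
      thus "Nb W \<in> carrier (mod_H K v)" using Nb norm_J_set by (simp add: carrier_mod_H)
    qed (simp add: Nb_def)
  qed (use norm_J_set Nb in blast)+
  moreover have "inj_on Nb (carrier (mod_J K v \<sigma>))"
  proof (rule inj_onI)
    fix W W' assume W: "W \<in> carrier (mod_J K v \<sigma>)" "W' \<in> carrier (mod_J K v \<sigma>)" "Nb W = Nb W'"
    obtain x y where xy: "x \<in> J_set 1" "W = cls_J K v \<sigma> x" "y \<in> J_set 1" "W' = cls_J K v \<sigma> y"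
      using W(1,2) unfolding carrier_mod_J by (elim imageE) blast
    hence "galois_norm K x - galois_norm K y \<in> H_set 2"
      using W(3) Nb cls_H_eq_iff norm_J_set by simp
    hence "x - y \<in> J_set 2" using norm_injective[OF xy(3), of "x - y"] by simp
    thus "W = W'" using xy cls_J_eq_iff by simp
  qed
  ultimately show ?thesis by blast
qed

text \<open>
  The formula that determines both versions of the map \<open>\<Delta>\<close>.  A solution \<open>a\<close> with \<open>\<sigma> a = a + j\<close>
  is \<open>j\<close> times a generator, and \<open>dlog j = 0\<close>.
\<close>

lemma diagram_formula:
  assumes rsw: "is_rsw K v \<sigma> (AS \<alpha>) rsw" and \<phi>: "is_phi K v \<sigma> \<phi>" and Nb: "is_norm_map K v \<sigma> Nb"
    and a: "a \<in> as_solutions K" and b: "b \<in> \<O>"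
  shows "rsw (Nb (\<phi> (b \<odot>\<^bsub>MB\<^esub> dlB a))) = galois_norm K b \<odot>\<^bsub>MA\<^esub> dlA (AS a)"
proof -
  obtain j where j: "0 < j" "j < p" "\<sigma> a = a + of_nat j" "a / of_nat j \<in> gens" "(of_nat j :: 'a) \<noteq> 0"
    "AS (a / of_nat j) = AS a / of_nat j"
    using a as_solution_scaled[of a] unfolding as_solutions_def by blast
  define \<beta> where "\<beta> = a / of_nat j"
  have \<beta>: "\<beta> \<in> gens" "a = of_nat j * \<beta>" "AS a = of_nat j * AS \<beta>" using j by (auto simp: \<beta>_def)
  have a0: "a \<noteq> 0" using gens_nonzero[OF \<beta>(1)] \<beta>(2) j(5) by simp
  have J: "\<sigma> a / a - 1 = 1 / \<beta>" using j a0 gens_nonzero[OF \<beta>(1)] by (simp add: \<beta>(2) field_simps)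
  have lin: "linear_map (ring_on \<O>) MB (mod_J K v \<sigma>) \<phi>"
    using \<phi> by (auto simp: is_phi_def module_iso_def ring_B_eq intro: module_hom_linear)
  have "\<phi> (b \<odot>\<^bsub>MB\<^esub> dlB a) = b \<odot>\<^bsub>mod_J K v \<sigma>\<^esub> \<phi> (dlB a)"
    using linear_mapD(3)[OF lin, of b "dlB a"] b dlB_closed[OF a0] by simp
  also have "\<phi> (dlB a) = cls_J K v \<sigma> (1 / \<beta>)" using \<phi> a0 J by (auto simp: is_phi_def)
  also have "b \<odot>\<^bsub>mod_J K v \<sigma>\<^esub> cls_J K v \<sigma> (1 / \<beta>) = cls_J K v \<sigma> (b * (1 / \<beta>))"
    by (intro cls_J_smult b inverse_gen_J \<beta>)
  finally have 1: "\<phi> (b \<odot>\<^bsub>MB\<^esub> dlB a) = cls_J K v \<sigma> (b * (1 / \<beta>))" .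
  have "b * (1 / \<beta>) \<in> J_set 1" using b \<beta> by (intro J_set_mult inverse_gen_J) (auto simp: mem_integers)
  hence 2: "Nb (cls_J K v \<sigma> (b * (1 / \<beta>))) = cls_H K v (galois_norm K (b * (1 / \<beta>)))"
    using Nb unfolding is_norm_map_def ideal_J_eq by blast
  have 3: "galois_norm K (b * (1 / \<beta>)) = galois_norm K b * (1 / AS \<beta>)"
    by (simp add: norm_divide norm_gens \<beta>(1))
  have "galois_norm K b \<in> A"
    using norm_in_K norm_vle(2)[of b] one_vle_power[of b p] b vle_trans by (auto simp: mem_val_ring mem_integers)
  hence 4: "rsw (cls_H K v (galois_norm K b * (1 / AS \<beta>))) = galois_norm K b \<odot>\<^bsub>MA\<^esub> dlA (AS \<beta>)"
    by (rule is_rsw_smult[OF rsw \<beta>(1)])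
  have "dlA (AS a) = dlA (of_nat j) \<oplus>\<^bsub>MA\<^esub> dlA (AS \<beta>)"
    unfolding \<beta>(3) using j gens_AS[OF \<beta>(1)] gens_AS_nonzero[OF \<beta>(1)]
    by (intro LA.dl_mult) (auto simp: fraction_A)
  also have "dlA (of_nat j) = \<zero>\<^bsub>MA\<^esub>"
    using LA.dl_of_nat[OF j(5)] of_nat_inverse_A[OF j(1,2)] by simp
  finally have "dlA (AS a) = dlA (AS \<beta>)" using dlA_gens_closed[OF \<beta>(1)] by simp
  thus ?thesis using 1 2 3 4 by simp
qed

lemma diagram_PiE:
  assumes "is_rsw K v \<sigma> (AS \<alpha>) rsw" "is_phi K v \<sigma> \<phi>" "is_norm_map K v \<sigma> Nb"
  shows "(\<lambda>w\<in>carrier MB. rsw (Nb (\<phi> w))) \<in> carrier MB \<rightarrow>\<^sub>E carrier MA"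
proof (rule PiE_I)
  fix w assume w: "w \<in> carrier MB"
  have "\<phi> w \<in> carrier (mod_J K v \<sigma>)"
    using assms(2) w unfolding is_phi_def module_iso_def module_hom_def by auto
  hence "Nb (\<phi> w) \<in> carrier (mod_H K v)" using assms(3) unfolding is_norm_map_def by auto
  hence "rsw (Nb (\<phi> w)) \<in> carrier MA" using assms(1) unfolding is_rsw_def module_hom_def by auto
  thus "(\<lambda>w\<in>carrier MB. rsw (Nb (\<phi> w))) w \<in> carrier MA" using w by simp
qed simp

end


section \<open>Defectless extensions\<close>

context artin_schreier
begin

lemma max_ideal_ideal: "ideal (max_ideal v \<O>) (ring_on \<O>)"
  by (rule ideal_ring_onI[OF B_subring])
    (auto simp: mem_max_ideal mem_integers vless_imp_vle intro: vless_add vless_mult_integer)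

abbreviation residue :: "'a \<Rightarrow> 'a set" where
  "residue b \<equiv> max_ideal v \<O> +>\<^bsub>ring_on \<O>\<^esub> b"

abbreviation l where "l \<equiv> residue_L K v"
abbreviation k where "k \<equiv> residue_K K v"

lemma l_eq: "l = ring_on \<O> Quot max_ideal v \<O>"
  by (simp add: residue_L_def ring_B_eq)

lemma k_eq: "k = residue ` A"
  by (simp add: residue_K_def ring_B_eq)

lemma carrier_l: "carrier l = residue ` \<O>"
  by (auto simp: l_eq FactRing_def A_RCOSETS_def')

lemma cring_l: "cring l"
  unfolding l_eq by (rule ideal.quotient_is_cring[OF max_ideal_ideal cring_ring_on[OF B_subring]])

lemma residue_hom:
  "x \<in> \<O> \<Longrightarrow> residue x \<in> carrier l"
  "x \<in> \<O> \<Longrightarrow> y \<in> \<O> \<Longrightarrow> residue x \<oplus>\<^bsub>l\<^esub> residue y = residue (x + y)"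
  "x \<in> \<O> \<Longrightarrow> y \<in> \<O> \<Longrightarrow> residue x \<otimes>\<^bsub>l\<^esub> residue y = residue (x * y)"
  "\<one>\<^bsub>l\<^esub> = residue 1" "\<zero>\<^bsub>l\<^esub> = residue 0"
proof -
  note h = ideal.rcos_ring_hom[OF max_ideal_ideal]
  show "x \<in> \<O> \<Longrightarrow> residue x \<in> carrier l"
    "x \<in> \<O> \<Longrightarrow> y \<in> \<O> \<Longrightarrow> residue x \<oplus>\<^bsub>l\<^esub> residue y = residue (x + y)"
    "x \<in> \<O> \<Longrightarrow> y \<in> \<O> \<Longrightarrow> residue x \<otimes>\<^bsub>l\<^esub> residue y = residue (x * y)"
    "\<one>\<^bsub>l\<^esub> = residue 1"
    using ring_hom_memE[OF h] unfolding l_eq by simp_all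
  have "residue 0 = max_ideal v \<O>"
    by (rule abelian_subgroup.a_rcos_const[OF abelian_subgroupI3[OF ideal.axioms(1)[OF max_ideal_ideal]
          ring.is_abelian_group[OF ideal.axioms(2)[OF max_ideal_ideal]]]])
      (simp add: mem_max_ideal)
  thus "\<zero>\<^bsub>l\<^esub> = residue 0" by (simp add: l_eq FactRing_def)
qed

lemma residue_eq_iff:
  assumes "x \<in> \<O>" "y \<in> \<O>" shows "residue x = residue y \<longleftrightarrow> 1 \<lless> x - y"
proof -
  have S: "abelian_subgroup (max_ideal v \<O>) (ring_on \<O>)"
    by (rule abelian_subgroupI3[OF ideal.axioms(1)[OF max_ideal_ideal]
          ring.is_abelian_group[OF ideal.axioms(2)[OF max_ideal_ideal]]])
  have carr: "x \<in> carrier (ring_on \<O>)" "y \<in> carrier (ring_on \<O>)" using assms by simp_all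
  have "residue x = residue y \<longleftrightarrow> x \<in> residue y"
    using abelian_subgroup.a_repr_independence'[OF S _ carr(2), of x]
      abelian_subgroup.a_rcos_self[OF S carr(1)] by metis
  also have "\<dots> \<longleftrightarrow> x - y \<in> max_ideal v \<O>"
    using abelian_subgroup.a_rcos_module[OF S carr(2) carr(1)] uminus_ring_on[OF B_subring assms(2)] by simp
  finally show ?thesis by (simp add: mem_max_ideal)
qed

lemma carrier_value_group: "carrier (value_group v F) = v ` (F - {0})"
  by (simp add: value_group_def)

lemma field_l: "field l"
proof (rule cring.cring_fieldI[OF cring_l])
  interpret l: cring l by (rule cring_l)
  show "Units l = carrier l - {\<zero>\<^bsub>l\<^esub>}"
  proof (intro equalityI subsetI)
    fix w assume w: "w \<in> carrier l - {\<zero>\<^bsub>l\<^esub>}"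
    then obtain b where b: "b \<in> \<O>" "w = residue b" by (auto simp: carrier_l)
    have "\<not> 1 \<lless> b" using w b residue_eq_iff[of b 0] by (auto simp: residue_hom mem_integers)
    hence b1: "b \<preceq> 1" "b \<noteq> 0" by (auto simp: not_vless)
    hence "1 / b \<in> \<O>" by (simp add: mem_integers vle_divide_right)
    thus "w \<in> Units l"
      using b b1 residue_hom(1)[of "1 / b"] residue_hom(1)[OF b(1)]
      by (auto simp: Units_def residue_hom intro!: bexI[of _ "residue (1 / b)"])
  next
    fix w assume "w \<in> Units l"
    moreover have "\<one>\<^bsub>l\<^esub> \<noteq> \<zero>\<^bsub>l\<^esub>"
      using residue_eq_iff[of 1 0] by (simp add: residue_hom mem_integers)
    ultimately show "w \<in> carrier l - {\<zero>\<^bsub>l\<^esub>}"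
      using l.Units_closed[of w] by (auto simp: Units_def)
  qed
qed

lemma defectless_iff:
  "defectless K v \<longleftrightarrow>
    (Coset.order (value_group v UNIV Mod (v ` (K - {0}))) = p \<and> carrier l = k) \<or>
    (ring.dimension l p k (carrier l) \<and> v ` (UNIV - {0}) = v ` (K - {0}))"
  by (simp add: defectless_def Let_def char carrier_value_group)

text \<open>
  Without a best generator the extension is immediate, so that the index of the value groups and the degree of the
  residue fields are both \<open>1\<close>.
\<close>

lemma defectless_imp_best: assumes "defectless K v" shows "\<exists>\<beta>. best_gen \<beta>"
proof (rule ccontr)
  assume "\<not> ?thesis"
  hence no: "\<not> best_gen \<beta>" for \<beta> by blast
  have vals: "v ` (UNIV - {0}) = v ` (K - {0})"
  proof (intro equalityI subsetI)
    fix g assume "g \<in> v ` (UNIV - {0})"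
    then obtain x where x: "x \<noteq> 0" "g = v x" by auto
    obtain c where c: "c \<in> K" "x \<preceq> c" "c \<preceq> x" "c \<noteq> 0"
      using defect_immediate[OF no x(1)] by metis
    have "v c = v x" using c x by (intro v_eqI) auto
    thus "g \<in> v ` (K - {0})" using c(1,4) x(2) by (intro image_eqI[of _ _ c]) auto
  qed auto
  have res: "carrier l = k"
  proof (intro equalityI subsetI)
    fix w assume "w \<in> carrier l"
    then obtain b where b: "b \<in> \<O>" "w = residue b" by (auto simp: carrier_l)
    show "w \<in> k"
    proof (cases "b = 0")
      case True
      thus ?thesis using b by (auto simp: k_eq mem_val_ring)
    next
      case False
      then obtain c where c: "c \<in> K" "b \<lless> b - c" "b \<preceq> c"
        using defect_immediate[OF no] by metis
      have "1 \<preceq> b" using b by (simp add: mem_integers)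
      hence "1 \<preceq> c" "1 \<lless> b - c" using c vle_trans vle_vless_trans by blast+
      hence "residue b = residue c" using b c residue_eq_iff[of b c] by (simp add: mem_integers)
      thus ?thesis using b c \<open>1 \<preceq> c\<close> by (auto simp: k_eq mem_val_ring)
    qed
  next
    fix w assume "w \<in> k"
    then obtain a where "a \<in> A" "w = residue a" by (auto simp: k_eq)
    thus "w \<in> carrier l" unfolding carrier_l by (auto simp: mem_val_ring mem_integers)
  qed
  from assms consider
    "Coset.order (value_group v UNIV Mod (v ` (K - {0}))) = p" | "ring.dimension l p k (carrier l)"
    unfolding defectless_iff by blast
  thus False
  proof cases
    case 1
    let ?G = "v ` (UNIV - {0})"
    have coset: "?G #>\<^bsub>value_group v UNIV\<^esub> g = ?G" if g_in: "g \<in> ?G" for g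
    proof -
      obtain x where x: "x \<noteq> 0" "g = v x" using g_in by auto
      have "h \<in> ?G \<longleftrightarrow> (\<exists>h'\<in>?G. h = h' + g)" for h
      proof
        assume "h \<in> ?G"
        then obtain y where "y \<noteq> 0" "h = v y" by auto
        hence "h = v (y / x) + g" "y / x \<noteq> 0" using x by (simp_all add: v_divide)
        thus "\<exists>h'\<in>?G. h = h' + g" by blast
      next
        assume "\<exists>h'\<in>?G. h = h' + g"
        then obtain y where "y \<noteq> 0" "h = v y + g" by auto
        hence "h = v (y * x)" "y * x \<noteq> 0" using x by (simp_all add: v_mult)
        thus "h \<in> ?G" by blast
      qed
      thus ?thesis by (auto simp: r_coset_def value_group_def)
    qed
    have "carrier (value_group v UNIV Mod ?G) \<subseteq> {?G}"
      unfolding carrier_FactGroup carrier_value_group using coset by blast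
    from card_mono[OF _ this] have "Coset.order (value_group v UNIV Mod ?G) \<le> 1"
      by (simp add: Coset.order_def)
    thus False using 1 p_ge_2 unfolding vals by simp
  next
    case 2
    interpret l: field l by (rule field_l)
    have "l.dimension 1 k (carrier l)"
      unfolding res[symmetric] by (rule l.dimension_one[OF l.carrier_is_subfield])
    moreover have "l.dimension p k (carrier l)" using 2 .
    ultimately have "p = 1" unfolding res[symmetric] by (rule l.dimension_is_inj[OF l.carrier_is_subfield, rotated])
    thus False using p_ge_2 by simp
  qed
qed

lemma value_attained:
  assumes "\<And>i. poly P \<beta> \<preceq> coeff P i * \<beta> ^ i" "poly P \<beta> \<noteq> 0"
  obtains j where "j \<le> degree P" "coeff P j \<noteq> 0" "\<beta> ^ j \<noteq> 0" "v (poly P \<beta>) = v (coeff P j * \<beta> ^ j)"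
proof -
  have "\<exists>j\<le>degree P. coeff P j * \<beta> ^ j \<preceq> poly P \<beta>"
  proof (rule ccontr)
    assume "\<not> ?thesis"
    hence "poly P \<beta> \<lless> poly P \<beta>" by (intro poly_vless assms(2)) (auto simp: not_vle)
    thus False by simp
  qed
  then obtain j where j: "j \<le> degree P" "coeff P j * \<beta> ^ j \<preceq> poly P \<beta>" by blast
  hence nz: "coeff P j * \<beta> ^ j \<noteq> 0" using assms(2) by (metis zero_vle)
  hence "v (poly P \<beta>) = v (coeff P j * \<beta> ^ j)" using assms j by (intro v_eqI) auto
  moreover have "coeff P j \<noteq> 0" "\<beta> ^ j \<noteq> 0" using nz mult_eq_0_iff by blast+
  ultimately show thesis using that j(1) by blast
qed

text \<open>
  The value of \<open>x\<close> is that of one of the terms of its expansion, so the cosets of the values \<open>v (\<beta>\<^sup>j)\<close> for \<open>j < p\<close>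
  are all cosets; they are distinct by \<open>ramified_powers\<close>.  For integral \<open>x\<close> only the constant term can have the
  value \<open>0\<close>, so it has the residue class of \<open>x\<close>.
\<close>

lemma ramified_defectless:
  assumes \<beta>: "\<beta> \<in> gens" "v \<beta> \<notin> v ` (K - {0})"
  shows "defectless K v"
proof -
  have nz: "\<beta> \<noteq> 0" using gens_nonzero \<beta> by blast
  let ?H = "v ` (K - {0})"
  let ?coset = "\<lambda>j. ?H #>\<^bsub>value_group v UNIV\<^esub> v (\<beta> ^ j)"
  have coset: "?H #>\<^bsub>value_group v UNIV\<^esub> g = {h + g |h. h \<in> ?H}" for g
    by (auto simp: r_coset_def value_group_def)
  have H_add: "h + h' \<in> ?H" "h - h' \<in> ?H" if hh: "h \<in> ?H" "h' \<in> ?H" for h h'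
  proof -
    obtain x y where xy: "x \<in> K" "x \<noteq> 0" "h = v x" "y \<in> K" "y \<noteq> 0" "h' = v y" using hh by auto
    have "h + h' = v (x * y)" "x * y \<in> K - {0}" "h - h' = v (x / y)" "x / y \<in> K - {0}"
      using xy by (simp_all add: v_mult v_divide)
    thus "h + h' \<in> ?H" "h - h' \<in> ?H" by blast+
  qed
  have "carrier (value_group v UNIV Mod ?H) = ?coset ` {..<p}"
    unfolding carrier_FactGroup carrier_value_group
  proof (intro equalityI subsetI)
    fix C assume "C \<in> (\<lambda>x. ?H #>\<^bsub>value_group v UNIV\<^esub> x) ` v ` (UNIV - {0})"
    then obtain x where x: "x \<noteq> 0" "C = ?H #>\<^bsub>value_group v UNIV\<^esub> v x" by auto
    obtain P where P: "K_poly P" "degree P < p" "x = poly P \<beta>" using poly_repr[OF \<beta>(1)] by metis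
    obtain j where j: "j \<le> degree P" "coeff P j \<noteq> 0" "v x = v (coeff P j * \<beta> ^ j)"
      using value_attained[OF ramified_expansion[OF \<beta> P(1,2)]] x(1) P(3) by metis
    have vx: "v x = v (coeff P j) + v (\<beta> ^ j)" using j nz by (simp add: v_mult)
    have cj: "v (coeff P j) \<in> ?H" using j(2) K_poly_coeff[OF P(1)] by (intro imageI) simp
    have "h + v x \<in> {h + v (\<beta> ^ j) |h. h \<in> ?H}" if "h \<in> ?H" for h
      unfolding mem_Collect_eq using H_add(1)[OF that cj] by (intro exI[of _ "h + v (coeff P j)"]) (simp only: vx add.assoc simp_thms)
    moreover have "h + v (\<beta> ^ j) \<in> {h + v x |h. h \<in> ?H}" if "h \<in> ?H" for h
      unfolding mem_Collect_eq using H_add(2)[OF that cj] by (intro exI[of _ "h - v (coeff P j)"]) (simp only: vx diff_add_cancel add.assoc[symmetric] simp_thms)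
    ultimately have "C = ?coset j" unfolding x(2) coset by fast
    thus "C \<in> ?coset ` {..<p}" using j P by auto
  qed (use nz in auto)
  moreover have "inj_on ?coset {..<p}"
  proof (rule linorder_inj_onI')
    fix i j :: nat assume ij: "i \<in> {..<p}" "j \<in> {..<p}" "i < j"
    show "?coset i \<noteq> ?coset j"
    proof
      assume eq: "?coset i = ?coset j"
      have "0 \<in> ?H" using v_one by (intro image_eqI[of _ _ 1]) auto
      hence "v (\<beta> ^ j) \<in> ?coset j" unfolding coset by (auto intro!: exI[of _ 0])
      then obtain h where h: "h \<in> ?H" "v (\<beta> ^ j) = h + v (\<beta> ^ i)"
        unfolding eq[symmetric] unfolding coset by (elim CollectE exE conjE)
      obtain c where c: "h = v c" "c \<in> K - {0}" using h(1) by (rule imageE)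
      hence "v (\<beta> ^ j) = v (c * \<beta> ^ i)" using h(2) nz by (simp add: v_mult)
      thus False using ramified_powers[OF \<beta> ij(3), of c] c(2) ij by simp
    qed
  qed
  ultimately have "Coset.order (value_group v UNIV Mod ?H) = p"
    by (simp add: Coset.order_def card_image)
  moreover have "carrier l = k"
  proof (intro equalityI subsetI)
    fix w assume "w \<in> carrier l"
    then obtain b where b: "b \<in> \<O>" "w = residue b" by (auto simp: carrier_l)
    obtain P where P: "K_poly P" "degree P < p" "b = poly P \<beta>" using poly_repr[OF \<beta>(1)] by metis
    have le: "1 \<preceq> coeff P i * \<beta> ^ i" for i
      using ramified_expansion[OF \<beta> P(1,2), of i] b P(3) vle_trans by (auto simp: mem_integers)
    have "1 \<lless> coeff P i * \<beta> ^ i" if i: "i \<ge> 1" for i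
    proof (cases "coeff P i = 0")
      case False
      have "i < p" using False P(2) le_degree[of P i] by simp
      hence "v (1 / coeff P i * \<beta> ^ 0) \<noteq> v (\<beta> ^ i)" using False i P by (intro ramified_powers \<beta>) auto
      hence "v (coeff P i * \<beta> ^ i) \<noteq> 0"
        using False nz by (auto simp: v_mult v_divide add_eq_0_iff minus_equation_iff)
      thus ?thesis using le[of i] False nz by (auto simp: vle_def vless_iff)
    qed simp
    hence "1 \<lless> (\<Sum>i=1..degree P. coeff P i * \<beta> ^ i)" by (intro vless_sum) auto
    hence "1 \<lless> b - coeff P 0" using poly_split_const[of P \<beta>] P(3) by simp
    moreover have "1 \<preceq> coeff P 0" using le[of 0] by simp
    ultimately have "residue b = residue (coeff P 0)" using b residue_eq_iff by (simp add: mem_integers)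
    thus "w \<in> k" using b P \<open>1 \<preceq> coeff P 0\<close> by (auto simp: k_eq mem_val_ring)
  next
    fix w assume "w \<in> k"
    then obtain a where "a \<in> A" "w = residue a" by (auto simp: k_eq)
    thus "w \<in> carrier l" unfolding carrier_l by (auto simp: mem_val_ring mem_integers)
  qed
  ultimately show ?thesis unfolding defectless_iff by blast
qed

text \<open>
  The residue classes of the powers of the unit \<open>u = \<beta> \<gamma>\<close> below \<open>p\<close> form a basis.  The value of \<open>x\<close> is that of a
  term of its expansion, and \<open>\<beta>\<close> has the value of \<open>1 / \<gamma>\<close>, so all values are values of \<open>K\<close>.
\<close>

lemma unramified_defectless:
  assumes best: "best_gen \<beta>" and \<gamma>: "\<gamma> \<in> K" "\<gamma> \<noteq> 0" and u: "1 \<preceq> \<beta> * \<gamma>" "\<beta> * \<gamma> \<preceq> 1"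
  shows "defectless K v"
proof -
  define u where "u = \<beta> * \<gamma>"
  have \<beta>: "\<beta> \<in> gens" "\<beta> \<noteq> 0" using best gens_nonzero by (auto simp: best_gen_def)
  have uO: "u \<in> \<O>" "1 \<preceq> u" using u by (simp_all add: u_def mem_integers)
  interpret l: field l by (rule field_l)
  define S where "S = (\<lambda>n. {P. K_poly P \<and> int_poly P \<and> (P = 0 \<or> degree P < n)})"
  define E where "E = (\<lambda>n. (\<lambda>P. residue (poly P u)) ` S n)"
  have S_deg: "coeff P i = 0" if "P \<in> S n" "i \<ge> n" for P i n
    using that by (auto simp: S_def coeff_eq_0)
  have ev_int: "poly P u \<in> \<O>" if "int_poly P" for P
    using int_poly_eval[OF that uO(2)] by (simp add: mem_integers)
  have powO: "u ^ n \<in> \<O>" for n using uO one_vle_power by (simp add: mem_integers)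
  have "l.dimension n k (E n)" if "n \<le> p" for n
    using that
  proof (induction n)
    case 0
    have "E 0 = {\<zero>\<^bsub>l\<^esub>}" by (auto simp: E_def S_def residue_hom)
    thus ?case by simp
  next
    case (Suc n)
    have new: "residue (u ^ n) \<notin> E n"
    proof
      assume "residue (u ^ n) \<in> E n"
      then obtain P where P: "P \<in> S n" "residue (u ^ n) = residue (poly P u)" by (auto simp: E_def)
      let ?Q = "monom 1 n - P"
      have int: "K_poly P" "int_poly P" using P by (auto simp: S_def)
      have "int_poly (monom 1 n)" by (simp add: int_poly_def coeff_monom)
      hence Q: "K_poly ?Q" "int_poly ?Q" using int by (auto intro: int_poly_diff)
      have "1 \<lless> poly ?Q u"
        using P(2) residue_eq_iff[OF powO ev_int[OF int(2)]] by (simp add: poly_monom)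
      moreover have "degree ?Q < p"
        using Suc.prems P(1) by (intro degree_diff_less) (auto simp: S_def degree_monom_eq)
      ultimately have "small_poly ?Q"
        using residue_independent[OF best \<gamma> u Q] unfolding u_def by blast
      hence "1 \<lless> coeff ?Q n" unfolding small_poly_def by blast
      thus False using S_deg[OF P(1)] by simp
    qed
    have "l.line_extension k (residue (u ^ n)) (E n) = E (Suc n)"
    proof (intro equalityI subsetI)
      fix w assume "w \<in> l.line_extension k (residue (u ^ n)) (E n)"
      then obtain a P where aP: "a \<in> A" "P \<in> S n"
        "w = residue a \<otimes>\<^bsub>l\<^esub> residue (u ^ n) \<oplus>\<^bsub>l\<^esub> residue (poly P u)"
        unfolding l.line_extension_mem_iff by (auto simp: k_eq E_def)
      have aO: "a \<in> \<O>" "1 \<preceq> a" "a \<in> K" using aP by (auto simp: mem_val_ring mem_integers)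
      have int: "int_poly P" using aP by (simp add: S_def)
      have auO: "a * u ^ n \<in> \<O>" using aO powO one_vle_mult by (simp add: mem_integers)
      have "w = residue (a * u ^ n + poly P u)"
        unfolding aP(3) using aO powO auO ev_int[OF int] by (simp add: residue_hom)
      hence "w = residue (poly (monom a n + P) u)" by (simp add: poly_monom)
      moreover have "monom a n + P \<in> S (Suc n)"
        using aP aO by (auto simp: S_def int_poly_add int_poly_monom degree_monom_le less_Suc_eq_le
            intro!: degree_add_le)
      ultimately show "w \<in> E (Suc n)" unfolding E_def by blast
    next
      fix w assume "w \<in> E (Suc n)"
      then obtain P where P: "P \<in> S (Suc n)" "w = residue (poly P u)" by (auto simp: E_def)
      define R where "R = P - monom (coeff P n) n"
      have cn: "coeff P n \<in> A" using P by (simp add: S_def mem_val_ring int_poly_def)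
      have R: "R \<in> S n"
      proof -
        have "coeff R i = 0" if "i \<ge> n" for i
          using S_deg[OF P(1), of i] that by (cases "i = n") (auto simp: R_def)
        hence "R = 0 \<or> degree R < n" by (metis leading_coeff_0_iff not_le)
        thus ?thesis using P cn by (auto simp: R_def S_def mem_val_ring intro!: int_poly_diff int_poly_monom)
      qed
      have cO: "coeff P n \<in> \<O>" using cn by (auto simp: mem_val_ring mem_integers)
      have cuO: "coeff P n * u ^ n \<in> \<O>" using cO powO one_vle_mult by (simp add: mem_integers)
      have "poly P u = coeff P n * u ^ n + poly R u" by (simp add: R_def poly_monom)
      hence "w = residue (coeff P n) \<otimes>\<^bsub>l\<^esub> residue (u ^ n) \<oplus>\<^bsub>l\<^esub> residue (poly R u)"
        using P(2) cO powO cuO ev_int[of R] R by (simp add: residue_hom S_def)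
      thus "w \<in> l.line_extension k (residue (u ^ n)) (E n)"
        unfolding l.line_extension_mem_iff using cn R by (auto simp: k_eq E_def)
    qed
    moreover have "l.dimension (Suc n) k (l.line_extension k (residue (u ^ n)) (E n))"
      using Suc new residue_hom(1)[OF powO] by (intro l.Suc_dim) auto
    ultimately show ?case by simp
  qed
  hence dim: "l.dimension p k (E p)" by simp
  have "E p = carrier l"
  proof (intro equalityI subsetI)
    fix w assume "w \<in> carrier l"
    then obtain b where b: "b \<in> \<O>" "w = residue b" by (auto simp: carrier_l)
    obtain P where P: "K_poly P" "degree P < p" "b = poly P \<beta>" using poly_repr[OF \<beta>(1)] by metis
    define Q where "Q = P \<circ>\<^sub>p [:0, 1 / \<gamma>:]"
    have "1 \<preceq> coeff Q i" for i
    proof -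
      have "1 \<preceq> b" using b by (simp add: mem_integers)
      also have "b \<preceq> coeff P i * \<beta> ^ i" unfolding P(3) by (rule best_expansion[OF best P(1,2)])
      also have "coeff P i * \<beta> ^ i = coeff Q i * u ^ i"
        using \<gamma> by (simp add: Q_def coeff_pcompose_linear u_def field_simps)
      also have "\<dots> \<preceq> coeff Q i * 1 ^ i" using u by (intro vle_mult vle_power) (auto simp: u_def)
      finally show ?thesis by simp
    qed
    hence "Q \<in> S p" using P \<gamma> by (auto simp: S_def Q_def int_poly_def degree_pcompose)
    moreover have "poly Q u = b" using \<gamma> P by (simp add: Q_def poly_pcompose u_def)
    ultimately show "w \<in> E p" using b unfolding E_def by force
  next
    fix w assume "w \<in> E p"
    then obtain P where "int_poly P" "w = residue (poly P u)" by (auto simp: E_def S_def)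
    thus "w \<in> carrier l" using ev_int residue_hom(1) by blast
  qed
  moreover have "v ` (UNIV - {0}) = v ` (K - {0})"
  proof (intro equalityI subsetI)
    fix g assume "g \<in> v ` (UNIV - {0})"
    then obtain x where x: "x \<noteq> 0" "g = v x" by auto
    obtain P where P: "K_poly P" "degree P < p" "x = poly P \<beta>" using poly_repr[OF \<beta>(1)] by metis
    obtain j where j: "coeff P j \<noteq> 0" "v x = v (coeff P j * \<beta> ^ j)"
      using value_attained[OF best_expansion[OF best P(1,2)]] x(1) P(3) by metis
    have "v (\<beta> * \<gamma>) = v 1" using u \<beta> \<gamma> by (intro v_eqI) auto
    hence "v \<beta> = v (1 / \<gamma>)" using \<beta> \<gamma> by (simp add: v_mult v_divide eq_neg_iff_add_eq_0)
    hence "v (\<beta> ^ j) = v ((1 / \<gamma>) ^ j)" using \<beta> \<gamma> by (intro v_power_cong) auto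
    hence "g = v (coeff P j * (1 / \<gamma>) ^ j)" using x j \<beta> \<gamma> by (simp add: v_mult)
    moreover have "coeff P j * (1 / \<gamma>) ^ j \<in> K - {0}" using P j \<gamma> by auto
    ultimately show "g \<in> v ` (K - {0})" by blast
  qed auto
  ultimately show ?thesis using dim unfolding defectless_iff by simp
qed

theorem defectless_iff_best: "defectless K v \<longleftrightarrow> (\<exists>\<beta>. best_gen \<beta>)"
proof
  assume "\<exists>\<beta>. best_gen \<beta>"
  then obtain \<beta> where best: "best_gen \<beta>" by blast
  have \<beta>: "\<beta> \<in> gens" "\<beta> \<noteq> 0" using best gens_nonzero by (auto simp: best_gen_def)
  show "defectless K v"
  proof (cases "v \<beta> \<in> v ` (K - {0})")
    case True
    then obtain c where c: "c \<in> K" "c \<noteq> 0" "v \<beta> = v c" by auto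
    have "1 \<preceq> \<beta> * (1 / c)" "\<beta> * (1 / c) \<preceq> 1"
      using c \<beta> by (simp_all add: vle_divide_right vle_divide_left vle_of_v_eq)
    thus ?thesis using unramified_defectless[OF best, of "1 / c"] c by auto
  qed (rule ramified_defectless[OF \<beta>(1)])
qed (rule defectless_imp_best)


subsection \<open>The map attached to a best generator\<close>

lemma best_gen_choice: assumes "best_gen \<beta>" shows "choice_defectless K v \<beta>"
proof -
  have \<beta>: "\<beta> \<in> gens" using assms by (simp add: best_gen_def)
  have "h \<noteq> 0 \<and> - v (AS \<beta>) \<le> - v h" if h: "h - AS \<beta> \<in> AS ` K" for h
  proof -
    obtain c where c: "c \<in> K" "h - AS \<beta> = AS c" using h by auto
    hence h: "h = AS (\<beta> + c)" by (simp add: AS_add algebra_simps)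
    have g: "\<beta> + c \<in> gens" using \<beta> c by (intro gens_add)
    hence "AS (\<beta> + c) \<preceq> AS \<beta>" using assms \<beta> by (intro AS_mono) (auto simp: best_gen_def)
    thus ?thesis using gens_AS_nonzero[OF \<beta>] gens_AS_nonzero[OF g] by (simp add: h vle_def)
  qed
  thus ?thesis
    using \<beta> gens_AS gens_AS_nonzero gens_generates
    by (auto simp: choice_defectless_def as_solutions_def best_def)
qed

text \<open>
  Let \<open>a = j \<beta>\<close>.  If \<open>AS a\<close> is a unit, then \<open>\<beta>\<close> has the value \<open>0\<close>, and no generator has a positive value.
  Otherwise the choice of \<open>a\<close> compares \<open>AS a\<close> with all \<open>j AS \<beta>'\<close>, which are congruent to it.
\<close>

lemma choice_best_gen:
  assumes "choice_defectless K v a"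
  obtains j where "0 < j" "j < p" "best_gen (a / of_nat j)" "a \<in> as_solutions K"
proof -
  have a: "a \<in> as_solutions K" "best K v (AS a)" using assms by (auto simp: choice_defectless_def)
  obtain j where j: "0 < j" "j < p" "a / of_nat j \<in> gens" "(of_nat j :: 'a) \<noteq> 0"
    "AS (a / of_nat j) = AS a / of_nat j"
    using a(1) as_solution_scaled[of a] unfolding as_solutions_def by blast
  define \<beta> where "\<beta> = a / of_nat j"
  have \<beta>: "\<beta> \<in> gens" "AS a = of_nat j * AS \<beta>" "a = of_nat j * \<beta>" using j by (auto simp: \<beta>_def)
  have junit: "v (of_nat j) = 0"
    using v_eqI[of "of_nat j" 1] of_nat_unit[OF j(1,2)] j(4) by simp
  have nz: "AS \<beta> \<noteq> 0" "AS a \<noteq> 0" using gens_AS_nonzero[OF \<beta>(1)] \<beta> j(4) by auto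
  have "\<beta>' \<preceq> \<beta>" if \<beta>': "\<beta>' \<in> gens" for \<beta>'
  proof (cases "v (AS a) = 0")
    case True
    hence "v (AS \<beta>) = v 1" using junit nz j(4) by (simp add: \<beta>(2) v_mult)
    hence "1 \<preceq> AS \<beta>" by (intro vle_of_v_eq) auto
    hence "1 ^ p \<preceq> \<beta> ^ p" using vle_trans[OF _ gens_AS_vle(1)[OF \<beta>(1)]] by simp
    hence "1 \<preceq> \<beta>" by (rule vle_power_cancel) (rule p_pos)
    with gens_vle_1[OF \<beta>'] show ?thesis by (rule vle_trans)
  next
    case False
    have "of_nat j * AS \<beta>' - AS a = AS (of_nat j * (\<beta>' - \<beta>))"
      unfolding AS_of_nat_mult AS_diff \<beta>(2) by (simp add: algebra_simps)
    moreover have "of_nat j * (\<beta>' - \<beta>) \<in> K" using gens_diff[OF \<beta>' \<beta>(1)] by simp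
    moreover have "of_nat j * AS \<beta>' \<in> K" using gens_AS[OF \<beta>'] by simp
    ultimately have "- v (AS a) \<le> - v (of_nat j * AS \<beta>')" "of_nat j * AS \<beta>' \<noteq> 0"
      using a(2) False unfolding best_def by auto
    hence "of_nat j * AS \<beta>' \<preceq> of_nat j * AS \<beta>" using \<beta>(2) by (simp add: vle_def)
    hence "AS \<beta>' \<preceq> AS \<beta>" using j(4) by simp
    hence "\<beta>' ^ p \<preceq> \<beta> ^ p"
      by (rule vle_trans[OF gens_AS_vle(2)[OF \<beta>'] vle_trans[OF _ gens_AS_vle(1)[OF \<beta>(1)]]])
    thus ?thesis by (rule vle_power_cancel) (rule p_pos)
  qed
  hence "best_gen \<beta>" using \<beta> by (simp add: best_gen_def)
  thus thesis using that j a by (simp add: \<beta>_def)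
qed

interpretation LB: log_derivation \<O> MB "\<lambda>b. sym_omega_BA K v \<sigma> (D b)" "\<lambda>x. dlB x"
  by (rule log_derivation_MB)

lemma dlB_K_mult: "c \<in> K \<Longrightarrow> c \<noteq> 0 \<Longrightarrow> x \<noteq> 0 \<Longrightarrow> dlB (x * c) = dlB x"
  using LB.dl_mult[of x c] dlB_K_zero[of c] by (simp add: fraction_B)

lemma MB_generated_best:
  assumes a: "choice_defectless K v a" and w: "w \<in> carrier MB"
  obtains b where "b \<in> \<O>" "w = b \<odot>\<^bsub>MB\<^esub> dlB a"
proof -
  obtain j where j: "0 < j" "j < p" "best_gen (a / of_nat j)" using choice_best_gen[OF a] by blast
  obtain \<beta>0 where "\<beta>0 \<in> gens" "\<And>\<beta>. \<beta> \<in> gens \<Longrightarrow> \<beta>0 \<preceq> \<beta> \<Longrightarrow> \<exists>b\<in>\<O>. w = b \<odot>\<^bsub>MB\<^esub> dlB \<beta>"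
    using MB_generated[OF w] by (auto simp: ev_def)
  then obtain b where b: "b \<in> \<O>" "w = b \<odot>\<^bsub>MB\<^esub> dlB (a / of_nat j)"
    using j(3) by (auto simp: best_gen_def)
  have "a / of_nat j \<noteq> 0" using j(3) gens_nonzero unfolding best_gen_def by blast
  hence "dlB (a * (1 / of_nat j)) = dlB a"
    using of_nat_neq_0[OF j(1,2)] by (intro dlB_K_mult) auto
  thus thesis using that b by simp
qed

lemma Delta_defectless_eq:
  assumes "is_rsw K v \<sigma> (AS \<alpha>) rsw" "is_phi K v \<sigma> \<phi>" "is_norm_map K v \<sigma> Nb"
    and a: "choice_defectless K v a" and \<Delta>: "is_Delta_defectless K v \<sigma> a \<Delta>" and w: "w \<in> carrier MB"
  shows "\<Delta> w = rsw (Nb (\<phi> w))"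
proof -
  obtain b where b: "b \<in> \<O>" "w = b \<odot>\<^bsub>MB\<^esub> dlB a" using MB_generated_best[OF a w] by blast
  have as: "a \<in> as_solutions K" using a by (simp add: choice_defectless_def)
  show ?thesis
    using \<Delta> b diagram_formula[OF assms(1-3) as b(1)] by (simp add: is_Delta_defectless_def ring_B_eq)
qed

lemma ex1_Delta_defectless:
  assumes "is_rsw K v \<sigma> (AS \<alpha>) rsw" "is_phi K v \<sigma> \<phi>" "is_norm_map K v \<sigma> Nb"
    and a: "choice_defectless K v a"
  shows "\<exists>!\<Delta>. is_Delta_defectless K v \<sigma> a \<Delta>"
proof (rule ex_ex1I)
  have as: "a \<in> as_solutions K" using a by (simp add: choice_defectless_def)
  have a0: "a \<noteq> 0"
    using as generates_not_K[of a] by (auto simp: as_solutions_def)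
  show "\<exists>\<Delta>. is_Delta_defectless K v \<sigma> a \<Delta>"
    using diagram_PiE[OF assms(1-3)] diagram_formula[OF assms(1-3) as] dlB_closed[OF a0]
    by (intro exI[of _ "\<lambda>w\<in>carrier MB. rsw (Nb (\<phi> w))"]) (simp add: is_Delta_defectless_def ring_B_eq)
  fix \<Delta> \<Delta>' assume \<Delta>: "is_Delta_defectless K v \<sigma> a \<Delta>" "is_Delta_defectless K v \<sigma> a \<Delta>'"
  show "\<Delta> = \<Delta>'"
    by (rule PiE_ext[of _ "carrier MB" "\<lambda>_. carrier MA"])
      (use \<Delta> in \<open>simp_all only: is_Delta_defectless_def Delta_defectless_eq[OF assms \<Delta>(1)]
        Delta_defectless_eq[OF assms \<Delta>(2)]\<close>)
qed


subsection \<open>The map in the case of defect\<close>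

text \<open>
  For \<open>\<beta>' = \<beta> \<gamma>\<close> one has \<open>d \<beta>' = \<beta>' dlog \<beta>'\<close>, and \<open>dlog \<beta>' = dlog \<beta>\<close> because \<open>\<gamma> \<in> K\<close>.
\<close>

lemma solutions_above_smult:
  assumes "choice_defect K v a \<gamma>" "\<beta> \<in> solutions_above K v a" "b \<in> \<O>"
  shows "\<beta> \<noteq> 0" "\<beta> * \<gamma> \<beta> \<in> \<O>" "\<beta> * \<gamma> \<beta> \<preceq> 1"
    "b \<odot>\<^bsub>MB\<^esub> sym_omega_BA K v \<sigma> (D (\<beta> * \<gamma> \<beta>)) = (b * (\<beta> * \<gamma> \<beta>)) \<odot>\<^bsub>MB\<^esub> dlB \<beta>"
proof -
  have g: "\<gamma> \<beta> \<in> K" "\<gamma> \<beta> \<noteq> 0" "v (\<gamma> \<beta>) = - v \<beta>"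
    using assms(1,2) by (auto simp: choice_defect_def mem_val_ring)
  have "generates K \<beta>" using assms(2) by (auto simp: solutions_above_def as_solutions_def)
  thus nz: "\<beta> \<noteq> 0" using generates_not_K by fastforce
  have "v (\<beta> * \<gamma> \<beta>) = 0" using g nz by (simp add: v_mult)
  hence unit: "1 \<preceq> \<beta> * \<gamma> \<beta>" "\<beta> * \<gamma> \<beta> \<preceq> 1" using nz g by (auto simp: vle_def)
  thus O: "\<beta> * \<gamma> \<beta> \<in> \<O>" "\<beta> * \<gamma> \<beta> \<preceq> 1" by (simp_all add: mem_integers)
  have "sym_omega_BA K v \<sigma> (D (\<beta> * \<gamma> \<beta>)) = (\<beta> * \<gamma> \<beta>) \<odot>\<^bsub>MB\<^esub> dlB (\<beta> * \<gamma> \<beta>)"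
    using LB.dl_d[OF O(1)] nz g by simp
  also have "dlB (\<beta> * \<gamma> \<beta>) = dlB \<beta>" using g nz by (intro dlB_K_mult)
  finally show "b \<odot>\<^bsub>MB\<^esub> sym_omega_BA K v \<sigma> (D (\<beta> * \<gamma> \<beta>)) = (b * (\<beta> * \<gamma> \<beta>)) \<odot>\<^bsub>MB\<^esub> dlB \<beta>"
    using LB.smult_assoc'[OF assms(3) O(1) dlB_closed[OF nz]] by simp
qed

lemma adjoin_integers: "x \<in> \<O> \<Longrightarrow> b \<in> adjoin A x \<Longrightarrow> b \<in> \<O>"
proof -
  assume x: "x \<in> \<O>" and "b \<in> adjoin A x"
  then obtain P where P: "b = poly P x" "set (coeffs P) \<subseteq> A" by (auto simp: adjoin_def)
  have "coeff P i \<in> insert 0 (set (coeffs P))" for i by (metis insert_iff range_coeff range_eqI)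
  hence "int_poly P" using P(2) by (force simp: int_poly_def mem_val_ring)
  thus ?thesis using int_poly_eval x P(1) by (simp add: mem_integers)
qed

text \<open>
  Given \<open>w = b\<^sub>1 dlog \<beta>\<^sub>1\<close>, expand \<open>b\<^sub>1 / \<beta>\<^sub>1\<close> in powers of a generator \<open>\<beta>\<close> of large value.  With
  \<open>\<beta>' = \<beta> \<gamma>\<close>, this expresses \<open>b\<^sub>1 / (\<beta>\<^sub>1 \<gamma>)\<close> as a polynomial in \<open>\<beta>'\<close> with integral coefficients, and
  \<open>w = b\<^sub>1 / (\<beta>\<^sub>1 \<gamma>) d\<beta>'\<close>.
\<close>

lemma MB_generated_defect:
  assumes no: "\<And>\<beta>. \<not> best_gen \<beta>" and ch: "choice_defect K v a \<gamma>" and w: "w \<in> carrier MB"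
  obtains \<beta> b where "\<beta> \<in> solutions_above K v a" "b \<in> adjoin A (\<beta> * \<gamma> \<beta>)"
    "w = b \<odot>\<^bsub>MB\<^esub> sym_omega_BA K v \<sigma> (D (\<beta> * \<gamma> \<beta>))"
proof -
  have a: "a \<in> as_solutions K" using ch by (simp add: choice_defect_def)
  obtain j where j: "0 < j" "j < p" "a / of_nat j \<in> gens" "(of_nat j :: 'a) \<noteq> 0"
    using a as_solution_scaled[of a] unfolding as_solutions_def by blast
  have a0: "a \<noteq> 0" using gens_nonzero[OF j(3)] by auto
  obtain \<delta> where \<delta>: "\<delta> \<in> gens" "a / of_nat j \<lless> \<delta>"
    using no[of "a / of_nat j"] j(3) by (auto simp: best_gen_def not_vle)
  obtain \<beta>1 b1 where b1: "\<beta>1 \<in> gens" "b1 \<in> \<O>" "w = b1 \<odot>\<^bsub>MB\<^esub> dlB \<beta>1"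
    using ev_ex[OF MB_generated[OF w]] by blast
  have "ev (\<lambda>\<beta>. expands \<beta> (b1 / \<beta>1) \<and> \<beta>1 \<preceq> \<beta> \<and> \<delta> \<preceq> \<beta>)"
    by (intro ev_conj ev_expands ev_vle b1 \<delta>)
  then obtain \<beta> where \<beta>: "\<beta> \<in> gens" "expands \<beta> (b1 / \<beta>1)" "\<beta>1 \<preceq> \<beta>" "\<delta> \<preceq> \<beta>" by (auto dest: ev_ex)
  have nz: "\<beta> \<noteq> 0" "\<beta>1 \<noteq> 0" using gens_nonzero \<beta> b1 by blast+
  have above: "\<beta> \<in> solutions_above K v a"
  proof -
    have "a / of_nat j \<lless> \<beta>" using \<delta>(2) \<beta>(4) by (rule vless_vle_trans)
    hence "v (a / of_nat j) < v \<beta>" using nz by (simp add: vless_iff)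
    moreover have "v (of_nat j) = 0" using v_eqI[of "of_nat j" 1] of_nat_unit[OF j(1,2)] j(4) by simp
    ultimately have "v a < v \<beta>" using a0 j(4) by (simp add: v_divide)
    thus ?thesis using \<beta>(1) gens_AS gens_generates by (auto simp: solutions_above_def as_solutions_def)
  qed
  define u where "u = \<beta> * \<gamma> \<beta>"
  have g: "\<gamma> \<beta> \<in> K" "\<gamma> \<beta> \<noteq> 0" using ch above by (auto simp: choice_defect_def mem_val_ring)
  have u: "u \<in> \<O>" "u \<preceq> 1" using solutions_above_smult(2,3)[OF ch above, of 0]
    by (simp_all add: u_def mem_integers)
  obtain P where P: "K_poly P" "b1 / \<beta>1 = poly P \<beta>" "\<And>i. b1 / \<beta>1 \<preceq> coeff P i * \<beta> ^ i"
    using \<beta>(2) by (auto simp: expands_def)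
  define Q where "Q = smult (1 / \<gamma> \<beta>) (P \<circ>\<^sub>p [:0, 1 / \<gamma> \<beta>:])"
  define b where "b = b1 / (\<beta>1 * \<gamma> \<beta>)"
  have Qu: "poly Q u = b" using g by (simp add: Q_def poly_pcompose u_def b_def P(2)[symmetric])
  have "coeff Q i \<in> A" for i
  proof -
    have "1 * 1 \<preceq> b1 * (\<beta> / \<beta>1)"
      using b1(2) \<beta>(3) nz by (intro vle_mult) (auto simp: mem_integers vle_divide_right)
    hence "1 \<preceq> b1 / \<beta>1 * \<beta>" by simp
    also have "\<dots> \<preceq> coeff P i * \<beta> ^ i * \<beta>" by (intro vle_mult P) auto
    also have "\<dots> = coeff Q i * u ^ Suc i"
      using g by (simp add: Q_def coeff_pcompose_linear u_def power_mult_distrib field_simps)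
    also have "\<dots> \<preceq> coeff Q i * 1 ^ Suc i" by (intro vle_mult vle_power u) auto
    finally have "1 \<preceq> coeff Q i" by simp
    thus ?thesis using P(1) g by (simp add: mem_val_ring Q_def)
  qed
  hence "set (coeffs Q) \<subseteq> A" by (auto simp: coeffs_def)
  hence "b \<in> adjoin A u" unfolding adjoin_def using Qu by blast
  moreover have bO: "b \<in> \<O>" using adjoin_integers[OF u(1)] calculation .
  have "w = (b1 * (\<beta> / \<beta>1)) \<odot>\<^bsub>MB\<^esub> dlB \<beta>"
    using b1(3) dlB_gens[OF b1(1) \<beta>(1,3)] LB.smult_assoc'[OF b1(2) _ dlB_closed[OF nz(1)]]
    by (simp del: times_divide_eq_right)
  moreover have "b1 * (\<beta> / \<beta>1) = b * (\<beta> * \<gamma> \<beta>)" using g by (simp add: b_def)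
  ultimately show thesis
    using that[OF above, of b] solutions_above_smult(4)[OF ch above bO] by (simp add: u_def)
qed

text \<open>
  The factors \<open>\<gamma>\<close> exist because the extension is immediate.
\<close>

lemma ex_choice_defect:
  assumes no: "\<And>\<beta>. \<not> best_gen \<beta>"
  shows "\<exists>a \<gamma>. choice_defect K v a \<gamma>"
proof -
  have "\<exists>c. c \<in> A - {0} \<and> v c = - v \<beta>" if \<beta>_above: "\<beta> \<in> solutions_above K v \<alpha>" for \<beta>
  proof -
    have \<beta>: "AS \<beta> \<in> K" "generates K \<beta>" using \<beta>_above by (auto simp: solutions_above_def as_solutions_def)
    obtain j where j: "0 < j" "j < p" "\<beta> / of_nat j \<in> gens" "(of_nat j :: 'a) \<noteq> 0"
      using as_solution_scaled[OF \<beta>] by metis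
    have nz: "\<beta> \<noteq> 0" using gens_nonzero[OF j(3)] by auto
    have "\<beta> \<preceq> of_nat j" using gens_vle_1[OF j(3)] j(4) by (simp add: vle_divide_left)
    hence le: "\<beta> \<preceq> 1" using of_nat_unit[OF j(1,2)] vle_trans by blast
    obtain c where c: "c \<in> K" "\<beta> \<preceq> c" "c \<preceq> \<beta>" "c \<noteq> 0" using defect_immediate[OF no nz] by metis
    have "v c = v \<beta>" using c nz by (intro v_eqI)
    moreover have "c \<preceq> 1" using c(3) le by (rule vle_trans)
    ultimately show ?thesis using c by (intro exI[of _ "1 / c"]) (simp add: mem_val_ring vle_divide_right v_divide)
  qed
  then obtain \<gamma> where "\<forall>\<beta>\<in>solutions_above K v \<alpha>. \<gamma> \<beta> \<in> A - {0} \<and> v (\<gamma> \<beta>) = - v \<beta>" by metis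
  moreover have "\<alpha> \<in> as_solutions K"
    using gens_AS[OF \<alpha>_gens] gens_generates[OF \<alpha>_gens] by (simp add: as_solutions_def)
  ultimately show ?thesis unfolding choice_defect_def by blast
qed

lemma solutions_above_diagram:
  assumes "is_rsw K v \<sigma> (AS \<alpha>) rsw" "is_phi K v \<sigma> \<phi>" "is_norm_map K v \<sigma> Nb"
    and ch: "choice_defect K v a \<gamma>" and \<beta>: "\<beta> \<in> solutions_above K v a" and b: "b \<in> adjoin A (\<beta> * \<gamma> \<beta>)"
  shows "b \<odot>\<^bsub>MB\<^esub> sym_omega_BA K v \<sigma> (D (\<beta> * \<gamma> \<beta>)) \<in> carrier MB"
    "rsw (Nb (\<phi> (b \<odot>\<^bsub>MB\<^esub> sym_omega_BA K v \<sigma> (D (\<beta> * \<gamma> \<beta>))))) =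
      galois_norm K (b * (\<beta> * \<gamma> \<beta>)) \<odot>\<^bsub>MA\<^esub> dlA (AS \<beta>)"
proof -
  note u = solutions_above_smult(1,2)[OF ch \<beta>, of 0]
  have uO: "\<beta> * \<gamma> \<beta> \<in> \<O>" using u by (simp add: mem_integers)
  have bO: "b \<in> \<O>" by (rule adjoin_integers[OF uO b])
  have as: "\<beta> \<in> as_solutions K" using \<beta> by (simp add: solutions_above_def)
  show "b \<odot>\<^bsub>MB\<^esub> sym_omega_BA K v \<sigma> (D (\<beta> * \<gamma> \<beta>)) \<in> carrier MB" using bO uO by simp
  show "rsw (Nb (\<phi> (b \<odot>\<^bsub>MB\<^esub> sym_omega_BA K v \<sigma> (D (\<beta> * \<gamma> \<beta>))))) =
      galois_norm K (b * (\<beta> * \<gamma> \<beta>)) \<odot>\<^bsub>MA\<^esub> dlA (AS \<beta>)"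
    unfolding solutions_above_smult(4)[OF ch \<beta> bO]
    using LB.R_closed(4)[OF bO uO] by (rule diagram_formula[OF assms(1-3) as])
qed

lemma Delta_defect_eq:
  assumes "is_rsw K v \<sigma> (AS \<alpha>) rsw" "is_phi K v \<sigma> \<phi>" "is_norm_map K v \<sigma> Nb"
    and no: "\<And>\<beta>. \<not> best_gen \<beta>" and ch: "choice_defect K v a \<gamma>"
    and \<Delta>: "is_Delta_defect K v \<sigma> a \<gamma> \<Delta>" and w: "w \<in> carrier MB"
  shows "\<Delta> w = rsw (Nb (\<phi> w))"
proof -
  obtain \<beta> b where b: "\<beta> \<in> solutions_above K v a" "b \<in> adjoin A (\<beta> * \<gamma> \<beta>)"
    "w = b \<odot>\<^bsub>MB\<^esub> sym_omega_BA K v \<sigma> (D (\<beta> * \<gamma> \<beta>))"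
    using MB_generated_defect[OF no ch w] by blast
  show ?thesis
    using \<Delta> b solutions_above_diagram(2)[OF assms(1-3) ch b(1,2)]
    unfolding is_Delta_defect_def Let_def by simp
qed

lemma ex1_Delta_defect:
  assumes "is_rsw K v \<sigma> (AS \<alpha>) rsw" "is_phi K v \<sigma> \<phi>" "is_norm_map K v \<sigma> Nb"
    and no: "\<And>\<beta>. \<not> best_gen \<beta>" and ch: "choice_defect K v a \<gamma>"
  shows "\<exists>!\<Delta>. is_Delta_defect K v \<sigma> a \<gamma> \<Delta>"
proof (rule ex_ex1I)
  show "\<exists>\<Delta>. is_Delta_defect K v \<sigma> a \<gamma> \<Delta>"
    using diagram_PiE[OF assms(1-3)] solutions_above_diagram[OF assms(1-3) ch]
    by (intro exI[of _ "\<lambda>w\<in>carrier MB. rsw (Nb (\<phi> w))"]) (simp add: is_Delta_defect_def Let_def)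
  fix \<Delta> \<Delta>' assume \<Delta>: "is_Delta_defect K v \<sigma> a \<gamma> \<Delta>" "is_Delta_defect K v \<sigma> a \<gamma> \<Delta>'"
  show "\<Delta> = \<Delta>'"
    by (rule PiE_ext[of _ "carrier MB" "\<lambda>_. carrier MA"])
      (use \<Delta> in \<open>simp_all only: is_Delta_defect_def Delta_defect_eq[OF assms(1-3) no ch \<Delta>(1)]
        Delta_defect_eq[OF assms(1-3) no ch \<Delta>(2)]\<close>)
qed

end


section \<open>The commutative diagram\<close>

theorem theorem1p5:
  fixes K :: "'a::field set"
    and v :: "'a \<Rightarrow> 'g::linordered_ab_group_add"
    and p :: nat and \<alpha> f :: 'a and \<sigma> :: "'a \<Rightarrow> 'a"
  assumes "CHAR('a) = p" and "p > 0"
    and "subfield K type_ring"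
    and "valuation v" and "henselian v K"
    and "f \<in> K" and "f \<noteq> 0" and "\<alpha> ^ p - \<alpha> = f" and "generates K \<alpha>"
    and "ring.dimension type_ring p K UNIV"
    and "\<sigma> \<in> galois_group K" and "\<sigma> \<alpha> = \<alpha> + 1"
    and "defectless K v \<or> rank_one K v"
  shows "(\<exists>!rsw. is_rsw K v \<sigma> f rsw) \<and>
    (\<exists>\<phi>. is_phi K v \<sigma> \<phi>) \<and>
    (\<forall>rsw \<phi>. is_rsw K v \<sigma> f rsw \<longrightarrow> is_phi K v \<sigma> \<phi> \<longrightarrow>
      (\<exists>Nb. is_norm_map K v \<sigma> Nb \<and> inj_on Nb (carrier (mod_J K v \<sigma>)) \<and>
        (defectless K v \<longrightarrow>
          (\<exists>a. choice_defectless K v a) \<and>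
          (\<forall>a. choice_defectless K v a \<longrightarrow>
            (\<exists>!\<Delta>. is_Delta_defectless K v \<sigma> a \<Delta>) \<and>
            (\<forall>\<Delta>. is_Delta_defectless K v \<sigma> a \<Delta> \<longrightarrow>
              (\<forall>w\<in>carrier (mod_omega_BA K v \<sigma>). \<Delta> w = rsw (Nb (\<phi> w)))))) \<and>
        (\<not> defectless K v \<longrightarrow>
          (\<exists>a \<gamma>. choice_defect K v a \<gamma>) \<and>
          (\<forall>a \<gamma>. choice_defect K v a \<gamma> \<longrightarrow>
            (\<exists>!\<Delta>. is_Delta_defect K v \<sigma> a \<gamma> \<Delta>) \<and>
            (\<forall>\<Delta>. is_Delta_defect K v \<sigma> a \<gamma> \<Delta> \<longrightarrow>
              (\<forall>w\<in>carrier (mod_omega_BA K v \<sigma>). \<Delta> w = rsw (Nb (\<phi> w))))))))"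
proof -
  interpret artin_schreier v K p \<alpha> \<sigma>
    by (intro artin_schreier.intro valued_field.intro as_extension.intro artin_schreier_axioms.intro)
      (use assms in simp_all)
  have f: "f = AS \<alpha>" using assms by (simp add: AS_eq)
  show ?thesis
  proof (intro conjI allI impI)
    show "\<exists>!rsw. is_rsw K v \<sigma> f rsw" unfolding f by (rule ex1_rsw)
    show "\<exists>\<phi>. is_phi K v \<sigma> \<phi>" by (rule ex_phi)
    fix rsw \<phi> assume "is_rsw K v \<sigma> f rsw" and \<phi>: "is_phi K v \<sigma> \<phi>"
    hence rsw: "is_rsw K v \<sigma> (AS \<alpha>) rsw" by (simp add: f)
    obtain Nb where Nb: "is_norm_map K v \<sigma> Nb" "inj_on Nb (carrier (mod_J K v \<sigma>))"
      using ex_norm_map by blast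
    note maps = rsw \<phi> Nb(1)
    have no: "\<not> best_gen \<beta>" if "\<not> defectless K v" for \<beta>
      using that defectless_iff_best by blast
    show "\<exists>Nb. is_norm_map K v \<sigma> Nb \<and> inj_on Nb (carrier (mod_J K v \<sigma>)) \<and>
        (defectless K v \<longrightarrow>
          (\<exists>a. choice_defectless K v a) \<and>
          (\<forall>a. choice_defectless K v a \<longrightarrow>
            (\<exists>!\<Delta>. is_Delta_defectless K v \<sigma> a \<Delta>) \<and>
            (\<forall>\<Delta>. is_Delta_defectless K v \<sigma> a \<Delta> \<longrightarrow>
              (\<forall>w\<in>carrier (mod_omega_BA K v \<sigma>). \<Delta> w = rsw (Nb (\<phi> w)))))) \<and>
        (\<not> defectless K v \<longrightarrow>
          (\<exists>a \<gamma>. choice_defect K v a \<gamma>) \<and>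
          (\<forall>a \<gamma>. choice_defect K v a \<gamma> \<longrightarrow>
            (\<exists>!\<Delta>. is_Delta_defect K v \<sigma> a \<gamma> \<Delta>) \<and>
            (\<forall>\<Delta>. is_Delta_defect K v \<sigma> a \<gamma> \<Delta> \<longrightarrow>
              (\<forall>w\<in>carrier (mod_omega_BA K v \<sigma>). \<Delta> w = rsw (Nb (\<phi> w))))))"
    proof (intro exI[of _ Nb] conjI impI allI ballI Nb)
      show "\<exists>a. choice_defectless K v a" if "defectless K v"
        using that defectless_iff_best best_gen_choice by blast
      show "\<exists>!\<Delta>. is_Delta_defectless K v \<sigma> a \<Delta>" if "choice_defectless K v a" for a
        using ex1_Delta_defectless[OF maps that] .
      show "\<Delta> w = rsw (Nb (\<phi> w))"
        if "choice_defectless K v a" "is_Delta_defectless K v \<sigma> a \<Delta>" "w \<in> carrier MB" for a \<Delta> w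
        using Delta_defectless_eq[OF maps that] .
      show "\<exists>a \<gamma>. choice_defect K v a \<gamma>" if "\<not> defectless K v"
        using ex_choice_defect[OF no[OF that]] .
      show "\<exists>!\<Delta>. is_Delta_defect K v \<sigma> a \<gamma> \<Delta>" if "\<not> defectless K v" "choice_defect K v a \<gamma>" for a \<gamma>
        using ex1_Delta_defect[OF maps no[OF that(1)] that(2)] .
      show "\<Delta> w = rsw (Nb (\<phi> w))"
        if "\<not> defectless K v" "choice_defect K v a \<gamma>" "is_Delta_defect K v \<sigma> a \<gamma> \<Delta>" "w \<in> carrier MB"
        for a \<gamma> \<Delta> w
        using Delta_defect_eq[OF maps no[OF that(1)] that(2-4)] .
    qed
  qed
qed


end
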